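(* Fix $1\le n\le\omega$. Let $E$ be an equivalence relation on $X_n$ which is classifiable by countable structures and extends $F_n$ (i.e. $F_n\subseteq E$). Then either (i) $F_n\le_B E$, or (ii) there are $k<n$ and a comeager set $C\subseteq X_n$ such that for all $x,y\in C$, if $(x\restriction k)\mathrel{F_k}(y\restriction k)$ then $x\mathrel{E}y$ (for $k=0$ this says that $C$ is contained in a single $E$-class).
   Context: Let $\mathbb N=\{0,1,2,\dots\}$ and identify $2^{\mathbb N}$ with $\mathcal P(\mathbb N)$. For $1\le m\le\omega$ and $x\in((2^{\mathbb N})^{\mathbb N})^m$ define recursively: $A^x_1=\{x(0)(k):k\in\mathbb N\}\subseteq 2^{\mathbb N}$; for $1\le j<m$ and $l\in\mathbb N$, $a^{x,l}_1=\{x(0)(k):x(1)(l)(k)=1\}$ and $a^{x,l}_{j}=\{a^{x,k}_{j-1}:x(j)(l)(k)=1\}$ for $j\ge 2$; and $A^x_{j+1}=\{a^{x,k}_j:k\in\mathbb N\}$ for $1\le j<m$. Let $X_1=(2^{\mathbb N})^{\mathbb N}$, and for $2\le n\le\omega$ let $X_n$ be the set of $x\in((2^{\mathbb N})^{\mathbb N})^n$ such that for every $1\le i<n$: (1) for every $m$ there is $k$ with $x(i)(k)(m)=1$; (2) for every $k$ there is $m$ with $x(i)(k)(m)=1$; (3) for all $k,l_1,l_2$, if $x(i-1)(l_1)=x(i-1)(l_2)$ then $x(i)(k)(l_1)=x(i)(k)(l_2)$. For $1\le n<\omega$, $F_n$ on $X_n$ is $x\mathrel{F_n}y\iff A^x_n=A^y_n$;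 $F_\omega$ on $X_\omega$ is $x\mathrel{F_\omega}y\iff A^x_j=A^y_j$ for all $1\le j<\omega$. $X_0$ is a one-point space and $F_0$ the equivalence relation with one class. Classifiable by countable structures: Borel reducible to isomorphism of countable $\mathcal L$-structures for some countable language $\mathcal L$. *)

theory Defs
  imports "HOL-Analysis.Analysis" "HOL-Library.Countable_Set_Type"
begin

(* Points of ((2^N)^N)^n, n <= omega, are coded as  x :: nat => nat => nat => bool,
   x i k m  = x(i)(k)(m); components i >= n are required to be constantly False. *)
type_synonym pt = "nat \<Rightarrow> nat \<Rightarrow> nat \<Rightarrow> bool"

(* hereditarily countable sets over urelements 2^N, to interpret the A^x_j *)
datatype hc = Ur "nat \<Rightarrow> bool" | HSet "hc cset"

(* a x j l = a^{x,l}_j  (j >= 1) *)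
fun a_set :: "pt \<Rightarrow> nat \<Rightarrow> nat \<Rightarrow> hc" where
  "a_set x 0 l = HSet cempty"
| "a_set x (Suc 0) l = HSet (cimage (\<lambda>k. Ur (x 0 k)) (acset {k. x 1 l k}))"
| "a_set x (Suc (Suc j)) l = HSet (cimage (\<lambda>k. a_set x (Suc j) k) (acset {k. x (Suc (Suc j)) l k}))"

(* A x j = A^x_j  (j >= 1) *)
fun A_set :: "pt \<Rightarrow> nat \<Rightarrow> hc" where
  "A_set x 0 = HSet cempty"
| "A_set x (Suc 0) = HSet (cimage (\<lambda>k. Ur (x 0 k)) (acset UNIV))"
| "A_set x (Suc (Suc j)) = HSet (cimage (\<lambda>k. a_set x (Suc j) k) (acset UNIV))"

definition Xsp :: "enat \<Rightarrow> pt set" where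
  "Xsp n = {x. (\<forall>i. enat i \<ge> n \<longrightarrow> x i = (\<lambda>_ _. False)) \<and>
     (\<forall>i. 1 \<le> i \<and> enat i < n \<longrightarrow>
        (\<forall>m. \<exists>k. x i k m) \<and> (\<forall>k. \<exists>m. x i k m) \<and>
        (\<forall>k l1 l2. x (i - 1) l1 = x (i - 1) l2 \<longrightarrow> x i k l1 = x i k l2))}"

definition Frel :: "enat \<Rightarrow> (pt \<times> pt) set" where
  "Frel n = {(x, y). x \<in> Xsp n \<and> y \<in> Xsp n \<and>
     (if n = \<infinity> then (\<forall>j\<ge>1. A_set x j = A_set y j)
      else if n = 0 then True
      else A_set x (the_enat n) = A_set y (the_enat n))}"

definition restr :: "pt \<Rightarrow> nat \<Rightarrow> pt" where
  "restr x k = (\<lambda>i. if i < k then x i else (\<lambda>_ _. False))"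

definition ptop :: "pt topology" where
  "ptop = product_topology (\<lambda>_. product_topology (\<lambda>_. product_topology
            (\<lambda>_. discrete_topology (UNIV :: bool set)) UNIV) UNIV) UNIV"

definition Xtop :: "enat \<Rightarrow> pt topology" where
  "Xtop n = subtopology ptop (Xsp n)"

definition borel_of :: "'a topology \<Rightarrow> 'a measure" where
  "borel_of T = sigma (topspace T) {U. openin T U}"

definition comeager_in :: "'a topology \<Rightarrow> 'a set \<Rightarrow> bool" where
  "comeager_in T C \<longleftrightarrow> C \<subseteq> topspace T \<and>
     (\<exists>D :: nat \<Rightarrow> 'a set. (\<forall>i. openin T (D i) \<and> T closure_of (D i) = topspace T)
        \<and> (\<Inter>i. D i) \<subseteq> C)"

(* Countable structures with universe N in a countable language:
   relation symbols RS \<subseteq> N with arities ra, function symbols FS \<subseteq> N with arities fa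
   (constants are 0-ary function symbols). A structure is coded by (R, G):
   R i t = R_i(t), G j t = G_j(t); entries outside the language are normalised. *)
type_synonym struc = "(nat \<Rightarrow> nat list \<Rightarrow> bool) \<times> (nat \<Rightarrow> nat list \<Rightarrow> nat)"

definition Mod :: "nat set \<Rightarrow> (nat \<Rightarrow> nat) \<Rightarrow> nat set \<Rightarrow> (nat \<Rightarrow> nat) \<Rightarrow> struc set" where
  "Mod RS ra FS fa = {(R, G).
      (\<forall>i t. (i \<notin> RS \<or> length t \<noteq> ra i) \<longrightarrow> \<not> R i t) \<and>
      (\<forall>j t. (j \<notin> FS \<or> length t \<noteq> fa j) \<longrightarrow> G j t = 0)}"

definition Modtop :: "nat set \<Rightarrow> (nat \<Rightarrow> nat) \<Rightarrow> nat set \<Rightarrow> (nat \<Rightarrow> nat) \<Rightarrow> struc topology" where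
  "Modtop RS ra FS fa = subtopology
     (prod_topology
        (product_topology (\<lambda>_. product_topology (\<lambda>_. discrete_topology (UNIV :: bool set)) UNIV) UNIV)
        (product_topology (\<lambda>_. product_topology (\<lambda>_. discrete_topology (UNIV :: nat set)) UNIV) UNIV))
     (Mod RS ra FS fa)"

definition struc_iso :: "nat set \<Rightarrow> (nat \<Rightarrow> nat) \<Rightarrow> nat set \<Rightarrow> (nat \<Rightarrow> nat) \<Rightarrow> struc \<Rightarrow> struc \<Rightarrow> bool" where
  "struc_iso RS ra FS fa M N \<longleftrightarrow> (\<exists>\<pi>. bij \<pi> \<and>
      (\<forall>i\<in>RS. \<forall>t. length t = ra i \<longrightarrow> (fst M i t \<longleftrightarrow> fst N i (map \<pi> t))) \<and>
      (\<forall>j\<in>FS. \<forall>t. length t = fa j \<longrightarrow> \<pi> (snd M j t) = snd N j (map \<pi> t)))"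

definition borel_reducible :: "'a topology \<Rightarrow> ('a \<times> 'a) set \<Rightarrow> 'b topology \<Rightarrow> ('b \<times> 'b) set \<Rightarrow> bool" where
  "borel_reducible S E T E' \<longleftrightarrow> (\<exists>f \<in> borel_of S \<rightarrow>\<^sub>M borel_of T.
      \<forall>x\<in>topspace S. \<forall>y\<in>topspace S. (x, y) \<in> E \<longleftrightarrow> (f x, f y) \<in> E')"

definition classifiable :: "'a topology \<Rightarrow> ('a \<times> 'a) set \<Rightarrow> bool" where
  "classifiable S E \<longleftrightarrow> (\<exists>RS ra FS fa.
      borel_reducible S E (Modtop RS ra FS fa) {(M, N). struc_iso RS ra FS fa M N})"

end

theory Submission
  imports Defs
begin

text \<open>A point \<open>x\<close> codes a hierarchy of countable sets (``tokens''), level by level. A Borel map \<open>h\<close>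
  replaces the tokens of \<open>x\<close> by finite trees over tokens, attaches mutually generic reals to the trees
  of level 0, and declares the membership bits between consecutive levels so richly that every finite
  pattern of bits is realised. The map \<open>h\<close> preserves \<open>F\<^sub>n\<close>. If \<open>x\<close> and \<open>y\<close> first differ at
  level \<open>i\<close>, a back-and-forth argument enumerates the pair \<open>(h x, h y)\<close> by a point that is
  Cohen-generic in a Cantor space which depends only on a finite amount of information about \<open>(x, y)\<close>,
  its joint type. Since \<open>E\<close> is classifiable it has the Baire property along these enumerations, so
  whether \<open>h x\<close> and \<open>h y\<close> are \<open>E\<close>-related depends only on the joint type.

  If no pair of inequivalent points is related, \<open>h\<close> reduces \<open>F\<^sub>n\<close> to \<open>E\<close>. Otherwise some type with
  first difference at level \<open>i\<close> is related, and transitivity of \<open>E\<close> propagates this to the type of pairs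
  whose tokens at level \<open>i\<close> are disjoint. For that type the enumeration consists of two points which are
  mutually generic over their common levels below \<open>i\<close>, and Kuratowski--Ulam gives the second alternative
  with \<open>k = i\<close>.\<close>

section \<open>Baire category in Cantor spaces\<close>

text \<open>Two obstacles shape the construction. First, the pair \<open>(x, y)\<close> is not
  itself generic: to enumerate it by a generic point, every finite demand on membership bits must be
  answered by an object that is present. Trees can do this: a layer decrees a bit downwards and its
  coded table answers for the trees above, while the set of all trees depends on the tokens alone,
  so equivalence is preserved. Secondly, just above the first difference objects of the two sides
  can have the same bits towards the common part, so these bits are not independent coordinates of
  the pair. Views are designed for this: a layer keyed by a private tree cannot be seen from the
  common part, hence many trees share one trace. Coordinates for bits towards the common part belong
  to traces, and a tree with a given trace keeps only its bits towards private trees. A side without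
  private tokens at the first difference becomes private one or two levels higher, which is what the
  flags of a joint type record. Classifiability enters because isomorphism is analytic and analytic
  sets have the Baire property.\<close>

definition holds :: "('c \<times> bool) list \<Rightarrow> ('c \<Rightarrow> bool) \<Rightarrow> bool" where
  "holds s z \<longleftrightarrow> (\<forall>(c, b) \<in> set s. z c = b)"

definition cyl :: "'c set \<Rightarrow> ('c \<Rightarrow> bool) \<Rightarrow> ('c \<Rightarrow> bool) set" where
  "cyl F z = {z'. \<forall>c\<in>F. z' c = z c}"

definition opn :: "('c \<Rightarrow> bool) set \<Rightarrow> bool" where
  "opn D \<longleftrightarrow> (\<forall>z\<in>D. \<exists>F. finite F \<and> cyl F z \<subseteq> D)"

definition dns :: "('c \<Rightarrow> bool) set \<Rightarrow> bool" where
  "dns D \<longleftrightarrow> (\<forall>F z. finite F \<longrightarrow> cyl F z \<inter> D \<noteq> {})"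

definition comeager :: "('c \<Rightarrow> bool) set \<Rightarrow> bool" where
  "comeager Q \<longleftrightarrow> (\<exists>D :: nat \<Rightarrow> ('c \<Rightarrow> bool) set. (\<forall>k. opn (D k) \<and> dns (D k)) \<and> (\<Inter>k. D k) \<subseteq> Q)"

definition bp :: "(('c \<Rightarrow> bool) \<Rightarrow> bool) \<Rightarrow> bool" where
  "bp P \<longleftrightarrow> (\<exists>O'. opn O' \<and> comeager {z. P z \<longleftrightarrow> z \<in> O'})"

lemma cyl_self [simp]: "z \<in> cyl F z"
  by (simp add: cyl_def)

lemma cyl_trans: "z' \<in> cyl F z \<Longrightarrow> F \<subseteq> F' \<Longrightarrow> cyl F' z' \<subseteq> cyl F z"
  unfolding cyl_def by fastforce

lemma cyl_eq: "z' \<in> cyl F z \<Longrightarrow> cyl F z' = cyl F z"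
  unfolding cyl_def by auto

lemma opn_cyl: "finite F \<Longrightarrow> opn (cyl F z)"
  unfolding opn_def using cyl_trans by blast

lemma opn_UNIV: "opn UNIV"
  unfolding opn_def by auto

lemma dns_UNIV: "dns UNIV"
  unfolding dns_def using cyl_self by blast

lemma opn_Union: "(\<And>D. D \<in> \<D> \<Longrightarrow> opn D) \<Longrightarrow> opn (\<Union>\<D>)"
  unfolding opn_def by (meson Sup_upper2 UnionE)

lemma comeager_mono: "comeager A \<Longrightarrow> A \<subseteq> B \<Longrightarrow> comeager B"
  unfolding comeager_def by (meson subset_trans)

lemma comeager_opn_dns: "opn D \<Longrightarrow> dns D \<Longrightarrow> comeager D"
  unfolding comeager_def by (intro exI[of _ "\<lambda>_. D"]) auto

lemma comeager_UNIV: "comeager UNIV"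
  by (simp add: comeager_opn_dns opn_UNIV dns_UNIV)

lemma comeager_INT:
  fixes Q :: "'i::countable \<Rightarrow> ('c \<Rightarrow> bool) set"
  assumes "\<And>i. comeager (Q i)"
  shows "comeager (\<Inter>i. Q i)"
proof -
  obtain D :: "'i \<Rightarrow> nat \<Rightarrow> ('c \<Rightarrow> bool) set" where
    D: "\<And>i k. opn (D i k) \<and> dns (D i k)" "\<And>i. (\<Inter>k. D i k) \<subseteq> Q i"
    using assms unfolding comeager_def by metis
  define D' where "D' n = (if fst (prod_decode n) \<in> range (to_nat :: 'i \<Rightarrow> nat)
      then D (from_nat (fst (prod_decode n))) (snd (prod_decode n)) else UNIV)" for n
  have "opn (D' n) \<and> dns (D' n)" for n by (simp add: D'_def D opn_UNIV dns_UNIV)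
  moreover have "(\<Inter>n. D' n) \<subseteq> (\<Inter>i. Q i)"
  proof
    fix z assume z: "z \<in> (\<Inter>n. D' n)"
    have "z \<in> D i k" for i k
    proof -
      have "z \<in> D' (prod_encode (to_nat i, k))" using z by blast
      then show ?thesis by (simp add: D'_def)
    qed
    then show "z \<in> (\<Inter>i. Q i)" using D(2) by blast
  qed
  ultimately show ?thesis unfolding comeager_def by blast
qed

lemma comeager_Int: "comeager A \<Longrightarrow> comeager B \<Longrightarrow> comeager (A \<inter> B)"
proof -
  assume "comeager A" "comeager B"
  then have "comeager (\<Inter>i::bool. if i then A else B)" by (intro comeager_INT) auto
  then show ?thesis by (rule comeager_mono) (auto split: if_splits)
qed

lemma comeager_Collect_all:
  fixes P :: "('c \<Rightarrow> bool) \<Rightarrow> 'i::countable \<Rightarrow> bool"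
  assumes "\<And>i. comeager {z. P z i}"
  shows "comeager {z. \<forall>i. P z i}"
  using comeager_INT[of "\<lambda>i. {z. P z i}", OF assms] by (rule comeager_mono) auto

text \<open>Fusion: step \<open>n\<close> enters \<open>D n\<close> and also freezes the
  \<open>n\<close>-th coordinate. Since the coordinates are countable, each is eventually frozen and
  the limit is a total point.\<close>

lemma baire:
  fixes Q :: "('c::countable \<Rightarrow> bool) set"
  assumes Q: "comeager Q" and F0: "finite F0"
  shows "cyl F0 z0 \<inter> Q \<noteq> {}"
proof -
  obtain D where D: "\<And>k::nat. opn (D k)" "\<And>k. dns (D k)" "(\<Inter>k. D k) \<subseteq> Q"
    using Q unfolding comeager_def by blast
  define R where "R n p p' \<longleftrightarrow> fst p \<subseteq> fst p' \<and> snd p' \<in> cyl (fst p) (snd p) \<and> cyl (fst p') (snd p') \<subseteq> D n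
      \<and> (\<forall>c. to_nat c = n \<longrightarrow> c \<in> fst p')" for n and p p' :: "'c set \<times> ('c \<Rightarrow> bool)"
  have step: "\<exists>p'. finite (fst p') \<and> R n p p'" if "finite (fst p)" for p n
  proof -
    obtain z' where z': "z' \<in> cyl (fst p) (snd p)" "z' \<in> D n" using D(2) \<open>finite (fst p)\<close> unfolding dns_def by blast
    obtain F where F: "finite F" "cyl F z' \<subseteq> D n" using D(1) z' unfolding opn_def by blast
    define F' where "F' = fst p \<union> F \<union> {c. to_nat c = n}"
    have "finite {c :: 'c. to_nat c = n}"
      by (rule finite_subset[of _ "{from_nat n}"]) auto
    then have "finite F'" unfolding F'_def using that F by auto
    moreover have "cyl F' z' \<subseteq> D n" using F(2) unfolding F'_def cyl_def by auto
    ultimately show ?thesis unfolding R_def using z' by (intro exI[of _ "(F', z')"]) (auto simp: F'_def)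
  qed
  have "\<exists>f. f 0 = (F0, z0) \<and> (\<forall>n. finite (fst (f n)) \<and> R n (f n) (f (Suc n)))"
  proof -
    have "\<exists>f. \<forall>n. (finite (fst (f n)) \<and> (n = 0 \<longrightarrow> f n = (F0, z0))) \<and> R n (f n) (f (Suc n))"
      by (rule dependent_nat_choice) (use F0 step in auto)
    then show ?thesis by blast
  qed
  then obtain f where f0: "f 0 = (F0, z0)" and f: "\<And>n. finite (fst (f n))" "\<And>n. R n (f n) (f (Suc n))" by auto
  have mono: "fst (f m) \<subseteq> fst (f (m + d)) \<and> snd (f (m + d)) \<in> cyl (fst (f m)) (snd (f m))" for m d
  proof (induction d)
    case (Suc d)
    then show ?case using f(2)[of "m + d"] unfolding R_def cyl_def by auto
  qed simp
  define z where "z c = snd (f (Suc (to_nat c))) c" for c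
  have z: "z \<in> cyl (fst (f n)) (snd (f n))" for n
    unfolding cyl_def
  proof (intro CollectI ballI)
    fix c assume c: "c \<in> fst (f n)"
    have c': "c \<in> fst (f (Suc (to_nat c)))" using f(2)[of "to_nat c"] unfolding R_def by auto
    show "z c = snd (f n) c"
    proof (cases "n \<le> Suc (to_nat c)")
      case True
      then have "snd (f (Suc (to_nat c))) \<in> cyl (fst (f n)) (snd (f n))" using mono[of n "Suc (to_nat c) - n"] by auto
      then show ?thesis using c unfolding z_def cyl_def by auto
    next
      case False
      then have "snd (f n) \<in> cyl (fst (f (Suc (to_nat c)))) (snd (f (Suc (to_nat c))))"
        using mono[of "Suc (to_nat c)" "n - Suc (to_nat c)"] by auto
      then show ?thesis using c' unfolding z_def cyl_def by auto
    qed
  qed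
  have "z \<in> D n" for n using z[of "Suc n"] f(2)[of n] unfolding R_def by blast
  then have "z \<in> Q" using D(3) by blast
  moreover have "z \<in> cyl F0 z0" using z[of 0] f0 by simp
  ultimately show ?thesis by blast
qed

lemma comeager_nonempty: "comeager (Q :: ('c::countable \<Rightarrow> bool) set) \<Longrightarrow> \<exists>z. z \<in> Q"
  using baire[of Q "{}"] by blast

lemma finite_to_holds:
  assumes "finite F"
  shows "\<exists>s. {z'. holds s z'} = cyl F z"
proof -
  obtain xs where "set xs = F" using assms finite_list by blast
  then show ?thesis by (intro exI[of _ "map (\<lambda>c. (c, z c)) xs"]) (auto simp: holds_def cyl_def)
qed

section \<open>Meager sets and closure properties of the Baire property\<close>

definition mgr :: "('c \<Rightarrow> bool) set \<Rightarrow> bool" where "mgr A \<longleftrightarrow> comeager (- A)"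

lemma mgr_subset: "mgr A \<Longrightarrow> B \<subseteq> A \<Longrightarrow> mgr B"
  unfolding mgr_def by (erule comeager_mono) auto

lemma mgr_UN: "(\<And>i::'i::countable. mgr (A i)) \<Longrightarrow> mgr (\<Union>i. A i)"
  unfolding mgr_def using comeager_INT[of "\<lambda>i. - A i"] by (simp add: Compl_UN)

lemma mgr_Un: "mgr A \<Longrightarrow> mgr B \<Longrightarrow> mgr (A \<union> B)"
  unfolding mgr_def by (simp add: comeager_Int)

lemma mgr_empty: "mgr {}"
  unfolding mgr_def by (simp add: comeager_UNIV)

lemma bp_of_coord: "bp (\<lambda>z. z c)"
  unfolding bp_def
proof (intro exI conjI)
  show "opn {z. z c}" unfolding opn_def cyl_def by (auto intro!: exI[of _ "{c}"])
qed (simp add: comeager_UNIV)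

text \<open>An open set together with its exterior is dense, so off a meager set the complement of
  an open set is open. This yields closure of the Baire property under negation.\<close>

lemma opn_exterior_dns:
  assumes "opn U"
  defines "V \<equiv> {z. \<exists>F. finite F \<and> cyl F z \<inter> U = {}}"
  shows "opn V" "dns (U \<union> V)" "U \<inter> V = {}"
proof -
  show "opn V" unfolding opn_def V_def
  proof (intro ballI)
    fix z assume "z \<in> {z. \<exists>F. finite F \<and> cyl F z \<inter> U = {}}"
    then obtain F where F: "finite F" "cyl F z \<inter> U = {}" by auto
    have "cyl F z \<subseteq> {z. \<exists>F. finite F \<and> cyl F z \<inter> U = {}}"
      using F cyl_eq by blast
    then show "\<exists>F. finite F \<and> cyl F z \<subseteq> {z. \<exists>F. finite F \<and> cyl F z \<inter> U = {}}" using F by blast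
  qed
  show "dns (U \<union> V)" unfolding dns_def V_def using cyl_self by blast
  show "U \<inter> V = {}" unfolding V_def using cyl_self by blast
qed

lemma bp_not:
  assumes "bp P" shows "bp (\<lambda>z. \<not> P z)"
proof -
  obtain U where U: "opn U" "comeager {z. P z \<longleftrightarrow> z \<in> U}" using assms unfolding bp_def by blast
  define V where "V = {z. \<exists>F. finite F \<and> cyl F z \<inter> U = {}}"
  note e = opn_exterior_dns[OF U(1), folded V_def]
  have "comeager (U \<union> V)" using e opn_Union[of "{U, V}"] U(1) by (intro comeager_opn_dns) auto
  from comeager_Int[OF U(2) this] have "comeager {z. (\<not> P z) \<longleftrightarrow> z \<in> V}"
    by (rule comeager_mono) (use e(3) in auto)
  then show ?thesis unfolding bp_def using e(1) by blast
qed

lemma bp_ex: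
  fixes P :: "'i::countable \<Rightarrow> _"
  assumes "\<And>i. bp (P i)" shows "bp (\<lambda>z. \<exists>i. P i z)"
proof -
  obtain U where U: "\<And>i. opn (U i)" "\<And>i. comeager {z. P i z \<longleftrightarrow> z \<in> U i}" using assms unfolding bp_def by metis
  have "comeager {z. (\<exists>i. P i z) \<longleftrightarrow> z \<in> (\<Union>i. U i)}"
    using comeager_Collect_all[of "\<lambda>z i. P i z \<longleftrightarrow> z \<in> U i", OF U(2)] by (rule comeager_mono) auto
  moreover have "opn (\<Union>i. U i)" using U(1) by (intro opn_Union) auto
  ultimately show ?thesis unfolding bp_def by blast
qed

lemma bp_all:
  fixes P :: "'i::countable \<Rightarrow> _"
  assumes "\<And>i. bp (P i)" shows "bp (\<lambda>z. \<forall>i. P i z)"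
  using bp_not[OF bp_ex[of "\<lambda>i z. \<not> P i z", OF bp_not[OF assms]]] by simp

lemma bp_conj:
  assumes "bp P" "bp Q" shows "bp (\<lambda>z. P z \<and> Q z)"
proof -
  have "bp (\<lambda>z. \<forall>i. (if i then P else Q) z)" by (rule bp_all) (use assms in auto)
  moreover have "(\<forall>i. (if i then P else Q) z) = (P z \<and> Q z)" for z by (auto split: if_splits)
  ultimately show ?thesis by simp
qed

lemma bp_disj:
  assumes "bp P" "bp Q" shows "bp (\<lambda>z. P z \<or> Q z)"
  using bp_not[OF bp_conj[OF bp_not[OF assms(1)] bp_not[OF assms(2)]]] by simp

lemma bp_imp:
  assumes "bp P" "bp Q" shows "bp (\<lambda>z. P z \<longrightarrow> Q z)"
  using bp_disj[OF bp_not[OF assms(1)] assms(2)] by simp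

lemma bp_iff:
  assumes "bp P" "bp Q" shows "bp (\<lambda>z. P z \<longleftrightarrow> Q z)"
proof -
  have "(\<lambda>z. (P z \<longrightarrow> Q z) \<and> (Q z \<longrightarrow> P z)) = (\<lambda>z. P z \<longleftrightarrow> Q z)" by auto
  then show ?thesis using bp_conj[OF bp_imp[OF assms] bp_imp[OF assms(2,1)]] by metis
qed

lemma bp_const: "bp (\<lambda>z. b)"
  unfolding bp_def
  by (rule exI[of _ "if b then UNIV else {}"]) (auto simp: opn_UNIV comeager_UNIV opn_def)

text \<open>The classical argument that the Suslin operation preserves the Baire property, for the
  projection of a set that is closed in the product of a comeager set \<open>Q\<close> with Baire
  space.\<close>

lemma bp_analytic:
  fixes P :: "('c::countable \<Rightarrow> bool) \<Rightarrow> (nat \<Rightarrow> nat) \<Rightarrow> bool"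
  assumes Q: "comeager Q"
    and closed: "\<And>z \<beta>. z \<in> Q \<Longrightarrow> \<not> P z \<beta> \<Longrightarrow>
      \<exists>F k. finite F \<and> (\<forall>z'\<in>Q \<inter> cyl F z. \<forall>\<beta>'. (\<forall>i<k. \<beta>' i = \<beta> i) \<longrightarrow> \<not> P z' \<beta>')"
  shows "bp (\<lambda>z. \<exists>\<beta>. P z \<beta>)"
proof -
  \<comment> \<open>\<open>A s\<close> is the part of the projection with a witness through
    \<open>s\<close>, \<open>B s\<close> the closed set where \<open>A s\<close> is nonmeager in
    every neighbourhood, and \<open>H s\<close> the interior of \<open>B s\<close>. The open set
    sought is \<open>H []\<close>.\<close>
  define A where "A s = {z\<in>Q. \<exists>\<beta>. (\<forall>i<length s. \<beta> i = s ! i) \<and> P z \<beta>}" for s :: "nat list"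
  define B where "B s = {z. \<forall>F. finite F \<longrightarrow> \<not> mgr (A s \<inter> cyl F z)}" for s
  define H where "H s = {z. \<exists>F. finite F \<and> cyl F z \<subseteq> B s}" for s
  have HB: "H s \<subseteq> B s" for s 
  proof
    fix z assume "z \<in> H s"
    then obtain F where "cyl F z \<subseteq> B s" unfolding H_def by auto
    then show "z \<in> B s" using cyl_self by (rule subsetD)
  qed
  have opnH: "opn (H s)" for s unfolding opn_def H_def
  proof (intro ballI)
    fix z assume "z \<in> {z. \<exists>F. finite F \<and> cyl F z \<subseteq> B s}"
    then obtain F where F: "finite F" "cyl F z \<subseteq> B s" by auto
    then have "cyl F z \<subseteq> {z. \<exists>F. finite F \<and> cyl F z \<subseteq> B s}" using cyl_eq by blast
    then show "\<exists>F. finite F \<and> cyl F z \<subseteq> {z. \<exists>F. finite F \<and> cyl F z \<subseteq> B s}" using F by blast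
  qed
  have opnB: "opn (- B s)" for s unfolding opn_def
  proof (intro ballI)
    fix z assume "z \<in> - B s"
    then obtain F where F: "finite F" "mgr (A s \<inter> cyl F z)" unfolding B_def by auto
    have "cyl F z \<subseteq> - B s"
    proof
      fix z' assume "z' \<in> cyl F z"
      then have "mgr (A s \<inter> cyl F z')" using F cyl_eq by metis
      then show "z' \<in> - B s" unfolding B_def using F by auto
    qed
    then show "\<exists>F. finite F \<and> cyl F z \<subseteq> - B s" using F by blast
  qed
  \<comment> \<open>Banach's category argument: \<open>A s - B s\<close> is covered by those of the
    countably many basic sets in which \<open>A s\<close> is meager.\<close>
  have AB: "mgr (A s - B s)" for s
  proof -
    have "mgr (\<Union>t::('c\<times>bool) list. if mgr (A s \<inter> {z. holds t z}) then A s \<inter> {z. holds t z} else {})"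
      by (rule mgr_UN) (auto simp: mgr_empty)
    moreover have "A s - B s \<subseteq> (\<Union>t::('c\<times>bool) list. if mgr (A s \<inter> {z. holds t z}) then A s \<inter> {z. holds t z} else {})"
    proof
      fix z assume z: "z \<in> A s - B s"
      then obtain F where F: "finite F" "mgr (A s \<inter> cyl F z)" unfolding B_def by auto
      obtain t where t: "{z'. holds t z'} = cyl F z" using finite_to_holds[OF F(1)] by blast
      have "z \<in> A s \<inter> {z. holds t z}" "mgr (A s \<inter> {z. holds t z})" using z F t by auto
      then show "z \<in> (\<Union>t::('c\<times>bool) list. if mgr (A s \<inter> {z. holds t z}) then A s \<inter> {z. holds t z} else {})" by (intro UN_I[of t]) auto
    qed
    ultimately show ?thesis by (rule mgr_subset)
  qed
  have BH: "mgr (B s - H s)" for s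
  proof -
    have "opn (H s \<union> - B s)" using opn_Union[of "{H s, - B s}"] opnH opnB by auto
    moreover have "dns (H s \<union> - B s)" unfolding dns_def
    proof (intro allI impI notI)
      fix F :: "'c set" and z assume F: "finite F" and e: "cyl F z \<inter> (H s \<union> - B s) = {}"
      then have "cyl F z \<subseteq> B s" by blast
      then have "z \<in> H s" using F unfolding H_def by blast
      then show False using e cyl_self[of z F] by blast
    qed
    ultimately have "comeager (H s \<union> - B s)" by (rule comeager_opn_dns)
    then show ?thesis unfolding mgr_def by (rule comeager_mono) auto
  qed
  have As: "A s = (\<Union>k. A (s @ [k]))" for s
  proof
    show "A s \<subseteq> (\<Union>k. A (s @ [k]))"
    proof
      fix z assume "z \<in> A s"
      then obtain \<beta> where "z \<in> Q" "\<forall>i<length s. \<beta> i = s ! i" "P z \<beta>" unfolding A_def by auto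
      then have "z \<in> A (s @ [\<beta> (length s)])" unfolding A_def by (auto simp: nth_append less_Suc_eq)
      then show "z \<in> (\<Union>k. A (s @ [k]))" by blast
    qed
    show "(\<Union>k. A (s @ [k])) \<subseteq> A s" unfolding A_def by (auto simp: nth_append less_Suc_eq)
  qed
  \<comment> \<open>Density: near a point of \<open>B s\<close> the set \<open>A s\<close> is
    nonmeager, so one of the countably many \<open>A (s @ [k])\<close> is nonmeager there; up to a
    meager set it lies in \<open>H (s @ [k])\<close>, which must therefore be met.\<close>
  have M: "comeager {z. z \<in> B s \<longrightarrow> (\<exists>k. z \<in> H (s @ [k]))}" for s
  proof -
    let ?D = "(\<Union>k. H (s @ [k])) \<union> - B s"
    have "opn ?D" using opn_Union[of "insert (- B s) (range (\<lambda>k. H (s @ [k])))"] opnH opnB by (auto simp: Un_commute)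
    moreover have "dns ?D" unfolding dns_def
    proof (intro allI impI notI)
      fix F :: "'c set" and z assume F: "finite F" and e: "cyl F z \<inter> ?D = {}"
      have "z \<in> B s" using e cyl_self[of z F] by blast
      then have "\<not> mgr (A s \<inter> cyl F z)" using F unfolding B_def by auto
      moreover have "A s \<inter> cyl F z = (\<Union>k. A (s @ [k]) \<inter> cyl F z)" using As by blast
      ultimately obtain k where k: "\<not> mgr (A (s @ [k]) \<inter> cyl F z)" using mgr_UN[of "\<lambda>k. A (s @ [k]) \<inter> cyl F z"] by auto
      have "A (s @ [k]) \<inter> cyl F z \<subseteq> (A (s @ [k]) - B (s @ [k])) \<union> (B (s @ [k]) - H (s @ [k]))" using e by blast
      then show False using k AB BH mgr_Un mgr_subset by metis
    qed
    ultimately have "comeager ?D" by (rule comeager_opn_dns)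
    then show ?thesis by (rule comeager_mono) auto
  qed
  have "comeager {z. \<forall>s. z \<in> B s \<longrightarrow> (\<exists>k. z \<in> H (s @ [k]))}" by (rule comeager_Collect_all) (rule M)
  moreover have "comeager (- (A [] - B []))" "comeager (- (B [] - H []))" using AB BH unfolding mgr_def by auto
  ultimately have "comeager (Q \<inter> {z. \<forall>s. z \<in> B s \<longrightarrow> (\<exists>k. z \<in> H (s @ [k]))} \<inter> - (A [] - B []) \<inter> - (B [] - H []))"
    using Q by (intro comeager_Int) auto
  then have "comeager {z. (\<exists>\<beta>. P z \<beta>) \<longleftrightarrow> z \<in> H []}"
  proof (rule comeager_mono, intro subsetI CollectI iffI)
    fix z assume z: "z \<in> Q \<inter> {z. \<forall>s. z \<in> B s \<longrightarrow> (\<exists>k. z \<in> H (s @ [k]))} \<inter> - (A [] - B []) \<inter> - (B [] - H [])"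
    {
      assume "\<exists>\<beta>. P z \<beta>"
      then have "z \<in> A []" using z unfolding A_def by auto
      then show "z \<in> H []" using z by auto
    }
    assume "z \<in> H []"
    then have z0: "z \<in> B []" using HB by blast
    have step: "\<exists>k. z \<in> B (s @ [k])" if "z \<in> B s" for s using z that HB by blast
    \<comment> \<open>The point chooses a branch along which it stays in \<open>B\<close>. It need
      not lie in any \<open>A s\<close>; staying in \<open>B\<close> is enough, because a failure of
      \<open>P\<close> would spread to a neighbourhood and a finite part of the branch.\<close>
    define f where "f = rec_nat [] (\<lambda>_ s. s @ [SOME k. z \<in> B (s @ [k])])"
    have f: "f 0 = []" "f (Suc n) = f n @ [SOME k. z \<in> B (f n @ [k])]" for n unfolding f_def by auto
    have fB: "z \<in> B (f n)" for n
      by (induction n) (use z0 f step in \<open>auto intro: someI_ex\<close>)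
    have len: "length (f n) = n" for n by (induction n) (auto simp: f)
    define \<beta> where "\<beta> n = f (Suc n) ! n" for n
    have nth: "f n ! i = \<beta> i" if "i < n" for i n using that
    proof (induction n)
      case (Suc n)
      then show ?case by (cases "i = n") (auto simp: \<beta>_def f nth_append len less_Suc_eq)
    qed simp
    have zQ: "z \<in> Q" using z by simp
    have "P z \<beta>"
    proof (rule ccontr)
      assume "\<not> P z \<beta>"
      then obtain F k where F: "finite F" "\<forall>z'\<in>Q \<inter> cyl F z. \<forall>\<beta>'. (\<forall>i<k. \<beta>' i = \<beta> i) \<longrightarrow> \<not> P z' \<beta>'"
        using closed[OF zQ, of \<beta>] by blast
      have "z' \<notin> A (f k)" if "z' \<in> cyl F z" for z'
      proof
        assume "z' \<in> A (f k)"
        then obtain \<beta>' where "z' \<in> Q" "\<forall>i<k. \<beta>' i = f k ! i" "P z' \<beta>'" unfolding A_def len by auto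
        then show False using F(2) that nth by auto
      qed
      then have "A (f k) \<inter> cyl F z = {}" by blast
      then show False using fB[of k] F(1) mgr_empty unfolding B_def by auto
    qed
    then show "\<exists>\<beta>. P z \<beta>" by blast
  qed
  then show ?thesis unfolding bp_def using opnH by blast
qed

section \<open>Fibres of comeager sets\<close>

definition glue :: "('c \<Rightarrow> 'd) \<Rightarrow> 'c set \<Rightarrow> ('c \<Rightarrow> bool) \<Rightarrow> ('d \<Rightarrow> bool) \<Rightarrow> 'd \<Rightarrow> bool" where
  "glue g A w z = (\<lambda>d. if d \<in> g ` A then w (inv_into A g d) else z d)"

lemma glue_image: "inj_on g A \<Longrightarrow> c \<in> A \<Longrightarrow> glue g A w z (g c) = w c"
  by (simp add: glue_def)

lemma glue_other: "d \<notin> g ` A \<Longrightarrow> glue g A w z d = z d"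
  by (simp add: glue_def)

text \<open>The first factor consists of the coordinates in \<open>g ` A\<close>.\<close>

lemma kuratowski_ulam:
  fixes g :: "'c::countable \<Rightarrow> 'd::countable"
  assumes g: "inj_on g A" and Q: "comeager Q"
  shows "\<exists>D. (\<forall>k::nat. opn (D k) \<and> dns (D k) \<and> (\<forall>w w'. (\<forall>c\<in>A. w c = w' c) \<longrightarrow> w \<in> D k \<longrightarrow> w' \<in> D k)) \<and>
    (\<forall>w\<in>(\<Inter>k. D k). comeager {z. glue g A w z \<in> Q})"
proof -
  obtain U where U: "\<And>k::nat. opn (U k)" "\<And>k. dns (U k)" "(\<Inter>k. U k) \<subseteq> Q"
    using Q unfolding comeager_def by blast
  \<comment> \<open>Contradictory lists \<open>s\<close> are let through, so that
    \<open>E k s\<close> is dense for every \<open>s\<close>.\<close>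
  define E where "E k s = {w. (\<exists>z::'d\<Rightarrow>bool. holds s z) \<longrightarrow> (\<exists>z. holds s z \<and> glue g A w z \<in> U k)}" for k s
  have gc: "glue g A w z = glue g A w' z" if "\<forall>c\<in>A. w c = w' c" for w w' z
    using that unfolding glue_def by (auto simp: inv_into_into)
  have inv: "w' \<in> E k s" if "\<forall>c\<in>A. w c = w' c" "w \<in> E k s" for w w' k s
    using that gc[OF that(1)] unfolding E_def by auto
  have op: "opn (E k s)" for k s
    unfolding opn_def
  proof
    fix w assume w: "w \<in> E k s"
    show "\<exists>F. finite F \<and> cyl F w \<subseteq> E k s"
    proof (cases "\<exists>z::'d\<Rightarrow>bool. holds s z")
      case True
      then obtain z where z: "holds s z" "glue g A w z \<in> U k" using w unfolding E_def by auto
      obtain F where F: "finite F" "cyl F (glue g A w z) \<subseteq> U k" using U(1) z unfolding opn_def by blast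
      have "cyl (inv_into A g ` F) w \<subseteq> E k s"
      proof
        fix w' assume w': "w' \<in> cyl (inv_into A g ` F) w"
        have "glue g A w' z \<in> cyl F (glue g A w z)" using w' unfolding cyl_def glue_def by auto
        then show "w' \<in> E k s" using F z unfolding E_def by auto
      qed
      then show ?thesis using F by blast
    qed (auto simp: E_def)
  qed
  have dn: "dns (E k s)" for k s
    unfolding dns_def
  proof (intro allI impI)
    fix F :: "'c set" and w assume F: "finite F"
    show "cyl F w \<inter> E k s \<noteq> {}"
    proof (cases "\<exists>z::'d\<Rightarrow>bool. holds s z")
      case True
      then obtain z where z: "holds s z" by blast
      have "finite (g ` F \<union> fst ` set s)" using F by simp
      then obtain y where y: "y \<in> cyl (g ` F \<union> fst ` set s) (\<lambda>d. if d \<in> g ` (F \<inter> A) then w (inv_into A g d) else z d)" "y \<in> U k"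
        using U(2) unfolding dns_def by blast
      \<comment> \<open>The point \<open>y\<close> of \<open>U k\<close> is split: its coordinates
        in the image of \<open>A\<close> define \<open>w'\<close>, the others define
        \<open>z'\<close>, and glueing the two gives back \<open>y\<close>.\<close>
      define z' where "z' d = (if d \<in> g ` A then z d else y d)" for d
      define w' where "w' c = (if c \<in> A then y (g c) else w c)" for c
      have 1: "w' \<in> cyl F w" using y(1) g unfolding cyl_def w'_def by auto
      have "z' c = b" if cb: "(c, b) \<in> set s" for c b
      proof -
        have zc: "z c = b" using z cb unfolding holds_def by auto
        have "c \<in> fst ` set s" using cb by force
        then have "y c = (if c \<in> g ` (F \<inter> A) then w (inv_into A g c) else z c)" using y(1) unfolding cyl_def by blast
        then show ?thesis using zc unfolding z'_def by auto
      qed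
      then have 2: "holds s z'" unfolding holds_def by auto
      have 3: "glue g A w' z' = y" unfolding glue_def w'_def z'_def using g
        by (auto simp: inv_into_into f_inv_into_f)
      then show ?thesis using 1 2 y(2) unfolding E_def by auto
    next
      case False
      then have "w \<in> E k s" unfolding E_def by auto
      then show ?thesis using cyl_self[of w F] by blast
    qed
  qed
  define D where "D n = (case prod_decode n of (k, m) \<Rightarrow> E k (from_nat m))" for n
  have "comeager {z. glue g A w z \<in> Q}" if w: "w \<in> (\<Inter>n. D n)" for w
  proof -
    have wE: "w \<in> E k s" for k s
    proof -
      have "w \<in> D (prod_encode (k, to_nat s))" using w by blast
      then show ?thesis by (simp add: D_def)
    qed
    have o: "opn {z. glue g A w z \<in> U k}" for k
      unfolding opn_def
    proof
      fix z assume "z \<in> {z. glue g A w z \<in> U k}"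
      then obtain F where F: "finite F" "cyl F (glue g A w z) \<subseteq> U k" using U(1) unfolding opn_def by blast
      have "cyl F z \<subseteq> {z. glue g A w z \<in> U k}" using F(2) unfolding cyl_def glue_def by auto
      then show "\<exists>F. finite F \<and> cyl F z \<subseteq> {z. glue g A w z \<in> U k}" using F by blast
    qed
    have d: "dns {z. glue g A w z \<in> U k}" for k
      unfolding dns_def
    proof (intro allI impI)
      fix F :: "'d set" and z assume "finite F"
      then obtain s where s: "{z'. holds s z'} = cyl F z" using finite_to_holds by blast
      then have "holds s z" using cyl_self by blast
      then obtain z' where "holds s z'" "glue g A w z' \<in> U k" using wE[of k s] unfolding E_def by auto
      then show "cyl F z \<inter> {z. glue g A w z \<in> U k} \<noteq> {}" using s by blast
    qed
    have "comeager (\<Inter>k. {z. glue g A w z \<in> U k})" by (intro comeager_INT comeager_opn_dns o d)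
    then show ?thesis by (rule comeager_mono) (use U(3) in auto)
  qed
  moreover have "opn (D k) \<and> dns (D k) \<and> (\<forall>w w'. (\<forall>c\<in>A. w c = w' c) \<longrightarrow> w \<in> D k \<longrightarrow> w' \<in> D k)" for k
    unfolding D_def using op dn inv by (auto split: prod.split)
  ultimately show ?thesis by blast
qed

section \<open>Finite trees over a hierarchy of tokens\<close>

text \<open>\<open>Ext e k b j p\<close> adds a layer to the tree \<open>e\<close>: it prescribes the bit \<open>b\<close> between \<open>e\<close> and the
  tree \<open>k\<close> one level below, while \<open>j\<close> and \<open>p\<close> prescribe the bits towards the level above: \<open>j\<close> codes a
  finite table of views, and the trees \<open>p\<close> of all layers are the ones through which these views are taken.\<close>

datatype 'a el = Base 'a nat | Ext "'a el" "'a el" bool nat "'a el"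

text \<open>Keys and tokens occur in a view only as positions in the list of observers and as
  membership bits. Hence views are countable in number, and finite tables of views can be coded by
  numbers.\<close>

datatype vw = VB nat "bool list" | VE vw nat bool nat vw

instance el :: (countable) countable by countable_datatype
instance vw :: countable by countable_datatype

fun hmem :: "hc \<Rightarrow> hc \<Rightarrow> bool" where
  "hmem a (HSet c) = (a \<in> rcset c)"
| "hmem a (Ur r) = False"

primrec tok :: "'a el \<Rightarrow> 'a" where
  "tok (Base a q) = a"
| "tok (Ext e k b j p) = tok e"

primrec parts :: "'a el \<Rightarrow> 'a el list" where
  "parts (Base a q) = []"
| "parts (Ext e k b j p) = p # parts e"

primrec topj :: "'a el \<Rightarrow> nat" where
  "topj (Base a q) = 0"
| "topj (Ext e k b j p) = j"

primrec keybit :: "'a el \<Rightarrow> 'a el \<Rightarrow> bool option" where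
  "keybit (Base a q) w = None"
| "keybit (Ext e k b j p) w = (if w = k then Some b else keybit e w)"

primrec keyset :: "'a el \<Rightarrow> 'a el set" where
  "keyset (Base a q) = {}"
| "keyset (Ext e k b j p) = insert k (keyset e)"

primrec hkeys :: "'a el \<Rightarrow> 'a el set" where
  "hkeys (Base a q) = {}"
| "hkeys (Ext e k b j p) = insert k (hkeys e \<union> hkeys p)"

primrec htoks :: "'a el \<Rightarrow> 'a set" where
  "htoks (Base a q) = {a}"
| "htoks (Ext e k b j p) = htoks e \<union> htoks p"

definition idx :: "'a list \<Rightarrow> 'a \<Rightarrow> nat" where
  "idx P k = length (takeWhile (\<lambda>x. x \<noteq> k) P)"

text \<open>What a list \<open>P\<close> of trees of one level sees of a tree of the next level: a layer of the latter
  is visible only if its key is in \<open>P\<close>, and its token is seen only through the tokens in \<open>P\<close>.\<close>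

primrec view :: "hc el list \<Rightarrow> hc el \<Rightarrow> vw" where
  "view P (Base b q) = VB q (map (\<lambda>p. hmem (tok p) b) P)"
| "view P (Ext e k b j p) = (if k \<in> set P then VE (view P e) (idx P k) b j (view P p) else view P e)"

text \<open>A number codes a finite table of views, a finite initial segment of a real (see
  \<open>pref\<close>), and a third number that is free; the latter provides arbitrarily large codes
  of the same data.\<close>

definition tab :: "nat \<Rightarrow> vw set" where
  "tab j = set (fst (from_nat j :: vw list \<times> bool list \<times> nat))"

definition pref :: "nat \<Rightarrow> bool list" where
  "pref j = fst (snd (from_nat j :: vw list \<times> bool list \<times> nat))"

text \<open>A key of \<open>e\<close> settles the bit by decree; without one, the lower tree
  \<open>w\<close> looks the view of \<open>e\<close> up in its table. So whichever of the two trees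
  is chosen last can still obtain the desired bit.\<close>

definition bit :: "hc el \<Rightarrow> hc el \<Rightarrow> bool" where
  "bit w e = (case keybit e w of Some b \<Rightarrow> b | None \<Rightarrow> view (parts w) e \<in> tab (topj w))"

lemma idx_nth: "k \<in> set P \<Longrightarrow> idx P k < length P \<and> P ! idx P k = k"
  unfolding idx_def by (induction P) auto

lemma idx_inj: "k \<in> set P \<Longrightarrow> k' \<in> set P \<Longrightarrow> idx P k = idx P k' \<Longrightarrow> k = k'"
  by (metis idx_nth)

text \<open>Recomputes a view through \<open>P\<close> from the view through a list
  \<open>P'\<close> containing \<open>P\<close>; it witnesses that larger lists see at least as
  much.\<close>

primrec vrestr :: "'a list \<Rightarrow> 'a list \<Rightarrow> vw \<Rightarrow> vw" where
  "vrestr P P' (VB q bl) = VB q (map (\<lambda>p. bl ! idx P' p) P)"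
| "vrestr P P' (VE v k b j u) =
    (if P' ! k \<in> set P then VE (vrestr P P' v) (idx P (P' ! k)) b j (vrestr P P' u) else vrestr P P' v)"

lemma view_vrestr: "set P \<subseteq> set P' \<Longrightarrow> view P e = vrestr P P' (view P' e)"
proof (induction e)
  case (Base b q)
  then show ?case using idx_nth[of _ P'] by (auto simp: subset_iff)
next
  case (Ext e k b j p)
  then show ?case using idx_nth[of k P'] by (auto simp: subset_iff)
qed

lemma view_mono: "set P \<subseteq> set P' \<Longrightarrow> view P' e = view P' f \<Longrightarrow> view P e = view P f"
  by (metis view_vrestr)

text \<open>A list containing the keys makes the layers visible, and enlarging a list never hides a
  difference. So the two trees are compared in parallel until they differ in a key, a number, a bit,
  or a base token.\<close>

lemma view_separates:
  assumes "e1 \<noteq> e2" "hkeys e1 \<union> hkeys e2 \<subseteq> K"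
    and "\<And>b b'. b \<in> htoks e1 \<Longrightarrow> b' \<in> htoks e2 \<Longrightarrow> b \<noteq> b' \<Longrightarrow> \<exists>p\<in>K. hmem (tok p) b \<noteq> hmem (tok p) b'"
  shows "\<exists>P. set P \<subseteq> K \<and> view P e1 \<noteq> view P e2"
  using assms
proof (induction e1 arbitrary: e2)
  case (Base b q)
  show ?case
  proof (cases e2)
    case (Base b' q')
    show ?thesis
    proof (cases "q = q'")
      case True
      then have "b \<noteq> b'" using Base \<open>Base b q \<noteq> e2\<close> by auto
      then obtain p where "p \<in> K" "hmem (tok p) b \<noteq> hmem (tok p) b'" using Base.prems(3)[of b b'] Base by auto
      then show ?thesis by (intro exI[of _ "[p]"]) (auto simp: Base)
    qed (auto intro!: exI[of _ "[]"] simp: Base)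
  next
    case (Ext e k b' j p)
    then show ?thesis using Base.prems(2) by (intro exI[of _ "[k]"]) auto
  qed
next
  case (Ext e k b j p)
  show ?case
  proof (cases e2)
    case (Base b' q')
    then show ?thesis using Ext.prems(2) by (intro exI[of _ "[k]"]) auto
  next
    case e2: (Ext e' k' b' j' p')
    consider "k \<noteq> k'" | "k = k'" "b \<noteq> b' \<or> j \<noteq> j'" | "k = k'" "e \<noteq> e'" | "k = k'" "p \<noteq> p'"
      using Ext.prems(1) e2 by auto
    then show ?thesis
    proof cases
      case 1
      then have "idx [k, k'] k \<noteq> idx [k, k'] k'" using idx_inj[of k "[k, k']" k'] by auto
      then show ?thesis using Ext.prems(2) e2 by (intro exI[of _ "[k, k']"]) auto
    next
      case 2
      then show ?thesis using Ext.prems(2) e2 by (intro exI[of _ "[k]"]) auto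
    next
      case 3
      have "\<exists>P. set P \<subseteq> K \<and> view P e \<noteq> view P e'"
        using Ext.IH(1)[of e'] 3 Ext.prems(2,3) e2 by auto
      then obtain P where P: "set P \<subseteq> K" "view P e \<noteq> view P e'" by blast
      then have "view (k # P) e \<noteq> view (k # P) e'" using view_mono[of P "k # P"] by auto
      then show ?thesis using Ext.prems(2) e2 P(1) 3 by (intro exI[of _ "k # P"]) auto
    next
      case 4
      have "\<exists>P. set P \<subseteq> K \<and> view P p \<noteq> view P p'"
        using Ext.IH(3)[of p'] 4 Ext.prems(2,3) e2 by auto
      then obtain P where P: "set P \<subseteq> K" "view P p \<noteq> view P p'" by blast
      then have "view (k # P) p \<noteq> view (k # P) p'" using view_mono[of P "k # P"] by auto
      then show ?thesis using Ext.prems(2) e2 P(1) 4 by (intro exI[of _ "k # P"]) auto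
    qed
  qed
qed

section \<open>Traces: what can be seen of a tree from a set of trees one level below\<close>

definition labeq :: "hc el set \<Rightarrow> hc el \<Rightarrow> hc el \<Rightarrow> bool" where
  "labeq C e f \<longleftrightarrow> (\<forall>P. set P \<subseteq> C \<longrightarrow> view P e = view P f)"

lemma labeq_refl [simp]: "labeq C e e"
  by (simp add: labeq_def)

lemma labeq_sym: "labeq C e f \<Longrightarrow> labeq C f e"
  by (simp add: labeq_def)

lemma labeq_trans: "labeq C e f \<Longrightarrow> labeq C f g \<Longrightarrow> labeq C e g"
  by (simp add: labeq_def)

lemma not_labeq: "\<not> labeq C e f \<Longrightarrow> \<exists>P. set P \<subseteq> C \<and> view P e \<noteq> view P f"
  by (auto simp: labeq_def)

text \<open>The source of freedom above the first difference: layers keyed outside \<open>C\<close>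
  leave the trace on \<open>C\<close> untouched, so one trace is shared by many trees.\<close>

lemma labeq_Ext_hidden: "k \<notin> C \<Longrightarrow> labeq C (Ext e k b j p) e"
  by (auto simp: labeq_def)

lemma labeq_Ext_cong: "labeq C e e' \<Longrightarrow> labeq C p p' \<Longrightarrow> labeq C (Ext e k b j p) (Ext e' k b j p')"
  by (auto simp: labeq_def)

lemma labeq_Ext_Ext:
  assumes "labeq C (Ext e k b j p) (Ext e' k' b' j' p')" "k \<in> C" "k' \<in> C"
  shows "k = k'" "b = b'" "j = j'" "labeq C e e'" "labeq C p p'"
proof -
  have *: "view P (Ext e k b j p) = view P (Ext e' k' b' j' p')" if "set P \<subseteq> C" for P
    using assms(1) that unfolding labeq_def by blast
  show k: "k = k'" using *[of "[k, k']"] assms(2,3) idx_inj[of k "[k, k']" k'] by auto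
  show "b = b'" "j = j'" using *[of "[k, k']"] assms(2,3) by auto
  have "view P e = view P e' \<and> view P p = view P p'" if "set P \<subseteq> C" for P
  proof -
    have "view (k # P) e = view (k # P) e' \<and> view (k # P) p = view (k # P) p'"
      using *[of "k # P"] that assms(2) k by auto
    then show ?thesis using view_mono[of P "k # P"] by auto
  qed
  then show "labeq C e e'" "labeq C p p'" unfolding labeq_def by auto
qed

lemma labeq_Base_Ext: "k \<in> C \<Longrightarrow> \<not> labeq C (Base c q) (Ext e k b j p)"
  unfolding labeq_def by (intro notI, drule spec[of _ "[k]"]) auto

lemma labeq_Base: "labeq C (Base b q) (Base c q') \<longleftrightarrow> q = q' \<and> (\<forall>p\<in>C. hmem (tok p) b = hmem (tok p) c)"
proof
  assume l: "labeq C (Base b q) (Base c q')"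
  have "hmem (tok p) b = hmem (tok p) c" if "p \<in> C" for p
    using l that unfolding labeq_def by (auto dest!: spec[of _ "[p]"])
  moreover have "q = q'" using l unfolding labeq_def by (auto dest!: spec[of _ "[]"])
  ultimately show "q = q' \<and> (\<forall>p\<in>C. hmem (tok p) b = hmem (tok p) c)" by blast
qed (auto simp: labeq_def)

text \<open>Here \<open>R\<close> will be membership in the trees of one side. A tree with the same
  trace must carry the visible layer too, possibly under hidden ones; peeling these off gives
  matching traces for the constituents.\<close>

lemma labeq_Ext_strip:
  assumes "labeq C (Ext e k b j p) g" "k \<in> C" "R g"
    and R: "\<And>e k b j p. R (Ext e k b j p) \<Longrightarrow> R e \<and> R p"
  shows "\<exists>g' p'. R g' \<and> R p' \<and> labeq C e g' \<and> labeq C p p'"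
  using assms(1,3)
proof (induction g)
  case (Base c q)
  then show ?case using labeq_Base_Ext[OF assms(2)] labeq_sym by blast
next
  case (Ext g1 k1 b1 j1 p1)
  show ?case
  proof (cases "k1 \<in> C")
    case True
    then show ?thesis using labeq_Ext_Ext[OF Ext.prems(1) assms(2) True] R Ext.prems(2) by blast
  next
    case False
    then have "labeq C (Ext e k b j p) g1" using labeq_Ext_hidden Ext.prems(1) labeq_trans by blast
    then show ?thesis using Ext.IH(1) R Ext.prems(2) by blast
  qed
qed

lemma labeq_Base_strip:
  assumes "labeq C (Base b q) g" "R g" and R: "\<And>e k b j p. R (Ext e k b j p) \<Longrightarrow> R e \<and> R p"
  shows "\<exists>c. R (Base c q) \<and> (\<forall>p\<in>C. hmem (tok p) b = hmem (tok p) c)"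
  using assms(1,2)
proof (induction g)
  case (Base c q')
  then show ?case using labeq_Base by auto
next
  case (Ext g1 k1 b1 j1 p1)
  then have "k1 \<notin> C" using labeq_Base_Ext by blast
  then have "labeq C (Base b q) g1" using labeq_Ext_hidden Ext.prems(1) labeq_trans by blast
  then show ?case using Ext.IH(1) R Ext.prems(2) by blast
qed

primrec vkeybit :: "nat \<Rightarrow> vw \<Rightarrow> bool option" where
  "vkeybit i (VB q bl) = None"
| "vkeybit i (VE v k b j u) = (if k = i then Some b else vkeybit i v)"

lemma keybit_view: "u \<in> set P \<Longrightarrow> keybit e u = vkeybit (idx P u) (view P e)"
proof (induction e)
  case (Ext e k b j p)
  show ?case
  proof (cases "k \<in> set P")
    case True
    have "idx P k = idx P u \<longleftrightarrow> u = k" using idx_inj[of u P k] True Ext.prems by metis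
    then show ?thesis using Ext True by simp
  next
    case False
    then have "u \<noteq> k" using Ext.prems by auto
    then show ?thesis using Ext False by simp
  qed
qed simp

text \<open>Both branches of \<open>bit\<close> are functions of the trace: whether \<open>u\<close>
  is a key, and with which bit, is read off the view through \<open>[u]\<close>, and the table of
  \<open>u\<close> is consulted with the view through its parts.\<close>

lemma labeq_bit:
  assumes "labeq C e f" "u \<in> C" "set (parts u) \<subseteq> C"
  shows "bit u e = bit u f"
proof -
  have "view [u] e = view [u] f" "view (parts u) e = view (parts u) f" using assms unfolding labeq_def by auto
  then show ?thesis using keybit_view[of u "[u]" e] keybit_view[of u "[u]" f] unfolding bit_def
    by (auto split: option.split)
qed

section \<open>Realising a finite pattern of bits by adding layers\<close>

inductive bld :: "'a el set \<Rightarrow> 'a el set \<Rightarrow> 'a el \<Rightarrow> 'a el \<Rightarrow> bool" for Ks Ps e0 where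
  bld_refl: "bld Ks Ps e0 e0"
| bld_Ext: "bld Ks Ps e0 e \<Longrightarrow> k \<in> Ks \<Longrightarrow> p \<in> Ps \<Longrightarrow> bld Ks Ps e0 (Ext e k b j p)"

lemma labeq_bld: "bld Ks Ps e0 e \<Longrightarrow> Ks \<inter> C = {} \<Longrightarrow> labeq C e0 e"
proof (induction rule: bld.induct)
  case (bld_Ext e k p b j)
  then show ?case using labeq_Ext_hidden[of k C e b j p] labeq_sym labeq_trans by blast
qed simp

lemma finite_keyset: "finite (keyset e)"
  by (induction e) auto

lemma keybit_None: "keybit e w = None \<longleftrightarrow> w \<notin> keyset e"
  by (induction e) auto

lemma ex_code: "\<exists>j>N. tab j = set vs \<and> pref j = \<pi>"
proof -
  let ?f = "\<lambda>d::nat. to_nat (vs, \<pi>, d)"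
  have "inj ?f" by (auto simp: inj_def)
  then have "infinite (range ?f)" by (rule range_inj_infinite)
  then have "\<not> range ?f \<subseteq> {..N}" using finite_subset by blast
  then obtain d where "?f d \<notin> {..N}" by blast
  then have "?f d > N" by (simp only: atMost_iff not_le)
  then show ?thesis by (intro exI[of _ "?f d"]) (simp add: tab_def pref_def)
qed

text \<open>Bits towards the trees of \<open>Ks\<close> are decreed by keys. For the bits towards
  \<open>Up\<close>, the table lists the views of those trees that shall contain the new one; since
  all of \<open>Ps\<close> is among the parts, different members of \<open>Up\<close> have different
  views.\<close>

lemma exists_extension:
  fixes e0 :: "hc el"
  assumes fin: "finite Ks" "finite Ps" "finite Up" and ne: "Ks \<noteq> {}" "Ps \<noteq> {}"
    and sep: "\<And>f g. f \<in> Up \<Longrightarrow> g \<in> Up \<Longrightarrow> f \<noteq> g \<Longrightarrow> \<exists>P. set P \<subseteq> Ps \<and> view P f \<noteq> view P g"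
  shows "\<exists>e1 k b j p. k \<in> Ks \<and> bld Ks Ps e0 (Ext e1 k b j p) \<and> N < j \<and> pref j = \<pi> \<and>
    (\<forall>k'\<in>Ks. bit k' (Ext e1 k b j p) = dn k') \<and> (\<forall>f\<in>Up. bit (Ext e1 k b j p) f = up f)"
proof -
  have "finite (Ks \<times> Ps)" using fin by simp
  then obtain prs where prs: "set prs = Ks \<times> Ps" using finite_list by blast
  \<comment> \<open>One layer for each pair, all with the same number \<open>j\<close>: every member
    of \<open>Ks\<close> becomes a key and every member of \<open>Ps\<close> a part.\<close>
  define B where "B j qs = foldr (\<lambda>(k, p) a. Ext a k (dn k) j p) qs e0" for j qs
  have Bparts: "parts (B j qs) = map snd qs @ parts e0" for j qs
    by (induction qs) (auto simp: B_def)
  have Bbld: "bld Ks Ps e0 (B j qs)" if "set qs \<subseteq> Ks \<times> Ps" for j qs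
    using that by (induction qs) (auto simp: B_def intro: bld.intros)
  have Bkey: "keybit (B j qs) k = Some (dn k)" if "k \<in> fst ` set qs" for j qs k
    using that by (induction qs) (force simp: B_def)+
  define P where "P = map snd prs @ parts e0"
  have PsP: "Ps \<subseteq> set P" unfolding P_def using prs ne(1) by force
  have inj: "f = g" if fg: "f \<in> Up" "g \<in> Up" "view P f = view P g" for f g
  proof (rule ccontr)
    assume "f \<noteq> g"
    then obtain P' where "set P' \<subseteq> Ps" "view P' f \<noteq> view P' g" using sep[OF fg(1,2) \<open>f \<noteq> g\<close>] by blast
    then show False using view_mono[of P' P f g] fg(3) PsP by auto
  qed
  obtain vs where vs: "set vs = view P ` {f \<in> Up. up f}" using finite_list[of "view P ` {f \<in> Up. up f}"] fin(3) by auto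
  \<comment> \<open>The number of the new tree will exceed the numbers of all keys occurring in
    \<open>Up\<close>. So it is none of these keys, and its table is really consulted.\<close>
  have "finite (topj ` (\<Union>f\<in>Up. keyset f))" using fin(3) finite_keyset by auto
  then obtain N' where N': "\<And>m. m \<in> topj ` (\<Union>f\<in>Up. keyset f) \<Longrightarrow> m \<le> N'" by (meson finite_nat_set_iff_bounded_le)
  obtain j where j: "j > max N N'" "tab j = set vs" "pref j = \<pi>" using ex_code[of "max N N'" vs \<pi>] by auto
  obtain k p qs where qs: "prs = (k, p) # qs" using prs ne by (cases prs) auto
  let ?e = "Ext (B j qs) k (dn k) j p"
  have e: "?e = B j prs" by (simp add: qs B_def)
  have "bit k' ?e = dn k'" if "k' \<in> Ks" for k'
  proof -
    have "k' \<in> fst ` set prs" using that prs ne(2) by force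
    then show ?thesis unfolding e bit_def using Bkey by simp
  qed
  moreover have "bit ?e f = up f" if f: "f \<in> Up" for f
  proof -
    have "?e \<notin> keyset f"
    proof
      assume "?e \<in> keyset f"
      then have "j \<in> topj ` (\<Union>f\<in>Up. keyset f)" using f by force
      then show False using N' j(1) by fastforce
    qed
    then have "bit ?e f \<longleftrightarrow> view (parts ?e) f \<in> tab j" unfolding bit_def using keybit_None[of f ?e] by simp
    also have "parts ?e = P" unfolding e Bparts P_def ..
    also have "view P f \<in> tab j \<longleftrightarrow> up f" unfolding j(2) vs using inj f by auto
    finally show ?thesis .
  qed
  moreover have "bld Ks Ps e0 ?e" unfolding e by (rule Bbld) (use prs in auto)
  moreover have "k \<in> Ks" using qs prs by auto
  ultimately show ?thesis using j by (intro exI[of _ "B j qs"] exI[of _ k] exI[of _ "dn k"] exI[of _ j] exI[of _ p]) auto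
qed

text \<open>On level 0 the truncated subtraction makes the keys trees of level 0 again. They settle
  no bit there but keep the form of trees the same on all levels.\<close>

primrec wfe :: "(nat \<Rightarrow> 'a set) \<Rightarrow> nat \<Rightarrow> 'a el \<Rightarrow> bool" where
  "wfe S l (Base a q) = (a \<in> S l)"
| "wfe S l (Ext e k b j p) = (wfe S l e \<and> wfe S (l - 1) k \<and> wfe S l p)"

definition El :: "(nat \<Rightarrow> 'a set) \<Rightarrow> nat \<Rightarrow> 'a el set" where
  "El S l = {e. wfe S l e}"

lemma El_Base [simp]: "Base a q \<in> El S l \<longleftrightarrow> a \<in> S l"
  by (simp add: El_def)

lemma El_Ext [simp]: "Ext e k b j p \<in> El S l \<longleftrightarrow> e \<in> El S l \<and> k \<in> El S (l - 1) \<and> p \<in> El S l"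
  by (auto simp: El_def)

lemma El_bld: "bld Ks Ps e0 e \<Longrightarrow> e0 \<in> El S l \<Longrightarrow> Ks \<subseteq> El S (l - 1) \<Longrightarrow> Ps \<subseteq> El S l \<Longrightarrow> e \<in> El S l"
  by (induction rule: bld.induct) auto

lemma El_tok: "e \<in> El S l \<Longrightarrow> tok e \<in> S l"
  by (induction e) auto

lemma El_parts: "e \<in> El S l \<Longrightarrow> set (parts e) \<subseteq> El S l"
  by (induction e) auto

lemma El_hkeys: "e \<in> El S l \<Longrightarrow> hkeys e \<subseteq> El S (l - 1)"
  by (induction e) auto

lemma El_htoks: "e \<in> El S l \<Longrightarrow> htoks e \<subseteq> S l"
  by (induction e) auto

lemma El_cong:
  assumes "\<And>m. m \<le> l \<Longrightarrow> S m = S' m"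
  shows "El S l = El S' l"
proof -
  have "wfe S m e = wfe S' m e" if "m \<le> l" for m and e :: "'a el"
    using that by (induction e arbitrary: m) (auto simp: assms)
  then show ?thesis unfolding El_def by auto
qed

section \<open>The Borel structure and the Baire property\<close>

text \<open>An abstraction from the three nested products: local determination by finitely many
  coordinates is inherited by a product, one factor at a time.\<close>

definition finite_loc :: "'a topology \<Rightarrow> ('j \<Rightarrow> 'a \<Rightarrow> bool) \<Rightarrow> bool" where
  "finite_loc T C \<longleftrightarrow> (\<forall>V x. openin T V \<longrightarrow> x \<in> V \<longrightarrow> (\<exists>F. finite F \<and> (\<forall>x'. (\<forall>j\<in>F. C j x' = C j x) \<longrightarrow> x' \<in> V)))"

lemma finite_loc_product:
  assumes T: "finite_loc T C" and UT: "topspace T = UNIV"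
  shows "finite_loc (product_topology (\<lambda>_::'i. T) UNIV) (\<lambda>(i, j) x. C j (x i))"
  unfolding finite_loc_def
proof (intro allI impI)
  fix V and x :: "'i \<Rightarrow> 'a" assume V: "openin (product_topology (\<lambda>_. T) UNIV) V" "x \<in> V"
  then obtain U where U: "finite {i. U i \<noteq> UNIV}" "\<And>i. openin T (U i)" "x \<in> Pi\<^sub>E UNIV U" "Pi\<^sub>E UNIV U \<subseteq> V"
    unfolding openin_product_topology_alt UT by auto
  have "\<forall>i. \<exists>F. finite F \<and> (\<forall>x'. (\<forall>j\<in>F. C j x' = C j (x i)) \<longrightarrow> x' \<in> U i)"
    using T U(2,3) unfolding finite_loc_def by (auto simp: PiE_iff)
  then obtain F where F: "\<And>i. finite (F i)" "\<And>i x'. (\<forall>j\<in>F i. C j x' = C j (x i)) \<Longrightarrow> x' \<in> U i" by metis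
  let ?F = "Sigma {i. U i \<noteq> UNIV} F"
  have "x' \<in> V" if x': "\<forall>ij\<in>?F. (case ij of (i, j) \<Rightarrow> \<lambda>x. C j (x i)) x' = (case ij of (i, j) \<Rightarrow> \<lambda>x. C j (x i)) x" for x'
  proof -
    have "x' i \<in> U i" for i
    proof (cases "U i = UNIV")
      case False
      then have "\<forall>j\<in>F i. C j (x' i) = C j (x i)" using x' by auto
      then show ?thesis by (rule F(2))
    qed simp
    then show ?thesis using U(4) by (auto simp: PiE_iff)
  qed
  then show "\<exists>F. finite F \<and> (\<forall>x'. (\<forall>j\<in>F. (case j of (i, j) \<Rightarrow> \<lambda>x. C j (x i)) x' = (case j of (i, j) \<Rightarrow> \<lambda>x. C j (x i)) x) \<longrightarrow> x' \<in> V)"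
    using U(1) F(1) by (intro exI[of _ ?F]) blast
qed

definition co_of :: "pt \<Rightarrow> nat \<times> nat \<times> nat \<Rightarrow> bool" where
  "co_of x = (\<lambda>(l, k, m). x l k m)"

lemma openin_ptop_finite:
  assumes "openin ptop V" "x \<in> V"
  shows "\<exists>F. finite F \<and> (\<forall>x'. (\<forall>c\<in>F. co_of x' c = co_of x c) \<longrightarrow> x' \<in> V)"
proof -
  have d: "finite_loc (discrete_topology (UNIV :: bool set)) (\<lambda>_::unit. \<lambda>b. b)"
    unfolding finite_loc_def by (auto intro!: exI[of _ "{()}"])
  let ?C = "\<lambda>(l, j) x. (case j of (k, j) \<Rightarrow> \<lambda>x. (case j of (m, j::unit) \<Rightarrow> \<lambda>x. x m) (x k)) (x l)"
  have "finite_loc ptop ?C"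
    unfolding ptop_def by (intro finite_loc_product d) auto
  then obtain F where F: "finite F" "\<And>x'. (\<forall>j\<in>F. ?C j x' = ?C j x) \<Longrightarrow> x' \<in> V"
    using assms unfolding finite_loc_def by blast
  have "x' \<in> V" if c: "\<forall>c\<in>(\<lambda>(l, k, m, u). (l, k, m)) ` F. co_of x' c = co_of x c" for x'
  proof (rule F(2), rule ballI)
    fix j assume j: "j \<in> F"
    obtain l k m u where jj: "j = (l, k, m, u)" by (cases j) auto
    have "(l, k, m) \<in> (\<lambda>(l, k, m, u). (l, k, m)) ` F" using j jj by force
    then have "co_of x' (l, k, m) = co_of x (l, k, m)" using c by blast
    then show "?C j x' = ?C j x" unfolding jj by (simp add: co_of_def)
  qed
  then show ?thesis using F(1) by (intro exI[of _ "(\<lambda>(l, k, m, u). (l, k, m)) ` F"]) blast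
qed

lemma topspace_Xtop [simp]: "topspace (Xtop n) = Xsp n"
  by (simp add: Xtop_def ptop_def)

lemma space_borel_of [simp]: "space (borel_of T) = topspace T"
  by (simp add: borel_of_def space_measure_of_conv)

lemma sets_borel_of: "sets (borel_of T) = sigma_sets (topspace T) {U. openin T U}"
  unfolding borel_of_def by (rule sets_measure_of) (auto dest: openin_subset)

lemma continuous_coord: "continuous_map ptop (discrete_topology UNIV) (\<lambda>x. x l k m)"
proof -
  have 1: "continuous_map ptop (product_topology (\<lambda>_. product_topology (\<lambda>_. discrete_topology (UNIV :: bool set)) UNIV) UNIV) (\<lambda>x. x l)"
    unfolding ptop_def by (rule continuous_map_product_projection) simp
  have 2: "continuous_map (product_topology (\<lambda>_::nat. product_topology (\<lambda>_::nat. discrete_topology (UNIV :: bool set)) UNIV) UNIV)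
     (product_topology (\<lambda>_. discrete_topology (UNIV :: bool set)) UNIV) (\<lambda>x. x k)"
    by (rule continuous_map_product_projection) simp
  have 3: "continuous_map (product_topology (\<lambda>_::nat. discrete_topology (UNIV :: bool set)) UNIV) (discrete_topology UNIV) (\<lambda>x. x m)"
    by (rule continuous_map_product_projection) simp
  show ?thesis using continuous_map_compose[OF continuous_map_compose[OF 1 2] 3] by (simp add: o_def)
qed

lemma pred_coord: "Measurable.pred (borel_of (Xtop n)) (\<lambda>x. x l k m)"
proof -
  have "openin ptop {x \<in> topspace ptop. x l k m \<in> {True}}"
    using continuous_coord[of l k m] by (rule openin_continuous_map_preimage) simp
  then have "openin (Xtop n) ({x. x l k m} \<inter> Xsp n)"
    unfolding Xtop_def by (intro openin_subtopology_Int) (simp add: ptop_def)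
  then have "{x. x l k m} \<inter> Xsp n \<in> sets (borel_of (Xtop n))" unfolding sets_borel_of by blast
  then show ?thesis by (simp add: pred_def Collect_conj_eq Int_commute)
qed

definition vconds :: "pt set \<Rightarrow> ((nat \<times> nat \<times> nat) \<times> bool) list set" where
  "vconds V = {s. \<forall>x. holds s (co_of x) \<longrightarrow> x \<in> V}"

text \<open>Second countability in usable form: membership in an open set is a countable disjunction
  of finite conditions, hence measurable, or with the Baire property, as soon as the coordinates
  are.\<close>

lemma openin_ptop_iff_vconds:
  assumes "openin ptop V" shows "x \<in> V \<longleftrightarrow> (\<exists>s. s \<in> vconds V \<and> holds s (co_of x))"
proof
  assume "x \<in> V"
  then obtain F where F: "finite F" "\<And>x'. (\<forall>c\<in>F. co_of x' c = co_of x c) \<Longrightarrow> x' \<in> V"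
    using openin_ptop_finite[OF assms] by blast
  obtain s where s: "{z. holds s z} = cyl F (co_of x)" using finite_to_holds[OF F(1)] by blast
  then have "holds s (co_of x)" using cyl_self by blast
  moreover have "s \<in> vconds V" unfolding vconds_def
  proof (intro CollectI allI impI)
    fix x' assume "holds s (co_of x')"
    then have "co_of x' \<in> cyl F (co_of x)" using s by blast
    then show "x' \<in> V" using F(2) unfolding cyl_def by blast
  qed
  ultimately show "\<exists>s. s \<in> vconds V \<and> holds s (co_of x)" by blast
qed (auto simp: vconds_def)

lemma measurable_into_Xtop:
  assumes "f \<in> space M \<rightarrow> Xsp n" and "\<And>l k m. Measurable.pred M (\<lambda>w. f w l k m)"
  shows "f \<in> M \<rightarrow>\<^sub>M borel_of (Xtop n)"
  unfolding borel_of_def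
proof (rule measurable_measure_of)
  show "f \<in> space M \<rightarrow> topspace (Xtop n)" using assms(1) by simp
  show "{U. openin (Xtop n) U} \<subseteq> Pow (topspace (Xtop n))" using openin_subset by blast
  fix U assume "U \<in> {U. openin (Xtop n) U}"
  then obtain V where V: "openin ptop V" "U = V \<inter> Xsp n" unfolding Xtop_def by (auto simp: openin_subtopology)
  have *: "Measurable.pred M (\<lambda>w. co_of (f w) c)" for c
    using assms(2) by (cases c) (auto simp: co_of_def)
  have h: "Measurable.pred M (\<lambda>w. holds s (co_of (f w)))" for s
  proof (induction s)
    case (Cons a s)
    have "Measurable.pred M (\<lambda>w. co_of (f w) (fst a) = snd a)"
      using *[of "fst a"] by (cases "snd a") auto
    then have "Measurable.pred M (\<lambda>w. co_of (f w) (fst a) = snd a \<and> holds s (co_of (f w)))"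
      using Cons by (rule pred_intros_logic)
    then show ?case by (simp add: holds_def case_prod_unfold)
  qed (simp add: holds_def)
  then have "Measurable.pred M (\<lambda>w. \<exists>s. s \<in> vconds V \<and> holds s (co_of (f w)))"
    using h by (intro pred_intros_countable pred_intros_logic) simp_all
  then have "Measurable.pred M (\<lambda>w. f w \<in> V)" using openin_ptop_iff_vconds[OF V(1)] by simp
  then have "{w \<in> space M. f w \<in> V} \<in> sets M" by (simp add: pred_def)
  moreover have "f -` U \<inter> space M = {w \<in> space M. f w \<in> V}" using assms(1) V(2) by auto
  ultimately show "f -` U \<inter> space M \<in> sets M" by simp
qed

section \<open>The Baire property of preimages and of classifiable relations\<close>

definition bpmap :: "(('c::countable \<Rightarrow> bool) \<Rightarrow> pt) \<Rightarrow> bool" where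
  "bpmap \<phi> \<longleftrightarrow> (\<forall>l k m. bp (\<lambda>z. \<phi> z l k m))"

lemma bp_Xsp:
  assumes "bpmap \<phi>" shows "bp (\<lambda>z. \<phi> z \<in> Xsp n)"
proof -
  have b: "bp (\<lambda>z. \<phi> z l k m)" for l k m using assms unfolding bpmap_def by blast
  show ?thesis unfolding Xsp_def mem_Collect_eq fun_eq_iff
    by (intro bp_conj bp_all bp_imp bp_ex bp_iff bp_const b)
qed

lemma bp_borel:
  assumes \<phi>: "bpmap \<phi>" and B: "B \<in> sets (borel_of (Xtop n))"
  shows "bp (\<lambda>z. \<phi> z \<in> B)"
  using B unfolding sets_borel_of
proof (induction rule: sigma_sets.induct)
  case (Basic U)
  then obtain V where V: "openin ptop V" "U = V \<inter> Xsp n" unfolding Xtop_def by (auto simp: openin_subtopology)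
  have b: "bp (\<lambda>z. co_of (\<phi> z) c)" for c
    using \<phi> unfolding bpmap_def by (cases c) (auto simp: co_of_def)
  have "bp (\<lambda>z. holds s (co_of (\<phi> z)))" for s
  proof (induction s)
    case (Cons a s)
    have "bp (\<lambda>z. (co_of (\<phi> z) (fst a) \<longleftrightarrow> snd a) \<and> holds s (co_of (\<phi> z)))" by (intro bp_conj bp_iff bp_const b Cons)
    then show ?case by (simp add: holds_def case_prod_unfold)
  qed (simp add: holds_def bp_const)
  then have "bp (\<lambda>z. \<exists>s. s \<in> vconds V \<and> holds s (co_of (\<phi> z)))" by (intro bp_ex bp_conj bp_const)
  then have "bp (\<lambda>z. \<phi> z \<in> V)" using openin_ptop_iff_vconds[OF V(1)] by simp
  then show ?case using bp_Xsp[OF \<phi>, of n] bp_conj V(2) by simp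
next
  case Empty
  then show ?case using bp_const[of False] by simp
next
  case (Compl a)
  then have "bp (\<lambda>z. \<phi> z \<in> Xsp n \<and> \<not> \<phi> z \<in> a)" by (intro bp_conj bp_not bp_Xsp \<phi>)
  then show ?case by simp
next
  case (Union a)
  then have "bp (\<lambda>z. \<exists>i. \<phi> z \<in> a i)" by (intro bp_ex)
  then show ?case by simp
qed

text \<open>On the comeager set where each predicate and each negation agrees with its open
  approximation, both truth values are locally constant.\<close>

lemma bp_continuity:
  fixes p :: "'i::countable \<Rightarrow> ('c::countable \<Rightarrow> bool) \<Rightarrow> bool"
  assumes "\<And>i. bp (p i)"
  shows "\<exists>Q. comeager Q \<and> (\<forall>z\<in>Q. \<forall>i. \<exists>F. finite F \<and> (\<forall>z'\<in>Q \<inter> cyl F z. p i z' = p i z))"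
proof -
  obtain U where U: "\<And>i. opn (U i)" "\<And>i. comeager {z. p i z \<longleftrightarrow> z \<in> U i}" using assms unfolding bp_def by metis
  obtain V where V: "\<And>i. opn (V i)" "\<And>i. comeager {z. (\<not> p i z) \<longleftrightarrow> z \<in> V i}"
    using bp_not[OF assms] unfolding bp_def by metis
  let ?Q = "{z. \<forall>i. p i z \<longleftrightarrow> z \<in> U i} \<inter> {z. \<forall>i. (\<not> p i z) \<longleftrightarrow> z \<in> V i}"
  have "comeager ?Q" by (intro comeager_Int comeager_Collect_all U V)
  moreover have "\<exists>F. finite F \<and> (\<forall>z'\<in>?Q \<inter> cyl F z. p i z' = p i z)" if z: "z \<in> ?Q" for z i
  proof (cases "p i z")
    case True
    then have "z \<in> U i" using z by auto
    then obtain F where "finite F" "cyl F z \<subseteq> U i" using U(1)[of i] unfolding opn_def by blast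
    then show ?thesis using True by (intro exI[of _ F]) auto
  next
    case False
    then have "z \<in> V i" using z by auto
    then obtain F where "finite F" "cyl F z \<subseteq> V i" using V(1)[of i] unfolding opn_def by blast
    then show ?thesis using False by (intro exI[of _ F]) auto
  qed
  ultimately show ?thesis by blast
qed

text \<open>An isomorphism is a sequence of numbers, and on a comeager set where all atomic facts
  are continuous the requirement on this sequence is closed; so \<open>bp_analytic\<close>
  applies.\<close>

lemma bp_struc_iso:
  fixes R1 R2 :: "('c::countable \<Rightarrow> bool) \<Rightarrow> nat \<Rightarrow> nat list \<Rightarrow> bool" and G1 G2 :: "('c \<Rightarrow> bool) \<Rightarrow> nat \<Rightarrow> nat list \<Rightarrow> nat"
  assumes b: "\<And>i t. bp (\<lambda>z. R1 z i t)" "\<And>i t. bp (\<lambda>z. R2 z i t)"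
    "\<And>j t m. bp (\<lambda>z. G1 z j t = m)" "\<And>j t m. bp (\<lambda>z. G2 z j t = m)"
  shows "bp (\<lambda>z. struc_iso RS ra FS fa (R1 z, G1 z) (R2 z, G2 z))"
proof -
  define p where "p = (\<lambda>(tag::nat, i::nat, t::nat list, m::nat) z.
    if tag = 0 then R1 z i t else if tag = 1 then R2 z i t else if tag = 2 then G1 z i t = m else G2 z i t = m)"
  have "bp (p c)" for c
  proof (cases c)
    case (fields a i t m)
    show ?thesis using b unfolding p_def fields by (cases "a = 0"; cases "a = 1"; cases "a = 2") simp_all
  qed
  then obtain Q where Q: "comeager Q" "\<And>z c. z \<in> Q \<Longrightarrow> \<exists>F. finite F \<and> (\<forall>z'\<in>Q \<inter> cyl F z. p c z' = p c z)"
    using bp_continuity[of p] by blast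
  \<comment> \<open>Even entries of \<open>\<beta>\<close> list the permutation and odd entries its
    inverse, which turns bijectivity into a closed condition.\<close>
  define P where "P z \<beta> \<longleftrightarrow> (\<forall>m. \<beta> (2 * \<beta> (2 * m) + 1) = m) \<and> (\<forall>m. \<beta> (2 * \<beta> (2 * m + 1)) = m) \<and>
     (\<forall>i\<in>RS. \<forall>t. length t = ra i \<longrightarrow> (R1 z i t \<longleftrightarrow> R2 z i (map (\<lambda>m. \<beta> (2 * m)) t))) \<and>
     (\<forall>j\<in>FS. \<forall>t. length t = fa j \<longrightarrow> \<beta> (2 * G1 z j t) = G2 z j (map (\<lambda>m. \<beta> (2 * m)) t))" for z \<beta>
  have "bp (\<lambda>z. \<exists>\<beta>. P z \<beta>)"
  proof (rule bp_analytic[OF Q(1)])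
    fix z \<beta> assume z: "z \<in> Q" and nP: "\<not> P z \<beta>"
    let ?G = "\<lambda>F k. finite F \<and> (\<forall>z'\<in>Q \<inter> cyl F z. \<forall>\<beta>'. (\<forall>i<k. \<beta>' i = \<beta> i) \<longrightarrow> \<not> P z' \<beta>')"
    \<comment> \<open>Every entry of \<open>t\<close> is at most \<open>sum_list t\<close>, so this
      initial segment of \<open>\<beta>\<close> determines the image of \<open>t\<close>.\<close>
    have tk: "map (\<lambda>m. \<beta>' (2 * m)) t = map (\<lambda>m. \<beta> (2 * m)) t" if "\<forall>i<Suc (2 * sum_list t). \<beta>' i = \<beta> i" for \<beta>' t
    proof (rule map_cong[OF refl])
      fix m assume "m \<in> set t"
      then have "m \<le> sum_list t" by (simp add: member_le_sum_list)
      then show "\<beta>' (2 * m) = \<beta> (2 * m)" using that by auto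
    qed
    consider m where "\<beta> (2 * \<beta> (2 * m) + 1) \<noteq> m" | m where "\<beta> (2 * \<beta> (2 * m + 1)) \<noteq> m"
      | i t where "i \<in> RS" "length t = ra i" "R1 z i t \<noteq> R2 z i (map (\<lambda>m. \<beta> (2 * m)) t)"
      | j t where "j \<in> FS" "length t = fa j" "\<beta> (2 * G1 z j t) \<noteq> G2 z j (map (\<lambda>m. \<beta> (2 * m)) t)"
      using nP unfolding P_def by blast
    then show "\<exists>F k. ?G F k"
    proof cases
      case (1 m)
      have "?G {} (Suc (2 * m) + Suc (2 * \<beta> (2 * m) + 1))"
      proof (intro conjI ballI allI impI notI)
        fix z' \<beta>' assume a: "\<forall>i<Suc (2 * m) + Suc (2 * \<beta> (2 * m) + 1). \<beta>' i = \<beta> i" and P: "P z' \<beta>'"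
        have "\<beta>' (2 * m) = \<beta> (2 * m)" "\<beta>' (2 * \<beta> (2 * m) + 1) = \<beta> (2 * \<beta> (2 * m) + 1)" using a by auto
        moreover have "\<beta>' (2 * \<beta>' (2 * m) + 1) = m" using P unfolding P_def by blast
        ultimately show False using 1 by simp
      qed simp
      then show ?thesis by blast
    next
      case (2 m)
      have "?G {} (Suc (2 * m + 1) + Suc (2 * \<beta> (2 * m + 1)))"
      proof (intro conjI ballI allI impI notI)
        fix z' \<beta>' assume a: "\<forall>i<Suc (2 * m + 1) + Suc (2 * \<beta> (2 * m + 1)). \<beta>' i = \<beta> i" and P: "P z' \<beta>'"
        have "\<beta>' (2 * m + 1) = \<beta> (2 * m + 1)" "\<beta>' (2 * \<beta> (2 * m + 1)) = \<beta> (2 * \<beta> (2 * m + 1))" using a by auto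
        moreover have "\<beta>' (2 * \<beta>' (2 * m + 1)) = m" using P unfolding P_def by blast
        ultimately show False using 2 by simp
      qed simp
      then show ?thesis by blast
    next
      case (3 i t)
      let ?t = "map (\<lambda>m. \<beta> (2 * m)) t"
      obtain F1 where F1: "finite F1" "\<And>z'. z' \<in> Q \<inter> cyl F1 z \<Longrightarrow> p (0, i, t, 0) z' = p (0, i, t, 0) z"
        using Q(2)[OF z, of "(0, i, t, 0)"] by auto
      obtain F2 where F2: "finite F2" "\<And>z'. z' \<in> Q \<inter> cyl F2 z \<Longrightarrow> p (1, i, ?t, 0) z' = p (1, i, ?t, 0) z"
        using Q(2)[OF z, of "(1, i, ?t, 0)"] by auto
      have "?G (F1 \<union> F2) (Suc (2 * sum_list t))"
      proof (intro conjI ballI allI impI notI)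
        fix z' \<beta>' assume z': "z' \<in> Q \<inter> cyl (F1 \<union> F2) z" and a: "\<forall>i<Suc (2 * sum_list t). \<beta>' i = \<beta> i" and P: "P z' \<beta>'"
        have "z' \<in> Q \<inter> cyl F1 z" "z' \<in> Q \<inter> cyl F2 z" using z' unfolding cyl_def by auto
        then have "R1 z' i t = R1 z i t" "R2 z' i ?t = R2 z i ?t" using F1(2) F2(2) unfolding p_def by auto
        moreover have "R1 z' i t = R2 z' i (map (\<lambda>m. \<beta>' (2 * m)) t)" using P 3 unfolding P_def by blast
        ultimately show False using 3(3) tk[OF a] by simp
      qed (use F1 F2 in simp)
      then show ?thesis by blast
    next
      case (4 j t)
      let ?t = "map (\<lambda>m. \<beta> (2 * m)) t"
      let ?m = "G1 z j t"
      let ?m' = "G2 z j ?t"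
      obtain F1 where F1: "finite F1" "\<And>z'. z' \<in> Q \<inter> cyl F1 z \<Longrightarrow> p (2, j, t, ?m) z' = p (2, j, t, ?m) z"
        using Q(2)[OF z, of "(2, j, t, ?m)"] by auto
      obtain F2 where F2: "finite F2" "\<And>z'. z' \<in> Q \<inter> cyl F2 z \<Longrightarrow> p (3, j, ?t, ?m') z' = p (3, j, ?t, ?m') z"
        using Q(2)[OF z, of "(3, j, ?t, ?m')"] by auto
      have "?G (F1 \<union> F2) (Suc (2 * sum_list t) + Suc (2 * ?m))"
      proof (intro conjI ballI allI impI notI)
        fix z' \<beta>' assume z': "z' \<in> Q \<inter> cyl (F1 \<union> F2) z" and a: "\<forall>i<Suc (2 * sum_list t) + Suc (2 * ?m). \<beta>' i = \<beta> i" and P: "P z' \<beta>'"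
        have "z' \<in> Q \<inter> cyl F1 z" "z' \<in> Q \<inter> cyl F2 z" using z' unfolding cyl_def by auto
        then have "G1 z' j t = ?m" "G2 z' j ?t = ?m'" using F1(2) F2(2) unfolding p_def by auto
        moreover have "\<beta>' (2 * G1 z' j t) = G2 z' j (map (\<lambda>m. \<beta>' (2 * m)) t)" using P 4 unfolding P_def by blast
        moreover have "\<beta>' (2 * ?m) = \<beta> (2 * ?m)" using a by auto
        moreover have "\<forall>i<Suc (2 * sum_list t). \<beta>' i = \<beta> i" using a by auto
        ultimately show False using 4(3) tk by metis
      qed (use F1 F2 in simp)
      then show ?thesis by blast
    qed
  qed
  moreover have "(\<exists>\<beta>. P z \<beta>) \<longleftrightarrow> struc_iso RS ra FS fa (R1 z, G1 z) (R2 z, G2 z)" for z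
  proof
    assume "\<exists>\<beta>. P z \<beta>"
    then obtain \<beta> where \<beta>: "P z \<beta>" by blast
    have "bij (\<lambda>m. \<beta> (2 * m))"
    proof (rule bij_betw_byWitness[where f' = "\<lambda>m. \<beta> (2 * m + 1)"])
      show "\<forall>a\<in>UNIV. \<beta> (2 * \<beta> (2 * a) + 1) = a" "\<forall>a\<in>UNIV. \<beta> (2 * \<beta> (2 * a + 1)) = a" using \<beta> unfolding P_def by blast+
    qed auto
    then show "struc_iso RS ra FS fa (R1 z, G1 z) (R2 z, G2 z)"
      using \<beta> unfolding P_def struc_iso_def fst_conv snd_conv by blast
  next
    assume "struc_iso RS ra FS fa (R1 z, G1 z) (R2 z, G2 z)"
    then obtain \<pi> where \<pi>: "bij \<pi>" "\<forall>i\<in>RS. \<forall>t. length t = ra i \<longrightarrow> (R1 z i t \<longleftrightarrow> R2 z i (map \<pi> t))"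
      "\<forall>j\<in>FS. \<forall>t. length t = fa j \<longrightarrow> \<pi> (G1 z j t) = G2 z j (map \<pi> t)" unfolding struc_iso_def by auto
    define \<beta> where "\<beta> m = (if even m then \<pi> (m div 2) else inv \<pi> (m div 2))" for m
    have 1: "\<beta> (2 * m) = \<pi> m" "\<beta> (2 * m + 1) = inv \<pi> m" for m unfolding \<beta>_def by auto
    have "P z \<beta>" unfolding P_def 1 using \<pi> by (auto simp: bij_is_inj bij_is_surj surj_f_inv_f)
    then show "\<exists>\<beta>. P z \<beta>" by blast
  qed
  ultimately show ?thesis by simp
qed

lemma openin_Modtop_bit:
  "openin (Modtop RS ra FS fa) {M \<in> Mod RS ra FS fa. fst M i t}"
  "openin (Modtop RS ra FS fa) {M \<in> Mod RS ra FS fa. snd M j t = m}"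
proof -
  let ?A = "product_topology (\<lambda>_::nat. product_topology (\<lambda>_::nat list. discrete_topology (UNIV :: bool set)) UNIV) UNIV"
  let ?B = "product_topology (\<lambda>_::nat. product_topology (\<lambda>_::nat list. discrete_topology (UNIV :: nat set)) UNIV) UNIV"
  have a: "continuous_map ?A (discrete_topology UNIV) (\<lambda>x. x i t)"
    using continuous_map_compose[OF continuous_map_product_projection[of i UNIV "\<lambda>_. product_topology (\<lambda>_::nat list. discrete_topology (UNIV :: bool set)) UNIV"]
      continuous_map_product_projection[of t UNIV "\<lambda>_. discrete_topology (UNIV :: bool set)"]] by (simp add: o_def)
  have b: "continuous_map ?B (discrete_topology UNIV) (\<lambda>x. x j t)"
    using continuous_map_compose[OF continuous_map_product_projection[of j UNIV "\<lambda>_. product_topology (\<lambda>_::nat list. discrete_topology (UNIV :: nat set)) UNIV"]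
      continuous_map_product_projection[of t UNIV "\<lambda>_. discrete_topology (UNIV :: nat set)"]] by (simp add: o_def)
  have a': "continuous_map (prod_topology ?A ?B) (discrete_topology UNIV) (\<lambda>x. fst x i t)"
    using continuous_map_compose[OF continuous_map_fst a] by (simp add: o_def)
  have b': "continuous_map (prod_topology ?A ?B) (discrete_topology UNIV) (\<lambda>x. snd x j t)"
    using continuous_map_compose[OF continuous_map_snd b] by (simp add: o_def)
  have "openin (prod_topology ?A ?B) {x \<in> topspace (prod_topology ?A ?B). fst x i t \<in> {True}}"
    using a' by (rule openin_continuous_map_preimage) simp
  then have "openin (prod_topology ?A ?B) {M. fst M i t}" by simp
  then have "openin (Modtop RS ra FS fa) ({M. fst M i t} \<inter> Mod RS ra FS fa)" unfolding Modtop_def by (rule openin_subtopology_Int)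
  then show "openin (Modtop RS ra FS fa) {M \<in> Mod RS ra FS fa. fst M i t}" by (simp add: Collect_conj_eq Int_commute)
  have "openin (prod_topology ?A ?B) {x \<in> topspace (prod_topology ?A ?B). snd x j t \<in> {m}}"
    using b' by (rule openin_continuous_map_preimage) simp
  then have "openin (prod_topology ?A ?B) {M. snd M j t = m}" by simp
  then have "openin (Modtop RS ra FS fa) ({M. snd M j t = m} \<inter> Mod RS ra FS fa)" unfolding Modtop_def by (rule openin_subtopology_Int)
  then show "openin (Modtop RS ra FS fa) {M \<in> Mod RS ra FS fa. snd M j t = m}" by (simp add: Collect_conj_eq Int_commute)
qed

lemma bp_classifiable:
  assumes cl: "classifiable (Xtop n) E" and \<phi>: "bpmap \<phi>" and \<psi>: "bpmap \<psi>"
  shows "bp (\<lambda>z. \<phi> z \<in> Xsp n \<and> \<psi> z \<in> Xsp n \<and> (\<phi> z, \<psi> z) \<in> E)"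
proof -
  obtain RS ra FS fa f where f: "f \<in> borel_of (Xtop n) \<rightarrow>\<^sub>M borel_of (Modtop RS ra FS fa)"
    and E: "\<And>x y. x \<in> Xsp n \<Longrightarrow> y \<in> Xsp n \<Longrightarrow> (x, y) \<in> E \<longleftrightarrow> struc_iso RS ra FS fa (f x) (f y)"
    using cl unfolding classifiable_def borel_reducible_def topspace_Xtop mem_Collect_eq prod.case by blast
  have Mod: "topspace (Modtop RS ra FS fa) = Mod RS ra FS fa" by (simp add: Modtop_def)
  have 1: "{x \<in> Xsp n. f x \<in> B} \<in> sets (borel_of (Xtop n))" if "openin (Modtop RS ra FS fa) B" for B
  proof -
    have "B \<in> sets (borel_of (Modtop RS ra FS fa))" unfolding sets_borel_of using that by blast
    then have "f -` B \<inter> space (borel_of (Xtop n)) \<in> sets (borel_of (Xtop n))" using f measurable_sets by blast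
    moreover have "f -` B \<inter> space (borel_of (Xtop n)) = {x \<in> Xsp n. f x \<in> B}" by auto
    ultimately show ?thesis by simp
  qed
  have fM: "f x \<in> Mod RS ra FS fa" if "x \<in> Xsp n" for x
    using measurable_space[OF f, of x] that Mod by simp
  have R: "bp (\<lambda>z. \<theta> z \<in> Xsp n \<and> fst (f (\<theta> z)) i t)" if "bpmap \<theta>" for \<theta> :: "('a \<Rightarrow> bool) \<Rightarrow> pt" and i t
    using bp_borel[OF that 1[OF openin_Modtop_bit(1)[of RS ra FS fa i t]]] fM by (simp cong: conj_cong)
  have G: "bp (\<lambda>z. \<theta> z \<in> Xsp n \<and> snd (f (\<theta> z)) i t = m)" if "bpmap \<theta>" for \<theta> :: "('a \<Rightarrow> bool) \<Rightarrow> pt" and i t m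
    using bp_borel[OF that 1[OF openin_Modtop_bit(2)[of RS ra FS fa i t m]]] fM by (simp cong: conj_cong)
  \<comment> \<open>Nothing is known about \<open>f\<close> outside \<open>Xsp n\<close>; default
    values there make the atomic facts total predicates with the Baire property.\<close>
  define R' where "R' \<theta> z i t \<longleftrightarrow> \<theta> z \<in> Xsp n \<and> fst (f (\<theta> z)) i t" for \<theta> :: "('a \<Rightarrow> bool) \<Rightarrow> pt" and z i t
  define G' where "G' \<theta> z i t = (if \<theta> z \<in> Xsp n then snd (f (\<theta> z)) i t else 0)" for \<theta> :: "('a \<Rightarrow> bool) \<Rightarrow> pt" and z i t
  have bR: "bp (\<lambda>z. R' \<theta> z i t)" if "bpmap \<theta>" for \<theta> i t unfolding R'_def by (rule R[OF that])
  have bG: "bp (\<lambda>z. G' \<theta> z i t = m)" if "bpmap \<theta>" for \<theta> i t m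
  proof -
    have "(G' \<theta> z i t = m) \<longleftrightarrow> (\<theta> z \<in> Xsp n \<and> snd (f (\<theta> z)) i t = m) \<or> (\<not> \<theta> z \<in> Xsp n \<and> m = 0)" for z
      unfolding G'_def by auto
    moreover have "bp (\<lambda>z. (\<theta> z \<in> Xsp n \<and> snd (f (\<theta> z)) i t = m) \<or> (\<not> \<theta> z \<in> Xsp n \<and> m = 0))"
      by (intro bp_disj bp_conj bp_not bp_const bp_Xsp G that)
    ultimately show ?thesis by simp
  qed
  have "bp (\<lambda>z. struc_iso RS ra FS fa (R' \<phi> z, G' \<phi> z) (R' \<psi> z, G' \<psi> z))"
    by (rule bp_struc_iso) (intro bR bG \<phi> \<psi>)+
  then have "bp (\<lambda>z. \<phi> z \<in> Xsp n \<and> \<psi> z \<in> Xsp n \<and> struc_iso RS ra FS fa (R' \<phi> z, G' \<phi> z) (R' \<psi> z, G' \<psi> z))"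
    by (intro bp_conj bp_Xsp \<phi> \<psi>)
  moreover have "(\<phi> z \<in> Xsp n \<and> \<psi> z \<in> Xsp n \<and> struc_iso RS ra FS fa (R' \<phi> z, G' \<phi> z) (R' \<psi> z, G' \<psi> z)) \<longleftrightarrow>
     (\<phi> z \<in> Xsp n \<and> \<psi> z \<in> Xsp n \<and> (\<phi> z, \<psi> z) \<in> E)" for z
    using E[of "\<phi> z" "\<psi> z"] unfolding struc_iso_def R'_def G'_def by auto
  ultimately show ?thesis by simp
qed

section \<open>The sets coded by a point, and enumerations of abstract structures\<close>

text \<open>Levels are counted from 0: \<open>tk x l\<close> enumerates the members of
  \<open>A_set x (l + 1)\<close>, the tokens of level \<open>l\<close>.\<close>

primrec tk :: "pt \<Rightarrow> nat \<Rightarrow> nat \<Rightarrow> hc" where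
  "tk x 0 k = Ur (x 0 k)"
| "tk x (Suc l) k = a_set x (Suc l) k"

declare tk.simps(2) [simp del]

definition tks :: "pt \<Rightarrow> nat \<Rightarrow> hc set" where
  "tks x l = range (tk x l)"

lemma rcset_acset [simp]: "rcset (acset (A :: 'a::countable set)) = A"
  by (rule acset_inverse) simp

lemma tk_Suc: "tk x (Suc l) k = HSet (cimage (tk x l) (acset {m. x (Suc l) k m}))"
proof (cases l)
  case 0
  have "tk x 0 = (\<lambda>k. Ur (x 0 k))" by auto
  then show ?thesis using 0 by (simp add: tk.simps(2))
next
  case (Suc j)
  have "tk x (Suc j) = (\<lambda>k. a_set x (Suc j) k)" by (auto simp: tk.simps(2))
  then show ?thesis using Suc by (simp add: tk.simps(2))
qed

lemma A_set_Suc: "A_set x (Suc l) = HSet (cimage (tk x l) (acset UNIV))"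
proof (cases l)
  case 0
  have "tk x 0 = (\<lambda>k. Ur (x 0 k))" by auto
  then show ?thesis using 0 by (simp add: tk.simps(2))
next
  case (Suc j)
  have "tk x (Suc j) = (\<lambda>k. a_set x (Suc j) k)" by (auto simp: tk.simps(2))
  then show ?thesis using Suc by (simp add: tk.simps(2))
qed

lemma A_set_eq_iff: "A_set x (Suc l) = A_set y (Suc l) \<longleftrightarrow> tks x l = tks y l"
proof -
  have "A_set x (Suc l) = A_set y (Suc l) \<longleftrightarrow> rcset (cimage (tk x l) (acset UNIV)) = rcset (cimage (tk y l) (acset UNIV))"
    by (simp add: A_set_Suc rcset_inject)
  then show ?thesis by (simp add: cimage.rep_eq tks_def)
qed

lemma hmem_tk_Suc: "hmem a (tk x (Suc l) k) \<longleftrightarrow> (\<exists>m. x (Suc l) k m \<and> a = tk x l m)"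
  by (auto simp: tk_Suc cimage.rep_eq)

lemma hmem_ext: "tk x (Suc l) k = tk y (Suc l) k' \<longleftrightarrow> (\<forall>a. hmem a (tk x (Suc l) k) = hmem a (tk y (Suc l) k'))"
  by (auto simp: tk_Suc rcset_inject[symmetric])

lemma Xsp_D:
  assumes "x \<in> Xsp n"
  shows "\<And>l. \<not> enat l < n \<Longrightarrow> x l = (\<lambda>_ _. False)"
    "\<And>l m. enat (Suc l) < n \<Longrightarrow> \<exists>k. x (Suc l) k m"
    "\<And>l k. enat (Suc l) < n \<Longrightarrow> \<exists>m. x (Suc l) k m"
    "\<And>l k m m'. enat (Suc l) < n \<Longrightarrow> x l m = x l m' \<Longrightarrow> x (Suc l) k m = x (Suc l) k m'"
proof -
  have c: "(\<forall>i. enat i \<ge> n \<longrightarrow> x i = (\<lambda>_ _. False)) \<and> (\<forall>i. 1 \<le> i \<and> enat i < n \<longrightarrow>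
        (\<forall>m. \<exists>k. x i k m) \<and> (\<forall>k. \<exists>m. x i k m) \<and>
        (\<forall>k l1 l2. x (i - 1) l1 = x (i - 1) l2 \<longrightarrow> x i k l1 = x i k l2))"
    using assms unfolding Xsp_def by (simp only: mem_Collect_eq)
  note a = conjunct1[OF c] and b = conjunct2[OF c, rule_format]
  show "\<And>l. \<not> enat l < n \<Longrightarrow> x l = (\<lambda>_ _. False)" using a by (simp add: not_less)
  fix l assume "enat (Suc l) < n"
  then have c: "1 \<le> Suc l \<and> enat (Suc l) < n" by simp
  note d = c
  show "\<And>m. \<exists>k. x (Suc l) k m" "\<And>k. \<exists>m. x (Suc l) k m" using b d by blast+
  show "\<And>k m m'. x l m = x l m' \<Longrightarrow> x (Suc l) k m = x (Suc l) k m'" using b d by (metis diff_Suc_1)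
qed

lemma Xsp_I:
  assumes "\<And>l. \<not> enat l < n \<Longrightarrow> x l = (\<lambda>_ _. False)"
    "\<And>l m. enat (Suc l) < n \<Longrightarrow> \<exists>k. x (Suc l) k m"
    "\<And>l k. enat (Suc l) < n \<Longrightarrow> \<exists>m. x (Suc l) k m"
    "\<And>l k m m'. enat (Suc l) < n \<Longrightarrow> x l m = x l m' \<Longrightarrow> x (Suc l) k m = x (Suc l) k m'"
  shows "x \<in> Xsp n"
  unfolding Xsp_def
proof (intro CollectI conjI allI impI)
  fix i assume "n \<le> enat i" then show "x i = (\<lambda>_ _. False)" using assms(1) by (simp add: not_less)
next
  fix i m assume "1 \<le> i \<and> enat i < n" then show "\<exists>k. x i k m" using assms(2)[of "i - 1"] by simp
next
  fix i m assume "1 \<le> i \<and> enat i < n" then show "\<exists>k. x i m k" using assms(3)[of "i - 1"] by simp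
next
  fix i k m m' assume "1 \<le> i \<and> enat i < n" "x (i - 1) m = x (i - 1) m'"
  then show "x i k m = x i k m'" using assms(4)[of "i - 1" m m' k] by simp
qed

lemma enat_Suc_lessD: "enat (Suc l) < n \<Longrightarrow> enat l < n"
  by (meson enat_ord_simps(2) less_trans lessI)

text \<open>The third clause of \<open>Xsp\<close> enters here: it makes membership depend on the
  tokens and not on their positions, so that equal sets are coded by equal rows.\<close>

lemma tk_eq_iff:
  assumes x: "x \<in> Xsp n" and "enat l < n"
  shows "tk x l k = tk x l k' \<longleftrightarrow> x l k = x l k'"
  using assms(2)
proof (induction l arbitrary: k k')
  case (Suc l)
  note l = enat_Suc_lessD[OF Suc.prems]
  have 1: "x (Suc l) k m \<Longrightarrow> x (Suc l) k' m" if t: "tk x (Suc l) k = tk x (Suc l) k'" for k k' m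
  proof -
    assume "x (Suc l) k m"
    then have "hmem (tk x l m) (tk x (Suc l) k')" using hmem_tk_Suc t by metis
    then obtain m' where "x (Suc l) k' m'" "tk x l m = tk x l m'" unfolding hmem_tk_Suc by blast
    then show ?thesis using Suc.IH[OF l] Xsp_D(4)[OF x Suc.prems] by blast
  qed
  show ?case
  proof
    assume "tk x (Suc l) k = tk x (Suc l) k'"
    then show "x (Suc l) k = x (Suc l) k'" using 1[of k k'] 1[of k' k] by (intro ext) auto
  qed (simp add: tk_Suc)
qed simp

lemma hmem_tk_iff:
  assumes x: "x \<in> Xsp n" and l: "enat (Suc l) < n"
  shows "hmem (tk x l m) (tk x (Suc l) k) \<longleftrightarrow> x (Suc l) k m"
  using tk_eq_iff[OF x enat_Suc_lessD[OF l]] Xsp_D(4)[OF x l] unfolding hmem_tk_Suc by blast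

lemma tks_lower:
  assumes "x \<in> Xsp n" "enat (Suc l) < n"
  shows "tks x l = {a. \<exists>b\<in>tks x (Suc l). hmem a b}"
proof
  show "tks x l \<subseteq> {a. \<exists>b\<in>tks x (Suc l). hmem a b}"
  proof
    fix a assume "a \<in> tks x l"
    then obtain m where m: "a = tk x l m" unfolding tks_def by auto
    obtain k where "x (Suc l) k m" using Xsp_D(2)[OF assms] by blast
    then have "hmem a (tk x (Suc l) k)" unfolding hmem_tk_Suc using m by blast
    then show "a \<in> {a. \<exists>b\<in>tks x (Suc l). hmem a b}" unfolding tks_def by blast
  qed
  show "{a. \<exists>b\<in>tks x (Suc l). hmem a b} \<subseteq> tks x l"
    unfolding tks_def by (auto simp: hmem_tk_Suc)
qed

lemma tks_separated:
  assumes "b \<in> tks x (Suc l)" "b' \<in> tks y (Suc l)" "b \<noteq> b'"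
  shows "\<exists>a\<in>tks x l \<union> tks y l. hmem a b \<noteq> hmem a b'"
proof -
  obtain k k' where k: "b = tk x (Suc l) k" "b' = tk y (Suc l) k'" using assms unfolding tks_def by auto
  then obtain a where "hmem a b \<noteq> hmem a b'" using hmem_ext assms(3) by metis
  moreover then have "a \<in> tks x l \<union> tks y l" unfolding k hmem_tk_Suc tks_def by blast
  ultimately show ?thesis by blast
qed

lemma tks_eq_Frel:
  assumes x: "x \<in> Xsp n" and y: "y \<in> Xsp n" and n: "1 \<le> n"
  shows "(x, y) \<in> Frel n \<longleftrightarrow> (\<forall>l. enat l < n \<longrightarrow> tks x l = tks y l)"
proof (cases n)
  case (enat N)
  then obtain M where M: "N = Suc M" using n by (cases N) (auto simp: one_enat_def)
  have *: "n \<noteq> 0" "n \<noteq> \<infinity>" using enat M by (auto simp: zero_enat_def)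
  have "(x, y) \<in> Frel n \<longleftrightarrow> tks x M = tks y M"
    unfolding Frel_def using x y * enat M A_set_eq_iff[of x M y] by simp
  moreover have "tks x l = tks y l" if "tks x M = tks y M" "l \<le> M" for l
    using that(2)
  proof (induction rule: inc_induct)
    case base show ?case by (rule that(1))
  next
    case (step l)
    then have "enat (Suc l) < n" using enat M by simp
    then show ?case using tks_lower[OF x] tks_lower[OF y] step by metis
  qed
  ultimately show ?thesis using enat M by (auto simp: less_Suc_eq_le)
next
  case infinity
  have "(x, y) \<in> Frel n \<longleftrightarrow> (\<forall>j\<ge>1. A_set x j = A_set y j)" unfolding Frel_def using x y infinity by simp
  also have "\<dots> \<longleftrightarrow> (\<forall>l. A_set x (Suc l) = A_set y (Suc l))"
    by (metis One_nat_def Suc_le_D le_add1 plus_1_eq_Suc)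
  finally show ?thesis using infinity by (simp add: A_set_eq_iff)
qed

text \<open>A point can enumerate any levelled structure with objects \<open>Ob\<close>, membership
  \<open>B\<close> between consecutive levels, and a real \<open>R\<close> for each bottom object.
  The reduction and the generic points enumerate the same structure in different orders, and the
  tokens do not depend on the order.\<close>

definition enum_of :: "enat \<Rightarrow> (nat \<Rightarrow> 'o set) \<Rightarrow> ('o \<Rightarrow> 'o \<Rightarrow> bool) \<Rightarrow> ('o \<Rightarrow> nat \<Rightarrow> bool) \<Rightarrow> (nat \<Rightarrow> nat \<Rightarrow> 'o) \<Rightarrow> pt \<Rightarrow> bool" where
  "enum_of n Ob B R e x \<longleftrightarrow> (\<forall>l. \<not> enat l < n \<longrightarrow> x l = (\<lambda>_ _. False)) \<and>
    (\<forall>l. enat l < n \<longrightarrow> range (e l) = Ob l) \<and> (\<forall>k m. x 0 k m = R (e 0 k) m) \<and>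
    (\<forall>l k m. enat (Suc l) < n \<longrightarrow> x (Suc l) k m = B (e l m) (e (Suc l) k))"

lemma enum_of_tk_eq:
  assumes x: "enum_of n Ob B R e x" and y: "enum_of n Ob B R e' y" and "enat l < n"
  shows "e l k = e' l k' \<Longrightarrow> tk x l k = tk y l k'"
  using assms(3)
proof (induction l arbitrary: k k')
  case 0
  then have "x 0 k = y 0 k'" using x y unfolding enum_of_def by (intro ext) auto
  then show ?case by simp
next
  case (Suc l)
  note l = enat_Suc_lessD[OF Suc.prems(2)]
  have r: "range (e l) = range (e' l)" using x y l unfolding enum_of_def by simp
  have b: "x (Suc l) k m = B (e l m) (e (Suc l) k)" "y (Suc l) k' m = B (e' l m) (e (Suc l) k)" for m
    using x y Suc.prems unfolding enum_of_def by auto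
  have "hmem a (tk x (Suc l) k) = hmem a (tk y (Suc l) k')" for a
  proof
    assume "hmem a (tk x (Suc l) k)"
    then obtain m where m: "x (Suc l) k m" "a = tk x l m" unfolding hmem_tk_Suc by blast
    obtain m' where m': "e l m = e' l m'" using r by (metis rangeE rangeI)
    then have "y (Suc l) k' m'" "a = tk y l m'" using m b Suc.IH[OF m' l] by auto
    then show "hmem a (tk y (Suc l) k')" unfolding hmem_tk_Suc by blast
  next
    assume "hmem a (tk y (Suc l) k')"
    then obtain m' where m: "y (Suc l) k' m'" "a = tk y l m'" unfolding hmem_tk_Suc by blast
    obtain m where m': "e l m = e' l m'" using r by (metis rangeE rangeI)
    then have "x (Suc l) k m" "a = tk x l m" using m b Suc.IH[OF m' l] by auto
    then show "hmem a (tk x (Suc l) k)" unfolding hmem_tk_Suc by blast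
  qed
  then show ?case using hmem_ext by metis
qed

lemma enum_of_tks_eq:
  assumes x: "enum_of n Ob B R e x" and y: "enum_of n Ob B R e' y" and l: "enat l < n"
  shows "tks x l = tks y l"
proof -
  have r: "range (e l) = range (e' l)" using x y l unfolding enum_of_def by simp
  have "\<exists>k'. e l k = e' l k'" "\<exists>k'. e l k' = e' l k" for k using r by (metis rangeE rangeI)+
  then show ?thesis using enum_of_tk_eq[OF x y l] unfolding tks_def by (auto simp: image_iff) metis+
qed

lemma enum_of_Xsp:
  assumes x: "enum_of n Ob B R e x"
    and 1: "\<And>l w. enat (Suc l) < n \<Longrightarrow> w \<in> Ob l \<Longrightarrow> \<exists>f\<in>Ob (Suc l). B w f"
    and 2: "\<And>l f. enat (Suc l) < n \<Longrightarrow> f \<in> Ob (Suc l) \<Longrightarrow> \<exists>w\<in>Ob l. B w f"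
    and 3: "\<And>w w'. w \<in> Ob 0 \<Longrightarrow> w' \<in> Ob 0 \<Longrightarrow> R w = R w' \<Longrightarrow> w = w'"
    and 4: "\<And>l f f'. enat (Suc l) < n \<Longrightarrow> f \<in> Ob (Suc l) \<Longrightarrow> f' \<in> Ob (Suc l) \<Longrightarrow> (\<And>w. w \<in> Ob l \<Longrightarrow> B w f = B w f') \<Longrightarrow> f = f'"
  shows "x \<in> Xsp n"
proof (rule Xsp_I)
  fix l assume "\<not> enat l < n" then show "x l = (\<lambda>_ _. False)" using x unfolding enum_of_def by blast
next
  fix l m assume l: "enat (Suc l) < n"
  have r: "range (e l) = Ob l" "range (e (Suc l)) = Ob (Suc l)" using x l enat_Suc_lessD[OF l] unfolding enum_of_def by auto
  have b: "x (Suc l) k m = B (e l m) (e (Suc l) k)" for k m using x l unfolding enum_of_def by auto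
  show "\<exists>k. x (Suc l) k m" using 1[OF l, of "e l m"] r b by (metis rangeE rangeI)
  show "\<exists>k. x (Suc l) m k" using 2[OF l, of "e (Suc l) m"] r b by (metis rangeE rangeI)
next
  fix l k m m' assume l: "enat (Suc l) < n" and eq: "x l m = x l m'"
  have b: "x (Suc l) k m = B (e l m) (e (Suc l) k)" for k m using x l unfolding enum_of_def by auto
  have r: "range (e l) = Ob l" using x enat_Suc_lessD[OF l] unfolding enum_of_def by auto
  have "e l m = e l m'"
  proof (cases l)
    case 0
    have "R (e 0 m) = R (e 0 m')" using eq x unfolding enum_of_def 0 fun_eq_iff by simp
    then show ?thesis using 3 r 0 by blast
  next
    case (Suc j)
    have j: "enat (Suc j) < n" using enat_Suc_lessD[OF l] Suc by simp
    have rj: "range (e j) = Ob j" using x enat_Suc_lessD[OF j] unfolding enum_of_def by auto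
    have bj: "x (Suc j) k m = B (e j m) (e (Suc j) k)" for k m using x j unfolding enum_of_def by auto
    have "B w (e l m) = B w (e l m')" if w: "w \<in> Ob j" for w
    proof -
      have "w \<in> range (e j)" using w rj by simp
      then obtain i where "w = e j i" by blast
      then show ?thesis using bj[of m i] bj[of m' i] eq Suc by simp
    qed
    then show ?thesis using 4[OF j, of "e l m" "e l m'"] r Suc by blast
  qed
  then show "x (Suc l) k m = x (Suc l) k m'" using b by simp
qed

section \<open>Mutually generic reals\<close>

text \<open>Indices for the objects in a joint enumeration of two points, the side \<open>s\<close> being \<open>True\<close> for the first:
  \<open>KC l\<close> are the common objects of level \<open>l\<close>, \<open>KP s\<close> the objects of side \<open>s\<close> at the first level where it
  has private ones, \<open>KT s\<close> its private traces on the common part one level higher, and \<open>KH s l\<close> everything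
  beyond. \<open>J s k a b\<close> is an object of side \<open>s\<close> whose trace is the one indexed by \<open>I k a\<close>. A coordinate
  \<open>Rb \<alpha> m\<close> is the \<open>m\<close>-th digit of a real, \<open>Bt \<alpha> \<beta>\<close> a membership bit.\<close>

datatype kd = KC nat | KP bool | KT bool | KH bool nat

datatype ix = I kd nat | J bool kd nat nat

datatype co = Rb ix nat | Bt ix ix

instance kd :: countable by countable_datatype
instance ix :: countable by countable_datatype
instance co :: countable by countable_datatype

definition trunc :: "nat \<Rightarrow> hc el \<Rightarrow> bool list el" where
  "trunc m = map_el (\<lambda>h. case h of Ur r \<Rightarrow> map r [0..<m] | HSet _ \<Rightarrow> [])"

definition nodeval :: "(bool list el \<times> nat \<Rightarrow> bool) \<Rightarrow> bool list el \<Rightarrow> nat \<Rightarrow> bool" where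
  "nodeval G u m = (if m < length (pref (topj u)) then pref (topj u) ! m else G (map_el (take m) u, m))"

text \<open>Digit \<open>m\<close> depends on the tokens only through their first \<open>m\<close>
  digits, which keeps the map Borel; distinct trees eventually have distinct truncations and from
  then on read different coordinates of \<open>G\<close>. The initial segment \<open>pref\<close>
  allows finitely many digits of a new tree to be prescribed in the back-and-forth.\<close>

definition rl :: "(bool list el \<times> nat \<Rightarrow> bool) \<Rightarrow> hc el \<Rightarrow> nat \<Rightarrow> bool" where
  "rl G w m = (if m < length (pref (topj w)) then pref (topj w) ! m else G (trunc m w, m))"

definition urt :: "hc el set" where
  "urt = El (\<lambda>_. range Ur) 0"

text \<open>The shape fixes all numbers and bits in the tree. Only then are there finitely many
  nodes of a given precision, as the fusion below requires.\<close>

definition nodes :: "nat \<Rightarrow> unit el \<Rightarrow> bool list el set" where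
  "nodes M \<sigma> = {u. map_el (\<lambda>_. ()) u = \<sigma> \<and> set_el u \<subseteq> {bl. length bl = M}}"

lemma topj_map_el [simp]: "topj (map_el f w) = topj w"
  by (cases w) auto

lemma urt_induct [consumes 1, case_names Base Ext]:
  assumes "w \<in> urt" "\<And>r q. P (Base (Ur r) q)"
    "\<And>e k b j p. e \<in> urt \<Longrightarrow> k \<in> urt \<Longrightarrow> p \<in> urt \<Longrightarrow> P e \<Longrightarrow> P k \<Longrightarrow> P p \<Longrightarrow> P (Ext e k b j p)"
  shows "P w"
  using assms(1) by (induction w) (auto simp: urt_def assms(2) intro!: assms(3)[unfolded urt_def])

lemma take_trunc:
  assumes "w \<in> urt" "m \<le> M" shows "map_el (take m) (trunc M w) = trunc m w"
  using assms(1)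
proof (induction rule: urt_induct)
  case (Base r q)
  then show ?case using assms(2) by (simp add: trunc_def take_map)
qed (auto simp: trunc_def)

lemma trunc_nodes: "w \<in> urt \<Longrightarrow> trunc M w \<in> nodes M (map_el (\<lambda>_. ()) w)"
  by (induction rule: urt_induct) (auto simp: trunc_def nodes_def)

lemma finite_nodes: "finite (nodes M \<sigma>)"
proof (induction \<sigma>)
  case (Base a q)
  have "nodes M (Base a q) \<subseteq> (\<lambda>bl. Base bl q) ` {bl. set bl \<subseteq> UNIV \<and> length bl = M}"
  proof
    fix u assume "u \<in> nodes M (Base a q)"
    then show "u \<in> (\<lambda>bl. Base bl q) ` {bl. set bl \<subseteq> UNIV \<and> length bl = M}"
      by (cases u) (auto simp: nodes_def)
  qed
  then show ?case by (rule finite_subset) (intro finite_imageI finite_lists_length_eq, simp)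
next
  case (Ext e k b j p)
  have "nodes M (Ext e k b j p) \<subseteq> (\<lambda>(e', k', p'). Ext e' k' b j p') ` (nodes M e \<times> nodes M k \<times> nodes M p)"
  proof
    fix u assume u: "u \<in> nodes M (Ext e k b j p)"
    then obtain e' k' p' where "u = Ext e' k' b j p'" "e' \<in> nodes M e" "k' \<in> nodes M k" "p' \<in> nodes M p"
      by (cases u) (auto simp: nodes_def)
    then show "u \<in> (\<lambda>(e', k', p'). Ext e' k' b j p') ` (nodes M e \<times> nodes M k \<times> nodes M p)" by force
  qed
  then show ?case by (rule finite_subset) (use Ext in auto)
qed

lemma nodes_take:
  assumes "u \<in> nodes M \<sigma>" "m \<le> M" shows "map_el (take m) u \<in> nodes m \<sigma>"
  using assms by (auto simp: nodes_def el.map_comp o_def el.set_map)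

lemma map_el_take_take: "m \<le> M \<Longrightarrow> map_el (take m) (map_el (take M) u) = map_el (take m) u"
  by (simp add: el.map_comp o_def min_absorb1)

lemma trunc_separates:
  assumes "w \<in> urt" "w' \<in> urt" "w \<noteq> w'"
  shows "\<exists>m. trunc m w \<noteq> trunc m w'"
  using assms
proof (induction arbitrary: w' rule: urt_induct)
  case (Base r q)
  show ?case
  proof (cases w')
    case (Base a q')
    then obtain r' where a: "a = Ur r'" using Base.prems unfolding urt_def by auto
    show ?thesis
    proof (cases "q = q'")
      case True
      then have "r \<noteq> r'" using Base a Base.prems by auto
      then obtain i where "r i \<noteq> r' i" by auto
      then have "map r [0..<Suc i] \<noteq> map r' [0..<Suc i]" by auto
      then show ?thesis unfolding Base a trunc_def by (intro exI[of _ "Suc i"]) auto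
    qed (auto simp: Base trunc_def)
  qed (auto simp: trunc_def)
next
  case (Ext e k b j p)
  show ?case
  proof (cases w')
    case w': (Ext e' k' b' j' p')
    have u: "e' \<in> urt" "k' \<in> urt" "p' \<in> urt" using Ext.prems(1) unfolding w' urt_def by auto
    consider "e \<noteq> e'" | "k \<noteq> k'" | "p \<noteq> p'" | "b \<noteq> b' \<or> j \<noteq> j'" using Ext.prems(2) w' by auto
    then show ?thesis
    proof cases
      case 1 then show ?thesis using Ext.IH(1)[OF u(1)] unfolding w' trunc_def by auto
    next
      case 2 then show ?thesis using Ext.IH(2)[OF u(2)] unfolding w' trunc_def by auto
    next
      case 3 then show ?thesis using Ext.IH(3)[OF u(3)] unfolding w' trunc_def by auto
    qed (auto simp: w' trunc_def)
  qed (auto simp: trunc_def)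
qed

lemma trunc_distinct:
  assumes "set ws \<subseteq> urt" "distinct ws"
  shows "\<exists>m. distinct (map (trunc m) ws)"
proof -
  have "\<exists>m. \<forall>w w'. w \<in> set ws \<and> w' \<in> set ws \<and> w \<noteq> w' \<longrightarrow> trunc m w \<noteq> trunc m w'"
  proof -
    have "\<forall>w w'. \<exists>m. w \<in> set ws \<and> w' \<in> set ws \<and> w \<noteq> w' \<longrightarrow> trunc m w \<noteq> trunc m w'"
      using trunc_separates assms(1) by (meson subsetD)
    then obtain f where f: "\<And>w w'. w \<in> set ws \<Longrightarrow> w' \<in> set ws \<Longrightarrow> w \<noteq> w' \<Longrightarrow> trunc (f w w') w \<noteq> trunc (f w w') w'"
      by metis
    define m where "m = Max ((\<lambda>(w, w'). f w w') ` (set ws \<times> set ws) \<union> {0})"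
    have le: "f w w' \<le> m" if "w \<in> set ws" "w' \<in> set ws" for w w'
      unfolding m_def by (rule Max_ge) (use that in auto)
    have "trunc m w \<noteq> trunc m w'" if w: "w \<in> set ws" "w' \<in> set ws" "w \<noteq> w'" for w w'
    proof -
      have "w \<in> urt" "w' \<in> urt" using w assms(1) by auto
      then have "map_el (take (f w w')) (trunc m w) = trunc (f w w') w" "map_el (take (f w w')) (trunc m w') = trunc (f w w') w'"
        using take_trunc le[OF w(1,2)] by blast+
      then show ?thesis using f[OF w] by metis
    qed
    then show ?thesis by blast
  qed
  then obtain m where "\<forall>w w'. w \<in> set ws \<and> w' \<in> set ws \<and> w \<noteq> w' \<longrightarrow> trunc m w \<noteq> trunc m w'" by blast
  then have "distinct (map (trunc m) ws)" using assms(2) by (auto simp: distinct_map inj_on_def)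
  then show ?thesis by blast
qed

lemma nodeval_trunc: "w \<in> urt \<Longrightarrow> m \<le> M \<Longrightarrow> nodeval G (trunc M w) m = rl G w m"
proof -
  assume a: "w \<in> urt" "m \<le> M"
  have "topj (trunc M w) = topj w" by (simp add: trunc_def)
  then show ?thesis unfolding nodeval_def rl_def using take_trunc[OF a] by simp
qed

section \<open>Rows that meet a dense open set under a finite condition on the other
  coordinates\<close>

definition free_cond :: "ix list \<Rightarrow> (co \<times> bool) list \<Rightarrow> bool" where
  "free_cond xs s \<longleftrightarrow> distinct xs \<and> (\<exists>z. holds s z) \<and> (\<forall>c\<in>fst ` set s. \<forall>\<alpha>\<in>set xs. \<forall>m. c \<noteq> Rb \<alpha> m)"

definition setrows :: "ix list \<Rightarrow> (nat \<Rightarrow> nat \<Rightarrow> bool) \<Rightarrow> (co \<Rightarrow> bool) \<Rightarrow> co \<Rightarrow> bool" where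
  "setrows xs r z c = (case c of Rb \<alpha> m \<Rightarrow> if \<alpha> \<in> set xs then r (idx xs \<alpha>) m else z c | Bt _ _ \<Rightarrow> z c)"

lemma idx_distinct: "distinct xs \<Longrightarrow> a < length xs \<Longrightarrow> idx xs (xs ! a) = a"
  using idx_nth[of "xs ! a" xs] nth_eq_iff_index_eq by fastforce

lemma setrows_row: "distinct xs \<Longrightarrow> a < length xs \<Longrightarrow> setrows xs r z (Rb (xs ! a) m) = r a m"
  by (simp add: setrows_def idx_distinct)

lemma setrows_holds: "free_cond xs s \<Longrightarrow> holds s z \<Longrightarrow> holds s (setrows xs r z)"
proof -
  assume f: "free_cond xs s" and z: "holds s z"
  have "setrows xs r z c = b" if cb: "(c, b) \<in> set s" for c b
  proof -
    have c: "c \<in> fst ` set s" using cb by force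
    have "z c = b" using z cb unfolding holds_def by auto
    moreover have "\<forall>\<alpha>\<in>set xs. \<forall>m. c \<noteq> Rb \<alpha> m" using f c unfolding free_cond_def by blast
    then have "setrows xs r z c = z c"
      unfolding setrows_def by (cases c) auto
    ultimately show ?thesis by simp
  qed
  then show ?thesis unfolding holds_def by auto
qed

lemma setrows_cyl:
  assumes "distinct xs" "\<And>a m. a < length xs \<Longrightarrow> Rb (xs ! a) m \<in> F \<Longrightarrow> r a m = z (Rb (xs ! a) m)"
  shows "setrows xs r z \<in> cyl F z"
  unfolding cyl_def
proof (intro CollectI ballI)
  fix c assume c: "c \<in> F"
  show "setrows xs r z c = z c"
  proof (cases c)
    case (Rb \<alpha> m)
    show ?thesis
    proof (cases "\<alpha> \<in> set xs")
      case True
      then show ?thesis using assms(2)[of "idx xs \<alpha>" m] idx_nth[OF True] c unfolding setrows_def Rb by simp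
    qed (simp add: setrows_def Rb)
  qed (simp add: setrows_def)
qed

definition meets :: "(co \<Rightarrow> bool) set \<Rightarrow> (co \<times> bool) list \<Rightarrow> ix list \<Rightarrow> (nat \<Rightarrow> nat \<Rightarrow> bool) \<Rightarrow> bool" where
  "meets D s xs r \<longleftrightarrow> (\<exists>z\<in>D. holds s z \<and> (\<forall>a<length xs. \<forall>m. z (Rb (xs ! a) m) = r a m))"

lemma meets_setrows:
  assumes "free_cond xs s" "holds s z" "setrows xs r z \<in> D" shows "meets D s xs r"
  unfolding meets_def
proof (intro bexI[OF _ assms(3)] conjI allI impI)
  show "holds s (setrows xs r z)" by (rule setrows_holds[OF assms(1,2)])
  fix a m assume "a < length xs"
  then show "setrows xs r z (Rb (xs ! a) m) = r a m" using assms(1) setrows_row unfolding free_cond_def by blast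
qed

text \<open>Digits below \<open>M0\<close> are already decided by \<open>v\<close>; from
  \<open>M0\<close> on, the rows are read off \<open>g\<close> at the distinct nodes
  \<open>us\<close>. Distinctness makes the rows independent coordinates of \<open>g\<close>, so
  that meeting \<open>D\<close> is a dense open demand on \<open>g\<close>.\<close>

lemma generic_rows:
  fixes D :: "(co \<Rightarrow> bool) set" and us :: "bool list el list"
  assumes D: "opn D" "dns D" and f: "free_cond xs s" and len: "length us = length xs" and dist: "distinct us"
  shows "opn {g. meets D s xs (\<lambda>a m. if m < M0 then v a m else g (us ! a, m))}" (is "opn ?T")
    "dns {g. meets D s xs (\<lambda>a m. if m < M0 then v a m else g (us ! a, m))}"
proof -
  have dx: "distinct xs" using f unfolding free_cond_def by blast
  let ?r = "\<lambda>g a m. if m < M0 then v a m else g (us ! a, m)"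
  show "opn ?T" unfolding opn_def
  proof
    fix g assume "g \<in> ?T"
    then have "meets D s xs (?r g)" by (simp only: mem_Collect_eq)
    then obtain z where z: "z \<in> D" "holds s z" "\<forall>a<length xs. \<forall>m. z (Rb (xs ! a) m) = ?r g a m" unfolding meets_def by blast
    obtain F where F: "finite F" "cyl F z \<subseteq> D" using D(1) z(1) unfolding opn_def by blast
    define H where "H = (\<lambda>c. case c of Rb \<alpha> m \<Rightarrow> (us ! idx xs \<alpha>, m) | Bt _ _ \<Rightarrow> (us ! 0, 0)) ` F"
    have "cyl H g \<subseteq> ?T"
    proof
      fix g' assume g': "g' \<in> cyl H g"
      have "setrows xs (?r g') z \<in> cyl F z"
      proof (rule setrows_cyl[OF dx])
        fix a m assume a: "a < length xs" and m: "Rb (xs ! a) m \<in> F"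
        have "(us ! a, m) \<in> H" unfolding H_def by (rule image_eqI[OF _ m]) (simp add: idx_distinct[OF dx a])
        then have "g' (us ! a, m) = g (us ! a, m)" using g' unfolding cyl_def by blast
        then show "?r g' a m = z (Rb (xs ! a) m)" using z(3) a by auto
      qed
      then have "setrows xs (?r g') z \<in> D" using F(2) by blast
      then have "meets D s xs (?r g')" by (rule meets_setrows[OF f z(2)])
      then show "g' \<in> ?T" by (simp only: mem_Collect_eq)
    qed
    moreover have "finite H" unfolding H_def using F(1) by simp
    ultimately show "\<exists>F. finite F \<and> cyl F g \<subseteq> ?T" by (intro exI[of _ H] conjI)
  qed
  show "dns ?T" unfolding dns_def
  proof (intro allI impI)
    fix F :: "(bool list el \<times> nat) set" and g0 assume F: "finite F"
    obtain zs where zs: "holds s zs" using f unfolding free_cond_def by blast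
    define z0 where "z0 = setrows xs (?r g0) zs"
    have z0: "holds s z0" unfolding z0_def using setrows_holds[OF f zs] by blast
    \<comment> \<open>The coordinates to be kept: those of the condition, the digits below
      \<open>M0\<close>, and the digits that \<open>F\<close> may fix in \<open>g\<close>.\<close>
    define H where "H = fst ` set s \<union> (\<lambda>(\<alpha>, m). Rb \<alpha> m) ` (set xs \<times> ({..<M0} \<union> snd ` F))"
    have "finite H" unfolding H_def using F by auto
    then obtain z where z: "z \<in> D" "z \<in> cyl H z0" using D(2) unfolding dns_def by blast
    define g where "g = (\<lambda>(u, m). if u \<in> set us \<and> M0 \<le> m then z (Rb (xs ! idx us u) m) else g0 (u, m))"
    have gu: "g (us ! a, m) = z (Rb (xs ! a) m)" if "a < length xs" "M0 \<le> m" for a m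
      unfolding g_def using that len idx_distinct[OF dist, of a] by simp
    have g1: "g \<in> cyl F g0" unfolding cyl_def
    proof (intro CollectI ballI)
      fix c assume c: "c \<in> F"
      obtain u m where um: "c = (u, m)" by (cases c)
      show "g c = g0 c"
      proof (cases "u \<in> set us \<and> M0 \<le> m")
        case True
        then obtain a where a: "a < length xs" "u = us ! a" using len by (metis in_set_conv_nth)
        have "m \<in> snd ` F" using c um by force
        then have "Rb (xs ! a) m \<in> H" unfolding H_def using a(1) by (intro UnI2 image_eqI[of _ _ "(xs ! a, m)"]) auto
        then have "z (Rb (xs ! a) m) = z0 (Rb (xs ! a) m)" using z(2) unfolding cyl_def by blast
        also have "\<dots> = g0 (us ! a, m)" unfolding z0_def using setrows_row[OF dx a(1)] True by simp
        finally show ?thesis using gu[OF a(1)] a um True by simp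
      next
        case False then show ?thesis by (auto simp: g_def um)
      qed
    qed
    have "meets D s xs (?r g)" unfolding meets_def
    proof (intro bexI[OF _ z(1)] conjI allI impI)
      have "z c = b" if cb: "(c, b) \<in> set s" for c b
      proof -
        have "c \<in> H" unfolding H_def using cb by (intro UnI1 image_eqI[of _ _ "(c, b)"]) auto
        then have "z c = z0 c" using z(2) unfolding cyl_def by blast
        then show ?thesis using z0 cb unfolding holds_def by auto
      qed
      then show "holds s z" unfolding holds_def by auto
      fix a m assume a: "a < length xs"
      show "z (Rb (xs ! a) m) = ?r g a m"
      proof (cases "m < M0")
        case True
        then have "Rb (xs ! a) m \<in> H" unfolding H_def using a by (intro UnI2 image_eqI[of _ _ "(xs ! a, m)"]) auto
        then have "z (Rb (xs ! a) m) = z0 (Rb (xs ! a) m)" using z(2) unfolding cyl_def by blast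
        then show ?thesis using True setrows_row[OF dx a] unfolding z0_def by simp
      qed (use gu[OF a] in simp)
    qed
    then have g2: "g \<in> ?T" by (simp only: mem_Collect_eq)
    show "cyl F g0 \<inter> ?T \<noteq> {}"
    proof
      assume eq: "cyl F g0 \<inter> ?T = {}"
      show False by (rule emptyE[OF subst[where P = "\<lambda>S. g \<in> S", OF eq IntI[OF g1 g2]]])
    qed
  qed
qed

text \<open>\<open>m0\<close> is the precision by which the truncations must already differ. Any
  tuple of distinct trees is covered by some \<open>m0\<close>, and for each precision
  \<open>M\<close> there are finitely many tuples.\<close>

definition tuples :: "nat \<Rightarrow> unit el list \<Rightarrow> nat \<Rightarrow> bool list el list set" where
  "tuples M \<sigma>s m0 = {us. length us = length \<sigma>s \<and> (\<forall>a<length \<sigma>s. us ! a \<in> nodes M (\<sigma>s ! a)) \<and> distinct (map (map_el (take m0)) us)}"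

lemma finite_tuples: "finite (tuples M \<sigma>s m0)"
proof (rule finite_subset)
  show "tuples M \<sigma>s m0 \<subseteq> {us. set us \<subseteq> (\<Union>\<sigma>\<in>set \<sigma>s. nodes M \<sigma>) \<and> length us = length \<sigma>s}"
    unfolding tuples_def by (fastforce simp: in_set_conv_nth)
  show "finite {us. set us \<subseteq> (\<Union>\<sigma>\<in>set \<sigma>s. nodes M \<sigma>) \<and> length us = length \<sigma>s}"
    by (intro finite_lists_length_eq finite_UN_I finite_nodes) auto
qed

lemma tuples_take:
  assumes "us \<in> tuples M \<sigma>s m0" "m0 \<le> M0" "M0 \<le> M"
  shows "map (map_el (take M0)) us \<in> tuples M0 \<sigma>s m0"
proof -
  have e: "map (map_el (take m0)) (map (map_el (take M0)) us) = map (map_el (take m0)) us"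
    by (simp add: map_el_take_take[OF assms(2)])
  show ?thesis unfolding tuples_def
  proof (intro CollectI conjI)
    show "distinct (map (map_el (take m0)) (map (map_el (take M0)) us))" unfolding e using assms(1) unfolding tuples_def by simp
  qed (use assms nodes_take in \<open>auto simp: tuples_def\<close>)
qed

definition forces :: "(co \<Rightarrow> bool) set \<Rightarrow> (co \<times> bool) list \<Rightarrow> ix list \<Rightarrow> nat \<Rightarrow> (nat \<Rightarrow> nat \<Rightarrow> bool) \<Rightarrow> bool" where
  "forces D s xs M r \<longleftrightarrow> (\<exists>z F. finite F \<and> cyl F z \<subseteq> D \<and> holds s z \<and> (\<forall>a<length xs. \<forall>m. Rb (xs ! a) m \<in> F \<longrightarrow> m < M) \<and>
     (\<forall>a<length xs. \<forall>m<M. z (Rb (xs ! a) m) = r a m))"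

lemma forces_cong:
  assumes "forces D s xs M r" "\<And>a m. a < length xs \<Longrightarrow> m < M \<Longrightarrow> r a m = r' a m"
  shows "forces D s xs M r'"
proof -
  obtain z F where "finite F" "cyl F z \<subseteq> D" "holds s z" "\<forall>a<length xs. \<forall>m. Rb (xs ! a) m \<in> F \<longrightarrow> m < M"
    "\<forall>a<length xs. \<forall>m<M. z (Rb (xs ! a) m) = r a m"
    using assms(1) unfolding forces_def by blast
  then show ?thesis unfolding forces_def using assms(2) by (intro exI[of _ z] exI[of _ F]) auto
qed

lemma forces_meets:
  assumes "forces D s xs M r" "free_cond xs s" "\<And>a m. a < length xs \<Longrightarrow> m < M \<Longrightarrow> r a m = r' a m"
  shows "meets D s xs r'"
proof -
  obtain z F where z: "cyl F z \<subseteq> D" "holds s z" "\<And>a m. a < length xs \<Longrightarrow> Rb (xs ! a) m \<in> F \<Longrightarrow> m < M"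
    "\<And>a m. a < length xs \<Longrightarrow> m < M \<Longrightarrow> z (Rb (xs ! a) m) = r a m"
    using assms(1) unfolding forces_def by blast
  have dx: "distinct xs" using assms(2) unfolding free_cond_def by blast
  have "setrows xs r' z \<in> cyl F z" by (rule setrows_cyl[OF dx]) (use z(3,4) assms(3) in metis)
  then show ?thesis using z(1) by (intro meets_setrows[OF assms(2) z(2)]) blast
qed

lemma meets_forces:
  assumes "meets D s xs r" "opn D"
  shows "\<exists>M1. \<forall>M\<ge>M1. forces D s xs M r"
proof -
  obtain z where z: "z \<in> D" "holds s z" "\<forall>a<length xs. \<forall>m. z (Rb (xs ! a) m) = r a m" using assms(1) unfolding meets_def by blast
  obtain F where F: "finite F" "cyl F z \<subseteq> D" using assms(2) z(1) unfolding opn_def by blast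
  define M1 where "M1 = Suc (Max ((\<lambda>c. case c of Rb \<alpha> m \<Rightarrow> m | Bt _ _ \<Rightarrow> 0) ` F \<union> {0}))"
  have "m < M1" if "Rb \<alpha> m \<in> F" for \<alpha> m
  proof -
    have "m \<in> (\<lambda>c. case c of Rb \<alpha> m \<Rightarrow> m | Bt _ _ \<Rightarrow> 0) ` F \<union> {0}" using that by force
    then have "m \<le> Max ((\<lambda>c. case c of Rb \<alpha> m \<Rightarrow> m | Bt _ _ \<Rightarrow> 0) ` F \<union> {0})" using F(1) by (intro Max_ge) auto
    then show ?thesis unfolding M1_def by simp
  qed
  then have "forces D s xs M r" if "M \<ge> M1" for M
    unfolding forces_def using z F that by (intro exI[of _ z] exI[of _ F]) (meson less_le_trans)
  then show ?thesis by blast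
qed

text \<open>One precision \<open>M\<close> serves all tuples of the given shapes. This uniformity
  makes the demand open in \<open>G\<close> and lets countably many demands take care of all tuples
  of trees.\<close>

definition goodG :: "(co \<Rightarrow> bool) set \<Rightarrow> (co \<times> bool) list \<Rightarrow> ix list \<Rightarrow> unit el list \<Rightarrow> nat \<Rightarrow> (bool list el \<times> nat \<Rightarrow> bool) set" where
  "goodG D s xs \<sigma>s m0 = {G. \<exists>M\<ge>m0. \<forall>us\<in>tuples M \<sigma>s m0. forces D s xs M (\<lambda>a m. nodeval G (us ! a) m)}"

lemma opn_goodG:
  assumes len: "length \<sigma>s = length xs"
  shows "opn (goodG D s xs \<sigma>s m0)"
  unfolding opn_def
proof
  fix G assume "G \<in> goodG D s xs \<sigma>s m0"
  then obtain M where M: "M \<ge> m0" "\<And>us. us \<in> tuples M \<sigma>s m0 \<Longrightarrow> forces D s xs M (\<lambda>a m. nodeval G (us ! a) m)" unfolding goodG_def by blast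
  define F where "F = (\<lambda>(u, m). (map_el (take m) u, m)) ` ((\<Union>us\<in>tuples M \<sigma>s m0. set us) \<times> {..<M})"
  have "finite F" unfolding F_def using finite_tuples by auto
  moreover have "cyl F G \<subseteq> goodG D s xs \<sigma>s m0"
  proof
    fix G' assume G': "G' \<in> cyl F G"
    have "forces D s xs M (\<lambda>a m. nodeval G' (us ! a) m)" if us: "us \<in> tuples M \<sigma>s m0" for us
    proof -
      have "nodeval G' (us ! a) m = nodeval G (us ! a) m" if "a < length xs" "m < M" for a m
      proof -
        have "a < length us" using us that len unfolding tuples_def by auto
        then have "us ! a \<in> (\<Union>us\<in>tuples M \<sigma>s m0. set us)" using us by fastforce
        then have "(map_el (take m) (us ! a), m) \<in> F" unfolding F_def using that(2) by force
        then have "G' (map_el (take m) (us ! a), m) = G (map_el (take m) (us ! a), m)" using G' unfolding cyl_def by blast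
        then show ?thesis unfolding nodeval_def by simp
      qed
      then show ?thesis using forces_cong[OF M(2)[OF us]] by metis
    qed
    then show "G' \<in> goodG D s xs \<sigma>s m0" unfolding goodG_def using M(1) by blast
  qed
  ultimately show "\<exists>F. finite F \<and> cyl F G \<subseteq> goodG D s xs \<sigma>s m0" by blast
qed

text \<open>The fusion step: from \<open>M0\<close> on, \<open>G\<close> is made to depend only on
  truncations to \<open>M0\<close> digits, so that finitely many tuples remain. A generic
  \<open>g\<close> meets \<open>D\<close> for all of them, and a common precision \<open>M\<close>
  witnesses this.\<close>

lemma dns_goodG:
  assumes D: "opn D" "dns D" and f: "free_cond xs s" and len: "length \<sigma>s = length xs"
  shows "dns (goodG D s xs \<sigma>s m0)"
  unfolding dns_def
proof (intro allI impI)
  fix F :: "(bool list el \<times> nat) set" and G0 assume F: "finite F"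
  \<comment> \<open>Beyond the given finite part of \<open>G0\<close>, beyond all prescribed initial
    segments, and beyond the precision that separates the tuples.\<close>
  define M0 where "M0 = Suc (Max (snd ` F \<union> (\<lambda>\<sigma>. length (pref (topj \<sigma>))) ` set \<sigma>s \<union> {m0}))"
  have fin: "finite (snd ` F \<union> (\<lambda>\<sigma>. length (pref (topj \<sigma>))) ` set \<sigma>s \<union> {m0})" using F by auto
  have M0: "m0 \<le> M0" "\<And>u m. (u, m) \<in> F \<Longrightarrow> m < M0" "\<And>\<sigma>. \<sigma> \<in> set \<sigma>s \<Longrightarrow> length (pref (topj \<sigma>)) \<le> M0"
  proof -
    have *: "m \<le> Max (snd ` F \<union> (\<lambda>\<sigma>. length (pref (topj \<sigma>))) ` set \<sigma>s \<union> {m0})"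
      if "m \<in> snd ` F \<union> (\<lambda>\<sigma>. length (pref (topj \<sigma>))) ` set \<sigma>s \<union> {m0}" for m
      using Max_ge[OF fin that] .
    show "m0 \<le> M0" unfolding M0_def using *[of m0] by simp
    {
      fix u m assume "(u, m) \<in> F"
      then have "m \<in> snd ` F" by force
      then show "m < M0" unfolding M0_def using *[of m] by simp
    }
    fix \<sigma> assume "\<sigma> \<in> set \<sigma>s"
    then show "length (pref (topj \<sigma>)) \<le> M0" unfolding M0_def using *[of "length (pref (topj \<sigma>))"] by simp
  qed
  let ?r = "\<lambda>us g a m. if m < M0 then nodeval G0 (us ! a) m else g (us ! a, m)"
  define T where "T us = (if us \<in> tuples M0 \<sigma>s m0 then {g. meets D s xs (?r us g)} else UNIV)" for us
  have dist: "distinct us" if "us \<in> tuples M0 \<sigma>s m0" for us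
    using that unfolding tuples_def by (simp add: distinct_map)
  have "comeager (T us)" for us
  proof (cases "us \<in> tuples M0 \<sigma>s m0")
    case True
    then have "length us = length xs" using len unfolding tuples_def by simp
    from generic_rows[OF D f this dist[OF True], of M0 "\<lambda>a m. nodeval G0 (us ! a) m"]
    show ?thesis unfolding T_def using True by (simp add: comeager_opn_dns)
  qed (simp add: T_def comeager_UNIV)
  then have "comeager (\<Inter>us. T us)" by (rule comeager_INT)
  then obtain g where g: "g \<in> (\<Inter>us. T us)" using comeager_nonempty by blast
  have gm: "meets D s xs (?r us g)" if "us \<in> tuples M0 \<sigma>s m0" for us
  proof -
    have "g \<in> T us" using g by blast
    then show ?thesis unfolding T_def using that by simp
  qed
  define M1 where "M1 us = (SOME M1. \<forall>M\<ge>M1. forces D s xs M (?r us g))" for us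
  have M1: "forces D s xs M (?r us g)" if "us \<in> tuples M0 \<sigma>s m0" "M \<ge> M1 us" for us M
    using someI_ex[OF meets_forces[OF gm[OF that(1)] D(1)]] that(2) unfolding M1_def by blast
  define M where "M = M0 + Max (M1 ` tuples M0 \<sigma>s m0 \<union> {0})"
  have M: "M0 \<le> M" "M1 us \<le> M" if "us \<in> tuples M0 \<sigma>s m0" for us
  proof -
    have "M1 us \<le> Max (M1 ` tuples M0 \<sigma>s m0 \<union> {0})" using that finite_tuples by (intro Max_ge) auto
    then show "M0 \<le> M" "M1 us \<le> M" unfolding M_def by auto
  qed
  have MM: "M0 \<le> M" unfolding M_def by simp
  define G where "G = (\<lambda>(u, m). if m < M0 then G0 (u, m) else g (map_el (take M0) u, m))"
  have "G \<in> cyl F G0" unfolding cyl_def G_def using M0(2) by auto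
  moreover have "forces D s xs M (\<lambda>a m. nodeval G (us' ! a) m)" if us': "us' \<in> tuples M \<sigma>s m0" for us'
  proof -
    define us where "us = map (map_el (take M0)) us'"
    have us: "us \<in> tuples M0 \<sigma>s m0" unfolding us_def by (rule tuples_take[OF us' M0(1) MM])
    have eq: "?r us g a m = nodeval G (us' ! a) m" if a: "a < length xs" and m: "m < M" for a m
    proof -
      have a': "a < length us'" "us' ! a \<in> nodes M (\<sigma>s ! a)" "\<sigma>s ! a \<in> set \<sigma>s" using us' a len unfolding tuples_def by auto
      have ua: "us ! a = map_el (take M0) (us' ! a)" unfolding us_def using a' by simp
      have tj: "topj (us' ! a) = topj (\<sigma>s ! a)" using a'(2) unfolding nodes_def by (metis (mono_tags, lifting) mem_Collect_eq topj_map_el)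
      show ?thesis
      proof (cases "m < M0")
        case True
        then show ?thesis unfolding nodeval_def ua G_def by (simp add: map_el_take_take)
      next
        case False
        then have "\<not> m < length (pref (topj (us' ! a)))" using M0(3)[OF a'(3)] tj by simp
        then show ?thesis unfolding nodeval_def ua G_def using False by (simp add: map_el_take_take)
      qed
    qed
    show ?thesis by (rule forces_cong[OF M1[OF us M(2)[OF us]] eq])
  qed
  ultimately have "G \<in> cyl F G0 \<inter> goodG D s xs \<sigma>s m0" unfolding goodG_def using M0(1) MM by (auto intro!: exI[of _ M])
  then show "cyl F G0 \<inter> goodG D s xs \<sigma>s m0 \<noteq> {}" by blast
qed

text \<open>A perfect set construction in the style of Mycielski: any finite tuple of distinct trees
  receives mutually generic rows, although there are continuum many trees.\<close>

lemma ex_generic_reals: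
  fixes D :: "nat \<Rightarrow> (co \<Rightarrow> bool) set"
  assumes D: "\<And>q. opn (D q)" "\<And>q. dns (D q)"
  shows "\<exists>G. \<forall>q s xs ws. free_cond xs s \<longrightarrow> length ws = length xs \<longrightarrow> distinct ws \<longrightarrow> set ws \<subseteq> urt \<longrightarrow>
     meets (D q) s xs (\<lambda>a. rl G (ws ! a))"
proof -
  \<comment> \<open>All data of a demand are countable: the trees enter only through their shapes
    and a separating precision.\<close>
  define W where "W = (\<lambda>(q, s, xs, \<sigma>s, m0). if free_cond xs s \<and> length \<sigma>s = length xs then goodG (D q) s xs \<sigma>s m0 else UNIV)"
  have "comeager (W i)" for i
    unfolding W_def by (auto simp: comeager_UNIV split: prod.split intro!: comeager_opn_dns opn_goodG dns_goodG D)
  then have "comeager (\<Inter>i. W i)" by (rule comeager_INT)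
  then obtain G where G: "G \<in> (\<Inter>i. W i)" using comeager_nonempty by blast
  have "meets (D q) s xs (\<lambda>a. rl G (ws ! a))" if f: "free_cond xs s" and len: "length ws = length xs" and d: "distinct ws" and u: "set ws \<subseteq> urt" for q s xs ws
  proof -
    obtain m0 where m0: "distinct (map (trunc m0) ws)" using trunc_distinct[OF u d] by blast
    define \<sigma>s where "\<sigma>s = map (map_el (\<lambda>_. ())) ws"
    have "G \<in> W (q, s, xs, \<sigma>s, m0)" using G by blast
    then have "G \<in> goodG (D q) s xs \<sigma>s m0" unfolding W_def using f len \<sigma>s_def by simp
    then obtain M where M: "M \<ge> m0" "\<And>us. us \<in> tuples M \<sigma>s m0 \<Longrightarrow> forces (D q) s xs M (\<lambda>a m. nodeval G (us ! a) m)"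
      unfolding goodG_def by blast
    have eq: "map (map_el (take m0)) (map (trunc M) ws) = map (trunc m0) ws" using take_trunc[OF _ M(1)] u by auto
    have "map (trunc M) ws \<in> tuples M \<sigma>s m0"
      unfolding tuples_def
    proof (intro CollectI conjI allI impI)
      show "distinct (map (map_el (take m0)) (map (trunc M) ws))" unfolding eq by (rule m0)
    qed (use trunc_nodes u in \<open>auto simp: \<sigma>s_def subset_iff\<close>)
    from M(2)[OF this] have "forces (D q) s xs M (\<lambda>a m. nodeval G (map (trunc M) ws ! a) m)" .
    then show ?thesis
    proof (rule forces_meets[OF _ f])
      fix a m assume "a < length xs" "m < M"
      then show "nodeval G (map (trunc M) ws ! a) m = rl G (ws ! a) m"
        using nodeval_trunc[of "ws ! a" m M G] u len by (auto simp: subset_iff)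
    qed
  qed
  then show ?thesis by blast
qed

section \<open>The reduction\<close>

text \<open>Trees over positions name the trees over the tokens of \<open>x\<close>; these names
  form a countable set that is the same for all \<open>x\<close>.\<close>

primrec ev :: "pt \<Rightarrow> nat \<Rightarrow> nat el \<Rightarrow> hc el" where
  "ev x l (Base k q) = Base (tk x l k) q"
| "ev x l (Ext e k b j p) = Ext (ev x l e) (ev x (l - 1) k) b j (ev x l p)"

definition hred :: "enat \<Rightarrow> (bool list el \<times> nat \<Rightarrow> bool) \<Rightarrow> pt \<Rightarrow> pt" where
  "hred n G x l k m = (enat l < n \<and> (case l of 0 \<Rightarrow> rl G (ev x 0 (from_nat k)) m
     | Suc l' \<Rightarrow> bit (ev x l' (from_nat m)) (ev x l (from_nat k))))"

lemma range_ev: "range (ev x l) = El (tks x) l"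
proof -
  have "ev x l t \<in> El (tks x) l" for t l by (induction t arbitrary: l) (auto simp: tks_def)
  moreover have "e \<in> El (tks x) l \<Longrightarrow> \<exists>t. e = ev x l t" for e l
  proof (induction e arbitrary: l)
    case (Base a q)
    then obtain k where "a = tk x l k" by (auto simp: tks_def)
    then show ?case by (intro exI[of _ "Base k q"]) simp
  next
    case (Ext e k b j p)
    then obtain t1 t2 t3 where "e = ev x l t1" "k = ev x (l - 1) t2" "p = ev x l t3" by (metis El_Ext)
    then show ?case by (intro exI[of _ "Ext t1 t2 b j t3"]) simp
  qed
  ultimately show ?thesis by blast
qed

lemma hred_enum:
  assumes "1 \<le> n"
  shows "enum_of n (El (tks x)) bit (rl G) (\<lambda>l k. ev x l (from_nat k)) (hred n G x)"
proof -
  have "0 < n" using assms by (cases n) (auto simp: one_enat_def zero_enat_def)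
  moreover have "range (\<lambda>k. ev x l (from_nat k)) = El (tks x) l" for l
  proof -
    have "range (\<lambda>k. ev x l (from_nat k)) = ev x l ` range from_nat" by (simp only: image_image)
    then show ?thesis by (simp only: range_ev surj_from_nat)
  qed
  ultimately show ?thesis unfolding enum_of_def hred_def by (auto simp: zero_enat_def fun_eq_iff)
qed

lemma tks_ne: "tks x l \<noteq> {}"
  by (simp add: tks_def)

lemma El_separated:
  assumes e: "e \<in> El (tks x) (Suc l)" and f: "f \<in> El (tks y) (Suc l)" and "e \<noteq> f"
    and eq: "tks x l = tks y l" "El (tks x) l = El (tks y) l"
  shows "\<exists>P. set P \<subseteq> El (tks x) l \<and> view P e \<noteq> view P f"
proof (rule view_separates[OF assms(3)])
  show "hkeys e \<union> hkeys f \<subseteq> El (tks x) l" using El_hkeys[OF e] El_hkeys[OF f] eq by auto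
  fix b b' assume "b \<in> htoks e" "b' \<in> htoks f" "b \<noteq> b'"
  then obtain a where a: "a \<in> tks x l" "hmem a b \<noteq> hmem a b'"
    using tks_separated[of b x l b' y] El_htoks[OF e] El_htoks[OF f] eq by blast
  then show "\<exists>p\<in>El (tks x) l. hmem (tok p) b \<noteq> hmem (tok p) b'" by (intro bexI[of _ "Base a 0"]) auto
qed

lemma El_bits:
  assumes "finite Up" "Up \<subseteq> El (tks x) (Suc l)"
  shows "\<exists>w\<in>El (tks x) l. \<forall>f\<in>Up. bit w f = up f"
proof -
  obtain a where a: "a \<in> tks x l" using tks_ne by blast
  \<comment> \<open>The extension lemma asks for at least one key; this token supplies one, and its
    bit may be anything.\<close>
  obtain a' where a': "a' \<in> tks x (l - 1)" using tks_ne by blast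
  have "\<exists>P. (\<forall>f g. f \<in> Up \<and> g \<in> Up \<and> f \<noteq> g \<longrightarrow> set (P f g) \<subseteq> El (tks x) l \<and> view (P f g) f \<noteq> view (P f g) g)"
    using El_separated[of _ x l _ x] assms(2) by (intro choice allI) (metis subsetD)
  then obtain P where P: "\<And>f g. f \<in> Up \<Longrightarrow> g \<in> Up \<Longrightarrow> f \<noteq> g \<Longrightarrow> set (P f g) \<subseteq> El (tks x) l \<and> view (P f g) f \<noteq> view (P f g) g" by blast
  define Ps where "Ps = insert (Base a 0) (\<Union>f\<in>Up. \<Union>g\<in>{g\<in>Up. g \<noteq> f}. set (P f g))"
  have fin: "finite Ps" unfolding Ps_def using assms(1) by auto
  have sub: "Ps \<subseteq> El (tks x) l" unfolding Ps_def using P a by fastforce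
  have "\<exists>e1 k b j p. k \<in> {Base a' 0} \<and> bld {Base a' 0} Ps (Base a 0) (Ext e1 k b j p) \<and> 0 < j \<and> pref j = [] \<and>
    (\<forall>k'\<in>{Base a' 0}. bit k' (Ext e1 k b j p) = True) \<and> (\<forall>f\<in>Up. bit (Ext e1 k b j p) f = up f)"
  proof (rule exists_extension)
    fix f g assume fg: "f \<in> Up" "g \<in> Up" "f \<noteq> g"
    then have "set (P f g) \<subseteq> Ps" unfolding Ps_def by blast
    then show "\<exists>P. set P \<subseteq> Ps \<and> view P f \<noteq> view P g" using P[OF fg] by blast
  qed (use fin assms(1) in \<open>auto simp: Ps_def\<close>)
  then obtain w where w: "bld {Base a' 0} Ps (Base a 0) w" "\<forall>f\<in>Up. bit w f = up f" by blast
  have "w \<in> El (tks x) l" using El_bld[OF w(1)] a a' sub by auto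
  then show ?thesis using w(2) by blast
qed

text \<open>The clauses of \<open>Xsp\<close> come from the richness of the trees: a key puts a
  given tree into another one, prescribed bits find a member of a tree and separate two trees, and
  the reals separate the bottom level. It is applied both to the reduction and to the generic
  points.\<close>

lemma El_enum_Xsp:
  assumes enum: "enum_of n (El (tks x)) bit (rl G) e z"
    and inj: "\<And>w w'. w \<in> urt \<Longrightarrow> w' \<in> urt \<Longrightarrow> rl G w = rl G w' \<Longrightarrow> w = w'"
  shows "z \<in> Xsp n"
proof (rule enum_of_Xsp[OF enum])
  fix l w assume "w \<in> El (tks x) l"
  obtain b where b: "b \<in> tks x (Suc l)" using tks_ne by blast
  let ?f = "Ext (Base b 0) w True 0 (Base b 0)"
  have "?f \<in> El (tks x) (Suc l)" "bit w ?f" using b \<open>w \<in> El (tks x) l\<close> by (auto simp: bit_def)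
  then show "\<exists>f\<in>El (tks x) (Suc l). bit w f" by blast
next
  fix l f assume "f \<in> El (tks x) (Suc l)"
  then show "\<exists>w\<in>El (tks x) l. bit w f" using El_bits[of "{f}" x l "\<lambda>_. True"] by auto
next
  fix w w' assume w: "w \<in> El (tks x) 0" "w' \<in> El (tks x) 0" "rl G w = rl G w'"
  have "wfe (tks x) 0 u \<Longrightarrow> wfe (\<lambda>_. range Ur) 0 u" for u by (induction u) (auto simp: tks_def)
  then show "w = w'" using inj w unfolding urt_def El_def by auto
next
  fix l f f' assume f: "f \<in> El (tks x) (Suc l)" "f' \<in> El (tks x) (Suc l)" and b: "\<And>w. w \<in> El (tks x) l \<Longrightarrow> bit w f = bit w f'"
  show "f = f'"
  proof (rule ccontr)
    assume "f \<noteq> f'"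
    then obtain w where "w \<in> El (tks x) l" "bit w f" "\<not> bit w f'"
      using El_bits[of "{f, f'}" x l "\<lambda>g. g = f"] f by auto
    then show False using b by blast
  qed
qed

lemma El_urt: "El (tks x) 0 \<subseteq> urt"
proof -
  have "wfe (tks x) 0 u \<Longrightarrow> wfe (\<lambda>_. range Ur) 0 u" for u by (induction u) (auto simp: tks_def)
  then show ?thesis unfolding urt_def El_def by auto
qed

section \<open>Measurability of the reduction\<close>

definition cmeas :: "'x measure \<Rightarrow> ('x \<Rightarrow> 'c::countable) \<Rightarrow> bool" where
  "cmeas M f \<longleftrightarrow> (\<forall>v. Measurable.pred M (\<lambda>x. f x = v))"

lemma cmeas_const: "cmeas M (\<lambda>_. c)"
  by (simp add: cmeas_def)

lemma cmeas_bool: "Measurable.pred M P \<Longrightarrow> cmeas M P"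
  unfolding cmeas_def by (intro allI, case_tac v) auto

text \<open>Views, key bits and truncations take values in countable types, where measurable fibres
  are enough and arbitrary functions may be applied afterwards.\<close>

lemma cmeas_pred:
  assumes "cmeas M f" shows "Measurable.pred M (\<lambda>x. Q (f x))"
proof -
  have "Measurable.pred M (\<lambda>x. \<exists>v. f x = v \<and> Q v)"
    using assms unfolding cmeas_def by (intro pred_intros_countable pred_intros_logic) simp_all
  then show ?thesis by simp
qed

lemma cmeas_app1:
  assumes "cmeas M f" shows "cmeas M (\<lambda>x. c (f x))"
  unfolding cmeas_def
proof
  fix v show "Measurable.pred M (\<lambda>x. c (f x) = v)" using cmeas_pred[OF assms, of "\<lambda>y. c y = v"] .
qed

lemma cmeas_app2:
  assumes "cmeas M f" "cmeas M g" shows "cmeas M (\<lambda>x. c (f x) (g x))"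
  unfolding cmeas_def
proof
  fix v
  have "Measurable.pred M (\<lambda>x. \<exists>a b. (f x = a \<and> g x = b) \<and> c a b = v)"
    using assms unfolding cmeas_def by (intro pred_intros_countable pred_intros_logic) simp_all
  then show "Measurable.pred M (\<lambda>x. c (f x) (g x) = v)" by simp
qed

lemma cmeas_app3:
  assumes "cmeas M f" "cmeas M g" "cmeas M h" shows "cmeas M (\<lambda>x. c (f x) (g x) (h x))"
  using cmeas_app2[OF cmeas_app2[OF assms(1,2), of Pair] assms(3), of "\<lambda>(a, b). c a b"] by simp

lemma cmeas_map:
  assumes "\<And>t. cmeas M (\<lambda>x. f x t)" shows "cmeas M (\<lambda>x. map (f x) P)"
  by (induction P) (auto intro: cmeas_const cmeas_app2 assms)

lemma cmeas_cong: "(\<And>x. x \<in> space M \<Longrightarrow> f x = g x) \<Longrightarrow> cmeas M f \<Longrightarrow> cmeas M g"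
  unfolding cmeas_def by (metis (mono_tags, lifting) measurable_cong)

context fixes n :: enat
begin

abbreviation "BM \<equiv> borel_of (Xtop n)"

text \<open>Equality of tokens is a statement about hereditarily countable sets; on
  \<open>Xsp n\<close> it reduces to equality of rows and is therefore Borel.\<close>

lemma cmeas_tk_eq:
  assumes "enat l < n" shows "cmeas BM (\<lambda>x. tk x l k = tk x l k')"
proof (rule cmeas_cong)
  show "cmeas BM (\<lambda>x. \<forall>m. x l k m = x l k' m)"
    by (intro cmeas_bool pred_intros_countable pred_intros_logic pred_coord)
  fix x assume "x \<in> space BM"
  then show "(\<forall>m. x l k m = x l k' m) = (tk x l k = tk x l k')" using tk_eq_iff[OF _ assms, of x k k'] by (auto simp: fun_eq_iff)
qed

lemma cmeas_hmem:
  assumes "enat (Suc l) < n" shows "cmeas BM (\<lambda>x. hmem (tk x l k) (tk x (Suc l) k'))"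
proof (rule cmeas_cong)
  show "cmeas BM (\<lambda>x. x (Suc l) k' k)" by (intro cmeas_bool pred_coord)
  fix x assume "x \<in> space BM"
  then show "x (Suc l) k' k = hmem (tk x l k) (tk x (Suc l) k')" using hmem_tk_iff[OF _ assms, of x k k'] by auto
qed

lemma cmeas_ev_eq: "enat l < n \<Longrightarrow> cmeas BM (\<lambda>x. ev x l t = ev x l t')"
proof (induction t arbitrary: l t')
  case (Base k q)
  show ?case
  proof (cases t')
    case (Base k' q')
    then show ?thesis using cmeas_app1[OF cmeas_tk_eq[OF Base.prems], where c = "\<lambda>b. b \<and> q = q'"] by simp
  qed (simp add: cmeas_const)
next
  case (Ext e k b j p)
  show ?case
  proof (cases t')
    case t': (Ext e' k' b' j' p')
    have "enat (l - 1) < n" using Ext.prems by (metis diff_le_self enat_ord_simps(1) le_less_trans)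
    then show ?thesis unfolding t'
      using cmeas_app3[OF Ext.IH(1)[OF Ext.prems, of e'] Ext.IH(2)[of "l - 1" k'] Ext.IH(3)[OF Ext.prems, of p'],
          where c = "\<lambda>x y z. x \<and> y \<and> b = b' \<and> j = j' \<and> z"] by simp
  qed (simp add: cmeas_const)
qed

lemma tok_ev: "tok (ev x l t) = tk x l (tok t)"
  by (induction t) auto

lemma parts_ev: "parts (ev x l t) = map (ev x l) (parts t)"
  by (induction t) auto

lemma topj_ev: "topj (ev x l t) = topj t"
  by (cases t) auto

lemma idx_map: "idx (map f P) c = length (takeWhile Not (map (\<lambda>t. c = f t) P))"
  unfolding idx_def by (induction P) auto

lemma cmeas_view:
  assumes "enat (Suc l) < n"
  shows "cmeas BM (\<lambda>x. view (map (ev x l) P) (ev x (Suc l) t))"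
proof (induction t)
  case (Base k q)
  have "cmeas BM (\<lambda>x. VB q (map (\<lambda>p. hmem (tk x l (tok p)) (tk x (Suc l) k)) P))"
    by (intro cmeas_app1[where c = "VB q"] cmeas_map cmeas_hmem assms)
  then show ?case by (simp add: tok_ev o_def)
next
  case (Ext e k b j p)
  have l: "enat l < n" using enat_Suc_lessD[OF assms] .
  have "cmeas BM (\<lambda>x. map (\<lambda>t. ev x l k = ev x l t) P)" by (intro cmeas_map cmeas_ev_eq l)
  from cmeas_app3[OF this Ext.IH(1) Ext.IH(3), where c = "\<lambda>bl v u. if True \<in> set bl then VE v (length (takeWhile Not bl)) b j u else v"]
  show ?case by (simp add: idx_map image_iff cong: if_cong)
qed

lemma cmeas_keybit:
  assumes "enat (Suc l) < n"
  shows "cmeas BM (\<lambda>x. keybit (ev x (Suc l) t) (ev x l w))"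
proof (induction t)
  case (Base k q)
  show ?case by (simp add: cmeas_const)
next
  case (Ext e k b j p)
  from cmeas_app2[OF cmeas_ev_eq[OF enat_Suc_lessD[OF assms], of w k] Ext.IH(1), where c = "\<lambda>y v. if y then Some b else v"]
  show ?case by simp
qed

lemma pred_bit:
  assumes "enat (Suc l) < n"
  shows "Measurable.pred BM (\<lambda>x. bit (ev x l w) (ev x (Suc l) t))"
proof -
  have "cmeas BM (\<lambda>x. bit (ev x l w) (ev x (Suc l) t))"
    unfolding bit_def parts_ev topj_ev
    by (rule cmeas_app2[OF cmeas_keybit[OF assms] cmeas_view[OF assms], where c = "\<lambda>y v. case y of Some b \<Rightarrow> b | None \<Rightarrow> v \<in> tab (topj w)"])
  then show ?thesis using cmeas_pred[of BM _ "\<lambda>b. b"] by blast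
qed

lemma cmeas_trunc: "cmeas BM (\<lambda>x. trunc m (ev x 0 t))"
proof (induction t)
  case (Base k q)
  have "cmeas BM (\<lambda>x. Base (map (\<lambda>i. x 0 k i) [0..<m]) q)"
    by (intro cmeas_app1[where c = "\<lambda>bl. Base bl q"] cmeas_map cmeas_bool pred_coord)
  then show ?case by (simp add: trunc_def)
next
  case (Ext e k b j p)
  from cmeas_app3[OF Ext.IH, where c = "\<lambda>e k p. Ext e k b j p"] show ?case by (simp add: trunc_def)
qed

lemma pred_rl: "Measurable.pred BM (\<lambda>x. rl G (ev x 0 t) m)"
  unfolding rl_def topj_ev
  using cmeas_pred[OF cmeas_trunc[of m t], of "\<lambda>u. if m < length (pref (topj t)) then pref (topj t) ! m else G (u, m)"] .

end

lemma hred_measurable: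
  assumes n: "1 \<le> n" and inj: "\<And>w w'. w \<in> urt \<Longrightarrow> w' \<in> urt \<Longrightarrow> rl G w = rl G w' \<Longrightarrow> w = w'"
  shows "hred n G \<in> borel_of (Xtop n) \<rightarrow>\<^sub>M borel_of (Xtop n)"
proof (rule measurable_into_Xtop)
  show "hred n G \<in> space (borel_of (Xtop n)) \<rightarrow> Xsp n" using El_enum_Xsp[OF hred_enum[OF n] inj] by blast
  fix l k m
  show "Measurable.pred (borel_of (Xtop n)) (\<lambda>x. hred n G x l k m)"
  proof (cases "enat l < n")
    case True
    then show ?thesis using pred_bit pred_rl unfolding hred_def by (cases l) auto
  qed (simp add: hred_def)
qed

section \<open>The joint structure of two points\<close>

text \<open>The level of the first difference, and whether: the second side has private tokens there; there are
  common tokens there; some trace on the common tokens is realised on both sides, only on the first side,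
  only on the second side.\<close>

type_synonym jtype = "nat \<times> bool \<times> bool \<times> bool \<times> bool \<times> bool"

text \<open>The first level with private objects of side \<open>s\<close>. If the second point has
  no private tokens on level \<open>i\<close>, all its trees there are common and its trees on level
  \<open>i + 1\<close> are determined by their traces. Its private part then begins on level
  \<open>i + 1\<close> if some trace is private (\<open>bY\<close>), and otherwise on level
  \<open>i + 2\<close>.\<close>

fun jlam :: "jtype \<Rightarrow> bool \<Rightarrow> nat" where
  "jlam (i, bW, bU, bC, bX, bY) s = (if s \<or> bW then i else if bY then i + 1 else i + 2)"

fun javk :: "enat \<Rightarrow> jtype \<Rightarrow> kd \<Rightarrow> bool" where
  "javk n (i, bW, bU, bC, bX, bY) (KC l) = (enat l < n \<and> (l < i \<or> (l = i \<and> bU) \<or> (l = i + 1 \<and> bC)))"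
| "javk n (i, bW, bU, bC, bX, bY) (KP s) = (enat (jlam (i, bW, bU, bC, bX, bY) s) < n)"
| "javk n (i, bW, bU, bC, bX, bY) (KT s) = (enat (jlam (i, bW, bU, bC, bX, bY) s + 1) < n \<and>
     (if s then bX else bW \<longrightarrow> bY))"
| "javk n (i, bW, bU, bC, bX, bY) (KH s l) = (jlam (i, bW, bU, bC, bX, bY) s + 2 \<le> l \<and> enat l < n)"

definition jpk :: "jtype \<Rightarrow> bool \<Rightarrow> kd \<Rightarrow> bool" where
  "jpk \<tau> s k \<longleftrightarrow> k = KC (jlam \<tau> s + 1) \<or> k = KT s"

fun jav :: "enat \<Rightarrow> jtype \<Rightarrow> ix \<Rightarrow> bool" where
  "jav n \<tau> (I k a) = javk n \<tau> k"
| "jav n \<tau> (J s k a b) = (javk n \<tau> k \<and> enat (jlam \<tau> s + 1) < n \<and> jpk \<tau> s k)"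

text \<open>The pairs of indices between which a free bit is stored. An object \<open>J\<close> has
  free bits towards the private objects below it and towards the level above; its bits towards the
  common part are those of its trace.\<close>

fun jadj :: "jtype \<Rightarrow> ix \<Rightarrow> ix \<Rightarrow> bool" where
  "jadj \<tau> (I (KC l) a) (I (KC l') b) = (l' = l + 1)"
| "jadj \<tau> (I (KC l) a) (I (KP s) b) = (l + 1 = jlam \<tau> s)"
| "jadj \<tau> (I (KC l) a) (I (KT s) b) = (l = jlam \<tau> s)"
| "jadj \<tau> (I (KP s) a) (J s' k b c) = (s = s')"
| "jadj \<tau> (J s k b c) (I (KH s' l) a) = (s = s' \<and> l = jlam \<tau> s + 2)"
| "jadj \<tau> (I (KH s l) a) (I (KH s' l') b) = (s = s' \<and> l' = l + 1 \<and> jlam \<tau> s + 2 \<le> l)"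
| "jadj \<tau> \<alpha> \<beta> = False"

fun jreal :: "jtype \<Rightarrow> ix \<Rightarrow> bool" where
  "jreal \<tau> (I (KC l) a) = (l = 0)"
| "jreal \<tau> (I (KP s) a) = (jlam \<tau> s = 0)"
| "jreal \<tau> \<alpha> = False"

fun grp :: "ix \<Rightarrow> kd + bool" where
  "grp (I k a) = Inl k"
| "grp (J s k a b) = Inr s"

fun par :: "ix \<Rightarrow> ix set" where
  "par (I k a) = {}"
| "par (J s k a b) = {I k a}"

text \<open>The points are ordered so that the first has a private token on level \<open>i\<close>;
  the final argument exchanges them where this requires it.\<close>

locale pairJ =
  fixes n :: enat and x y :: pt and i :: nat
  assumes iN: "enat i < n"
    and low: "\<And>l. l < i \<Longrightarrow> tks x l = tks y l"
    and V: "\<not> tks x i \<subseteq> tks y i"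
begin

definition EL :: "bool \<Rightarrow> nat \<Rightarrow> hc el set" where
  "EL s l = El (tks (if s then x else y)) l"

definition U :: "hc el set" where
  "U = EL True i \<inter> EL False i"

definition agree :: "hc \<Rightarrow> hc \<Rightarrow> bool" where
  "agree b c \<longleftrightarrow> (\<forall>a\<in>tks x i \<inter> tks y i. hmem a b = hmem a c)"

definition ty :: jtype where
  "ty = (i, \<not> tks y i \<subseteq> tks x i, tks x i \<inter> tks y i \<noteq> {},
     \<exists>b\<in>tks x (i + 1). \<exists>c\<in>tks y (i + 1). agree b c,
     \<exists>b\<in>tks x (i + 1). \<forall>c\<in>tks y (i + 1). \<not> agree b c,
     \<exists>c\<in>tks y (i + 1). \<forall>b\<in>tks x (i + 1). \<not> agree b c)"

abbreviation "lam \<equiv> jlam ty"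

lemma lam_True [simp]: "lam True = i"
  by (simp add: ty_def)

lemma EL_ne: "\<exists>e. e \<in> EL s l"
  using tks_ne[of "if s then x else y" l] unfolding EL_def by (metis El_Base ex_in_conv)

lemma EL_Base: "Base a q \<in> EL s l \<longleftrightarrow> a \<in> tks (if s then x else y) l"
  by (simp add: EL_def)

lemma EL_Ext: "Ext e k b j p \<in> EL s l \<longleftrightarrow> e \<in> EL s l \<and> k \<in> EL s (l - 1) \<and> p \<in> EL s l"
  by (simp add: EL_def)

lemma EL_low: "l < i \<Longrightarrow> EL s l = EL s' l"
  unfolding EL_def by (cases s; cases s') (auto intro!: El_cong low[symmetric] low)

lemma EL_sep:
  assumes "e \<in> EL s (Suc l)" "f \<in> EL s' (Suc l)" "e \<noteq> f" "l < i \<or> s = s'"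
  shows "\<exists>P. set P \<subseteq> EL s l \<and> view P e \<noteq> view P f"
proof -
  let ?u = "if s then x else y" and ?v = "if s' then x else y"
  have "tks ?u l = tks ?v l" using assms(4) low by auto
  moreover have "El (tks ?u) l = El (tks ?v) l" using assms(4) EL_low[of l s s'] unfolding EL_def by auto
  ultimately show ?thesis using El_separated[of e ?u l f ?v] assms unfolding EL_def by blast
qed

lemma EL_bld: "bld Ks Ps e0 e \<Longrightarrow> e0 \<in> EL s l \<Longrightarrow> Ks \<subseteq> EL s (l - 1) \<Longrightarrow> Ps \<subseteq> EL s l \<Longrightarrow> e \<in> EL s l"
  unfolding EL_def by (rule El_bld)

lemma EL_parts: "e \<in> EL s l \<Longrightarrow> set (parts e) \<subseteq> EL s l"
  unfolding EL_def by (rule El_parts)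

lemma EL_tok: "e \<in> EL s l \<Longrightarrow> tok e \<in> tks (if s then x else y) l"
  unfolding EL_def by (rule El_tok)

lemma U_parts: "u \<in> U \<Longrightarrow> set (parts u) \<subseteq> U"
  unfolding U_def using EL_parts by blast

lemma U_Base: "Base a q \<in> U \<longleftrightarrow> a \<in> tks x i \<inter> tks y i"
  by (simp add: U_def EL_Base)

lemma U_ExtD: "Ext e k b j p \<in> U \<Longrightarrow> e \<in> U \<and> p \<in> U"
  by (simp add: U_def EL_Ext)

lemma U_empty: "U = {} \<longleftrightarrow> tks x i \<inter> tks y i = {}"
proof
  assume "U = {}" then show "tks x i \<inter> tks y i = {}" using U_Base by blast
next
  assume e: "tks x i \<inter> tks y i = {}"
  have "u \<notin> U" for u using EL_tok[of u True i] EL_tok[of u False i] e unfolding U_def by auto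
  then show "U = {}" by blast
qed

lemma tok_U: "tok ` U = tks x i \<inter> tks y i"
proof
  show "tok ` U \<subseteq> tks x i \<inter> tks y i" using EL_tok[of _ True i] EL_tok[of _ False i] unfolding U_def by auto
  show "tks x i \<inter> tks y i \<subseteq> tok ` U" using U_Base[of _ 0] by (metis image_eqI subsetI tok.simps(1))
qed

lemma labeq_U_Base: "labeq U (Base b q) (Base c q') \<longleftrightarrow> q = q' \<and> agree b c"
proof -
  have "(\<forall>p\<in>U. hmem (tok p) b = hmem (tok p) c) \<longleftrightarrow> (\<forall>a\<in>tok ` U. hmem a b = hmem a c)" by auto
  then show ?thesis unfolding labeq_Base agree_def tok_U by simp
qed

section \<open>Common and private parts of the two sides\<close>

definition Kc :: "hc el set" where
  "Kc = {e \<in> EL False (i + 1). \<exists>f\<in>EL True (i + 1). labeq U e f}"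

text \<open>What the sides share on level \<open>lam s\<close>. If the second side becomes private
  on level \<open>i + 1\<close>, its trees with a common trace count as shared; if on level
  \<open>i + 2\<close>, nothing there is shared.\<close>

definition Cm :: "bool \<Rightarrow> hc el set" where
  "Cm s = (if lam s = i then U else if lam s = i + 1 then Kc else {})"

definition TT :: "bool \<Rightarrow> hc el set" where
  "TT s = {e \<in> EL s (lam s + 1). lam s = i \<longrightarrow> \<not> (\<exists>f\<in>EL (\<not> s) (i + 1). labeq U e f)}"

definition rep :: "hc el set \<Rightarrow> hc el set \<Rightarrow> hc el \<Rightarrow> hc el" where
  "rep A C e = (SOME e'. e' \<in> A \<and> labeq C e e')"

text \<open>Where indices stand for traces, each trace class is represented by one chosen tree, so
  that \<open>KC (i + 1)\<close> and \<open>KT s\<close> can be enumerated and given bits like all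
  other kinds.\<close>

fun Ob :: "kd \<Rightarrow> hc el set" where
  "Ob (KC l) = (if \<not> enat l < n then {} else if l < i then EL True l else if l = i then U
      else if l = i + 1 then rep (EL False (i + 1)) U ` Kc else {})"
| "Ob (KP s) = (if enat (lam s) < n then EL s (lam s) - Cm s else {})"
| "Ob (KT s) = (if enat (lam s + 1) < n then rep (EL s (lam s + 1)) (Cm s) ` TT s else {})"
| "Ob (KH s l) = (if lam s + 2 \<le> l \<and> enat l < n then EL s l else {})"

lemma rep_props: "e \<in> A \<Longrightarrow> rep A C e \<in> A \<and> labeq C e (rep A C e)"
  unfolding rep_def by (rule someI[of _ e]) simp

lemma rep_eq: "labeq C e e' \<Longrightarrow> rep A C e = rep A C e'"
proof -
  assume "labeq C e e'"
  then have "(\<lambda>f. f \<in> A \<and> labeq C e f) = (\<lambda>f. f \<in> A \<and> labeq C e' f)" using labeq_sym labeq_trans by blast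
  then show ?thesis unfolding rep_def by simp
qed

lemma rep_inj: "e \<in> A \<Longrightarrow> e' \<in> A \<Longrightarrow> labeq C (rep A C e) (rep A C e') \<Longrightarrow> rep A C e = rep A C e'"
  using rep_props[of e A C] rep_props[of e' A C] rep_eq labeq_trans labeq_sym by metis

lemma Kc_EL: "Kc \<subseteq> EL False (i + 1)"
  unfolding Kc_def by blast

lemma Kc_labeq: "e \<in> Kc \<Longrightarrow> labeq U e f \<Longrightarrow> f \<in> EL False (i + 1) \<Longrightarrow> f \<in> Kc"
  unfolding Kc_def using labeq_sym labeq_trans by blast

lemma lam_cases: "lam s = i \<or> (\<not> s \<and> tks y i \<subseteq> tks x i \<and> (lam s = i + 1 \<or> lam s = i + 2))"
  by (auto simp: ty_def)

lemma onesided: "lam s \<noteq> i \<Longrightarrow> s = False \<and> tks y i \<subseteq> tks x i \<and> U = EL False i"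
proof -
  assume "lam s \<noteq> i"
  then have 1: "\<not> s" "tks y i \<subseteq> tks x i" using lam_cases[of s] by auto
  have "wfe (tks y) l e \<Longrightarrow> wfe (tks x) l e" if "l \<le> i" for l e
    using that
  proof (induction e arbitrary: l)
    case (Base a q)
    then show ?case using low[of l] 1 by (cases "l = i") auto
  qed auto
  then have "EL False i \<subseteq> EL True i" unfolding EL_def El_def by auto
  then show ?thesis using 1 unfolding U_def by auto
qed

text \<open>In the one-sided case \<open>U\<close> is all of level \<open>i\<close> of the second
  side, so traces on \<open>U\<close> separate its trees one level higher.\<close>

lemma labeq_U_inj:
  assumes "lam False \<noteq> i" "e \<in> EL False (i + 1)" "f \<in> EL False (i + 1)" "labeq U e f"
  shows "e = f"
proof (rule ccontr)
  assume "e \<noteq> f"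
  then obtain P where "set P \<subseteq> EL False i" "view P e \<noteq> view P f" using EL_sep[of e False i f False] assms(2,3) by auto
  then show False using assms(4) onesided[OF assms(1)] unfolding labeq_def by auto
qed

lemma rep_Kc_onesided: "lam False \<noteq> i \<Longrightarrow> rep (EL False (i + 1)) U ` Kc = Kc"
proof -
  assume l: "lam False \<noteq> i"
  have "rep (EL False (i + 1)) U e = e" if "e \<in> Kc" for e
    using labeq_U_inj[OF l, of e] rep_props[of e "EL False (i + 1)" U] that Kc_EL by (metis subsetD)
  then show ?thesis by simp
qed

lemma Kc_Ext:
  assumes "e \<in> Kc" "p \<in> Kc" "k \<in> U" shows "Ext e k b j p \<in> Kc"
proof -
  obtain e' p' where p: "e' \<in> EL True (i + 1)" "labeq U e e'" "p' \<in> EL True (i + 1)" "labeq U p p'"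
    using assms unfolding Kc_def by blast
  have "Ext e' k b j p' \<in> EL True (i + 1)" using p assms(3) by (simp add: EL_Ext U_def)
  moreover have "Ext e k b j p \<in> EL False (i + 1)" using assms Kc_EL by (auto simp: EL_Ext U_def)
  ultimately show ?thesis unfolding Kc_def using labeq_Ext_cong[OF p(2,4)] by blast
qed

lemma Kc_bld: "bld Ks Ps e0 e \<Longrightarrow> e0 \<in> Kc \<Longrightarrow> Ks \<subseteq> U \<Longrightarrow> Ps \<subseteq> Kc \<Longrightarrow> e \<in> Kc"
  by (induction rule: bld.induct) (auto intro: Kc_Ext)

lemma Kc_ExtD: 
  assumes "Ext e k b j p \<in> Kc" "k \<in> U" shows "e \<in> Kc \<and> p \<in> Kc"
proof -
  obtain f where f: "f \<in> EL True (i + 1)" "labeq U (Ext e k b j p) f" using assms unfolding Kc_def by blast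
  obtain f' p' where "f' \<in> EL True (i + 1)" "p' \<in> EL True (i + 1)" "labeq U e f'" "labeq U p p'"
    using labeq_Ext_strip[OF f(2) assms(2), of "\<lambda>g. g \<in> EL True (i + 1)"] f(1) EL_Ext by blast
  moreover have "e \<in> EL False (i + 1)" "p \<in> EL False (i + 1)" using assms(1) Kc_EL EL_Ext by blast+
  ultimately show ?thesis unfolding Kc_def by blast
qed

lemma Kc_parts:
  assumes "lam False \<noteq> i" "e \<in> Kc" shows "set (parts e) \<subseteq> Kc"
  using assms(2)
proof (induction e)
  case (Ext e k b j p)
  have "Ext e k b j p \<in> EL False (i + 1)" using Ext.prems Kc_EL by blast
  then have "k \<in> EL False i" by (simp add: EL_Ext)
  then have "k \<in> U" using onesided[OF assms(1)] by simp
  then show ?case using Kc_ExtD[OF Ext.prems] Ext.IH(1) by auto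
qed simp

lemma Cm_sub: "Cm s \<subseteq> EL s (lam s)"
proof (cases "lam s = i")
  case True then show ?thesis unfolding Cm_def U_def by (cases s) auto
next
  case False then show ?thesis using onesided[OF False] Kc_EL unfolding Cm_def by auto
qed

lemma Cm_parts: "u \<in> Cm s \<Longrightarrow> set (parts u) \<subseteq> Cm s"
  using U_parts[of u] Kc_parts[of u] onesided[of s] unfolding Cm_def by (auto split: if_splits)

lemma Cm_ExtD: 
  assumes a: "Ext e k b j p \<in> Cm s" shows "e \<in> Cm s"
proof (cases "lam s = i")
  case True
  then have "Ext e k b j p \<in> U" using a by (simp add: Cm_def)
  then have "e \<in> U" using U_ExtD by blast
  then show ?thesis using True by (simp add: Cm_def)
next
  case False
  then have o: "s = False" "U = EL False i" using onesided by auto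
  have "Cm s = (if lam s = i + 1 then Kc else {})" using False by (simp add: Cm_def)
  then have K: "Ext e k b j p \<in> Kc" "Cm s = Kc" using a by (auto split: if_splits)
  then have "Ext e k b j p \<in> EL False (i + 1)" using Kc_EL by blast
  then have "k \<in> U" using o by (simp add: EL_Ext)
  then show ?thesis using Kc_ExtD[OF K(1)] K(2) by simp
qed

lemma Ob_KC_Cm: "enat (lam s) < n \<Longrightarrow> Ob (KC (lam s)) = Cm s"
proof -
  assume n: "enat (lam s) < n"
  show ?thesis
  proof (cases "lam s = i")
    case True then show ?thesis using n by (simp add: Cm_def)
  next
    case False
    then have s: "s = False" using onesided by blast
    have "lam s = i + 1 \<or> lam s = i + 2" using lam_cases[of s] False by blast
    then show ?thesis
    proof
      assume l: "lam s = i + 1"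
      then have "Ob (KC (lam s)) = rep (EL False (i + 1)) U ` Kc" using n by simp
      also have "\<dots> = Kc" by (rule rep_Kc_onesided) (use False s in simp)
      finally show ?thesis using l by (simp add: Cm_def)
    next
      assume l: "lam s = i + 2"
      then show ?thesis using n by (simp add: Cm_def)
    qed
  qed
qed

text \<open>What \<open>jlam\<close> is designed for: each of its three cases provides a tree
  outside the common part. Such trees serve as the hidden keys later on.\<close>

lemma private_ne: "EL s (lam s) - Cm s \<noteq> {}"
proof (cases "lam s = i")
  case True
  have "\<exists>a. a \<in> tks (if s then x else y) i \<and> a \<notin> tks x i \<inter> tks y i"
    using V True by (cases s) (auto simp: ty_def split: if_splits)
  then obtain a where a: "a \<in> tks (if s then x else y) i" "a \<notin> tks x i \<inter> tks y i" by blast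
  then have "Base a 0 \<in> EL s i - U" using U_Base EL_Base by blast
  then show ?thesis unfolding Cm_def using True by auto
next
  case F: False
  then have s: "s = False" using onesided by auto
  show ?thesis
  proof (cases "lam s = i + 1")
    case True
    then obtain c where c: "c \<in> tks y (i + 1)" "\<forall>b\<in>tks x (i + 1). \<not> agree b c" using s F by (auto simp: ty_def split: if_splits)
    have "Base c 0 \<notin> Kc"
    proof
      assume "Base c 0 \<in> Kc"
      then obtain f where f: "f \<in> EL True (i + 1)" "labeq U (Base c 0) f" unfolding Kc_def by blast
      then obtain b where "Base b 0 \<in> EL True (i + 1)" "\<forall>p\<in>U. hmem (tok p) c = hmem (tok p) b"
        using labeq_Base_strip[OF f(2), of "\<lambda>g. g \<in> EL True (i + 1)"] EL_Ext by blast
      then have "b \<in> tks x (i + 1)" "agree b c" unfolding agree_def tok_U[symmetric] EL_Base by auto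
      then show False using c by blast
    qed
    moreover have "Base c 0 \<in> EL s (lam s)" using c True s by (simp add: EL_Base)
    ultimately show ?thesis unfolding Cm_def using True by auto
  next
    case False
    then show ?thesis unfolding Cm_def using F EL_ne by auto
  qed
qed

text \<open>The partner has the base token exchanged for an agreeing one; layers keyed in
  \<open>U\<close> are copied, and all others are dropped because they are invisible from
  \<open>U\<close>.\<close>

lemma partnered:
  assumes "e \<in> EL s (i + 1)" and "\<And>b. b \<in> tks (if s then x else y) (i + 1) \<Longrightarrow> \<exists>c\<in>tks (if s then y else x) (i + 1). agree b c"
  shows "\<exists>f\<in>EL (\<not> s) (i + 1). labeq U e f"
  using assms(1)
proof (induction e)
  case (Base b q)
  then obtain c where "c \<in> tks (if s then y else x) (i + 1)" "agree b c" using assms(2) EL_Base by blast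
  then have "Base c q \<in> EL (\<not> s) (i + 1)" "labeq U (Base b q) (Base c q)" using labeq_U_Base by (auto simp: EL_Base)
  then show ?case by blast
next
  case (Ext e k b j p)
  then obtain e' p' where p: "e' \<in> EL (\<not> s) (i + 1)" "labeq U e e'" "p' \<in> EL (\<not> s) (i + 1)" "labeq U p p'"
    using EL_Ext by blast
  show ?case
  proof (cases "k \<in> U")
    case True
    then have "Ext e' k b j p' \<in> EL (\<not> s) (i + 1)" using p by (cases s) (auto simp: EL_Ext U_def)
    then show ?thesis using labeq_Ext_cong[OF p(2,4)] by blast
  next
    case False
    then show ?thesis using labeq_Ext_hidden labeq_trans p by blast
  qed
qed

lemma agree_sym: "agree b c \<longleftrightarrow> agree c b"
  unfolding agree_def by auto

lemma unpartnered_tok: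
  assumes "b \<in> tks (if s then x else y) (i + 1)" "\<And>c. c \<in> tks (if s then y else x) (i + 1) \<Longrightarrow> \<not> agree b c"
  shows "\<not> (\<exists>f\<in>EL (\<not> s) (i + 1). labeq U (Base b q) f)"
proof
  assume "\<exists>f\<in>EL (\<not> s) (i + 1). labeq U (Base b q) f"
  then obtain f where f: "f \<in> EL (\<not> s) (i + 1)" "labeq U (Base b q) f" by blast
  then obtain c where "Base c q \<in> EL (\<not> s) (i + 1)" "\<forall>p\<in>U. hmem (tok p) b = hmem (tok p) c"
    using labeq_Base_strip[OF f(2), of "\<lambda>g. g \<in> EL (\<not> s) (i + 1)"] EL_Ext by blast
  then have "c \<in> tks (if s then y else x) (i + 1)" "agree b c" unfolding agree_def tok_U[symmetric] EL_Base by (cases s; auto)+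
  then show False using assms(2) by blast
qed

lemma Kc_ne: "Kc \<noteq> {} \<longleftrightarrow> (\<exists>b\<in>tks x (i + 1). \<exists>c\<in>tks y (i + 1). agree b c)"
proof
  assume "\<exists>b\<in>tks x (i + 1). \<exists>c\<in>tks y (i + 1). agree b c"
  then obtain b c where bc: "b \<in> tks x (i + 1)" "c \<in> tks y (i + 1)" "agree b c" by blast
  then have "Base c 0 \<in> EL False (i + 1)" "Base b 0 \<in> EL True (i + 1)" "labeq U (Base c 0) (Base b 0)"
    using labeq_U_Base agree_sym EL_Base by auto
  then have "Base c 0 \<in> Kc" unfolding Kc_def by blast
  then show "Kc \<noteq> {}" by blast
next
  assume "Kc \<noteq> {}"
  then obtain e f where ef: "e \<in> EL False (i + 1)" "f \<in> EL True (i + 1)" "labeq U e f" unfolding Kc_def by blast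
  from ef(1,3) ef(2) show "\<exists>b\<in>tks x (i + 1). \<exists>c\<in>tks y (i + 1). agree b c"
  proof (induction e arbitrary: f)
    case (Base c q)
    then show ?case using unpartnered_tok[of c False q] agree_sym by (auto simp: EL_Base)
  next
    case (Ext e k b j p)
    show ?case
    proof (cases "k \<in> U")
      case True
      then obtain f' where "f' \<in> EL True (i + 1)" "labeq U e f'"
        using labeq_Ext_strip[OF Ext.prems(2) True, of "\<lambda>g. g \<in> EL True (i + 1)"] Ext.prems(3) EL_Ext by blast
      then show ?thesis using Ext.IH(1) Ext.prems(1) EL_Ext by blast
    next
      case False
      then have "labeq U e f" using labeq_Ext_hidden labeq_trans labeq_sym Ext.prems(2) by blast
      then show ?thesis using Ext.IH(1) Ext.prems(1,3) EL_Ext by blast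
    qed
  qed
qed

lemma TT_ne: "TT s \<noteq> {} \<longleftrightarrow> (lam s = i \<longrightarrow> (\<exists>b\<in>tks (if s then x else y) (i + 1). \<forall>c\<in>tks (if s then y else x) (i + 1). \<not> agree b c))"
proof (cases "lam s = i")
  case True
  show ?thesis
  proof
    assume "TT s \<noteq> {}"
    then obtain e where "e \<in> EL s (i + 1)" "\<not> (\<exists>f\<in>EL (\<not> s) (i + 1). labeq U e f)" unfolding TT_def using True by auto
    then show "lam s = i \<longrightarrow> (\<exists>b\<in>tks (if s then x else y) (i + 1). \<forall>c\<in>tks (if s then y else x) (i + 1). \<not> agree b c)"
      using partnered[of e s] by blast
  next
    assume "lam s = i \<longrightarrow> (\<exists>b\<in>tks (if s then x else y) (i + 1). \<forall>c\<in>tks (if s then y else x) (i + 1). \<not> agree b c)"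
    then obtain b where b: "b \<in> tks (if s then x else y) (i + 1)" "\<forall>c\<in>tks (if s then y else x) (i + 1). \<not> agree b c" using True by blast
    then have "Base b 0 \<in> TT s" unfolding TT_def using unpartnered_tok[of b s 0] True by (auto simp: EL_Base)
    then show "TT s \<noteq> {}" by blast
  qed
next
  case False
  then show ?thesis unfolding TT_def using EL_ne by auto
qed

lemma javk_ty:
  "javk n ty (KC l) \<longleftrightarrow> enat l < n \<and> (l < i \<or> (l = i \<and> tks x i \<inter> tks y i \<noteq> {}) \<or>
     (l = i + 1 \<and> (\<exists>b\<in>tks x (i + 1). \<exists>c\<in>tks y (i + 1). agree b c)))"
  "javk n ty (KP s) \<longleftrightarrow> enat (lam s) < n"
  "javk n ty (KT s) \<longleftrightarrow> enat (lam s + 1) < n \<and> (if s then (\<exists>b\<in>tks x (i + 1). \<forall>c\<in>tks y (i + 1). \<not> agree b c)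
     else \<not> tks y i \<subseteq> tks x i \<longrightarrow> (\<exists>c\<in>tks y (i + 1). \<forall>b\<in>tks x (i + 1). \<not> agree b c))"
  "javk n ty (KH s l) \<longleftrightarrow> lam s + 2 \<le> l \<and> enat l < n"
  unfolding ty_def javk.simps by (rule refl)+

lemma lam_eq_i: "lam s = i \<longleftrightarrow> s \<or> \<not> tks y i \<subseteq> tks x i"
  by (auto simp: ty_def)

text \<open>The type decides which kinds of indices have objects at all. Hence the space of
  meaningful coordinates depends on the type alone.\<close>

lemma Ob_avail: "Ob k \<noteq> {} \<longleftrightarrow> javk n ty k"
proof (cases k)
  case (KC l)
  show ?thesis
  proof (cases "l < i \<or> l > i + 1")
    case True then show ?thesis unfolding KC javk_ty using EL_ne[of True l] by auto
  next
    case False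
    then have "l = i \<or> l = i + 1" by auto
    then show ?thesis unfolding KC javk_ty using U_empty Kc_ne by auto
  qed
next
  case (KP s)
  then show ?thesis using private_ne[of s] unfolding KP javk_ty by simp
next
  case (KT s)
  have "(lam s = i \<longrightarrow> (\<exists>b\<in>tks (if s then x else y) (i + 1). \<forall>c\<in>tks (if s then y else x) (i + 1). \<not> agree b c)) \<longleftrightarrow>
    (if s then (\<exists>b\<in>tks x (i + 1). \<forall>c\<in>tks y (i + 1). \<not> agree b c) else \<not> tks y i \<subseteq> tks x i \<longrightarrow> (\<exists>c\<in>tks y (i + 1). \<forall>b\<in>tks x (i + 1). \<not> agree b c))"
    unfolding lam_eq_i using agree_sym by (cases s) auto
  note eq = this
  have o: "(Ob (KT s) \<noteq> {}) = (enat (lam s + 1) < n \<and> TT s \<noteq> {})" by auto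
  show ?thesis unfolding KT o TT_ne eq javk_ty by (rule refl)
next
  case (KH s l)
  then show ?thesis using EL_ne[of s l] unfolding KH javk_ty Ob.simps by auto
qed

end

text \<open>Assignments are injective within a group, so the value of a lower neighbour identifies
  its index; the bits demanded of a new object are then unambiguous.\<close>

lemma jadj_low_grp: "jadj \<tau> \<beta> \<alpha> \<Longrightarrow> jadj \<tau> \<beta>' \<alpha> \<Longrightarrow> grp \<beta> = grp \<beta>'"
proof (cases \<alpha>)
  case (J s k a b)
  assume "jadj \<tau> \<beta> \<alpha>" "jadj \<tau> \<beta>' \<alpha>"
  then show ?thesis unfolding J by (elim jadj.elims) auto
next
  case (I k a)
  assume "jadj \<tau> \<beta> \<alpha>" "jadj \<tau> \<beta>' \<alpha>"
  then show ?thesis unfolding I by (elim jadj.elims; cases k) auto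
qed

lemma labeqD: "labeq C e f \<Longrightarrow> set P \<subseteq> C \<Longrightarrow> view P e = view P f"
  by (simp add: labeq_def)

section \<open>Finite partial enumerations and the steps of the back-and-forth\<close>

context pairJ
begin

fun okx :: "(ix \<Rightarrow> hc el option) \<Rightarrow> ix \<Rightarrow> hc el \<Rightarrow> bool" where
  "okx e (I k a) w = (w \<in> Ob k)"
| "okx e (J s k a b) w = (w \<in> EL s (lam s + 1) \<and> enat (lam s + 1) < n \<and> jpk ty s k \<and>
     (\<exists>po. e (I k a) = Some po \<and> po \<in> Ob k \<and> labeq (Cm s) po w))"

text \<open>Injectivity is demanded within a group: one tree may occur both as the representative of
  its trace and as an object \<open>J\<close> with that trace, and the two occurrences carry
  different coordinates.\<close>

definition adm :: "(ix \<Rightarrow> hc el option) \<Rightarrow> bool" where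
  "adm e \<longleftrightarrow> finite (dom e) \<and> (\<forall>\<alpha> w. e \<alpha> = Some w \<longrightarrow> okx e \<alpha> w) \<and>
    (\<forall>\<alpha> \<beta> w. e \<alpha> = Some w \<longrightarrow> e \<beta> = Some w \<longrightarrow> grp \<alpha> = grp \<beta> \<longrightarrow> \<alpha> = \<beta>)"

lemma okx_mono: "okx e \<alpha> w \<Longrightarrow> e \<subseteq>\<^sub>m e' \<Longrightarrow> okx e' \<alpha> w"
  by (cases \<alpha>) (auto simp: map_le_def dom_def)

lemma adm_okx: "adm e \<Longrightarrow> e \<alpha> = Some w \<Longrightarrow> okx e \<alpha> w"
  unfolding adm_def by blast

lemma adm_inj: "adm e \<Longrightarrow> e \<alpha> = Some w \<Longrightarrow> e \<beta> = Some w \<Longrightarrow> grp \<alpha> = grp \<beta> \<Longrightarrow> \<alpha> = \<beta>"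
  unfolding adm_def by blast

lemma adm_jav: "adm e \<Longrightarrow> e \<alpha> = Some w \<Longrightarrow> jav n ty \<alpha>"
  using adm_okx[of e \<alpha> w] Ob_avail by (cases \<alpha>) auto

lemma adm_empty: "adm Map.empty"
  by (simp add: adm_def)

lemma adm_update:
  assumes e: "adm e" and a: "e \<alpha> = None" and w: "okx e \<alpha> w" and fr: "\<And>\<beta>. e \<beta> = Some w \<Longrightarrow> grp \<beta> \<noteq> grp \<alpha>"
  shows "adm (e(\<alpha> \<mapsto> w))"
proof -
  have le: "e \<subseteq>\<^sub>m e(\<alpha> \<mapsto> w)" using a by (auto simp: map_le_def)
  have "finite (dom (e(\<alpha> \<mapsto> w)))" using e unfolding adm_def by simp
  moreover have "okx (e(\<alpha> \<mapsto> w)) \<beta> v" if "(e(\<alpha> \<mapsto> w)) \<beta> = Some v" for \<beta> v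
    using okx_mono[OF _ le] w adm_okx[OF e] that by (cases "\<beta> = \<alpha>") auto
  moreover have "\<beta> = \<gamma>" if "(e(\<alpha> \<mapsto> w)) \<beta> = Some v" "(e(\<alpha> \<mapsto> w)) \<gamma> = Some v" "grp \<beta> = grp \<gamma>" for \<beta> \<gamma> v
    using that fr adm_inj[OF e, of \<beta> v \<gamma>] by (cases "\<beta> = \<alpha>"; cases "\<gamma> = \<alpha>") auto
  ultimately show ?thesis unfolding adm_def by blast
qed

definition fits :: "(bool list el \<times> nat \<Rightarrow> bool) \<Rightarrow> (co \<Rightarrow> bool) \<Rightarrow> nat \<Rightarrow> (ix \<Rightarrow> hc el option) \<Rightarrow> ix \<Rightarrow> hc el \<Rightarrow> bool" where
  "fits G z M e \<alpha> w \<longleftrightarrow> (\<forall>\<beta> v. e \<beta> = Some v \<longrightarrow> (jadj ty \<alpha> \<beta> \<longrightarrow> bit w v = z (Bt \<alpha> \<beta>)) \<and> (jadj ty \<beta> \<alpha> \<longrightarrow> bit v w = z (Bt \<beta> \<alpha>))) \<and>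
    (jreal ty \<alpha> \<longrightarrow> (\<forall>m<M. rl G w m = z (Rb \<alpha> m)))"

lemma finite_ran_adm: "adm e \<Longrightarrow> finite (ran e)"
  unfolding adm_def by (simp add: finite_ran)

text \<open>The forth step for indices that stand for trees. Candidates extend \<open>b0\<close> by
  keys from \<open>KS\<close> and parts from \<open>PS\<close>; \<open>cl\<close> keeps them in the
  right class, and \<open>up\<close> lets their tables tell the upper neighbours apart.\<close>

lemma forth_direct:
  assumes e: "adm e" and a: "e \<alpha> = None" and KS: "KS \<noteq> {}" and PS: "PS \<noteq> {}"
    and lo: "\<And>\<beta> v. e \<beta> = Some v \<Longrightarrow> jadj ty \<beta> \<alpha> \<Longrightarrow> v \<in> KS"
    and up: "\<And>\<beta> \<beta>' v v'. e \<beta> = Some v \<Longrightarrow> e \<beta>' = Some v' \<Longrightarrow> jadj ty \<alpha> \<beta> \<Longrightarrow> jadj ty \<alpha> \<beta>' \<Longrightarrow> \<beta> \<noteq> \<beta>' \<Longrightarrow>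
      \<exists>P. set P \<subseteq> PS \<and> view P v \<noteq> view P v'"
    and cl: "\<And>Ks Ps w. bld Ks Ps b0 w \<Longrightarrow> Ks \<subseteq> KS \<Longrightarrow> Ps \<subseteq> PS \<Longrightarrow> okx e \<alpha> w"
  shows "\<exists>w. adm (e(\<alpha> \<mapsto> w)) \<and> fits G z M e \<alpha> w"
proof -
  obtain k0 p0 where k0: "k0 \<in> KS" and p0: "p0 \<in> PS" using KS PS by blast
  define Lo where "Lo = {v. \<exists>\<beta>. e \<beta> = Some v \<and> jadj ty \<beta> \<alpha>}"
  define Up where "Up = {v. \<exists>\<beta>. e \<beta> = Some v \<and> jadj ty \<alpha> \<beta>}"
  have fin: "finite Lo" "finite Up" using finite_ran_adm[OF e] unfolding Lo_def Up_def
    by (auto elim!: rev_finite_subset simp: ran_def)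
  define Pf where "Pf f g = (SOME P. set P \<subseteq> PS \<and> view P f \<noteq> view P g)" for f g
  have Pf: "set (Pf f g) \<subseteq> PS \<and> view (Pf f g) f \<noteq> view (Pf f g) g" if fg: "f \<in> Up" "g \<in> Up" "f \<noteq> g" for f g
  proof -
    obtain \<beta> \<beta>' where b: "e \<beta> = Some f" "jadj ty \<alpha> \<beta>" "e \<beta>' = Some g" "jadj ty \<alpha> \<beta>'" using fg unfolding Up_def by blast
    have "\<beta> \<noteq> \<beta>'" using b \<open>f \<noteq> g\<close> by auto
    then have "\<exists>P. set P \<subseteq> PS \<and> view P f \<noteq> view P g" by (rule up[OF b(1,3,2,4)])
    then show ?thesis unfolding Pf_def by (rule someI_ex)
  qed
  define Ps where "Ps = insert p0 (\<Union>f\<in>Up. \<Union>g\<in>{g\<in>Up. f \<noteq> g}. set (Pf f g))"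
  have Psf: "finite Ps" unfolding Ps_def using fin by auto
  have PsPS: "Ps \<subseteq> PS" unfolding Ps_def using Pf p0 by blast
  define dn where "dn v \<longleftrightarrow> (\<exists>\<beta>. e \<beta> = Some v \<and> jadj ty \<beta> \<alpha> \<and> z (Bt \<beta> \<alpha>))" for v
  define ub where "ub v \<longleftrightarrow> (\<exists>\<beta>. e \<beta> = Some v \<and> jadj ty \<alpha> \<beta> \<and> z (Bt \<alpha> \<beta>))" for v
  \<comment> \<open>A number above those of all assigned trees makes the new tree fresh.\<close>
  have "finite (topj ` ran e)" using finite_ran_adm[OF e] by simp
  then obtain N where N: "\<And>m. m \<in> topj ` ran e \<Longrightarrow> m \<le> N" by (meson finite_nat_set_iff_bounded_le)
  have "\<exists>e1 k b j p. k \<in> insert k0 Lo \<and> bld (insert k0 Lo) Ps b0 (Ext e1 k b j p) \<and> N < j \<and> pref j = map (\<lambda>m. z (Rb \<alpha> m)) [0..<M] \<and>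
    (\<forall>k'\<in>insert k0 Lo. bit k' (Ext e1 k b j p) = dn k') \<and> (\<forall>f\<in>Up. bit (Ext e1 k b j p) f = ub f)"
  proof (rule exists_extension)
    fix f g assume fg: "f \<in> Up" "g \<in> Up" "f \<noteq> g"
    then have "set (Pf f g) \<subseteq> Ps" unfolding Ps_def by blast
    then show "\<exists>P. set P \<subseteq> Ps \<and> view P f \<noteq> view P g" using Pf[OF fg] by blast
  qed (use fin Psf in \<open>auto simp: Ps_def\<close>)
  then obtain e1 k b j p where w: "bld (insert k0 Lo) Ps b0 (Ext e1 k b j p)" "N < j" "pref j = map (\<lambda>m. z (Rb \<alpha> m)) [0..<M]"
    "\<And>k'. k' \<in> insert k0 Lo \<Longrightarrow> bit k' (Ext e1 k b j p) = dn k'" "\<And>f. f \<in> Up \<Longrightarrow> bit (Ext e1 k b j p) f = ub f" by blast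
  let ?w = "Ext e1 k b j p"
  have ok: "okx e \<alpha> ?w" using cl[OF w(1)] lo k0 PsPS unfolding Lo_def by blast
  have "?w \<notin> ran e" using N[of j] w(2) by (metis image_eqI not_le topj.simps(2))
  then have "adm (e(\<alpha> \<mapsto> ?w))" using adm_update[OF e a ok] by (metis ranI)
  moreover have "fits G z M e \<alpha> ?w"
    unfolding fits_def
  proof (intro conjI allI impI)
    fix \<beta> v assume b: "e \<beta> = Some v"
    { assume ad: "jadj ty \<alpha> \<beta>"
      have "ub v \<longleftrightarrow> z (Bt \<alpha> \<beta>)"
      proof
        assume "ub v"
        then obtain \<beta>' where b': "e \<beta>' = Some v" "jadj ty \<alpha> \<beta>'" "z (Bt \<alpha> \<beta>')" unfolding ub_def by blast
        then have "\<beta>' = \<beta>" using up[OF b b'(1) ad b'(2)] by auto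
        then show "z (Bt \<alpha> \<beta>)" using b' by simp
      qed (use b ad in \<open>auto simp: ub_def\<close>)
      then show "bit ?w v = z (Bt \<alpha> \<beta>)" using w(5)[of v] b ad unfolding Up_def by blast
    }
    assume ad: "jadj ty \<beta> \<alpha>"
    have "dn v \<longleftrightarrow> z (Bt \<beta> \<alpha>)"
    proof
      assume "dn v"
      then obtain \<beta>' where b': "e \<beta>' = Some v" "jadj ty \<beta>' \<alpha>" "z (Bt \<beta>' \<alpha>)" unfolding dn_def by blast
      then have "\<beta>' = \<beta>" using adm_inj[OF e b'(1) b] jadj_low_grp[OF b'(2) ad] by blast
      then show "z (Bt \<beta> \<alpha>)" using b' by simp
    qed (use b ad in \<open>auto simp: dn_def\<close>)
    then show "bit v ?w = z (Bt \<beta> \<alpha>)" using w(4)[of v] b ad unfolding Lo_def by blast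
  next
    fix m assume "m < M"
    then show "rl G ?w m = z (Rb \<alpha> m)" unfolding rl_def using w(3) by simp
  qed
  ultimately show ?thesis by blast
qed

primrec vj :: "vw \<Rightarrow> nat" where
  "vj (VB q bl) = q"
| "vj (VE v k b j u) = j"

text \<open>The forth step for indices that stand for traces: the new tree must differ from all
  assigned ones even in its trace on \<open>C\<close>. A fresh number is visible in the trace under
  a key from \<open>C\<close>, or at the base if \<open>C\<close> is empty.\<close>

lemma forth_label:
  assumes e: "adm e" and a: "e (I k a) = None" and Ob: "Ob k = rep A C ` \<C>" and sub: "\<C> \<subseteq> A" and b0: "b0 \<in> \<C>"
    and lo: "\<And>\<beta> v. e \<beta> = Some v \<Longrightarrow> jadj ty \<beta> (I k a) \<Longrightarrow> v \<in> C"
    and up: "\<And>\<beta> v. e \<beta> = Some v \<Longrightarrow> \<not> jadj ty (I k a) \<beta>"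
    and real: "\<not> jreal ty (I k a)" and parts: "\<And>u. u \<in> C \<Longrightarrow> set (parts u) \<subseteq> C"
    and cl1: "\<And>Ks w. bld Ks {b0} b0 w \<Longrightarrow> Ks \<subseteq> C \<Longrightarrow> w \<in> \<C>"
    and cl2: "\<And>q. C = {} \<Longrightarrow> Base (tok b0) q \<in> \<C>"
  shows "\<exists>w. adm (e(I k a \<mapsto> w)) \<and> fits G z M e (I k a) w"
proof -
  define dn where "dn v \<longleftrightarrow> (\<exists>\<beta>. e \<beta> = Some v \<and> jadj ty \<beta> (I k a) \<and> z (Bt \<beta> (I k a)))" for v
  define Lo where "Lo = {v. \<exists>\<beta>. e \<beta> = Some v \<and> jadj ty \<beta> (I k a)}"
  have fin: "finite Lo" "finite (ran e)" using finite_ran_adm[OF e] unfolding Lo_def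
    by (auto elim!: rev_finite_subset simp: ran_def)
  have "\<exists>w\<in>\<C>. (\<forall>v\<in>Lo. bit v w = dn v) \<and> (\<forall>g\<in>ran e. \<not> labeq C w g)"
  proof (cases "C = {}")
    case True
    have "finite ((\<lambda>g. vj (view [] g)) ` ran e)" using fin by simp
    then obtain N where N: "\<And>m. m \<in> (\<lambda>g. vj (view [] g)) ` ran e \<Longrightarrow> m \<le> N" by (meson finite_nat_set_iff_bounded_le)
    have "\<not> labeq C (Base (tok b0) (Suc N)) g" if "g \<in> ran e" for g
    proof
      assume "labeq C (Base (tok b0) (Suc N)) g"
      then have "view [] (Base (tok b0) (Suc N)) = view [] g" by (rule labeqD) simp
      then have "vj (view [] g) = Suc N" by (metis view.simps(1) vj.simps(1))
      then show False using N[of "Suc N"] that by force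
    qed
    moreover have "Lo = {}" using lo True unfolding Lo_def by blast
    ultimately show ?thesis using cl2[OF True] by blast
  next
    case False
    then obtain c0 where c0: "c0 \<in> C" by blast
    let ?Ks = "insert c0 Lo"
    have KsC: "?Ks \<subseteq> C" using c0 lo unfolding Lo_def by blast
    have "finite ((\<lambda>(c, g). vj (view [c] g)) ` (?Ks \<times> ran e))" using fin by simp
    then obtain N where N: "\<And>m. m \<in> (\<lambda>(c, g). vj (view [c] g)) ` (?Ks \<times> ran e) \<Longrightarrow> m \<le> N" by (meson finite_nat_set_iff_bounded_le)
    have "\<exists>e1 k b j p. k \<in> ?Ks \<and> bld ?Ks {b0} b0 (Ext e1 k b j p) \<and> N < j \<and> pref j = [] \<and>
      (\<forall>k'\<in>?Ks. bit k' (Ext e1 k b j p) = dn k') \<and> (\<forall>f\<in>{}. bit (Ext e1 k b j p) f = True)"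
      by (rule exists_extension) (use fin in auto)
    then obtain e1 k b j p where w: "k \<in> ?Ks" "bld ?Ks {b0} b0 (Ext e1 k b j p)" "N < j"
      "\<And>k'. k' \<in> ?Ks \<Longrightarrow> bit k' (Ext e1 k b j p) = dn k'" by blast
    have "\<not> labeq C (Ext e1 k b j p) g" if "g \<in> ran e" for g
    proof
      assume "labeq C (Ext e1 k b j p) g"
      then have "view [k] (Ext e1 k b j p) = view [k] g" by (rule labeqD) (use w(1) KsC in auto)
      then have "vj (view [k] g) = j" by (metis list.set_intros(1) view.simps(2) vj.simps(2))
      then show False using N[of j] w(1,3) that by force
    qed
    moreover have "Ext e1 k b j p \<in> \<C>" by (rule cl1[OF w(2) KsC])
    ultimately show ?thesis using w(4) by blast
  qed
  then obtain w where w: "w \<in> \<C>" "\<And>v. v \<in> Lo \<Longrightarrow> bit v w = dn v" "\<And>g. g \<in> ran e \<Longrightarrow> \<not> labeq C w g" by blast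
  define r where "r = rep A C w"
  have r: "labeq C w r" "r \<in> Ob k" using rep_props[of w A C] w(1) sub Ob unfolding r_def by auto
  have "adm (e(I k a \<mapsto> r))" using w(3) r(1) by (intro adm_update[OF e a]) (use r(2) in \<open>auto simp: ran_def\<close>)
  moreover have "fits G z M e (I k a) r"
    unfolding fits_def
  proof (intro conjI allI impI)
    fix \<beta> v assume b: "e \<beta> = Some v"
    { assume "jadj ty (I k a) \<beta>" then show "bit r v = z (Bt (I k a) \<beta>)" using up b by blast }
    assume ad: "jadj ty \<beta> (I k a)"
    have v: "v \<in> Lo" "v \<in> C" using b ad lo unfolding Lo_def by blast+
    have "dn v \<longleftrightarrow> z (Bt \<beta> (I k a))"
    proof
      assume "dn v"
      then obtain \<beta>' where b': "e \<beta>' = Some v" "jadj ty \<beta>' (I k a)" "z (Bt \<beta>' (I k a))" unfolding dn_def by blast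
      then have "\<beta>' = \<beta>" using adm_inj[OF e b'(1) b] jadj_low_grp[OF b'(2) ad] by blast
      then show "z (Bt \<beta> (I k a))" using b' by simp
    qed (use b ad in \<open>auto simp: dn_def\<close>)
    then show "bit v r = z (Bt \<beta> (I k a))" using w(2)[OF v(1)] labeq_bit[OF r(1) v(2) parts[OF v(2)]] by simp
  qed (use real in simp)
  ultimately show ?thesis by blast
qed

lemma Ob_KC_sub: "l < lam s \<Longrightarrow> Ob (KC l) \<subseteq> EL s l"
proof (cases "lam s = i")
  case True
  assume "l < lam s"
  then show ?thesis using True EL_low[of l True s] by auto
next
  case False
  assume l: "l < lam s"
  have o: "s = False" "U = EL False i" using onesided[OF False] by auto
  have "lam False \<noteq> i" using False o(1) by simp
  then show ?thesis using rep_Kc_onesided Kc_EL EL_low[of l True False] o by (auto split: if_splits)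
qed

lemma Kc_full: "lam False = i + 2 \<Longrightarrow> Kc = EL False (i + 1)"
proof -
  assume l: "lam False = i + 2"
  then have "\<not> (\<exists>c\<in>tks y (i + 1). \<forall>b\<in>tks x (i + 1). \<not> agree b c)" by (auto simp: ty_def split: if_splits)
  then have "\<exists>f\<in>EL True (i + 1). labeq U e f" if "e \<in> EL False (i + 1)" for e
    using partnered[OF that] agree_sym by auto
  then show ?thesis unfolding Kc_def by blast
qed

lemma KT_unpartnered:
  assumes "v \<in> Ob (KT s)" "lam s = i"
  shows "v \<in> EL s (i + 1)" "\<And>f. f \<in> EL (\<not> s) (i + 1) \<Longrightarrow> \<not> labeq U v f"
proof -
  obtain e where e: "e \<in> TT s" "v = rep (EL s (i + 1)) U e" using assms by (auto simp: Cm_def split: if_splits)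
  then have eE: "e \<in> EL s (i + 1)" using assms(2) unfolding TT_def by auto
  note r = rep_props[OF eE, of U, folded e(2)]
  show "v \<in> EL s (i + 1)" using r by blast
  fix f assume "f \<in> EL (\<not> s) (i + 1)"
  then show "\<not> labeq U v f" using e(1) r labeq_trans assms(2) unfolding TT_def by blast
qed

lemma KC_partnered:
  assumes "v \<in> Ob (KC (i + 1))"
  shows "v \<in> EL False (i + 1)" "\<exists>f\<in>EL True (i + 1). labeq U v f"
proof -
  obtain e where e: "e \<in> Kc" "v = rep (EL False (i + 1)) U e" using assms by (auto split: if_splits)
  note r = rep_props[of e "EL False (i + 1)" U, folded e(2)]
  then have "v \<in> Kc" using Kc_labeq e Kc_EL by blast
  then show "v \<in> EL False (i + 1)" "\<exists>f\<in>EL True (i + 1). labeq U v f" unfolding Kc_def by auto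
qed

lemma rep_objs_inj:
  "v \<in> Ob (KC (i + 1)) \<Longrightarrow> v' \<in> Ob (KC (i + 1)) \<Longrightarrow> labeq U v v' \<Longrightarrow> v = v'"
  "w \<in> Ob (KT s) \<Longrightarrow> w' \<in> Ob (KT s) \<Longrightarrow> labeq (Cm s) w w' \<Longrightarrow> w = w'"
proof -
  assume a: "v \<in> Ob (KC (i + 1))" "v' \<in> Ob (KC (i + 1))" "labeq U v v'"
  then obtain e e' where "e \<in> Kc" "v = rep (EL False (i + 1)) U e" "e' \<in> Kc" "v' = rep (EL False (i + 1)) U e'" by (auto split: if_splits)
  then show "v = v'" using rep_inj[of e "EL False (i + 1)" e' U] Kc_EL a(3) by blast
next
  assume a: "w \<in> Ob (KT s)" "w' \<in> Ob (KT s)" "labeq (Cm s) w w'"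
  then obtain e e' where e: "e \<in> TT s" "w = rep (EL s (lam s + 1)) (Cm s) e" "e' \<in> TT s" "w' = rep (EL s (lam s + 1)) (Cm s) e'" by (auto split: if_splits)
  then have "e \<in> EL s (lam s + 1)" "e' \<in> EL s (lam s + 1)" unfolding TT_def by blast+
  then show "w = w'" using rep_inj[of e "EL s (lam s + 1)" e' "Cm s"] a(3) e(2,4) by blast
qed

lemma lam_ge: "i \<le> lam s"
  using lam_cases[of s] by auto

lemma up_sep_low:
  assumes e: "adm e" and l: "l < i"
    and b: "e \<beta> = Some v" "e \<beta>' = Some v'" "jadj ty (I (KC l) a) \<beta>" "jadj ty (I (KC l) a) \<beta>'" "\<beta> \<noteq> \<beta>'"
  shows "\<exists>P. set P \<subseteq> EL True l \<and> view P v \<noteq> view P v'"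
proof -
  have side: "(\<exists>c. \<gamma> = I (KC (Suc l)) c \<and> u \<in> EL True (Suc l) \<and> (Suc l = i \<longrightarrow> u \<in> U)) \<or>
      (\<exists>s c. \<gamma> = I (KP s) c \<and> Suc l = i \<and> lam s = i \<and> u \<in> EL s i - U)"
    if g: "e \<gamma> = Some u" "jadj ty (I (KC l) a) \<gamma>" for \<gamma> u
  proof -
    have ok: "okx e \<gamma> u" by (rule adm_okx[OF e g(1)])
    consider c where "\<gamma> = I (KC (Suc l)) c" | s c where "\<gamma> = I (KP s) c" "Suc l = lam s" | s c where "\<gamma> = I (KT s) c" "l = lam s"
      using g(2) by (auto elim!: jadj.elims)
    then show ?thesis
    proof cases
      case (1 c)
      then have "u \<in> Ob (KC (Suc l))" using ok by simp
      then have "u \<in> EL True (Suc l) \<and> (Suc l = i \<longrightarrow> u \<in> U)" using l by (cases "Suc l = i") (auto simp: U_def split: if_splits)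
      then show ?thesis using 1 by blast
    next
      case (2 s c)
      then have "lam s = i" using lam_ge[of s] l by auto
      moreover have "u \<in> EL s (lam s) - Cm s" using ok 2 by (auto split: if_splits)
      ultimately show ?thesis using 2 unfolding Cm_def by auto
    next
      case (3 s c)
      then show ?thesis using lam_ge[of s] l by auto
    qed
  qed
  obtain s where s: "v \<in> EL s (Suc l)" using side[OF b(1,3)] by auto
  obtain s' where s': "v' \<in> EL s' (Suc l)" using side[OF b(2,4)] by auto
  have "v \<noteq> v'"
  proof
    assume vv: "v = v'"
    show False using side[OF b(1,3)]
    proof (elim disjE exE conjE)
      fix c assume 1: "\<beta> = I (KC (Suc l)) c" "Suc l = i \<longrightarrow> v \<in> U"
      show False using side[OF b(2,4)]
      proof (elim disjE exE conjE)
        fix c' assume "\<beta>' = I (KC (Suc l)) c'"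
        then show False using adm_inj[OF e b(1), of \<beta>'] b(2,5) vv 1 by simp
      next
        fix s c' assume "Suc l = i" "v' \<in> EL s i - U" then show False using 1 vv by blast
      qed
    next
      fix s c assume 1: "\<beta> = I (KP s) c" "Suc l = i" "v \<in> EL s i - U"
      show False using side[OF b(2,4)]
      proof (elim disjE exE conjE)
        fix c' assume "Suc l = i \<longrightarrow> v' \<in> U" then show False using 1 vv by blast
      next
        fix s' c' assume 2: "\<beta>' = I (KP s') c'" "v' \<in> EL s' i - U"
        show False
        proof (cases "s = s'")
          case True
          then show False using adm_inj[OF e b(1), of \<beta>'] b(2,5) vv 1 2 by simp
        next
          case False
          then have "v \<in> EL True i" "v \<in> EL False i" using 1 2 vv by (cases s; auto)+
          then show False using 1 unfolding U_def by blast
        qed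
      qed
    qed
  qed
  then obtain P where P: "set P \<subseteq> EL s l" "view P v \<noteq> view P v'" using EL_sep[OF s s'] l by blast
  have "EL s l = EL True l" by (rule EL_low[OF l])
  then show ?thesis using P by blast
qed

text \<open>Level \<open>i + 1\<close> seen from the common part \<open>U\<close>: common traces,
  private traces of either side, and private trees of a one-sided second point. A coincidence of
  traces between different kinds would give something private a partner on the other side.\<close>

lemma up_sep_i:
  assumes e: "adm e"
    and b: "e \<beta> = Some v" "e \<beta>' = Some v'" "jadj ty (I (KC i) a) \<beta>" "jadj ty (I (KC i) a) \<beta>'" "\<beta> \<noteq> \<beta>'"
  shows "\<exists>P. set P \<subseteq> U \<and> view P v \<noteq> view P v'"
proof (rule not_labeq, rule notI)
  assume lq: "labeq U v v'"
  have kinds: "(\<exists>c. \<gamma> = I (KC (i + 1)) c \<and> u \<in> Ob (KC (i + 1))) \<or> (\<exists>s c. \<gamma> = I (KT s) c \<and> lam s = i \<and> u \<in> Ob (KT s)) \<or>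
      (\<exists>c. \<gamma> = I (KP False) c \<and> lam False = i + 1 \<and> u \<in> EL False (i + 1) \<and> u \<notin> Kc)"
    if g: "e \<gamma> = Some u" "jadj ty (I (KC i) a) \<gamma>" for \<gamma> u
  proof -
    have ok: "okx e \<gamma> u" by (rule adm_okx[OF e g(1)])
    consider c where "\<gamma> = I (KC (i + 1)) c" | s c where "\<gamma> = I (KP s) c" "i + 1 = lam s" | s c where "\<gamma> = I (KT s) c" "i = lam s"
      using g(2) by (auto elim!: jadj.elims)
    then show ?thesis
    proof cases
      case (1 c) then show ?thesis using ok by (metis okx.simps(1))
    next
      case (2 s c)
      then have "s = False" using onesided[of s] by auto
      moreover have "u \<in> EL s (lam s) - Cm s" using ok 2 by (auto split: if_splits)
      ultimately show ?thesis using 2 unfolding Cm_def by auto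
    next
      case (3 s c) then show ?thesis using ok by (metis okx.simps(1))
    qed
  qed
  have KCKT: False if v12: "v1 \<in> Ob (KC (i + 1))" "v2 \<in> Ob (KT s)" "lam s = i" "labeq U v1 v2" for v1 v2 s
  proof (cases s)
    case True
    then show False using KT_unpartnered(2)[OF v12(2,3), of v1] KC_partnered(1)[OF v12(1)] labeq_sym[OF v12(4)] by simp
  next
    case False
    obtain f where f: "f \<in> EL True (i + 1)" "labeq U v1 f" using KC_partnered(2)[OF v12(1)] by blast
    have "labeq U v2 f" by (rule labeq_trans[OF labeq_sym[OF v12(4)] f(2)])
    then show False using KT_unpartnered(2)[OF v12(2,3), of f] f(1) False by simp
  qed
  have KCKP: False if v12: "v1 \<in> Ob (KC (i + 1))" "v2 \<in> EL False (i + 1)" "v2 \<notin> Kc" "labeq U v1 v2" for v1 v2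
  proof -
    obtain f where f: "f \<in> EL True (i + 1)" "labeq U v1 f" using KC_partnered(2)[OF v12(1)] by blast
    have "labeq U v2 f" by (rule labeq_trans[OF labeq_sym[OF v12(4)] f(2)])
    then show False using v12(2,3) f(1) unfolding Kc_def by blast
  qed
  have KTKP: False if "v1 \<in> Ob (KT s)" "lam s = i" "v2 \<in> EL False (i + 1)" "v2 \<notin> Kc" "labeq U v1 v2" "lam False = i + 1" for v1 v2 s
    using KT_unpartnered(2)[OF that(1,2), of v2] that by (cases s) auto
  have same: False if "v = v'" "grp \<beta> = grp \<beta>'"
    using adm_inj[OF e b(1)] b(2,5) that by blast
  show False using kinds[OF b(1,3)]
  proof (elim disjE exE conjE)
    fix c assume 1: "\<beta> = I (KC (i + 1)) c" "v \<in> Ob (KC (i + 1))"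
    show False using kinds[OF b(2,4)]
    proof (elim disjE exE conjE)
      fix c' assume 2: "\<beta>' = I (KC (i + 1)) c'" "v' \<in> Ob (KC (i + 1))"
      show False by (rule same[OF rep_objs_inj(1)[OF 1(2) 2(2) lq]]) (simp add: 1 2)
    qed (use KCKT KCKP 1 lq in blast)+
  next
    fix s c assume 1: "\<beta> = I (KT s) c" "lam s = i" "v \<in> Ob (KT s)"
    show False using kinds[OF b(2,4)]
    proof (elim disjE exE conjE)
      fix c' assume "v' \<in> Ob (KC (i + 1))" then show False using KCKT 1 labeq_sym[OF lq] by blast
    next
      fix s' c' assume 2: "\<beta>' = I (KT s') c'" "lam s' = i" "v' \<in> Ob (KT s')"
      show False
      proof (cases "s = s'")
        case True
        have "labeq (Cm s) v v'" using lq 1(2) unfolding Cm_def by simp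
        then have "v = v'" using rep_objs_inj(2)[of v s v'] 1(3) 2(3) True by blast
        then show False using same 1 2 True by simp
      next
        case False
        then have "s' = (\<not> s)" by auto
        then show False using KT_unpartnered(2)[OF 1(3,2), of v'] KT_unpartnered(1)[OF 2(3,2)] lq by simp
      qed
    qed (use KTKP 1 lq in blast)
  next
    fix c assume 1: "\<beta> = I (KP False) c" "lam False = i + 1" "v \<in> EL False (i + 1)" "v \<notin> Kc"
    show False using kinds[OF b(2,4)]
    proof (elim disjE exE conjE)
      fix c' assume "v' \<in> Ob (KC (i + 1))" then show False using KCKP 1 labeq_sym[OF lq] by blast
    next
      fix s' c' assume "lam s' = i" "v' \<in> Ob (KT s')" then show False using KTKP 1 labeq_sym[OF lq] by blast
    next
      fix c' assume 2: "\<beta>' = I (KP False) c'" "v' \<in> EL False (i + 1)"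
      have "v = v'" using labeq_U_inj[OF _ 1(3) 2(2) lq] 1(2) by simp
      then show False using same 1 2 by simp
    qed
  qed
qed

lemma up_sep_Suc:
  assumes e: "adm e" and l: "lam False \<noteq> i"
    and b: "e \<beta> = Some v" "e \<beta>' = Some v'" "jadj ty (I (KC (i + 1)) a) \<beta>" "jadj ty (I (KC (i + 1)) a) \<beta>'" "\<beta> \<noteq> \<beta>'"
  shows "\<exists>P. set P \<subseteq> Kc \<and> view P v \<noteq> view P v'"
proof -
  have kinds: "(\<exists>c. \<gamma> = I (KT False) c \<and> lam False = i + 1 \<and> u \<in> Ob (KT False)) \<or>
      (\<exists>c. \<gamma> = I (KP False) c \<and> lam False = i + 2 \<and> u \<in> EL False (i + 2))"
    if g: "e \<gamma> = Some u" "jadj ty (I (KC (i + 1)) a) \<gamma>" for \<gamma> u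
  proof -
    have ok: "okx e \<gamma> u" by (rule adm_okx[OF e g(1)])
    consider c where "\<gamma> = I (KC (i + 2)) c" | s c where "\<gamma> = I (KP s) c" "i + 2 = lam s" | s c where "\<gamma> = I (KT s) c" "i + 1 = lam s"
      using g(2) by (auto elim!: jadj.elims)
    then show ?thesis
    proof cases
      case (1 c) then show ?thesis using ok by (auto split: if_splits)
    next
      case (2 s c)
      then have "s = False" using onesided[of s] by auto
      moreover have "u \<in> EL s (lam s) - Cm s" using ok 2 by (auto split: if_splits)
      ultimately show ?thesis using 2 by auto
    next
      case (3 s c)
      then have "s = False" using onesided[of s] by auto
      then show ?thesis using ok 3 by (metis okx.simps(1))
    qed
  qed
  have same: "v \<noteq> v'" if "grp \<beta> = grp \<beta>'"
    using adm_inj[OF e b(1)] b(2,5) that by blast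
  show ?thesis
  proof (cases "lam False = i + 1")
    case True
    then have k: "\<exists>c. \<beta> = I (KT False) c" "v \<in> Ob (KT False)" "\<exists>c. \<beta>' = I (KT False) c" "v' \<in> Ob (KT False)"
      using kinds[OF b(1,3)] kinds[OF b(2,4)] by auto
    then have "v \<noteq> v'" using same by auto
    then have "\<not> labeq (Cm False) v v'" using rep_objs_inj(2)[of v False v'] k by blast
    then show ?thesis using not_labeq True unfolding Cm_def by auto
  next
    case False
    then have k: "\<exists>c. \<beta> = I (KP False) c" "v \<in> EL False (i + 2)" "\<exists>c. \<beta>' = I (KP False) c" "v' \<in> EL False (i + 2)" "lam False = i + 2"
      using kinds[OF b(1,3)] kinds[OF b(2,4)] by auto
    then have "v \<noteq> v'" using same by auto
    then show ?thesis using EL_sep[of v False "Suc i" v' False] k Kc_full by auto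
  qed
qed

lemma Cm_bld_notin: "bld Ks Ps e0 w \<Longrightarrow> e0 \<notin> Cm s \<Longrightarrow> w \<notin> Cm s"
  by (induction rule: bld.induct) (auto dest: Cm_ExtD)

text \<open>A partner of the extended tree, stripped of the visible layer, would yield a partner of
  the tree before the extension.\<close>

lemma TT_bld:
  assumes "bld Ks {b0} b0 w" "b0 \<in> TT s" "Ks \<subseteq> Cm s"
  shows "w \<in> TT s"
  using assms(1)
proof (induction rule: bld.induct)
  case (bld_Ext e k p b j)
  have E: "Ext e k b j p \<in> EL s (lam s + 1)"
    using bld_Ext assms(2,3) Cm_sub[of s] unfolding TT_def by (auto simp: EL_Ext)
  have "\<not> (\<exists>f\<in>EL (\<not> s) (i + 1). labeq U (Ext e k b j p) f)" if l: "lam s = i"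
  proof
    assume "\<exists>f\<in>EL (\<not> s) (i + 1). labeq U (Ext e k b j p) f"
    then obtain f where f: "f \<in> EL (\<not> s) (i + 1)" "labeq U (Ext e k b j p) f" by blast
    have "k \<in> U" using bld_Ext assms(3) l unfolding Cm_def by auto
    then obtain f' where "f' \<in> EL (\<not> s) (i + 1)" "labeq U e f'"
      using labeq_Ext_strip[OF f(2), of "\<lambda>g. g \<in> EL (\<not> s) (i + 1)"] f(1) EL_Ext by blast
    then show False using bld_Ext.IH l unfolding TT_def by blast
  qed
  then show ?case using E unfolding TT_def by blast
qed (rule assms(2))

end

context pairJ
begin

lemma Ob_KC_full: "enat l < n \<Longrightarrow> l < lam s \<Longrightarrow> Ob (KC l) = EL s l"
proof (cases "l < i")
  case True
  assume "enat l < n"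
  then show ?thesis using True EL_low[of l True s] by simp
next
  case False
  assume n: "enat l < n" and l: "l < lam s"
  then have ne: "lam s \<noteq> i" using False by simp
  then have o: "s = False" "U = EL False i" using onesided by auto
  have "l = i \<or> (l = i + 1 \<and> lam s = i + 2)" using lam_cases[of s] False l ne by auto
  then show ?thesis
  proof
    assume "l = i" then show ?thesis using n o by simp
  next
    assume "l = i + 1 \<and> lam s = i + 2"
    then show ?thesis using n o rep_Kc_onesided Kc_full by simp
  qed
qed

lemma forth_KC:
  assumes e: "adm e" and av: "b0 \<in> Ob (KC l)" and a: "e (I (KC l) a) = None"
  shows "\<exists>w. adm (e(I (KC l) a \<mapsto> w)) \<and> fits G z M e (I (KC l) a) w"
proof -
  have n: "enat l < n" using av by (auto split: if_splits)
  have low: "\<exists>c l'. \<beta> = I (KC l') c \<and> l = l' + 1" if "jadj ty \<beta> (I (KC l) a)" for \<beta>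
    using that by (auto elim!: jadj.elims)
  have loOb: "\<exists>l'. v \<in> Ob (KC l') \<and> l = l' + 1" if b: "e \<beta> = Some v" "jadj ty \<beta> (I (KC l) a)" for \<beta> v
    using low[OF b(2)] adm_okx[OF e b(1)] okx.simps(1) by blast
  \<comment> \<open>Up to level \<open>i\<close> the indices stand for shared trees. On level
    \<open>i + 1\<close> they do so again in the one-sided case, where a trace determines the tree,
    and otherwise they stand for trace classes.\<close>
  consider "l < i" | "l = i" | "l = i + 1" "lam False \<noteq> i" | "l = i + 1" "lam False = i"
    using av by (auto split: if_splits)
  then show ?thesis
  proof cases
    case 1
    show ?thesis
    proof (rule forth_direct[OF e a, where KS = "EL True (l - 1)" and PS = "EL True l" and ?b0.0 = b0])
      show "EL True (l - 1) \<noteq> {}" "EL True l \<noteq> {}" using EL_ne by blast+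
      show "v \<in> EL True (l - 1)" if b: "e \<beta> = Some v" "jadj ty \<beta> (I (KC l) a)" for \<beta> v
        using loOb[OF b] 1 by (auto split: if_splits)
      show "\<exists>P. set P \<subseteq> EL True l \<and> view P v \<noteq> view P v'"
        if "e \<beta> = Some v" "e \<beta>' = Some v'" "jadj ty (I (KC l) a) \<beta>" "jadj ty (I (KC l) a) \<beta>'" "\<beta> \<noteq> \<beta>'" for \<beta> \<beta>' v v'
        by (rule up_sep_low[OF e 1 that])
      show "okx e (I (KC l) a) w" if b: "bld Ks Ps b0 w" "Ks \<subseteq> EL True (l - 1)" "Ps \<subseteq> EL True l" for Ks Ps w
        using EL_bld[OF b(1) _ b(2,3)] av 1 n by (auto split: if_splits)
    qed
  next
    case 2
    have b0: "b0 \<in> U" using av 2 by (auto split: if_splits)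
    show ?thesis
    proof (rule forth_direct[OF e a, where KS = "EL True (l - 1) \<inter> EL False (l - 1)" and PS = "U" and ?b0.0 = b0])
      show "EL True (l - 1) \<inter> EL False (l - 1) \<noteq> {}"
      proof (cases "i = 0")
        case True then show ?thesis using b0 2 unfolding U_def by auto
      next
        case False then show ?thesis using EL_low[of "l - 1" True False] EL_ne[of True "l - 1"] 2 by auto
      qed
      show "U \<noteq> {}" using b0 by blast
      show "v \<in> EL True (l - 1) \<inter> EL False (l - 1)" if b: "e \<beta> = Some v" "jadj ty \<beta> (I (KC l) a)" for \<beta> v
        using loOb[OF b] EL_low[of "l - 1" True False] 2 by (auto split: if_splits)
      show "\<exists>P. set P \<subseteq> U \<and> view P v \<noteq> view P v'"
        if b: "e \<beta> = Some v" "e \<beta>' = Some v'" "jadj ty (I (KC l) a) \<beta>" "jadj ty (I (KC l) a) \<beta>'" "\<beta> \<noteq> \<beta>'" for \<beta> \<beta>' v v'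
        using up_sep_i[OF e b(1,2) _ _ b(5), of a] b(3,4) 2 by simp
      show "okx e (I (KC l) a) w" if b: "bld Ks Ps b0 w" "Ks \<subseteq> EL True (l - 1) \<inter> EL False (l - 1)" "Ps \<subseteq> U" for Ks Ps w
      proof -
        have "w \<in> EL s l" for s by (rule EL_bld[OF b(1)]) (use b b0 2 in \<open>cases s; auto simp: U_def\<close>)+
        then show ?thesis using 2 n by (simp add: U_def)
      qed
    qed
  next
    case 3
    have o: "U = EL False i" using onesided[OF 3(2)] by blast
    have ObK: "Ob (KC l) = Kc" using rep_Kc_onesided[OF 3(2)] 3(1) n by simp
    show ?thesis
    proof (rule forth_direct[OF e a, where KS = "U" and PS = "Kc" and ?b0.0 = b0])
      show "U \<noteq> {}" using o EL_ne[of False i] by auto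
      show "Kc \<noteq> {}" using av ObK by blast
      show "v \<in> U" if b: "e \<beta> = Some v" "jadj ty \<beta> (I (KC l) a)" for \<beta> v
        using loOb[OF b] 3(1) by (auto split: if_splits)
      show "\<exists>P. set P \<subseteq> Kc \<and> view P v \<noteq> view P v'"
        if b: "e \<beta> = Some v" "e \<beta>' = Some v'" "jadj ty (I (KC l) a) \<beta>" "jadj ty (I (KC l) a) \<beta>'" "\<beta> \<noteq> \<beta>'" for \<beta> \<beta>' v v'
        using up_sep_Suc[OF e 3(2) b(1,2) _ _ b(5), of a] b(3,4) 3(1) by simp
      show "okx e (I (KC l) a) w" if b: "bld Ks Ps b0 w" "Ks \<subseteq> U" "Ps \<subseteq> Kc" for Ks Ps w
        using Kc_bld[OF b(1) _ b(2,3)] av ObK by simp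
    qed
  next
    case 4
    obtain b1 where b1: "b1 \<in> Kc" using av 4 by (auto split: if_splits)
    show ?thesis
    proof (rule forth_label[OF e a, where A = "EL False (i + 1)" and C = U and \<C> = Kc and ?b0.0 = b1])
      show "Ob (KC l) = rep (EL False (i + 1)) U ` Kc" using 4 n by simp
      show "Kc \<subseteq> EL False (i + 1)" by (rule Kc_EL)
      show "b1 \<in> Kc" by (rule b1)
      show "v \<in> U" if b: "e \<beta> = Some v" "jadj ty \<beta> (I (KC l) a)" for \<beta> v
        using loOb[OF b] 4(1) by (auto split: if_splits)
      show "\<not> jadj ty (I (KC l) a) \<beta>" if b: "e \<beta> = Some v" for \<beta> v
      proof
        assume "jadj ty (I (KC l) a) \<beta>"
        then consider c where "\<beta> = I (KC (l + 1)) c" | s c where "\<beta> = I (KP s) c" "l + 1 = lam s" | s c where "\<beta> = I (KT s) c" "l = lam s"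
          by (auto elim!: jadj.elims)
        then show False
        proof cases
          case 1 then show ?thesis using adm_okx[OF e b] 4(1) by (auto split: if_splits)
        next
          case (2 s c) then show ?thesis using 4 lam_True by (cases s) auto
        next
          case (3 s c) then show ?thesis using 4 lam_True by (cases s) auto
        qed
      qed
      show "\<not> jreal ty (I (KC l) a)" using 4 by simp
      show "set (parts u) \<subseteq> U" if "u \<in> U" for u using U_parts[OF that] .
      show "w \<in> Kc" if b: "bld Ks {b1} b1 w" "Ks \<subseteq> U" for Ks w using Kc_bld[OF b(1) b1 b(2)] b1 by blast
      show "Base (tok b1) q \<in> Kc" if U0: "U = {}" for q
      proof -
        have "tok b1 \<in> tks y (i + 1)" using EL_tok[of b1 False "i + 1"] b1 Kc_EL by auto
        moreover obtain b where "b \<in> tks x (i + 1)" using tks_ne by blast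
        moreover have "labeq U (Base (tok b1) q) (Base b q)" unfolding labeq_Base U0 by simp
        ultimately show ?thesis unfolding Kc_def by (auto simp: EL_Base intro!: bexI[of _ "Base b q"])
      qed
    qed
  qed
qed

lemma forth:
  assumes e: "adm e" and av: "jav n ty \<alpha>" and a: "e \<alpha> = None" and pa: "\<And>\<gamma>. \<gamma> \<in> par \<alpha> \<Longrightarrow> e \<gamma> \<noteq> None"
  shows "\<exists>w. adm (e(\<alpha> \<mapsto> w)) \<and> fits G z M e \<alpha> w"
proof (cases \<alpha>)
  case \<alpha>: (I k c)
  then have "Ob k \<noteq> {}" using Ob_avail av by simp
  then obtain b0 where b0: "b0 \<in> Ob k" by blast
  note a' = a[unfolded \<alpha>]
  show ?thesis
  proof (cases k)
    case (KC l)
    then show ?thesis using forth_KC[OF e] b0 a' \<alpha> by blast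
  next
    case (KP s)
    then have n: "enat (lam s) < n" and b: "b0 \<in> EL s (lam s) - Cm s" using b0 by (auto split: if_splits)
    show ?thesis unfolding \<alpha> KP
    proof (rule forth_direct[OF e a'[unfolded KP], where KS = "EL s (lam s - 1)" and PS = "EL s (lam s)" and ?b0.0 = b0])
      show "EL s (lam s - 1) \<noteq> {}" "EL s (lam s) \<noteq> {}" using EL_ne by blast+
      show "v \<in> EL s (lam s - 1)" if b: "e \<beta> = Some v" "jadj ty \<beta> (I (KP s) c)" for \<beta> v
      proof -
        obtain l d where l: "\<beta> = I (KC l) d" "l + 1 = lam s" using b(2) by (auto elim!: jadj.elims)
        then have "v \<in> Ob (KC l)" using adm_okx[OF e b(1)] by simp
        then show ?thesis using Ob_KC_sub[of l s] l(2) by (metis add_diff_cancel_right' less_add_one subsetD)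
      qed
      show "\<exists>P. set P \<subseteq> EL s (lam s) \<and> view P v \<noteq> view P v'"
        if b: "e \<beta> = Some v" "e \<beta>' = Some v'" "jadj ty (I (KP s) c) \<beta>" "jadj ty (I (KP s) c) \<beta>'" "\<beta> \<noteq> \<beta>'" for \<beta> \<beta>' v v'
      proof -
        obtain k1 a1 b1 k2 a2 b2 where J: "\<beta> = J s k1 a1 b1" "\<beta>' = J s k2 a2 b2" using b(3,4) by (auto elim!: jadj.elims)
        have "v \<in> EL s (Suc (lam s))" "v' \<in> EL s (Suc (lam s))" using adm_okx[OF e b(1)] adm_okx[OF e b(2)] J by auto
        moreover have "v \<noteq> v'" using adm_inj[OF e b(1), of \<beta>'] b(2,5) J by auto
        ultimately show ?thesis using EL_sep by blast
      qed
      show "okx e (I (KP s) c) w" if w: "bld Ks Ps b0 w" "Ks \<subseteq> EL s (lam s - 1)" "Ps \<subseteq> EL s (lam s)" for Ks Ps w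
        using EL_bld[OF w(1) _ w(2,3)] Cm_bld_notin[OF w(1), of s] b n by simp
    qed
  next
    case (KT s)
    then have n: "enat (lam s + 1) < n" and ne: "TT s \<noteq> {}" using b0 by (auto split: if_splits)
    then obtain b1 where b1: "b1 \<in> TT s" by blast
    have n': "enat (lam s) < n" using n enat_Suc_lessD by auto
    show ?thesis unfolding \<alpha> KT
    proof (rule forth_label[OF e a'[unfolded KT], where A = "EL s (lam s + 1)" and C = "Cm s" and \<C> = "TT s" and ?b0.0 = b1])
      show "Ob (KT s) = rep (EL s (lam s + 1)) (Cm s) ` TT s" using n by simp
      show "TT s \<subseteq> EL s (lam s + 1)" unfolding TT_def by blast
      show "b1 \<in> TT s" by (rule b1)
      show "v \<in> Cm s" if b: "e \<beta> = Some v" "jadj ty \<beta> (I (KT s) c)" for \<beta> v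
      proof -
        obtain l d where l: "\<beta> = I (KC l) d" "l = lam s" using b(2) by (auto elim!: jadj.elims)
        then have "v \<in> Ob (KC (lam s))" using adm_okx[OF e b(1)] by (metis okx.simps(1))
        then show ?thesis using Ob_KC_Cm[OF n'] by blast
      qed
      show "\<not> jadj ty (I (KT s) c) \<beta>" for \<beta> by (cases \<beta>) auto
      show "\<not> jreal ty (I (KT s) c)" by simp
      show "set (parts u) \<subseteq> Cm s" if "u \<in> Cm s" for u by (rule Cm_parts[OF that])
      show "w \<in> TT s" if "bld Ks {b1} b1 w" "Ks \<subseteq> Cm s" for Ks w by (rule TT_bld[OF that(1) b1 that(2)])
      show "Base (tok b1) q \<in> TT s" if C0: "Cm s = {}" for q
      proof -
        have E: "Base (tok b1) q \<in> EL s (lam s + 1)" using EL_tok[of b1 s "lam s + 1"] b1 unfolding TT_def EL_Base by blast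
        have "lam s \<noteq> i"
        proof
          assume l: "lam s = i"
          then have "U = {}" using C0 unfolding Cm_def by simp
          then have "agree b c" for b c using U_empty unfolding agree_def by simp
          then have "\<exists>f\<in>EL (\<not> s) (i + 1). labeq U b1 f" using partnered[of b1 s] b1 l tks_ne unfolding TT_def by (metis (no_types, lifting) all_not_in_conv mem_Collect_eq)
          then show False using b1 l unfolding TT_def by blast
        qed
        then show ?thesis using E unfolding TT_def by blast
      qed
    qed
  next
    case (KH s l)
    then have n: "enat l < n" "lam s + 2 \<le> l" using b0 by (auto split: if_splits)
    show ?thesis unfolding \<alpha> KH
    proof (rule forth_direct[OF e a'[unfolded KH], where KS = "EL s (l - 1)" and PS = "EL s l" and ?b0.0 = b0])
      show "EL s (l - 1) \<noteq> {}" "EL s l \<noteq> {}" using EL_ne by blast+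
      show "v \<in> EL s (l - 1)" if b: "e \<beta> = Some v" "jadj ty \<beta> (I (KH s l) c)" for \<beta> v
      proof -
        consider k a1 b1 where "\<beta> = J s k a1 b1" "l = lam s + 2" | l' d where "\<beta> = I (KH s l') d" "l = l' + 1" using b(2) by (auto elim!: jadj.elims)
        then show ?thesis using adm_okx[OF e b(1)] by cases (auto split: if_splits)
      qed
      show "\<exists>P. set P \<subseteq> EL s l \<and> view P v \<noteq> view P v'"
        if b: "e \<beta> = Some v" "e \<beta>' = Some v'" "jadj ty (I (KH s l) c) \<beta>" "jadj ty (I (KH s l) c) \<beta>'" "\<beta> \<noteq> \<beta>'" for \<beta> \<beta>' v v'
      proof -
        obtain a1 a2 where J: "\<beta> = I (KH s (l + 1)) a1" "\<beta>' = I (KH s (l + 1)) a2" using b(3,4) by (auto elim!: jadj.elims)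
        have "v \<in> EL s (Suc l)" "v' \<in> EL s (Suc l)" using adm_okx[OF e b(1)] adm_okx[OF e b(2)] J by (auto split: if_splits)
        moreover have "v \<noteq> v'" using adm_inj[OF e b(1), of \<beta>'] b(2,5) J by auto
        ultimately show ?thesis using EL_sep by blast
      qed
      show "okx e (I (KH s l) c) w" if w: "bld Ks Ps b0 w" "Ks \<subseteq> EL s (l - 1)" "Ps \<subseteq> EL s l" for Ks Ps w
        using EL_bld[OF w(1) _ w(2,3)] b0 KH n by (auto split: if_splits)
    qed
  qed
next
  case \<alpha>: (J s k c d)
  note a' = a[unfolded \<alpha>]
  have n: "enat (lam s + 1) < n" and pk: "jpk ty s k" using av \<alpha> by auto
  have n': "enat (lam s) < n" using n enat_Suc_lessD by auto
  obtain po where po: "e (I k c) = Some po" using pa[of "I k c"] \<alpha> by auto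
  then have poO: "po \<in> Ob k" using adm_okx[OF e po] by simp
  \<comment> \<open>The trace of the parent may be represented by a tree of the other side, so a
    tree of side \<open>s\<close> with this trace is found first. Layers keyed by private trees can
    then be added without changing the trace.\<close>
  have "\<exists>b0. b0 \<in> EL s (lam s + 1) \<and> labeq (Cm s) po b0"
  proof (cases "k = KT s")
    case True
    then obtain f where f: "f \<in> TT s" "po = rep (EL s (lam s + 1)) (Cm s) f" using poO by (auto split: if_splits)
    then have "po \<in> EL s (lam s + 1)" using rep_props[of f "EL s (lam s + 1)" "Cm s"] unfolding TT_def by blast
    then show ?thesis by auto
  next
    case False
    then have k: "k = KC (lam s + 1)" using pk unfolding jpk_def by blast
    have l: "lam s = i"
    proof (rule ccontr)
      assume "lam s \<noteq> i"
      then have "lam s = i + 1 \<or> lam s = i + 2" using lam_cases[of s] by blast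
      then show False using poO k by (auto split: if_splits)
    qed
    then have "po \<in> Ob (KC (i + 1))" using poO k by simp
    from KC_partnered[OF this] show ?thesis using l unfolding Cm_def by (cases s) auto
  qed
  then obtain b0 where b0: "b0 \<in> EL s (lam s + 1)" "labeq (Cm s) po b0" by blast
  show ?thesis unfolding \<alpha>
  proof (rule forth_direct[OF e a', where KS = "EL s (lam s) - Cm s" and PS = "EL s (lam s + 1)" and ?b0.0 = b0])
    show "EL s (lam s) - Cm s \<noteq> {}" by (rule private_ne)
    show "EL s (lam s + 1) \<noteq> {}" using EL_ne by blast
    show "v \<in> EL s (lam s) - Cm s" if b: "e \<beta> = Some v" "jadj ty \<beta> (J s k c d)" for \<beta> v
    proof -
      obtain a1 where "\<beta> = I (KP s) a1" using b(2) by (auto elim!: jadj.elims)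
      then show ?thesis using adm_okx[OF e b(1)] by (auto split: if_splits)
    qed
    show "\<exists>P. set P \<subseteq> EL s (lam s + 1) \<and> view P v \<noteq> view P v'"
      if b: "e \<beta> = Some v" "e \<beta>' = Some v'" "jadj ty (J s k c d) \<beta>" "jadj ty (J s k c d) \<beta>'" "\<beta> \<noteq> \<beta>'" for \<beta> \<beta>' v v'
    proof -
      obtain a1 a2 where J: "\<beta> = I (KH s (lam s + 2)) a1" "\<beta>' = I (KH s (lam s + 2)) a2" using b(3,4) by (auto elim!: jadj.elims)
      have "v \<in> EL s (Suc (lam s + 1))" "v' \<in> EL s (Suc (lam s + 1))" using adm_okx[OF e b(1)] adm_okx[OF e b(2)] J by (auto split: if_splits)
      moreover have "v \<noteq> v'" using adm_inj[OF e b(1), of \<beta>'] b(2,5) J by auto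
      ultimately show ?thesis using EL_sep by blast
    qed
    show "okx e (J s k c d) w" if w: "bld Ks Ps b0 w" "Ks \<subseteq> EL s (lam s) - Cm s" "Ps \<subseteq> EL s (lam s + 1)" for Ks Ps w
    proof -
      have "w \<in> EL s (lam s + 1)" by (rule EL_bld[OF w(1) b0(1) _ w(3)]) (use w(2) in auto)
      moreover have "labeq (Cm s) po w" using labeq_trans[OF b0(2)] labeq_bld[OF w(1), of "Cm s"] w(2) by blast
      ultimately show ?thesis using n pk po poO by simp
    qed
  qed
qed

lemma ex_fresh_index: "finite A \<Longrightarrow> inj (f :: nat \<Rightarrow> ix) \<Longrightarrow> \<exists>a. f a \<notin> A"
  by (meson finite_subset image_subsetI infinite_UNIV_nat finite_imageD)

lemma back_I:
  assumes e: "adm e" and w: "w \<in> Ob k"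
  shows "\<exists>e' a. adm e' \<and> e \<subseteq>\<^sub>m e' \<and> e' (I k a) = Some w"
proof (cases "\<exists>a. e (I k a) = Some w")
  case True then show ?thesis using e map_le_refl by blast
next
  case False
  have "finite (dom e)" using e unfolding adm_def by blast
  moreover have "inj (I k)" by (auto simp: inj_def)
  ultimately obtain a where a: "I k a \<notin> dom e" using ex_fresh_index by blast
  have "adm (e(I k a \<mapsto> w))"
  proof (rule adm_update[OF e])
    fix \<beta> assume "e \<beta> = Some w"
    then show "grp \<beta> \<noteq> grp (I k a)" using False by (cases \<beta>) auto
  qed (use a w in auto)
  then show ?thesis using a by (intro exI[of _ "e(I k a \<mapsto> w)"] exI[of _ a]) (auto simp: map_le_def)
qed

lemma ex_parent:
  assumes f: "f \<in> EL s (lam s + 1)" and n: "enat (lam s + 1) < n"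
  shows "\<exists>k po. jpk ty s k \<and> po \<in> Ob k \<and> labeq (Cm s) po f"
proof (cases "f \<in> TT s")
  case True
  then have "rep (EL s (lam s + 1)) (Cm s) f \<in> Ob (KT s)" using n by simp
  then show ?thesis using rep_props[OF f, of "Cm s"] labeq_sym unfolding jpk_def by blast
next
  case False
  then obtain g where l: "lam s = i" and g: "g \<in> EL (\<not> s) (i + 1)" "labeq U f g" using f unfolding TT_def by blast
  have C: "Cm s = U" using l unfolding Cm_def by simp
  have "\<exists>h\<in>Kc. labeq U f h"
  proof (cases s)
    case True
    then have "g \<in> Kc" unfolding Kc_def using g f l labeq_sym by auto
    then show ?thesis using g by blast
  next
    case False
    then have "f \<in> Kc" unfolding Kc_def using g f l by auto
    then show ?thesis using labeq_refl by blast
  qed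
  then obtain h where h: "h \<in> Kc" "labeq U f h" by blast
  have r1: "rep (EL False (i + 1)) U h \<in> Ob (KC (lam s + 1))" using h(1) n l by simp
  have r2: "labeq (Cm s) (rep (EL False (i + 1)) U h) f" unfolding C
    using rep_props[of h "EL False (i + 1)" U] h Kc_EL labeq_sym labeq_trans by blast
  have j: "jpk ty s (KC (lam s + 1))" unfolding jpk_def by simp
  show ?thesis by (intro exI conjI, rule j, rule r1, rule r2)
qed

lemma back_J:
  assumes e: "adm e" and f: "f \<in> EL s (lam s + 1)" and n: "enat (lam s + 1) < n"
  shows "\<exists>e' k a b. adm e' \<and> e \<subseteq>\<^sub>m e' \<and> e' (J s k a b) = Some f"
proof (cases "\<exists>k a b. e (J s k a b) = Some f")
  case True then show ?thesis using e map_le_refl by blast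
next
  case False
  obtain k po where po: "jpk ty s k" "po \<in> Ob k" "labeq (Cm s) po f" using ex_parent[OF f n] by blast
  obtain e1 a where e1: "adm e1" "e \<subseteq>\<^sub>m e1" "e1 (I k a) = Some po" using back_I[OF e po(2)] by blast
  show ?thesis
  proof (cases "\<exists>k a b. e1 (J s k a b) = Some f")
    case True then show ?thesis using e1 by blast
  next
    case F: False
    have "finite (dom e1)" using e1 unfolding adm_def by blast
    moreover have "inj (J s k a)" by (auto simp: inj_def)
    ultimately obtain b where b: "J s k a b \<notin> dom e1" using ex_fresh_index by blast
    have "adm (e1(J s k a b \<mapsto> f))"
    proof (rule adm_update[OF e1(1)])
      fix \<beta> assume "e1 \<beta> = Some f"
      then show "grp \<beta> \<noteq> grp (J s k a b)" using F by (metis grp.elims grp.simps(2) sum.inject(2) sum.distinct(1))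
    qed (use b f n po e1 in auto)
    moreover have "e1 \<subseteq>\<^sub>m e1(J s k a b \<mapsto> f)" using b by (auto simp: map_le_def)
    ultimately show ?thesis using map_le_trans[OF e1(2)] by (intro exI[of _ "e1(J s k a b \<mapsto> f)"] exI) auto
  qed
qed

end

section \<open>Generic enumerations of a pair\<close>

lemma jadj_irrefl: "\<not> jadj \<tau> \<alpha> \<alpha>"
  by (auto elim!: jadj.elims)

context pairJ
begin

text \<open>The coordinates that an enumeration of the pair determines; the others are filled in
  freely by the finite lists \<open>s\<close>.\<close>

definition goodc :: "co \<Rightarrow> bool" where
  "goodc c = (case c of Rb \<alpha> m \<Rightarrow> jav n ty \<alpha> \<and> jreal ty \<alpha> | Bt \<alpha> \<beta> \<Rightarrow> jav n ty \<alpha> \<and> jav n ty \<beta> \<and> jadj ty \<alpha> \<beta>)"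

definition agr :: "(bool list el \<times> nat \<Rightarrow> bool) \<Rightarrow> (ix \<Rightarrow> hc el option) \<Rightarrow> (co \<times> bool) list \<Rightarrow> (co \<Rightarrow> bool) \<Rightarrow> bool" where
  "agr G e s z \<longleftrightarrow> holds s z \<and> (\<forall>\<alpha> \<beta> v w. e \<alpha> = Some v \<longrightarrow> e \<beta> = Some w \<longrightarrow> jadj ty \<alpha> \<beta> \<longrightarrow> z (Bt \<alpha> \<beta>) = bit v w) \<and>
    (\<forall>\<alpha> v m. e \<alpha> = Some v \<longrightarrow> jreal ty \<alpha> \<longrightarrow> z (Rb \<alpha> m) = rl G v m)"

text \<open>A forcing condition in two parts: \<open>e\<close> decides meaningful coordinates
  through the assigned objects and \<open>s\<close> speaks only about the others, so the two cannot
  conflict.\<close>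

definition cnd :: "(ix \<Rightarrow> hc el option) \<Rightarrow> (co \<times> bool) list \<Rightarrow> bool" where
  "cnd e s \<longleftrightarrow> adm e \<and> (\<forall>c\<in>fst ` set s. \<not> goodc c) \<and> (\<exists>z. holds s z)"

lemma jreal_cases:
  assumes e: "adm e" and v: "e \<alpha> = Some v" and r: "jreal ty \<alpha>"
  shows "(\<exists>a. \<alpha> = I (KC 0) a \<and> v \<in> EL True 0 \<and> (i = 0 \<longrightarrow> v \<in> U)) \<or> (\<exists>s a. \<alpha> = I (KP s) a \<and> i = 0 \<and> lam s = 0 \<and> v \<in> EL s 0 - U)"
proof -
  have ok: "okx e \<alpha> v" by (rule adm_okx[OF e v])
  consider a where "\<alpha> = I (KC 0) a" | s a where "\<alpha> = I (KP s) a" "lam s = 0" using r by (auto elim!: jreal.elims)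
  then show ?thesis
  proof cases
    case (1 a)
    then have "v \<in> Ob (KC 0)" using ok by simp
    note v0 = this
    have "v \<in> EL True 0 \<and> (i = 0 \<longrightarrow> v \<in> U)"
    proof (cases "i = 0")
      case True
      then have k: "KC 0 = KC i" by simp
      have "v \<in> Ob (KC i)" using v0 unfolding k .
      then have u: "v \<in> U" using iN by simp
      then have "v \<in> EL True i" unfolding U_def by blast
      then show ?thesis using u True by metis
    next
      case False
      then show ?thesis using v0 by (auto split: if_splits)
    qed
    then show ?thesis using 1 by blast
  next
    case (2 s a)
    then have i: "i = 0" using lam_ge[of s] by simp
    have "v \<in> EL s (lam s) - Cm s" using ok 2 by (auto split: if_splits)
    then show ?thesis using 2 i unfolding Cm_def by auto
  qed
qed

lemma real_inj:
  assumes e: "adm e" and a: "e \<alpha> = Some v" "jreal ty \<alpha>" and b: "e \<beta> = Some v" "jreal ty \<beta>"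
  shows "\<alpha> = \<beta>"
proof -
  have "grp \<alpha> = grp \<beta>"
    using jreal_cases[OF e a]
  proof (elim disjE exE conjE)
    fix c assume 1: "\<alpha> = I (KC 0) c" "i = 0 \<longrightarrow> v \<in> U"
    then show ?thesis using jreal_cases[OF e b] by auto
  next
    fix s c assume 1: "\<alpha> = I (KP s) c" "i = 0" "lam s = 0" "v \<in> EL s 0 - U"
    show ?thesis using jreal_cases[OF e b]
    proof (elim disjE exE conjE)
      fix d assume "i = 0 \<longrightarrow> v \<in> U" then show ?thesis using 1 by blast
    next
      fix s' d assume 2: "\<beta> = I (KP s') d" "v \<in> EL s' 0 - U"
      have "s = s'"
      proof (rule ccontr)
        assume "s \<noteq> s'"
        then have "v \<in> EL True 0" "v \<in> EL False 0" using 1 2 by (cases s; auto)+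
        then show False using 1 unfolding U_def by auto
      qed
      then show ?thesis using 1 2 by simp
    qed
  qed
  then show ?thesis by (rule adm_inj[OF e a(1) b(1)])
qed

lemma real_urt:
  assumes "adm e" "e \<alpha> = Some v" "jreal ty \<alpha>"
  shows "v \<in> urt"
proof -
  obtain s where "v \<in> EL s 0" using jreal_cases[OF assms] by blast
  then show ?thesis using El_urt unfolding EL_def by blast
qed

text \<open>The bits between assigned objects form a finite condition, but the rows of assigned
  bottom objects are complete reals. Mutual genericity of these reals provides a point of
  \<open>D\<close> with exactly these rows.\<close>

lemma ex_agr:
  assumes c: "cnd e s"
    and gen: "\<And>s xs ws. free_cond xs s \<Longrightarrow> length ws = length xs \<Longrightarrow> distinct ws \<Longrightarrow> set ws \<subseteq> urt \<Longrightarrow> meets D s xs (\<lambda>a. rl G (ws ! a))"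
  shows "\<exists>z\<in>D. agr G e s z"
proof -
  have e: "adm e" using c unfolding cnd_def by blast
  have fin: "finite (dom e)" using e unfolding adm_def by blast
  have "finite {\<alpha> \<in> dom e. jreal ty \<alpha>}" using fin by simp
  then obtain xs where xs: "set xs = {\<alpha> \<in> dom e. jreal ty \<alpha>}" "distinct xs" using finite_distinct_list by blast
  define ws where "ws = map (\<lambda>\<alpha>. the (e \<alpha>)) xs"
  have "inj_on (\<lambda>\<alpha>. the (e \<alpha>)) (set xs)"
  proof (rule inj_onI)
    fix \<alpha> \<beta> assume a: "\<alpha> \<in> set xs" "\<beta> \<in> set xs" "the (e \<alpha>) = the (e \<beta>)"
    then obtain v w where "e \<alpha> = Some v" "e \<beta> = Some w" "jreal ty \<alpha>" "jreal ty \<beta>" using xs by auto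
    then show "\<alpha> = \<beta>" using real_inj[OF e] a(3) by simp
  qed
  then have dw: "distinct ws" unfolding ws_def using xs(2) by (simp add: distinct_map)
  have uw: "set ws \<subseteq> urt" unfolding ws_def using xs(1) real_urt[OF e] by auto
  define Bp where "Bp = (\<lambda>(\<alpha>, \<beta>). (Bt \<alpha> \<beta>, bit (the (e \<alpha>)) (the (e \<beta>)))) ` {(\<alpha>, \<beta>). \<alpha> \<in> dom e \<and> \<beta> \<in> dom e \<and> jadj ty \<alpha> \<beta>}"
  have "finite {(\<alpha>, \<beta>). \<alpha> \<in> dom e \<and> \<beta> \<in> dom e \<and> jadj ty \<alpha> \<beta>}" by (rule finite_subset[of _ "dom e \<times> dom e"]) (use fin in auto)
  then have "finite Bp" unfolding Bp_def by simp
  then obtain bs where bs: "set bs = Bp" using finite_list by blast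
  have good: "goodc (Bt \<alpha> \<beta>)" if "\<alpha> \<in> dom e" "\<beta> \<in> dom e" "jadj ty \<alpha> \<beta>" for \<alpha> \<beta>
    using that adm_jav[OF e] unfolding goodc_def by auto
  have goodr: "goodc (Rb \<alpha> m)" if "\<alpha> \<in> set xs" for \<alpha> m
    using that adm_jav[OF e] xs(1) unfolding goodc_def by auto
  obtain z1 where z1: "holds s z1" using c unfolding cnd_def by blast
  define z2 where "z2 c = (case c of Bt \<alpha> \<beta> \<Rightarrow> (if \<alpha> \<in> dom e \<and> \<beta> \<in> dom e \<and> jadj ty \<alpha> \<beta> then bit (the (e \<alpha>)) (the (e \<beta>)) else z1 c) | Rb _ _ \<Rightarrow> z1 c)" for c
  have "holds (s @ bs) z2"
  proof -
    have "z2 c = b" if cb: "(c, b) \<in> set s" for c b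
    proof -
      have "\<not> goodc c" using cb c unfolding cnd_def by force
      then have "z2 c = z1 c" unfolding z2_def using good by (cases c) auto
      then show ?thesis using z1 cb unfolding holds_def by auto
    qed
    moreover have "z2 c = b" if cb: "(c, b) \<in> set bs" for c b
      using cb unfolding bs Bp_def z2_def by auto
    ultimately show ?thesis unfolding holds_def by auto
  qed
  moreover have "\<forall>c\<in>fst ` set (s @ bs). \<forall>\<alpha>\<in>set xs. \<forall>m. c \<noteq> Rb \<alpha> m"
  proof (intro ballI allI notI)
    fix c \<alpha> m assume a: "c \<in> fst ` set (s @ bs)" "\<alpha> \<in> set xs" "c = Rb \<alpha> m"
    have "c \<notin> fst ` set bs" using a(3) unfolding bs Bp_def by auto
    then have "c \<in> fst ` set s" using a(1) by auto
    moreover have "\<forall>c\<in>fst ` set s. \<not> goodc c" using c unfolding cnd_def by (elim conjE)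
    ultimately have "\<not> goodc c" by (rule bspec[rotated])
    then show False using goodr[OF a(2), of m] unfolding a(3) by (rule notE)
  qed
  ultimately have "free_cond xs (s @ bs)" unfolding free_cond_def using xs(2) by blast
  then have "meets D (s @ bs) xs (\<lambda>a. rl G (ws ! a))" by (rule gen[OF _ _ dw uw]) (simp add: ws_def)
  then obtain z where z: "z \<in> D" "holds (s @ bs) z" "\<forall>a<length xs. \<forall>m. z (Rb (xs ! a) m) = rl G (ws ! a) m"
    unfolding meets_def by blast
  have "agr G e s z" unfolding agr_def
  proof (intro conjI allI impI)
    show "holds s z" using z(2) unfolding holds_def by auto
    fix \<alpha> \<beta> v w assume "e \<alpha> = Some v" "e \<beta> = Some w" "jadj ty \<alpha> \<beta>"
    then have "(Bt \<alpha> \<beta>, bit v w) \<in> set bs" unfolding bs Bp_def by (intro image_eqI[of _ _ "(\<alpha>, \<beta>)"]) auto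
    then show "z (Bt \<alpha> \<beta>) = bit v w" using z(2) unfolding holds_def by auto
  next
    fix \<alpha> v m assume a: "e \<alpha> = Some v" "jreal ty \<alpha>"
    then have "\<alpha> \<in> set xs" using xs(1) by auto
    then obtain j where j: "j < length xs" "xs ! j = \<alpha>" by (meson in_set_conv_nth)
    then show "z (Rb \<alpha> m) = rl G v m" using z(3) a unfolding ws_def by auto
  qed
  then show ?thesis using z(1) by blast
qed

text \<open>Weakens \<open>agr\<close> to the first \<open>M\<close> digits: a newly added bottom
  object can match the row of \<open>z\<close> on a finite initial segment only.\<close>

definition inv_z :: "(bool list el \<times> nat \<Rightarrow> bool) \<Rightarrow> (co \<Rightarrow> bool) \<Rightarrow> nat \<Rightarrow> (ix \<Rightarrow> hc el option) \<Rightarrow> bool" where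
  "inv_z G z M e \<longleftrightarrow> adm e \<and> (\<forall>\<alpha> \<beta> v w. e \<alpha> = Some v \<longrightarrow> e \<beta> = Some w \<longrightarrow> jadj ty \<alpha> \<beta> \<longrightarrow> z (Bt \<alpha> \<beta>) = bit v w) \<and>
    (\<forall>\<alpha> v m. e \<alpha> = Some v \<longrightarrow> jreal ty \<alpha> \<longrightarrow> m < M \<longrightarrow> z (Rb \<alpha> m) = rl G v m)"

lemma add_one0:
  assumes e: "inv_z G z M e" and av: "jav n ty \<alpha>" and pa: "\<And>\<gamma>. \<gamma> \<in> par \<alpha> \<Longrightarrow> e \<gamma> \<noteq> None"
  shows "\<exists>e'. inv_z G z M e' \<and> e \<subseteq>\<^sub>m e' \<and> \<alpha> \<in> dom e'"
proof (cases "e \<alpha>")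
  case None
  have ad: "adm e" using e unfolding inv_z_def by blast
  obtain w where w: "adm (e(\<alpha> \<mapsto> w))" "fits G z M e \<alpha> w" using forth[OF ad av None pa] by blast
  have f1: "bit w v = z (Bt \<alpha> \<beta>)" if "e \<beta> = Some v" "jadj ty \<alpha> \<beta>" for \<beta> v using w(2) that unfolding fits_def by blast
  have f2: "bit v w = z (Bt \<beta> \<alpha>)" if "e \<beta> = Some v" "jadj ty \<beta> \<alpha>" for \<beta> v using w(2) that unfolding fits_def by blast
  have f3: "rl G w m = z (Rb \<alpha> m)" if "jreal ty \<alpha>" "m < M" for m using w(2) that unfolding fits_def by blast
  have "inv_z G z M (e(\<alpha> \<mapsto> w))" unfolding inv_z_def
  proof (intro conjI allI impI)
    show "adm (e(\<alpha> \<mapsto> w))" by (rule w(1))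
    fix \<beta> \<gamma> v u assume a: "(e(\<alpha> \<mapsto> w)) \<beta> = Some v" "(e(\<alpha> \<mapsto> w)) \<gamma> = Some u" "jadj ty \<beta> \<gamma>"
    show "z (Bt \<beta> \<gamma>) = bit v u"
      using a f1[of \<gamma> u] f2[of \<beta> v] e jadj_irrefl[of ty \<alpha>] unfolding inv_z_def
      by (cases "\<beta> = \<alpha>"; cases "\<gamma> = \<alpha>") auto
  next
    fix \<beta> v m assume a: "(e(\<alpha> \<mapsto> w)) \<beta> = Some v" "jreal ty \<beta>" "m < M"
    show "z (Rb \<beta> m) = rl G v m"
      using a f3[of m] e unfolding inv_z_def by (cases "\<beta> = \<alpha>") auto
  qed
  then show ?thesis using None by (intro exI[of _ "e(\<alpha> \<mapsto> w)"]) (auto simp: map_le_def)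
next
  case (Some v)
  then show ?thesis using e map_le_refl by blast
qed

lemma add_one:
  assumes e: "inv_z G z M e" and av: "jav n ty \<alpha>"
  shows "\<exists>e'. inv_z G z M e' \<and> e \<subseteq>\<^sub>m e' \<and> \<alpha> \<in> dom e'"
proof (cases \<alpha>)
  case (I k a)
  then show ?thesis using add_one0[OF e av] by simp
next
  case (J s k a b)
  then have "jav n ty (I k a)" using av by simp
  then obtain e1 where e1: "inv_z G z M e1" "e \<subseteq>\<^sub>m e1" "I k a \<in> dom e1" using add_one0[OF e, of "I k a"] by auto
  then obtain e2 where "inv_z G z M e2" "e1 \<subseteq>\<^sub>m e2" "\<alpha> \<in> dom e2" using add_one0[OF e1(1) av] J by auto
  then show ?thesis using map_le_trans[OF e1(2)] by blast
qed

lemma add_all: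
  assumes "finite A" "\<And>\<alpha>. \<alpha> \<in> A \<Longrightarrow> jav n ty \<alpha>" and e: "inv_z G z M e"
  shows "\<exists>e'. inv_z G z M e' \<and> e \<subseteq>\<^sub>m e' \<and> A \<subseteq> dom e'"
  using assms(1,2)
proof (induction A)
  case empty then show ?case using e map_le_refl by blast
next
  case (insert \<alpha> A)
  then obtain e1 where e1: "inv_z G z M e1" "e \<subseteq>\<^sub>m e1" "A \<subseteq> dom e1" by auto
  obtain e2 where e2: "inv_z G z M e2" "e1 \<subseteq>\<^sub>m e2" "\<alpha> \<in> dom e2" using add_one[OF e1(1), of \<alpha>] insert.prems by auto
  have "A \<subseteq> dom e2" using e1(3) map_le_implies_dom_le[OF e2(2)] by blast
  then show ?case using e2 map_le_trans[OF e1(2) e2(2)] by blast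
qed

text \<open>Meaningful coordinates in \<open>F\<close> are decided by assigning objects to their
  indices with the forth step; the remaining ones are recorded in the list.\<close>

lemma extend_cnd:
  assumes c: "cnd e s" and a: "agr G e s z" and F: "finite F"
  shows "\<exists>e' s'. cnd e' s' \<and> e \<subseteq>\<^sub>m e' \<and> set s \<subseteq> set s' \<and> (\<forall>z'. agr G e' s' z' \<longrightarrow> z' \<in> cyl F z)"
proof -
  define A where "A = (\<Union>c\<in>{c\<in>F. goodc c}. case c of Rb \<alpha> m \<Rightarrow> {\<alpha>} | Bt \<alpha> \<beta> \<Rightarrow> {\<alpha>, \<beta>})"
  define M where "M = Suc (Max ((\<lambda>c. case c of Rb \<alpha> m \<Rightarrow> m | Bt _ _ \<Rightarrow> 0) ` F \<union> {0}))"
  have M: "m < M" if "Rb \<alpha> m \<in> F" for \<alpha> m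
  proof -
    have "m \<in> (\<lambda>c. case c of Rb \<alpha> m \<Rightarrow> m | Bt _ _ \<Rightarrow> 0) ` F \<union> {0}" by (intro UnI1 image_eqI[OF _ that]) simp
    then have "m \<le> Max ((\<lambda>c. case c of Rb \<alpha> m \<Rightarrow> m | Bt _ _ \<Rightarrow> 0) ` F \<union> {0})" using F by (intro Max_ge) auto
    then show ?thesis unfolding M_def by simp
  qed
  have fA: "finite A" unfolding A_def using F by (auto split: co.split)
  have Aav: "jav n ty \<alpha>" if "\<alpha> \<in> A" for \<alpha> using that unfolding A_def goodc_def by (auto split: co.splits)
  have "inv_z G z M e" using c a unfolding inv_z_def cnd_def agr_def by simp
  then obtain e' where e': "inv_z G z M e'" "e \<subseteq>\<^sub>m e'" "A \<subseteq> dom e'" using add_all[OF fA Aav] by blast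
  obtain cs where cs: "set cs = {c\<in>F. \<not> goodc c}" using finite_list[of "{c\<in>F. \<not> goodc c}"] F by auto
  define s' where "s' = s @ map (\<lambda>c. (c, z c)) cs"
  have hs: "holds s' z" using a unfolding agr_def holds_def s'_def by auto
  have "\<not> goodc d" if "d \<in> fst ` set s'" for d
    using that c cs unfolding s'_def cnd_def by auto
  then have "cnd e' s'" unfolding cnd_def using e'(1) hs unfolding inv_z_def by blast
  moreover have "z' \<in> cyl F z" if z': "agr G e' s' z'" for z'
    unfolding cyl_def
  proof (intro CollectI ballI)
    fix d assume d: "d \<in> F"
    show "z' d = z d"
    proof (cases "goodc d")
      case False
      then have "(d, z d) \<in> set s'" using cs d unfolding s'_def by auto
      then show ?thesis using z' unfolding agr_def holds_def by blast
    next
      case True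
      show ?thesis
      proof (cases d)
        case (Rb \<alpha> m)
        then have "\<alpha> \<in> A" using True d unfolding A_def by force
        then obtain v where v: "e' \<alpha> = Some v" using e'(3) by blast
        have "jreal ty \<alpha>" using True Rb unfolding goodc_def by simp
        then have "z' d = rl G v m" "z d = rl G v m" using z' e'(1) v M[of \<alpha> m] d Rb unfolding agr_def inv_z_def by auto
        then show ?thesis by simp
      next
        case (Bt \<alpha> \<beta>)
        then have "\<alpha> \<in> A" "\<beta> \<in> A" using True d unfolding A_def by force+
        then obtain v w where v: "e' \<alpha> = Some v" "e' \<beta> = Some w" using e'(3) by blast
        have "jadj ty \<alpha> \<beta>" using True Bt unfolding goodc_def by simp
        then have "z' d = bit v w" "z d = bit v w" using z' e'(1) v Bt unfolding agr_def inv_z_def by auto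
        then show ?thesis by simp
      qed
    qed
  qed
  moreover have "set s \<subseteq> set s'" unfolding s'_def by simp
  ultimately show ?thesis using e'(2) by blast
qed

text \<open>The requirements of the construction: enter an open set, give an index an object, and
  give an object an index, once for the indices \<open>I\<close> and once for \<open>J\<close>.
  Objects are named by trees over positions, which keeps the list countable.\<close>

type_synonym task = "nat + ix + (kd \<times> bool \<times> nat \<times> nat el) + (bool \<times> nat el)"

definition sidept :: "bool \<Rightarrow> pt" where
  "sidept s = (if s then x else y)"

definition task_done :: "(nat \<Rightarrow> (co \<Rightarrow> bool) set) \<Rightarrow> (bool list el \<times> nat \<Rightarrow> bool) \<Rightarrow> task \<Rightarrow> (ix \<Rightarrow> hc el option) \<Rightarrow> (co \<times> bool) list \<Rightarrow> bool" where
  "task_done D G t e s = (case t of Inl q \<Rightarrow> (\<forall>z. agr G e s z \<longrightarrow> z \<in> D q)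
     | Inr (Inl \<alpha>) \<Rightarrow> (jav n ty \<alpha> \<longrightarrow> \<alpha> \<in> dom e)
     | Inr (Inr (Inl (k, sd, l, u))) \<Rightarrow> (ev (sidept sd) l u \<in> Ob k \<longrightarrow> (\<exists>a. e (I k a) = Some (ev (sidept sd) l u)))
     | Inr (Inr (Inr (sd, u))) \<Rightarrow> (enat (lam sd + 1) < n \<longrightarrow> (\<exists>k a b. e (J sd k a b) = Some (ev (sidept sd) (lam sd + 1) u))))"

lemma EL_ev: "EL s l = range (ev (sidept s) l)"
  unfolding EL_def sidept_def range_ev ..

lemma do_task:
  assumes c: "cnd e s" and D: "\<And>q. opn (D q)"
    and gen: "\<And>q s xs ws. free_cond xs s \<Longrightarrow> length ws = length xs \<Longrightarrow> distinct ws \<Longrightarrow> set ws \<subseteq> urt \<Longrightarrow> meets (D q) s xs (\<lambda>a. rl G (ws ! a))"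
  shows "\<exists>e' s'. cnd e' s' \<and> e \<subseteq>\<^sub>m e' \<and> set s \<subseteq> set s' \<and> task_done D G t e' s'"
proof -
  have ad: "adm e" using c unfolding cnd_def by blast
  have keep: "cnd e' s" if "adm e'" for e' using c that unfolding cnd_def by blast
  consider q where "t = Inl q" | \<alpha> where "t = Inr (Inl \<alpha>)" | k sd l u where "t = Inr (Inr (Inl (k, sd, l, u)))" | sd u where "t = Inr (Inr (Inr (sd, u)))"
    by (metis sumE surj_pair)
  then show ?thesis
  proof cases
    case (1 q)
    obtain z where z: "z \<in> D q" "agr G e s z" using ex_agr[OF c gen[of _ _ _ q]] by blast
    obtain F where F: "finite F" "cyl F z \<subseteq> D q" using D[of q] z(1) unfolding opn_def by blast
    obtain e' s' where es: "cnd e' s'" "e \<subseteq>\<^sub>m e'" "set s \<subseteq> set s'" "\<forall>z'. agr G e' s' z' \<longrightarrow> z' \<in> cyl F z"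
      using extend_cnd[OF c z(2) F(1)] by blast
    have "task_done D G t e' s'" unfolding task_done_def 1 using es(4) F(2) by auto
    then show ?thesis using es by blast
  next
    case (2 \<alpha>)
    show ?thesis
    proof (cases "jav n ty \<alpha>")
      case True
      obtain z where z: "z \<in> D 0" "agr G e s z" using ex_agr[OF c gen[of _ _ _ 0]] by blast
      have "inv_z G z 0 e" using ad z(2) unfolding inv_z_def agr_def by simp
      then obtain e' where e': "inv_z G z 0 e'" "e \<subseteq>\<^sub>m e'" "\<alpha> \<in> dom e'" using add_one[OF _ True] by blast
      have "cnd e' s" using keep e'(1) unfolding inv_z_def by blast
      moreover have "task_done D G t e' s" unfolding task_done_def 2 using e'(3) by simp
      ultimately show ?thesis using e'(2) by blast
    next
      case False
      then have "task_done D G t e s" unfolding task_done_def 2 by simp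
      then show ?thesis using c map_le_refl by blast
    qed
  next
    case (3 k sd l u)
    show ?thesis
    proof (cases "ev (sidept sd) l u \<in> Ob k")
      case True
      then obtain e' a where e': "adm e'" "e \<subseteq>\<^sub>m e'" "e' (I k a) = Some (ev (sidept sd) l u)" using back_I[OF ad True] by blast
      then have "task_done D G t e' s" unfolding task_done_def 3 by auto
      then show ?thesis using e' keep by blast
    next
      case False
      then have "task_done D G t e s" unfolding task_done_def 3 by simp
      then show ?thesis using c map_le_refl by blast
    qed
  next
    case (4 sd u)
    show ?thesis
    proof (cases "enat (lam sd + 1) < n")
      case True
      have "ev (sidept sd) (lam sd + 1) u \<in> EL sd (lam sd + 1)" unfolding EL_ev by simp
      then obtain e' k a b where e': "adm e'" "e \<subseteq>\<^sub>m e'" "e' (J sd k a b) = Some (ev (sidept sd) (lam sd + 1) u)" using back_J[OF ad _ True] by blast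
      then have "task_done D G t e' s" unfolding task_done_def 4 by auto
      then show ?thesis using e' keep by blast
    next
      case False
      then have "task_done D G t e s" unfolding task_done_def 4 by simp
      then show ?thesis using c map_le_refl by blast
    qed
  qed
qed

lemma generic_enumeration:
  assumes D: "\<And>q::nat. opn (D q)" and W: "opn W" "W \<noteq> {}"
    and gen: "\<And>q s xs ws. free_cond xs s \<Longrightarrow> length ws = length xs \<Longrightarrow> distinct ws \<Longrightarrow> set ws \<subseteq> urt \<Longrightarrow> meets (D q) s xs (\<lambda>a. rl G (ws ! a))"
  shows "\<exists>z \<epsilon>. z \<in> W \<and> (\<forall>q. z \<in> D q) \<and>
    (\<forall>k a. javk n ty k \<longrightarrow> \<epsilon> (I k a) \<in> Ob k) \<and>
    (\<forall>s k a b. jav n ty (J s k a b) \<longrightarrow> \<epsilon> (J s k a b) \<in> EL s (lam s + 1) \<and> labeq (Cm s) (\<epsilon> (I k a)) (\<epsilon> (J s k a b))) \<and>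
    (\<forall>k. \<forall>w\<in>Ob k. \<exists>a. \<epsilon> (I k a) = w) \<and>
    (\<forall>s. enat (lam s + 1) < n \<longrightarrow> (\<forall>w\<in>EL s (lam s + 1). \<exists>k a b. jav n ty (J s k a b) \<and> \<epsilon> (J s k a b) = w)) \<and>
    (\<forall>\<alpha> \<beta>. jav n ty \<alpha> \<longrightarrow> jav n ty \<beta> \<longrightarrow> jadj ty \<alpha> \<beta> \<longrightarrow> z (Bt \<alpha> \<beta>) = bit (\<epsilon> \<alpha>) (\<epsilon> \<beta>)) \<and>
    (\<forall>\<alpha> m. jav n ty \<alpha> \<longrightarrow> jreal ty \<alpha> \<longrightarrow> z (Rb \<alpha> m) = rl G (\<epsilon> \<alpha>) m)"
proof -
  have dt: "\<exists>e' s'. cnd e' s' \<and> e \<subseteq>\<^sub>m e' \<and> set s \<subseteq> set s' \<and> task_done D G t e' s'" if "cnd e s" for e s t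
    by (rule do_task[OF that D]) (rule gen)
  obtain z0 where z0: "z0 \<in> W" using W by blast
  obtain F0 where F0: "finite F0" "cyl F0 z0 \<subseteq> W" using W(1) z0 unfolding opn_def by blast
  have c0: "cnd Map.empty []" unfolding cnd_def holds_def using adm_empty by simp
  have a0: "agr G Map.empty [] z0" unfolding agr_def holds_def by simp
  obtain e0 s0 where p0: "cnd e0 s0" "\<forall>z'. agr G e0 s0 z' \<longrightarrow> z' \<in> cyl F0 z0" using extend_cnd[OF c0 a0 F0(1)] by blast
  have "\<exists>f. \<forall>k. (cnd (fst (f k)) (snd (f k)) \<and> (k = 0 \<longrightarrow> f k = (e0, s0))) \<and>
    (fst (f k) \<subseteq>\<^sub>m fst (f (Suc k)) \<and> set (snd (f k)) \<subseteq> set (snd (f (Suc k))) \<and> task_done D G (from_nat k) (fst (f (Suc k))) (snd (f (Suc k))))"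
  proof (rule dependent_nat_choice)
    show "\<exists>p. cnd (fst p) (snd p) \<and> ((0::nat) = 0 \<longrightarrow> p = (e0, s0))" using p0(1) by auto
    fix p :: "(ix \<Rightarrow> hc el option) \<times> (co \<times> bool) list" and k :: nat
    assume "cnd (fst p) (snd p) \<and> (k = 0 \<longrightarrow> p = (e0, s0))"
    then have "cnd (fst p) (snd p)" by blast
    then obtain e' s' where "cnd e' s' \<and> fst p \<subseteq>\<^sub>m e' \<and> set (snd p) \<subseteq> set s' \<and> task_done D G (from_nat k) e' s'"
      using dt[of "fst p" "snd p" "from_nat k"] by blast
    then show "\<exists>p'. (cnd (fst p') (snd p') \<and> (Suc k = 0 \<longrightarrow> p' = (e0, s0))) \<and>
       (fst p \<subseteq>\<^sub>m fst p' \<and> set (snd p) \<subseteq> set (snd p') \<and> task_done D G (from_nat k) (fst p') (snd p'))"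
      by (intro exI[of _ "(e', s')"]) auto
  qed
  then obtain f where f: "\<And>k. cnd (fst (f k)) (snd (f k))" "f 0 = (e0, s0)" "\<And>k. fst (f k) \<subseteq>\<^sub>m fst (f (Suc k))"
    "\<And>k. set (snd (f k)) \<subseteq> set (snd (f (Suc k)))" "\<And>k. task_done D G (from_nat k) (fst (f (Suc k))) (snd (f (Suc k)))" by auto
  define e where "e k = fst (f k)" for k
  define s where "s k = snd (f k)" for k
  have em: "e k \<subseteq>\<^sub>m e k'" if "k \<le> k'" for k k'
    using that unfolding e_def by (induction rule: dec_induct) (auto intro: map_le_trans f(3))
  have sm: "set (s k) \<subseteq> set (s k')" if "k \<le> k'" for k k'
    using that unfolding s_def by (induction rule: dec_induct) (use f(4) in blast)+
  have cn: "cnd (e k) (s k)" for k unfolding e_def s_def by (rule f(1))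
  have ad: "adm (e k)" for k using cn unfolding cnd_def by blast
  define \<epsilon> where "\<epsilon> \<alpha> = the (e (LEAST k. \<alpha> \<in> dom (e k)) \<alpha>)" for \<alpha>
  have \<epsilon>: "\<epsilon> \<alpha> = v" if v: "e k \<alpha> = Some v" for k \<alpha> v
  proof -
    let ?K = "LEAST k. \<alpha> \<in> dom (e k)"
    have 1: "\<alpha> \<in> dom (e k)" using v by blast
    have "?K \<le> k" by (rule Least_le) (rule 1)
    moreover have "\<alpha> \<in> dom (e ?K)" by (rule LeastI[of "\<lambda>k. \<alpha> \<in> dom (e k)"]) (rule 1)
    ultimately have "e k \<alpha> = e ?K \<alpha>" using em[of ?K k] unfolding map_le_def by simp
    then show ?thesis unfolding \<epsilon>_def using v by (metis option.sel)
  qed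
  have task: "task_done D G t (e (Suc (to_nat t))) (s (Suc (to_nat t)))" for t
    using f(5)[of "to_nat t"] unfolding e_def s_def by simp
  have dom: "\<exists>k v. e k \<alpha> = Some v \<and> \<epsilon> \<alpha> = v" if "jav n ty \<alpha>" for \<alpha>
  proof -
    have "\<alpha> \<in> dom (e (Suc (to_nat (Inr (Inl \<alpha>) :: task))))" using task[of "Inr (Inl \<alpha>)"] that unfolding task_done_def by simp
    then show ?thesis using \<epsilon> by blast
  qed
  \<comment> \<open>A meaningless coordinate is \<open>False\<close> unless some condition demands
    \<open>True\<close>.\<close>
  define z where "z c = (if goodc c then (case c of Rb \<alpha> m \<Rightarrow> rl G (\<epsilon> \<alpha>) m | Bt \<alpha> \<beta> \<Rightarrow> bit (\<epsilon> \<alpha>) (\<epsilon> \<beta>)) else (\<exists>k. (c, True) \<in> set (s k)))" for c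
  have ag: "agr G (e k) (s k) z" for k
    unfolding agr_def
  proof (intro conjI allI impI)
    have "z c = b" if cb: "(c, b) \<in> set (s k)" for c b
    proof -
      have "\<forall>c\<in>fst ` set (s k). \<not> goodc c" using cn[of k] unfolding cnd_def by (elim conjE)
      then have "\<not> goodc c" using cb by force
      then have zc: "z c = (\<exists>k. (c, True) \<in> set (s k))" unfolding z_def by simp
      have "b" if k': "(c, True) \<in> set (s k')" for k'
      proof -
        have "(c, True) \<in> set (s (max k k'))" "(c, b) \<in> set (s (max k k'))" using sm[of k "max k k'"] sm[of k' "max k k'"] k' cb by auto
        moreover obtain z' where "holds (s (max k k')) z'" using cn[of "max k k'"] unfolding cnd_def by blast
        ultimately have "z' c = True" "z' c = b" unfolding holds_def by fastforce+
        then show b by simp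
      qed
      then show ?thesis using zc cb by (cases b) auto
    qed
    then show "holds (s k) z" unfolding holds_def by auto
    fix \<alpha> \<beta> v w assume a: "e k \<alpha> = Some v" "e k \<beta> = Some w" "jadj ty \<alpha> \<beta>"
    then have "goodc (Bt \<alpha> \<beta>)" using adm_jav[OF ad] unfolding goodc_def by auto
    then show "z (Bt \<alpha> \<beta>) = bit v w" using \<epsilon>[OF a(1)] \<epsilon>[OF a(2)] unfolding z_def by simp
  next
    fix \<alpha> v m assume a: "e k \<alpha> = Some v" "jreal ty \<alpha>"
    then have "goodc (Rb \<alpha> m)" using adm_jav[OF ad] unfolding goodc_def by auto
    then show "z (Rb \<alpha> m) = rl G v m" using \<epsilon>[OF a(1)] unfolding z_def by simp
  qed
  have "z \<in> W"
  proof -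
    have "agr G e0 s0 z" using ag[of 0] f(2) unfolding e_def s_def by simp
    then show ?thesis using p0(2) F0(2) by blast
  qed
  moreover have "z \<in> D q" for q
    using task[of "Inl q"] ag[of "Suc (to_nat (Inl q :: task))"] unfolding task_done_def by simp
  moreover have "\<epsilon> (I k a) \<in> Ob k" if "javk n ty k" for k a
  proof -
    obtain j v where j: "e j (I k a) = Some v" "\<epsilon> (I k a) = v" using dom[of "I k a"] \<open>javk n ty k\<close> by auto
    then show ?thesis using adm_okx[OF ad j(1)] by simp
  qed
  moreover have "\<epsilon> (J sd k a b) \<in> EL sd (lam sd + 1) \<and> labeq (Cm sd) (\<epsilon> (I k a)) (\<epsilon> (J sd k a b))" if jv: "jav n ty (J sd k a b)" for sd k a b
  proof -
    obtain j v where j: "e j (J sd k a b) = Some v" "\<epsilon> (J sd k a b) = v" using dom[OF jv] by auto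
    then obtain po where "e j (I k a) = Some po" "labeq (Cm sd) po v" "v \<in> EL sd (lam sd + 1)" using adm_okx[OF ad j(1)] by auto
    then show ?thesis using \<epsilon> j(2) by simp
  qed
  moreover have "\<exists>a. \<epsilon> (I k a) = w" if w0: "w \<in> Ob k" for k w
  proof -
    have "\<exists>sd l. w \<in> EL sd l"
    proof (cases k)
      case (KC l)
      then show ?thesis using w0 KC_partnered(1)[of w] by (cases "l = i + 1") (auto simp: U_def split: if_splits)
    next
      case (KP s) then show ?thesis using w0 by (auto split: if_splits)
    next
      case (KT s)
      then obtain g where "g \<in> TT s" "w = rep (EL s (lam s + 1)) (Cm s) g" using w0 by (auto split: if_splits)
      then have "w \<in> EL s (lam s + 1)" using rep_props[of g "EL s (lam s + 1)" "Cm s"] unfolding TT_def by blast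
      then show ?thesis by blast
    next
      case (KH s l) then show ?thesis using w0 by (auto split: if_splits)
    qed
    then obtain sd l u where u: "w = ev (sidept sd) l u" unfolding EL_ev by blast
    then have "\<exists>a. e (Suc (to_nat (Inr (Inr (Inl (k, sd, l, u))) :: task))) (I k a) = Some w"
      using task[of "Inr (Inr (Inl (k, sd, l, u)))"] w0 unfolding task_done_def by simp
    then show ?thesis using \<epsilon> by blast
  qed
  moreover have "\<exists>k a b. jav n ty (J sd k a b) \<and> \<epsilon> (J sd k a b) = w" if n: "enat (lam sd + 1) < n" and w: "w \<in> EL sd (lam sd + 1)" for sd w
  proof -
    obtain u where u: "w = ev (sidept sd) (lam sd + 1) u" using w unfolding EL_ev by blast
    have "\<exists>k a b. e (Suc (to_nat (Inr (Inr (Inr (sd, u))) :: task))) (J sd k a b) = Some w"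
      using task[of "Inr (Inr (Inr (sd, u)))"] n u unfolding task_done_def by simp
    then show ?thesis using \<epsilon> adm_jav[OF ad] by blast
  qed
  moreover have "z (Bt \<alpha> \<beta>) = bit (\<epsilon> \<alpha>) (\<epsilon> \<beta>)" if "jav n ty \<alpha>" "jav n ty \<beta>" "jadj ty \<alpha> \<beta>" for \<alpha> \<beta>
    using that unfolding z_def goodc_def by simp
  moreover have "z (Rb \<alpha> m) = rl G (\<epsilon> \<alpha>) m" if "jav n ty \<alpha>" "jreal ty \<alpha>" for \<alpha> m
    using that unfolding z_def goodc_def by simp
  ultimately show ?thesis by (intro exI[of _ z] exI[of _ \<epsilon>]) blast
qed

end

section \<open>Relatedness depends only on the joint type\<close>

definition Pix :: "enat \<Rightarrow> jtype \<Rightarrow> bool \<Rightarrow> nat \<Rightarrow> ix set" where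
  "Pix n \<tau> s l = (if l < jlam \<tau> s then range (I (KC l))
     else if l = jlam \<tau> s then (if javk n \<tau> (KC l) then range (I (KC l)) else {}) \<union> range (I (KP s))
     else if l = jlam \<tau> s + 1 then {J s k a b |k a b. jav n \<tau> (J s k a b)}
     else range (I (KH s l)))"

definition pix :: "enat \<Rightarrow> jtype \<Rightarrow> bool \<Rightarrow> nat \<Rightarrow> nat \<Rightarrow> ix" where
  "pix n \<tau> s l = from_nat_into (Pix n \<tau> s l)"

text \<open>The bit between a common object and an object \<open>J\<close> is stored at the trace of
  the latter. In this way the two points share coordinates even above their first
  difference.\<close>

definition cob :: "ix \<Rightarrow> ix \<Rightarrow> co" where
  "cob \<alpha> \<beta> = (case \<beta> of J s k a b \<Rightarrow> (case \<alpha> of I (KC l) c \<Rightarrow> Bt \<alpha> (I k a) | _ \<Rightarrow> Bt \<alpha> \<beta>) | _ \<Rightarrow> Bt \<alpha> \<beta>)"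

definition phi :: "enat \<Rightarrow> jtype \<Rightarrow> bool \<Rightarrow> (co \<Rightarrow> bool) \<Rightarrow> pt" where
  "phi n \<tau> s z l k m = (enat l < n \<and> (case l of 0 \<Rightarrow> z (Rb (pix n \<tau> s 0 k) m)
     | Suc l' \<Rightarrow> z (cob (pix n \<tau> s l' m) (pix n \<tau> s l k))))"

lemma bpmap_phi: "bpmap (phi n \<tau> s)"
  unfolding bpmap_def
proof (intro allI)
  fix l k m show "bp (\<lambda>z. phi n \<tau> s z l k m)"
    unfolding phi_def by (cases l) (auto intro!: bp_conj bp_const bp_of_coord)
qed

context pairJ
begin

lemma Pix_jav:
  assumes "\<alpha> \<in> Pix n ty s l" "enat l < n" shows "jav n ty \<alpha>"
proof -
  consider "l < lam s" | "l = lam s" | "l = lam s + 1" | "l > lam s + 1" by linarith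
  then show ?thesis
  proof cases
    case 1
    then have "Ob (KC l) \<noteq> {}" using Ob_KC_full[OF assms(2) 1] EL_ne[of s l] by auto
    then have "javk n ty (KC l)" using Ob_avail by blast
    then show ?thesis using assms 1 unfolding Pix_def by auto
  next
    case 2
    then show ?thesis using assms javk_ty(2)[of s] unfolding Pix_def by (auto split: if_splits)
  next
    case 3
    then show ?thesis using assms unfolding Pix_def by auto
  next
    case 4
    then show ?thesis using assms javk_ty(4)[of s l] unfolding Pix_def by auto
  qed
qed

context
  fixes z :: "co \<Rightarrow> bool" and \<epsilon> :: "ix \<Rightarrow> hc el" and G
  assumes p1: "\<And>k a. javk n ty k \<Longrightarrow> \<epsilon> (I k a) \<in> Ob k"
    and p2: "\<And>s k a b. jav n ty (J s k a b) \<Longrightarrow> \<epsilon> (J s k a b) \<in> EL s (lam s + 1) \<and> labeq (Cm s) (\<epsilon> (I k a)) (\<epsilon> (J s k a b))"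
    and p3: "\<And>k w. w \<in> Ob k \<Longrightarrow> \<exists>a. \<epsilon> (I k a) = w"
    and p4: "\<And>s w. enat (lam s + 1) < n \<Longrightarrow> w \<in> EL s (lam s + 1) \<Longrightarrow> \<exists>k a b. jav n ty (J s k a b) \<and> \<epsilon> (J s k a b) = w"
    and p5: "\<And>\<alpha> \<beta>. jav n ty \<alpha> \<Longrightarrow> jav n ty \<beta> \<Longrightarrow> jadj ty \<alpha> \<beta> \<Longrightarrow> z (Bt \<alpha> \<beta>) = bit (\<epsilon> \<alpha>) (\<epsilon> \<beta>)"
    and p6: "\<And>\<alpha> m. jav n ty \<alpha> \<Longrightarrow> jreal ty \<alpha> \<Longrightarrow> z (Rb \<alpha> m) = rl G (\<epsilon> \<alpha>) m"
begin

lemma image_I: "javk n ty k \<Longrightarrow> \<epsilon> ` range (I k) = Ob k"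
  using p1 p3 by blast

lemma Pix_range:
  assumes n: "enat l < n" shows "\<epsilon> ` Pix n ty s l = EL s l"
proof -
  consider "l < lam s" | "l = lam s" | "l = lam s + 1" | "l > lam s + 1" by linarith
  then show ?thesis
  proof cases
    case 1
    have o: "Ob (KC l) = EL s l" by (rule Ob_KC_full[OF n 1])
    then have "javk n ty (KC l)" using Ob_avail EL_ne[of s l] by blast
    then show ?thesis using image_I o 1 unfolding Pix_def by simp
  next
    case 2
    have ln: "enat (lam s) < n" using n 2 by simp
    have "javk n ty (KP s)" using javk_ty(2) ln by blast
    then have P: "\<epsilon> ` range (I (KP s)) = EL s (lam s) - Cm s" using image_I ln by simp
    have C: "\<epsilon> ` (if javk n ty (KC l) then range (I (KC l)) else {}) = Cm s"
    proof (cases "javk n ty (KC l)")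
      case True
      then show ?thesis using image_I[OF True] Ob_KC_Cm[OF ln] 2 by simp
    next
      case False
      then have "Ob (KC l) = {}" using Ob_avail by blast
      then show ?thesis using Ob_KC_Cm[OF ln] 2 False by simp
    qed
    have "\<epsilon> ` Pix n ty s l = \<epsilon> ` (if javk n ty (KC l) then range (I (KC l)) else {}) \<union> \<epsilon> ` range (I (KP s))"
      unfolding Pix_def using 2 by (simp add: image_Un)
    then show ?thesis unfolding P C using Cm_sub[of s] 2 by blast
  next
    case 3
    have "\<epsilon> ` {J s k a b |k a b. jav n ty (J s k a b)} = EL s (lam s + 1)" (is "?L = ?R")
    proof
      show "?L \<subseteq> ?R" using p2 by blast
      show "?R \<subseteq> ?L"
      proof
        fix w assume "w \<in> ?R"
        then obtain k a b where "jav n ty (J s k a b)" "\<epsilon> (J s k a b) = w" using p4[of s w] n 3 by auto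
        then show "w \<in> ?L" by blast
      qed
    qed
    then show ?thesis using 3 unfolding Pix_def by simp
  next
    case 4
    then have "javk n ty (KH s l)" using javk_ty(4) n by simp
    then have "\<epsilon> ` range (I (KH s l)) = EL s l" using image_I 4 n by simp
    then show ?thesis using 4 unfolding Pix_def by simp
  qed
qed

lemma pix_in: "enat l < n \<Longrightarrow> pix n ty s l k \<in> Pix n ty s l"
  unfolding pix_def using Pix_range[of l s] EL_ne[of s l] by (intro from_nat_into) auto

lemma pix_range: "enat l < n \<Longrightarrow> range (\<lambda>k. \<epsilon> (pix n ty s l k)) = EL s l"
proof -
  assume n: "enat l < n"
  have "Pix n ty s l \<noteq> {}" using Pix_range[OF n, of s] EL_ne[of s l] by auto
  then have "range (pix n ty s l) = Pix n ty s l" unfolding pix_def by (intro range_from_nat_into) auto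
  then have "\<epsilon> ` range (pix n ty s l) = EL s l" using Pix_range[OF n] by simp
  then show ?thesis by (simp only: image_image)
qed

lemma phi_bits:
  assumes n: "enat (Suc l) < n" and a: "\<alpha> \<in> Pix n ty s l" and b: "\<beta> \<in> Pix n ty s (Suc l)"
  shows "z (cob \<alpha> \<beta>) = bit (\<epsilon> \<alpha>) (\<epsilon> \<beta>)"
proof -
  have n': "enat l < n" by (rule enat_Suc_lessD[OF n])
  have ja: "jav n ty \<alpha>" "jav n ty \<beta>" using Pix_jav a b n n' by blast+
  consider "Suc l < lam s" | "Suc l = lam s" | "l = lam s" | "l = lam s + 1" | "l > lam s + 1" by linarith
  then show ?thesis
  proof cases
    case 1
    then obtain c d where cd: "\<alpha> = I (KC l) c" "\<beta> = I (KC (Suc l)) d" using a b unfolding Pix_def by auto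
    then show ?thesis using p5[OF ja] unfolding cob_def by simp
  next
    case 2
    then obtain c where c: "\<alpha> = I (KC l) c" using a unfolding Pix_def by auto
    have "(\<exists>d. \<beta> = I (KC (Suc l)) d) \<or> (\<exists>d. \<beta> = I (KP s) d)" using b 2 unfolding Pix_def by (auto split: if_splits)
    then show ?thesis using p5[OF ja] c 2 unfolding cob_def by auto
  next
    case 3
    then obtain k c d where J: "\<beta> = J s k c d" using b unfolding Pix_def by auto
    have "(\<exists>e. \<alpha> = I (KC l) e \<and> javk n ty (KC l)) \<or> (\<exists>e. \<alpha> = I (KP s) e)" using a 3 unfolding Pix_def by (auto split: if_splits)
    then show ?thesis
    proof (elim disjE exE conjE)
      fix e assume e: "\<alpha> = I (KC l) e" "javk n ty (KC l)"
      have k: "javk n ty k" "jpk ty s k" using ja(2) J by auto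
      have "jadj ty \<alpha> (I k c)" using k(2) e 3 unfolding jpk_def by auto
      then have "z (Bt \<alpha> (I k c)) = bit (\<epsilon> \<alpha>) (\<epsilon> (I k c))" using p5[OF ja(1), of "I k c"] k by simp
      moreover have "\<epsilon> \<alpha> \<in> Cm s" using p1[OF e(2), of e] e(1) Ob_KC_Cm[of s] n' 3 by simp
      then have "bit (\<epsilon> \<alpha>) (\<epsilon> (I k c)) = bit (\<epsilon> \<alpha>) (\<epsilon> \<beta>)" using labeq_bit[of "Cm s"] p2[of s k c d] ja(2) J Cm_parts by blast
      ultimately show ?thesis unfolding cob_def J e(1) by simp
    next
      fix e assume e: "\<alpha> = I (KP s) e"
      then show ?thesis using p5[OF ja] J unfolding cob_def by simp
    qed
  next
    case 4
    then obtain k c d where J: "\<alpha> = J s k c d" using a unfolding Pix_def by auto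
    obtain e where "\<beta> = I (KH s (Suc l)) e" using b 4 unfolding Pix_def by auto
    then show ?thesis using p5[OF ja] J 4 unfolding cob_def by simp
  next
    case 5
    then obtain c d where cd: "\<alpha> = I (KH s l) c" "\<beta> = I (KH s (Suc l)) d" using a b unfolding Pix_def by auto
    then show ?thesis using p5[OF ja] 5 unfolding cob_def by simp
  qed
qed

lemma phi_enum:
  shows "enum_of n (EL s) bit (rl G) (\<lambda>l k. \<epsilon> (pix n ty s l k)) (phi n ty s z)"
proof -
  have n0: "enat 0 < n" using iN by (metis enat_ord_simps(2) gr_zeroI less_trans not_gr_zero)
  have "phi n ty s z 0 k m = rl G (\<epsilon> (pix n ty s 0 k)) m" for k m
  proof -
    let ?\<alpha> = "pix n ty s 0 k"
    have p: "?\<alpha> \<in> Pix n ty s 0" by (rule pix_in[OF n0])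
    have "jreal ty ?\<alpha>"
    proof (cases "lam s = 0")
      case True
      then show ?thesis using p unfolding Pix_def by (auto split: if_splits)
    next
      case False
      then show ?thesis using p unfolding Pix_def by auto
    qed
    then show ?thesis using p6 Pix_jav[OF p n0] n0 unfolding phi_def by simp
  qed
  moreover have "phi n ty s z (Suc l) k m = bit (\<epsilon> (pix n ty s l m)) (\<epsilon> (pix n ty s (Suc l) k))" if l: "enat (Suc l) < n" for l k m
    using phi_bits[OF l pix_in[OF enat_Suc_lessD[OF l]] pix_in[OF l]] l unfolding phi_def by simp
  moreover have "phi n ty s z l = (\<lambda>_ _. False)" if "\<not> enat l < n" for l
    using that unfolding phi_def by (intro ext) simp
  ultimately show ?thesis unfolding enum_of_def using pix_range by blast
qed

end

text \<open>A zero-one law: every nonempty open set contains a generic point whose two readings are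
  \<open>Frel\<close>-equivalent to \<open>hred n G x\<close> and \<open>hred n G y\<close>. So
  \<open>W0\<close> is dense if these are related and empty if they are not.\<close>

lemma pair_status:
  assumes n1: "1 \<le> n" and eq: "equiv (Xsp n) E" and FE: "Frel n \<subseteq> E"
    and inj: "\<And>w w'. w \<in> urt \<Longrightarrow> w' \<in> urt \<Longrightarrow> rl G w = rl G w' \<Longrightarrow> w = w'"
    and D: "\<And>q::nat. opn (D q)"
    and gen: "\<And>q s xs ws. free_cond xs s \<Longrightarrow> length ws = length xs \<Longrightarrow> distinct ws \<Longrightarrow> set ws \<subseteq> urt \<Longrightarrow> meets (D q) s xs (\<lambda>a. rl G (ws ! a))"
    and W0: "opn W0" "\<And>z. (\<And>q. z \<in> D q) \<Longrightarrow> (phi n ty True z \<in> Xsp n \<and> phi n ty False z \<in> Xsp n \<and> (phi n ty True z, phi n ty False z) \<in> E) \<longleftrightarrow> z \<in> W0"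
  shows "(hred n G x, hred n G y) \<in> E \<longleftrightarrow> W0 \<noteq> {}" "(hred n G x, hred n G y) \<in> E \<Longrightarrow> dns W0"
proof -
  have key: "\<exists>z\<in>W. z \<in> W0 \<longleftrightarrow> (hred n G x, hred n G y) \<in> E" if W: "opn W" "W \<noteq> {}" for W
  proof -
    have "\<exists>z \<epsilon>. z \<in> W \<and> (\<forall>q. z \<in> D q) \<and>
      (\<forall>k a. javk n ty k \<longrightarrow> \<epsilon> (I k a) \<in> Ob k) \<and>
      (\<forall>s k a b. jav n ty (J s k a b) \<longrightarrow> \<epsilon> (J s k a b) \<in> EL s (lam s + 1) \<and> labeq (Cm s) (\<epsilon> (I k a)) (\<epsilon> (J s k a b))) \<and>
      (\<forall>k. \<forall>w\<in>Ob k. \<exists>a. \<epsilon> (I k a) = w) \<and>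
      (\<forall>s. enat (lam s + 1) < n \<longrightarrow> (\<forall>w\<in>EL s (lam s + 1). \<exists>k a b. jav n ty (J s k a b) \<and> \<epsilon> (J s k a b) = w)) \<and>
      (\<forall>\<alpha> \<beta>. jav n ty \<alpha> \<longrightarrow> jav n ty \<beta> \<longrightarrow> jadj ty \<alpha> \<beta> \<longrightarrow> z (Bt \<alpha> \<beta>) = bit (\<epsilon> \<alpha>) (\<epsilon> \<beta>)) \<and>
      (\<forall>\<alpha> m. jav n ty \<alpha> \<longrightarrow> jreal ty \<alpha> \<longrightarrow> z (Rb \<alpha> m) = rl G (\<epsilon> \<alpha>) m)"
      by (rule generic_enumeration[OF D W]) (rule gen)
    then obtain z \<epsilon> where ze: "z \<in> W" "\<forall>q. z \<in> D q"
      "\<forall>k a. javk n ty k \<longrightarrow> \<epsilon> (I k a) \<in> Ob k"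
      "\<forall>s k a b. jav n ty (J s k a b) \<longrightarrow> \<epsilon> (J s k a b) \<in> EL s (lam s + 1) \<and> labeq (Cm s) (\<epsilon> (I k a)) (\<epsilon> (J s k a b))"
      "\<forall>k. \<forall>w\<in>Ob k. \<exists>a. \<epsilon> (I k a) = w"
      "\<forall>s. enat (lam s + 1) < n \<longrightarrow> (\<forall>w\<in>EL s (lam s + 1). \<exists>k a b. jav n ty (J s k a b) \<and> \<epsilon> (J s k a b) = w)"
      "\<forall>\<alpha> \<beta>. jav n ty \<alpha> \<longrightarrow> jav n ty \<beta> \<longrightarrow> jadj ty \<alpha> \<beta> \<longrightarrow> z (Bt \<alpha> \<beta>) = bit (\<epsilon> \<alpha>) (\<epsilon> \<beta>)"
      "\<forall>\<alpha> m. jav n ty \<alpha> \<longrightarrow> jreal ty \<alpha> \<longrightarrow> z (Rb \<alpha> m) = rl G (\<epsilon> \<alpha>) m"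
      by (elim exE conjE)
    have z: "z \<in> W" "\<And>q. z \<in> D q" using ze(1,2) by simp_all
    have e: "enum_of n (EL s) bit (rl G) (\<lambda>l k. \<epsilon> (pix n ty s l k)) (phi n ty s z)" for s
    proof (rule phi_enum)
      show "\<epsilon> (I k a) \<in> Ob k" if "javk n ty k" for k a using ze(3) that by simp
      show "\<epsilon> (J s k a b) \<in> EL s (lam s + 1) \<and> labeq (Cm s) (\<epsilon> (I k a)) (\<epsilon> (J s k a b))" if "jav n ty (J s k a b)" for s k a b
        using ze(4) that by blast
      show "\<exists>a. \<epsilon> (I k a) = w" if "w \<in> Ob k" for k w using ze(5) that by blast
      show "\<exists>k a b. jav n ty (J s k a b) \<and> \<epsilon> (J s k a b) = w" if "enat (lam s + 1) < n" "w \<in> EL s (lam s + 1)" for s w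
        using ze(6) that by blast
      show "z (Bt \<alpha> \<beta>) = bit (\<epsilon> \<alpha>) (\<epsilon> \<beta>)" if "jav n ty \<alpha>" "jav n ty \<beta>" "jadj ty \<alpha> \<beta>" for \<alpha> \<beta> using ze(7) that by blast
      show "z (Rb \<alpha> m) = rl G (\<epsilon> \<alpha>) m" if "jav n ty \<alpha>" "jreal ty \<alpha>" for \<alpha> m using ze(8) that by blast
    qed
    have en: "enum_of n (El (tks (sidept s))) bit (rl G) (\<lambda>l k. \<epsilon> (pix n ty s l k)) (phi n ty s z)" for s
      using e[of s] unfolding EL_def[abs_def] sidept_def by simp
    have X: "phi n ty s z \<in> Xsp n" "hred n G (sidept s) \<in> Xsp n" for s
      using El_enum_Xsp[OF en inj] El_enum_Xsp[OF hred_enum[OF n1] inj] by blast+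
    have "(phi n ty s z, hred n G (sidept s)) \<in> Frel n" for s
      using enum_of_tks_eq[OF en hred_enum[OF n1]] tks_eq_Frel[OF X n1] by blast
    then have "(phi n ty s z, hred n G (sidept s)) \<in> E" for s using FE by blast
    from this[of True] this[of False] have r: "(phi n ty True z, hred n G x) \<in> E" "(phi n ty False z, hred n G y) \<in> E"
      unfolding sidept_def by auto
    have "(phi n ty True z, phi n ty False z) \<in> E \<longleftrightarrow> (hred n G x, hred n G y) \<in> E"
      using r equivE[OF eq] by (meson symD transD)
    then show ?thesis using W0(2)[OF z(2)] X z(1) by blast
  qed
  show "dns W0" if h: "(hred n G x, hred n G y) \<in> E"
    unfolding dns_def
  proof (intro allI impI)
    fix F :: "co set" and z assume "finite F"
    then have "opn (cyl F z)" by (rule opn_cyl)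
    then show "cyl F z \<inter> W0 \<noteq> {}" using key[of "cyl F z"] h cyl_self by blast
  qed
  then show "(hred n G x, hred n G y) \<in> E \<longleftrightarrow> W0 \<noteq> {}"
    using key[OF W0(1)] key[OF opn_UNIV] by blast
qed

end

lemma opn_dns_rows_differ:
  fixes a b :: "nat \<Rightarrow> 'd"
  assumes inj: "inj a" and dj: "\<And>m m'. a m \<noteq> b m'"
  shows "opn {z :: 'd \<Rightarrow> bool. \<exists>m. z (a m) \<noteq> z (b m)}" "dns {z :: 'd \<Rightarrow> bool. \<exists>m. z (a m) \<noteq> z (b m)}"
proof -
  show "opn {z :: 'd \<Rightarrow> bool. \<exists>m. z (a m) \<noteq> z (b m)}" unfolding opn_def
  proof
    fix z :: "'d \<Rightarrow> bool" assume "z \<in> {z. \<exists>m. z (a m) \<noteq> z (b m)}"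
    then obtain m where "z (a m) \<noteq> z (b m)" by blast
    then show "\<exists>F. finite F \<and> cyl F z \<subseteq> {z. \<exists>m. z (a m) \<noteq> z (b m)}"
      by (intro exI[of _ "{a m, b m}"]) (auto simp: cyl_def)
  qed
  show "dns {z :: 'd \<Rightarrow> bool. \<exists>m. z (a m) \<noteq> z (b m)}" unfolding dns_def
  proof (intro allI impI)
    fix F :: "'d set" and z :: "'d \<Rightarrow> bool" assume F: "finite F"
    have "infinite (range a)" using inj by (simp add: range_inj_infinite)
    then have "\<not> range a \<subseteq> F" using F finite_subset by blast
    then obtain m where m: "a m \<notin> F" by blast
    let ?z = "z(a m := \<not> z (b m))"
    have "?z \<in> cyl F z" using m by (auto simp: cyl_def)
    moreover have "?z (a m) \<noteq> ?z (b m)" using dj[of m m] by (metis fun_upd_apply)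
    then have "?z \<in> {z. \<exists>m. z (a m) \<noteq> z (b m)}" by blast
    ultimately show "cyl F z \<inter> {z. \<exists>m. z (a m) \<noteq> z (b m)} \<noteq> {}" by blast
  qed
qed

definition relz :: "enat \<Rightarrow> (pt \<times> pt) set \<Rightarrow> jtype \<Rightarrow> (co \<Rightarrow> bool) \<Rightarrow> bool" where
  "relz n E \<tau> z \<longleftrightarrow> phi n \<tau> True z \<in> Xsp n \<and> phi n \<tau> False z \<in> Xsp n \<and> (phi n \<tau> True z, phi n \<tau> False z) \<in> E"

text \<open>There are countably many types, so one \<open>G\<close> is generic for the comeager sets
  of all of them; one more dense open set makes the reals of distinct trees different.\<close>

lemma ex_generic_reduction:
  assumes n1: "1 \<le> n" and eq: "equiv (Xsp n) E" and cl: "classifiable (Xtop n) E" and FE: "Frel n \<subseteq> E"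
  shows "\<exists>G R. (\<forall>w\<in>urt. \<forall>w'\<in>urt. rl G w = rl G w' \<longrightarrow> w = w') \<and>
    (\<forall>x y i. pairJ n x y i \<longrightarrow> ((hred n G x, hred n G y) \<in> E \<longleftrightarrow> R (pairJ.ty x y i))) \<and>
    (\<forall>x y i. pairJ n x y i \<longrightarrow> R (pairJ.ty x y i) \<longrightarrow> comeager {z. relz n E (pairJ.ty x y i) z})"
proof -
  have "\<exists>O'. opn O' \<and> comeager {z. relz n E \<tau> z \<longleftrightarrow> z \<in> O'}" for \<tau>
    using bp_classifiable[OF cl bpmap_phi bpmap_phi] unfolding relz_def bp_def by blast
  then obtain W where W: "\<And>\<tau>. opn (W \<tau>)" "\<And>\<tau>. comeager {z. relz n E \<tau> z \<longleftrightarrow> z \<in> W \<tau>}" by metis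
  from W(2) have "\<exists>D. \<forall>\<tau>. (\<forall>k::nat. opn (D \<tau> k) \<and> dns (D \<tau> k)) \<and> (\<Inter>k. D \<tau> k) \<subseteq> {z. relz n E \<tau> z \<longleftrightarrow> z \<in> W \<tau>}"
    unfolding comeager_def by (intro choice) blast
  then obtain D where D: "\<And>\<tau> k. opn (D \<tau> k)" "\<And>\<tau> k. dns (D \<tau> k)"
    "\<And>\<tau>. (\<Inter>k::nat. D \<tau> k) \<subseteq> {z. relz n E \<tau> z \<longleftrightarrow> z \<in> W \<tau>}" by blast
  let ?\<alpha> = "I (KC 0) 0" and ?\<beta> = "I (KC 0) 1"
  let ?N = "{z. \<exists>m. z (Rb ?\<alpha> m) \<noteq> z (Rb ?\<beta> m)}"
  have N: "opn ?N" "dns ?N" by (rule opn_dns_rows_differ[of "Rb ?\<alpha>" "Rb ?\<beta>"]; simp add: inj_def)+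
  define D' where "D' m = (case (from_nat m :: (jtype \<times> nat) option) of None \<Rightarrow> ?N | Some (\<tau>, k) \<Rightarrow> D \<tau> k)" for m
  have od: "opn (D' m)" "dns (D' m)" for m
    unfolding D'_def using D(1,2) N by (auto split: option.split prod.split)
  obtain G where "\<forall>q s xs ws. free_cond xs s \<longrightarrow> length ws = length xs \<longrightarrow> distinct ws \<longrightarrow> set ws \<subseteq> urt \<longrightarrow>
     meets (D' q) s xs (\<lambda>a. rl G (ws ! a))" using ex_generic_reals[of D'] od by blast
  then have G: "meets (D' q) s xs (\<lambda>a. rl G (ws ! a))" if "free_cond xs s" "length ws = length xs" "distinct ws" "set ws \<subseteq> urt" for q s xs ws
    using that by blast
  have DS: "D' (to_nat (Some (\<tau>, k))) = D \<tau> k" "D' (to_nat (None :: (jtype \<times> nat) option)) = ?N" for \<tau> k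
    unfolding D'_def by simp_all
  have inj: "w = w'" if w: "w \<in> urt" "w' \<in> urt" "rl G w = rl G w'" for w w'
  proof (rule ccontr)
    assume n: "w \<noteq> w'"
    have "free_cond [?\<alpha>, ?\<beta>] []" unfolding free_cond_def holds_def by simp
    then have "meets ?N [] [?\<alpha>, ?\<beta>] (\<lambda>a. rl G ([w, w'] ! a))"
      using G[of "[?\<alpha>, ?\<beta>]" "[]" "[w, w']" "to_nat (None :: (jtype \<times> nat) option)"] w n unfolding DS by simp
    then obtain z where z: "z \<in> ?N" "\<forall>a<length [?\<alpha>, ?\<beta>]. \<forall>m. z (Rb ([?\<alpha>, ?\<beta>] ! a) m) = rl G ([w, w'] ! a) m"
      unfolding meets_def by blast
    have "z (Rb ?\<alpha> m) = rl G w m" "z (Rb ?\<beta> m) = rl G w' m" for m using z(2)[rule_format, of 0 m] z(2)[rule_format, of 1 m] by simp_all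
    then show False using z(1) w(3) by simp
  qed
  have st: "(hred n G x, hred n G y) \<in> E \<longleftrightarrow> W (pairJ.ty x y i) \<noteq> {}"
    "(hred n G x, hred n G y) \<in> E \<Longrightarrow> dns (W (pairJ.ty x y i))" if p: "pairJ n x y i" for x y i
  proof -
    let ?t = "pairJ.ty x y i"
    have g: "meets (D ?t q) s xs (\<lambda>a. rl G (ws ! a))" if "free_cond xs s" "length ws = length xs" "distinct ws" "set ws \<subseteq> urt" for q s xs ws
      using G[OF that, of "to_nat (Some (?t, q))"] unfolding DS .
    have w: "(phi n ?t True z \<in> Xsp n \<and> phi n ?t False z \<in> Xsp n \<and> (phi n ?t True z, phi n ?t False z) \<in> E) \<longleftrightarrow> z \<in> W ?t"
      if "\<And>q. z \<in> D ?t q" for z using D(3)[of ?t] that unfolding relz_def by blast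
    show "(hred n G x, hred n G y) \<in> E \<longleftrightarrow> W (pairJ.ty x y i) \<noteq> {}"
      by (rule pairJ.pair_status(1)[OF p n1 eq FE, where D = "D ?t"]) (use inj D(1) g W(1) w in blast)+
    show "dns (W (pairJ.ty x y i))" if "(hred n G x, hred n G y) \<in> E"
      by (rule pairJ.pair_status(2)[OF p n1 eq FE, where D = "D ?t"]) (use inj D(1) g W(1) w that in blast)+
  qed
  have "comeager {z. relz n E (pairJ.ty x y i) z}" if p: "pairJ n x y i" and r: "W (pairJ.ty x y i) \<noteq> {}" for x y i
  proof (rule comeager_mono)
    let ?t = "pairJ.ty x y i"
    have "dns (W ?t)" using st[OF p] r by blast
    then show "comeager ({z. relz n E ?t z \<longleftrightarrow> z \<in> W ?t} \<inter> W ?t)" by (intro comeager_Int W(2) comeager_opn_dns W(1))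
  qed blast
  then show ?thesis using inj st(1) by (intro exI[of _ G] exI[of _ "\<lambda>\<tau>. W \<tau> \<noteq> {}"]) blast
qed

section \<open>Transferring relatedness to disjoint pairs\<close>

text \<open>Test points with eight tokens on each level up to \<open>i\<close>; the token \<open>j\<close> of a positive level contains all
  tokens of the level below except \<open>j\<close>. They need not lie in the space \<open>Xsp n\<close>.\<close>

fun tc :: "nat \<Rightarrow> nat \<Rightarrow> hc" where
  "tc 0 j = Ur (\<lambda>m. m = j)"
| "tc (Suc l) j = HSet (cimage (\<lambda>m. tc l (m mod 8)) (acset {m. m mod 8 \<noteq> j}))"

lemma tc_inj: "j < 8 \<Longrightarrow> j' < 8 \<Longrightarrow> tc l j = tc l j' \<Longrightarrow> j = j'"
proof (induction l arbitrary: j j')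
  case 0
  then have "(\<lambda>m. m = j) = (\<lambda>m. m = j')" by simp
  then show ?case by metis
next
  case (Suc l)
  show ?case
  proof (rule ccontr)
    assume n: "j \<noteq> j'"
    have e: "hmem a (tc (Suc l) j) = hmem a (tc (Suc l) j')" for a using Suc.prems by simp
    have "hmem (tc l j') (tc (Suc l) j)" using n Suc.prems(2) by (auto simp: cimage.rep_eq intro!: image_eqI[of _ _ j'])
    then have "hmem (tc l j') (tc (Suc l) j')" using e by blast
    then obtain m where m: "m mod 8 \<noteq> j'" "tc l j' = tc l (m mod 8)" by (auto simp: cimage.rep_eq)
    then show False using Suc.IH[of j' "m mod 8"] Suc.prems(2) by simp
  qed
qed

definition lev :: "nat \<Rightarrow> nat \<Rightarrow> nat \<Rightarrow> bool" where
  "lev l j m = (if l = 0 then m = j else m mod 8 \<noteq> j)"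

text \<open>\<open>A\<close> selects the tokens of level \<open>i\<close>, and the members of
  \<open>T\<close> become the tokens of level \<open>i + 1\<close>, read as sets of tokens of level
  \<open>i\<close>.\<close>

definition conc :: "enat \<Rightarrow> nat \<Rightarrow> nat set \<Rightarrow> nat set set \<Rightarrow> pt" where
  "conc n i A T l k m = (enat l < n \<and> (if l < i then lev l (k mod 8) m
     else if l = i then lev l (from_nat_into A k) m
     else if l = i + 1 then from_nat_into A m \<in> from_nat_into T k else True))"

locale concpt =
  fixes n :: enat and i :: nat and A :: "nat set" and T :: "nat set set"
  assumes iN: "enat i < n" and A8: "A \<subseteq> {..<8}" and A_ne: "A \<noteq> {}"
    and TA: "\<Union>T = A"
begin

abbreviation "g \<equiv> from_nat_into A"
abbreviation "t \<equiv> from_nat_into T"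
abbreviation "p \<equiv> conc n i A T"

lemma T_ne: "T \<noteq> {}" using TA A_ne by blast
lemma fin: "finite A" "finite T"
proof -
  show "finite A" using A8 finite_subset by blast
  then show "finite T" using TA finite_UnionD by blast
qed
lemma t_in: "t k \<in> T" using T_ne by (rule from_nat_into)
lemma range_g: "range g = A" using A_ne fin by (intro range_from_nat_into countable_finite)
lemma range_t: "range t = T" using T_ne fin by (intro range_from_nat_into countable_finite)

lemma tk_low: "l < i \<Longrightarrow> tk p l k = tc l (k mod 8)"
proof (induction l arbitrary: k)
  case 0
  then show ?case using iN unfolding conc_def lev_def by (simp add: zero_enat_def[symmetric]) (metis gr_zeroI not_less_zero zero_enat_def)
next
  case (Suc l)
  have n: "enat (Suc l) < n" using Suc.prems iN by (meson enat_ord_simps(2) less_trans)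
  have "tk p l = (\<lambda>m. tc l (m mod 8))" using Suc by (intro ext) simp
  moreover have "{m. p (Suc l) k m} = {m. m mod 8 \<noteq> k mod 8}" using Suc.prems n unfolding conc_def lev_def by auto
  ultimately show ?case unfolding tk_Suc by simp
qed

lemma tk_mid: "tk p i k = tc i (g k)"
proof (cases i)
  case 0
  then show ?thesis using iN unfolding conc_def lev_def by simp
next
  case (Suc l)
  have "tk p l = (\<lambda>m. tc l (m mod 8))" using tk_low Suc by (intro ext) simp
  moreover have "{m. p (Suc l) k m} = {m. m mod 8 \<noteq> g k}" using Suc iN unfolding conc_def lev_def by auto
  ultimately show ?thesis unfolding Suc tk_Suc by simp
qed

lemma tks_low: "l < i \<Longrightarrow> tks p l = tc l ` {..<8}"
proof -
  assume l: "l < i"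
  have "j \<in> range (\<lambda>k::nat. k mod 8)" if "j < 8" for j using that by (intro image_eqI[of _ _ j]) simp_all
  then have "range (\<lambda>k::nat. k mod 8) = {..<8}" by auto
  moreover have "range (\<lambda>k. tc l (k mod 8)) = tc l ` range (\<lambda>k. k mod 8)" by (simp only: image_image)
  ultimately have "range (\<lambda>k. tc l (k mod 8)) = tc l ` {..<8}" by simp
  then show ?thesis unfolding tks_def using tk_low[OF l] by simp
qed

lemma tks_mid: "tks p i = tc i ` A"
proof -
  have "tk p i = (\<lambda>k. tc i (g k))" by (intro ext tk_mid)
  then have "tks p i = tc i ` range g" unfolding tks_def by (simp only: image_image)
  then show ?thesis unfolding range_g .
qed

text \<open>If level \<open>i + 1\<close> is not below \<open>n\<close>, its component is constantly
  \<open>False\<close> and its only token is the empty set.\<close>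

definition T0 :: "nat set set" where
  "T0 = (if enat (i + 1) < n then T else {{}})"

lemma tks_top: "tks p (i + 1) = (\<lambda>s. HSet (cimage (tc i) (acset s))) ` T0"
proof -
  have "tk p (Suc i) k = HSet (cimage (tc i) (acset (if enat (i + 1) < n then t k else {})))" for k
  proof -
    have "tk p i ` {m. p (Suc i) k m} = tc i ` (if enat (i + 1) < n then t k else {})"
    proof (cases "enat (i + 1) < n")
      case True
      then have "{m. p (Suc i) k m} = {m. g m \<in> t k}" unfolding conc_def by auto
      moreover have "g ` {m. g m \<in> t k} = t k \<inter> range g" by auto
      then have "g ` {m. g m \<in> t k} = t k" unfolding range_g using TA t_in[of k] by auto
      moreover have "tk p i ` S = tc i ` (g ` S)" for S by (auto simp: tk_mid)
      ultimately show ?thesis using True by simp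
    next
      case False
      then show ?thesis unfolding conc_def by simp
    qed
    then have "cimage (tk p i) (acset {m. p (Suc i) k m}) = cimage (tc i) (acset (if enat (i + 1) < n then t k else {}))"
      by (simp add: rcset_inject[symmetric] cimage.rep_eq)
    then show ?thesis unfolding tk_Suc by simp
  qed
  moreover have "range (\<lambda>k. if enat (i + 1) < n then t k else {}) = T0" unfolding T0_def using range_t by auto
  moreover have "range (\<lambda>k. HSet (cimage (tc i) (acset (f k)))) = (\<lambda>s. HSet (cimage (tc i) (acset s))) ` range f" for f :: "nat \<Rightarrow> nat set"
    by (simp only: image_image)
  ultimately show ?thesis unfolding tks_def by simp
qed

lemma T0_sub: "s \<in> T0 \<Longrightarrow> s \<subseteq> {..<8}"
  using TA A8 unfolding T0_def by (auto split: if_splits)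

end

lemma hmem_tc: "j < 8 \<Longrightarrow> s \<subseteq> {..<8} \<Longrightarrow> hmem (tc i j) (HSet (cimage (tc i) (acset s))) \<longleftrightarrow> j \<in> s"
  using tc_inj[of j _ i] by (auto simp: cimage.rep_eq)

lemma inj_on_tc: "inj_on (tc i) {..<8}"
  using tc_inj by (intro inj_onI) simp

lemma tc_image_Int: "A \<subseteq> {..<8} \<Longrightarrow> B \<subseteq> {..<8} \<Longrightarrow> tc i ` A \<inter> tc i ` B = tc i ` (A \<inter> B)"
  by (rule inj_on_image_Int[OF inj_on_tc, symmetric])

lemma tc_image_sub: "A \<subseteq> {..<8} \<Longrightarrow> B \<subseteq> {..<8} \<Longrightarrow> tc i ` A \<subseteq> tc i ` B \<longleftrightarrow> A \<subseteq> B"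
  by (rule inj_on_image_subset_iff[OF inj_on_tc])

lemma conc_pair:
  assumes "concpt n i A T" "concpt n i B S" and AB: "\<not> A \<subseteq> B"
  defines "T0 \<equiv> if enat (i + 1) < n then T else {{}}" and "S0 \<equiv> if enat (i + 1) < n then S else {{}}"
  shows "pairJ n (conc n i A T) (conc n i B S) i"
    "pairJ.ty (conc n i A T) (conc n i B S) i = (i, \<not> B \<subseteq> A, A \<inter> B \<noteq> {},
       \<exists>s\<in>T0. \<exists>r\<in>S0. s \<inter> (A \<inter> B) = r \<inter> (A \<inter> B),
       \<exists>s\<in>T0. \<forall>r\<in>S0. s \<inter> (A \<inter> B) \<noteq> r \<inter> (A \<inter> B),
       \<exists>r\<in>S0. \<forall>s\<in>T0. s \<inter> (A \<inter> B) \<noteq> r \<inter> (A \<inter> B))"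
proof -
  interpret a: concpt n i A T by fact
  interpret b: concpt n i B S by fact
  interpret pairJ n "conc n i A T" "conc n i B S" i
  proof
    show "enat i < n" by (rule a.iN)
    show "\<not> tks (conc n i A T) i \<subseteq> tks (conc n i B S) i"
      unfolding a.tks_mid b.tks_mid tc_image_sub[OF a.A8 b.A8] by (rule AB)
    show "tks (conc n i A T) l = tks (conc n i B S) l" if "l < i" for l
      using a.tks_low[OF that] b.tks_low[OF that] by simp
  qed
  show "pairJ n (conc n i A T) (conc n i B S) i" by (rule pairJ_axioms)
  have T0: "a.T0 = T0" "b.T0 = S0" unfolding a.T0_def b.T0_def T0_def S0_def by simp_all
  let ?u = "\<lambda>s. HSet (cimage (tc i) (acset s))"
  have ag: "agree (?u s) (?u r) \<longleftrightarrow> s \<inter> (A \<inter> B) = r \<inter> (A \<inter> B)" if "s \<in> T0" "r \<in> S0" for s r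
  proof -
    have sr: "s \<subseteq> {..<8}" "r \<subseteq> {..<8}" using a.T0_sub b.T0_sub that T0 by auto
    have "agree (?u s) (?u r) \<longleftrightarrow> (\<forall>j\<in>A \<inter> B. hmem (tc i j) (?u s) = hmem (tc i j) (?u r))"
      unfolding agree_def a.tks_mid b.tks_mid tc_image_Int[OF a.A8 b.A8] by (simp only: ball_simps)
    also have "\<dots> \<longleftrightarrow> (\<forall>j\<in>A \<inter> B. j \<in> s \<longleftrightarrow> j \<in> r)"
      using hmem_tc[OF _ sr(1)] hmem_tc[OF _ sr(2)] a.A8 by (intro ball_cong) auto
    finally show ?thesis by blast
  qed
  show "ty = (i, \<not> B \<subseteq> A, A \<inter> B \<noteq> {},
       \<exists>s\<in>T0. \<exists>r\<in>S0. s \<inter> (A \<inter> B) = r \<inter> (A \<inter> B),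
       \<exists>s\<in>T0. \<forall>r\<in>S0. s \<inter> (A \<inter> B) \<noteq> r \<inter> (A \<inter> B),
       \<exists>r\<in>S0. \<forall>s\<in>T0. s \<inter> (A \<inter> B) \<noteq> r \<inter> (A \<inter> B))"
    unfolding ty_def a.tks_mid b.tks_mid a.tks_top b.tks_top tc_image_sub[OF b.A8 a.A8] tc_image_Int[OF a.A8 b.A8] T0
    by (simp add: ag image_is_empty del: image_Int)
qed

lemma concpt_I:
  assumes "enat i < n" "P \<union> C \<noteq> {}" "P \<union> C \<subseteq> {..<8}" "X \<noteq> {}" "\<Union>X = C"
  shows "concpt n i (P \<union> C) ((\<union>) P ` X)"
proof
  show "\<Union> ((\<union>) P ` X) = P \<union> C" using assms(4,5) by auto
qed (use assms in auto)

text \<open>\<open>P\<close> and \<open>Q\<close> are the private tokens of level \<open>i\<close>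
  and \<open>C\<close> the common ones. Every set of level \<open>i + 1\<close> contains all private
  tokens of its side, so its trace on \<open>C\<close> is the prescribed member of \<open>X\<close>
  or \<open>Y\<close>.\<close>

lemma concpt_pair:
  assumes c: "concpt n i (P \<union> C) ((\<union>) P ` X)" "concpt n i (Q \<union> C) ((\<union>) Q ` Y)"
    and d: "P \<inter> Q = {}" "P \<inter> C = {}" "Q \<inter> C = {}" "P \<noteq> {}" and u: "\<Union>X = C" "\<Union>Y = C"
  defines "X0 \<equiv> if enat (i + 1) < n then X else {{}}" and "Y0 \<equiv> if enat (i + 1) < n then Y else {{}}"
  shows "pairJ n (conc n i (P \<union> C) ((\<union>) P ` X)) (conc n i (Q \<union> C) ((\<union>) Q ` Y)) i"
    "pairJ.ty (conc n i (P \<union> C) ((\<union>) P ` X)) (conc n i (Q \<union> C) ((\<union>) Q ` Y)) i =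
      (i, Q \<noteq> {}, C \<noteq> {}, X0 \<inter> Y0 \<noteq> {}, \<not> X0 \<subseteq> Y0, \<not> Y0 \<subseteq> X0)"
proof -
  have ns: "\<not> P \<union> C \<subseteq> Q \<union> C" using d by blast
  show "pairJ n (conc n i (P \<union> C) ((\<union>) P ` X)) (conc n i (Q \<union> C) ((\<union>) Q ` Y)) i" by (rule conc_pair(1)[OF c ns])
  have AB: "(P \<union> C) \<inter> (Q \<union> C) = C" "Q \<union> C \<subseteq> P \<union> C \<longleftrightarrow> Q = {}" using d by blast+
  define f where "f s = s \<inter> C" for s :: "nat set"
  have X: "f ` (if enat (i + 1) < n then (\<union>) P ` X else {{}}) = X0"
  proof -
    have "f (P \<union> s) = s" if "s \<in> X" for s using d u(1) that unfolding f_def by blast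
    then have "(\<lambda>s. f (P \<union> s)) ` X = X" by simp
    then show ?thesis unfolding X0_def by (simp add: image_image) (simp add: f_def)
  qed
  have Y: "f ` (if enat (i + 1) < n then (\<union>) Q ` Y else {{}}) = Y0"
  proof -
    have "f (Q \<union> s) = s" if "s \<in> Y" for s using d u(2) that unfolding f_def by blast
    then have "(\<lambda>s. f (Q \<union> s)) ` Y = Y" by simp
    then show ?thesis unfolding Y0_def by (simp add: image_image) (simp add: f_def)
  qed
  have r: "(\<exists>s\<in>S. \<exists>r\<in>R. f s = f r) \<longleftrightarrow> f ` S \<inter> f ` R \<noteq> {}"
    "(\<exists>s\<in>S. \<forall>r\<in>R. f s \<noteq> f r) \<longleftrightarrow> \<not> f ` S \<subseteq> f ` R"
    "(\<exists>r\<in>R. \<forall>s\<in>S. f s \<noteq> f r) \<longleftrightarrow> \<not> f ` R \<subseteq> f ` S" for S R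
    unfolding image_subset_iff image_iff disjoint_iff by (blast, metis, metis)
  show "pairJ.ty (conc n i (P \<union> C) ((\<union>) P ` X)) (conc n i (Q \<union> C) ((\<union>) Q ` Y)) i =
      (i, Q \<noteq> {}, C \<noteq> {}, X0 \<inter> Y0 \<noteq> {}, \<not> X0 \<subseteq> Y0, \<not> Y0 \<subseteq> X0)"
    unfolding conc_pair(2)[OF c ns] AB f_def[symmetric] r X Y by simp
qed

text \<open>Constraints among the flags of a realised type; under them the test points below can
  imitate the type.\<close>

lemma pairJ_ty_cases:
  assumes p: "pairJ n x y i" and X: "x \<in> Xsp n" "y \<in> Xsp n" and t: "pairJ.ty x y i = (i', bW, bU, bC, bX, bY)"
  shows "i' = i" "\<not> bU \<Longrightarrow> bW \<and> bC \<and> \<not> bX \<and> \<not> bY" "\<not> bC \<Longrightarrow> bX \<and> bY"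
    "\<not> enat (i + 1) < n \<Longrightarrow> bC \<and> \<not> bX \<and> \<not> bY"
proof -
  interpret pairJ n x y i by fact
  note t' = t[unfolded ty_def]
  have b: "bW = (\<not> tks y i \<subseteq> tks x i)" "bU = (tks x i \<inter> tks y i \<noteq> {})" "bC = (\<exists>b\<in>tks x (i + 1). \<exists>c\<in>tks y (i + 1). agree b c)"
    "bX = (\<exists>b\<in>tks x (i + 1). \<forall>c\<in>tks y (i + 1). \<not> agree b c)" "bY = (\<exists>c\<in>tks y (i + 1). \<forall>b\<in>tks x (i + 1). \<not> agree b c)"
    using t' unfolding prod.inject by - (elim conjE, erule sym)+
  show "i' = i" using t' by simp
  obtain u v where uv: "u \<in> tks x (i + 1)" "v \<in> tks y (i + 1)" using tks_ne by blast
  show "bX \<and> bY" if "\<not> bC" using that uv unfolding b by blast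
  show "bW \<and> bC \<and> \<not> bX \<and> \<not> bY" if U: "\<not> bU"
  proof -
    have e: "tks x i \<inter> tks y i = {}" using U unfolding b by simp
    then have "agree b c" for b c unfolding agree_def by simp
    then show ?thesis unfolding b using uv e tks_ne[of y i] by blast
  qed
  show "bC \<and> \<not> bX \<and> \<not> bY" if N: "\<not> enat (i + 1) < n"
  proof -
    have "tks w (i + 1) = {HSet (cimage (tk w i) (acset {}))}" if w: "w \<in> Xsp n" for w
      using Xsp_D(1)[OF w N] unfolding tks_def by (auto simp: tk_Suc)
    then have "tks x (i + 1) = {HSet (cimage (tk x i) (acset {}))}" "tks y (i + 1) = {HSet (cimage (tk y i) (acset {}))}"
      using X by blast+
    moreover have "agree (HSet (cimage (tk x i) (acset {}))) (HSet (cimage (tk y i) (acset {})))"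
      unfolding agree_def by (simp add: cimage.rep_eq)
    ultimately show ?thesis unfolding b by simp
  qed
qed

text \<open>Two left partners of one right point are related to each other and have the same traces on their
  common part; one more step through an intermediate point makes the common part empty.\<close>

lemma related_disjoint_pair:
  assumes sym: "sym S" and tr: "trans S"
    and H: "\<And>x y. pairJ n x y i \<Longrightarrow> (h x, h y) \<in> S \<longleftrightarrow> R (pairJ.ty x y i)"
    and p: "pairJ n x y i" and X: "x \<in> Xsp n" "y \<in> Xsp n" and r: "(h x, h y) \<in> S"
  shows "\<exists>x' y'. pairJ n x' y' i \<and> pairJ.ty x' y' i = (i, True, False, True, False, False) \<and> R (pairJ.ty x' y' i)"
proof -
  have iN: "enat i < n" using p unfolding pairJ_def by blast
  have comp: "(h a, h b) \<in> S" if "R (pairJ.ty a c i)" "R (pairJ.ty b c i)" "pairJ n a c i" "pairJ n b c i" for a b c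
    using that H sym tr by (meson symD transD)
  obtain i' bW bU bC bX bY where t0: "pairJ.ty x y i = (i', bW, bU, bC, bX, bY)" by (metis surj_pair)
  note b = pairJ_ty_cases[OF p X t0]
  have t: "pairJ.ty x y i = (i, bW, bU, bC, bX, bY)" using t0 b(1) by simp
  have R0: "R (i, bW, bU, bC, bX, bY)" using H[OF p] r t by simp
  \<comment> \<open>Eight tokens in four blocks: \<open>{0, 1}\<close> and \<open>{2, 3}\<close>
    private to the two left points, \<open>{4, 5}\<close> to the right one, \<open>{6, 7}\<close>
    common. Two common tokens allow a shared trace \<open>{6, 7}\<close> besides the private traces
    \<open>{6}\<close> and \<open>{7}\<close>.\<close>
  define C where "C = (if bU then {6, 7::nat} else {})"
  define Q where "Q = (if bW then {4, 5::nat} else {})"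
  define X where "X = {C} \<union> (if bC \<and> bX then {{6::nat}} else {})"
  define Y where "Y = (if bC then {C} \<union> (if bY then {{7::nat}} else {}) else {{6}, {7}})"
  have CX: "\<Union>X = C" "\<Union>Y = C" unfolding X_def Y_def C_def using b(2,3) by (auto split: if_splits)
  have cx: "concpt n i ({0, 1} \<union> C) ((\<union>) {0, 1} ` X)"
    by (rule concpt_I[OF iN]) (use CX in \<open>auto simp: C_def X_def\<close>)
  have cx': "concpt n i ({2, 3} \<union> C) ((\<union>) {2, 3} ` X)"
    by (rule concpt_I[OF iN]) (use CX in \<open>auto simp: C_def X_def\<close>)
  have cy: "concpt n i (Q \<union> C) ((\<union>) Q ` Y)"
    by (rule concpt_I[OF iN]) (use CX b(2) in \<open>auto simp: C_def Q_def Y_def\<close>)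
  let ?X0 = "if enat (i + 1) < n then X else {{}}" and ?Y0 = "if enat (i + 1) < n then Y else {{}}"
  have xy: "(i, Q \<noteq> {}, C \<noteq> {}, ?X0 \<inter> ?Y0 \<noteq> {}, \<not> ?X0 \<subseteq> ?Y0, \<not> ?Y0 \<subseteq> ?X0) = (i, bW, bU, bC, bX, bY)"
  proof -
    have "Q \<noteq> {} \<longleftrightarrow> bW" "C \<noteq> {} \<longleftrightarrow> bU" unfolding Q_def C_def by auto
    moreover have "(?X0 \<inter> ?Y0 \<noteq> {} \<longleftrightarrow> bC) \<and> (\<not> ?X0 \<subseteq> ?Y0 \<longleftrightarrow> bX) \<and> (\<not> ?Y0 \<subseteq> ?X0 \<longleftrightarrow> bY)"
    proof (cases "enat (i + 1) < n")
      case True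
      have ne: "{6::nat} \<noteq> {6, 7}" "{7::nat} \<noteq> {6, 7}" "{6::nat} \<noteq> {7}" by auto
      show ?thesis
      proof (cases bC)
        case c: True
        show ?thesis
        proof (cases bU)
          case True
          then show ?thesis unfolding X_def Y_def C_def using \<open>enat (i + 1) < n\<close> c ne by simp
        next
          case False
          then show ?thesis unfolding X_def Y_def C_def using \<open>enat (i + 1) < n\<close> c b(2) by simp
        qed
      next
        case False
        then have "bU" "bX" "bY" using b(2,3) by blast+
        then show ?thesis unfolding X_def Y_def C_def using \<open>enat (i + 1) < n\<close> False ne ne[symmetric] by simp
      qed
    next
      case False
      then show ?thesis using b(4) by simp
    qed
    ultimately show ?thesis by simp
  qed
  let ?x = "conc n i ({0, 1} \<union> C) ((\<union>) {0, 1} ` X)" and ?x' = "conc n i ({2, 3} \<union> C) ((\<union>) {2, 3} ` X)"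
    and ?y = "conc n i (Q \<union> C) ((\<union>) Q ` Y)"
  have dj: "{0, 1} \<inter> Q = {}" "{2, 3} \<inter> Q = {}" "{0, 1} \<inter> C = {}" "{2, 3} \<inter> C = {}" "Q \<inter> C = {}" "{0, 1} \<inter> {2, 3 :: nat} = {}"
    unfolding Q_def C_def by auto
  have q1: "pairJ n ?x ?y i" "pairJ.ty ?x ?y i = (i, bW, bU, bC, bX, bY)"
    using concpt_pair[OF cx cy dj(1,3,5) _ CX] unfolding xy by simp_all
  have q2: "pairJ n ?x' ?y i" "pairJ.ty ?x' ?y i = (i, bW, bU, bC, bX, bY)"
    using concpt_pair[OF cx' cy dj(2,4,5) _ CX] unfolding xy by simp_all
  have ne: "X \<noteq> {}" unfolding X_def by simp
  have q3: "pairJ n ?x ?x' i" "pairJ.ty ?x ?x' i = (i, True, bU, True, False, False)"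
  proof -
    show "pairJ n ?x ?x' i" using concpt_pair(1)[OF cx cx' dj(6,3,4) _ CX(1) CX(1)] by simp
    have "pairJ.ty ?x ?x' i = (i, {2, 3 :: nat} \<noteq> {}, C \<noteq> {}, ?X0 \<inter> ?X0 \<noteq> {}, \<not> ?X0 \<subseteq> ?X0, \<not> ?X0 \<subseteq> ?X0)"
      by (rule concpt_pair(2)[OF cx cx' dj(6,3,4) _ CX(1) CX(1)]) simp
    also have "\<dots> = (i, True, bU, True, False, False)" using ne xy by auto
    finally show "pairJ.ty ?x ?x' i = (i, True, bU, True, False, False)" .
  qed
  have "(h ?x, h ?x') \<in> S" by (rule comp[of _ ?y]) (use q1 q2 R0 in simp_all)
  then have R3: "R (i, True, bU, True, False, False)" using H[OF q3(1)] q3(2) by simp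
  show ?thesis
  proof (cases bU)
    case False
    then show ?thesis using q3 R3 by (intro exI[of _ ?x] exI[of _ ?x']) simp
  next
    case True
    \<comment> \<open>Removing the common tokens: \<open>{0, 1}\<close> is related to
      \<open>{2, 1}\<close>, the same set \<open>{1, 2}\<close> is related to \<open>{3, 2}\<close>,
      and the two ends are disjoint.\<close>
    define c where "c a b = conc n i {a, b} {{a, b}}" for a b :: nat
    have cp: "concpt n i {a, b} {{a, b}}" if "a < 8" "b < 8" for a b :: nat
      using concpt_I[OF iN, of "{a, b}" "{}" "{{}}"] that by simp
    have e: "{a} \<union> {b} = {a, b}" "(\<union>) {a} ` {{b}} = {{a, b}}" "{a, b} \<union> {} = {a, b}" "(\<union>) {a, b} ` {{}} = {{a, b}}" for a b :: nat by auto
    have one: "pairJ n (c a b) (c d b) i \<and> pairJ.ty (c a b) (c d b) i = (i, True, True, True, False, False)"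
      if "a < 8" "b < 8" "d < 8" "a \<noteq> b" "a \<noteq> d" "b \<noteq> d" for a b d
      using concpt_pair[of n i "{a}" "{b}" "{{b}}" "{d}" "{{b}}"] cp[of a b] cp[of d b] that unfolding e c_def by simp
    have two: "pairJ n (c 0 1) (c 3 2) i \<and> pairJ.ty (c 0 1) (c 3 2) i = (i, True, False, True, False, False)"
      using concpt_pair[of n i "{0, 1}" "{}" "{{}}" "{3, 2}" "{{}}"] cp[of 0 1] cp[of 3 2] unfolding e c_def by simp
    have cc: "c a b = c b a" for a b unfolding c_def by (simp add: insert_commute)
    have "(h (c 0 1), h (c 2 1)) \<in> S" using H[of "c 0 1" "c 2 1"] one[of 0 1 2] R3 True by simp
    moreover have "(h (c 1 2), h (c 3 2)) \<in> S" using H[of "c 1 2" "c 3 2"] one[of 1 2 3] R3 True by simp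
    ultimately have "(h (c 0 1), h (c 3 2)) \<in> S" using tr cc[of 1 2] by (metis transD)
    then show ?thesis using H[of "c 0 1" "c 3 2"] two by (intro exI[of _ "c 0 1"] exI[of _ "c 3 2"]) simp
  qed
qed

section \<open>Absorbing everything above the first level of disagreement\<close>

lemma comeager_permute:
  fixes \<pi> :: "'a \<Rightarrow> 'b"
  assumes b: "bij \<pi>" and Q: "comeager Q"
  shows "comeager {z. z \<circ> \<pi> \<in> Q}"
proof -
  obtain D where D: "\<And>k::nat. opn (D k)" "\<And>k. dns (D k)" "(\<Inter>k. D k) \<subseteq> Q" using Q unfolding comeager_def by blast
  have o: "opn {z. z \<circ> \<pi> \<in> D k}" for k unfolding opn_def
  proof
    fix z assume "z \<in> {z. z \<circ> \<pi> \<in> D k}"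
    then obtain F where F: "finite F" "cyl F (z \<circ> \<pi>) \<subseteq> D k" using D(1)[of k] unfolding opn_def by blast
    have "z' \<circ> \<pi> \<in> cyl F (z \<circ> \<pi>)" if "z' \<in> cyl (\<pi> ` F) z" for z' using that unfolding cyl_def by simp
    then show "\<exists>F. finite F \<and> cyl F z \<subseteq> {z. z \<circ> \<pi> \<in> D k}" using F by (intro exI[of _ "\<pi> ` F"]) auto
  qed
  have d: "dns {z. z \<circ> \<pi> \<in> D k}" for k unfolding dns_def
  proof (intro allI impI)
    fix F :: "'b set" and z :: "'b \<Rightarrow> bool" assume F: "finite F"
    let ?p = "inv \<pi>"
    have "cyl (?p ` F) (z \<circ> \<pi>) \<inter> D k \<noteq> {}" using D(2)[of k] F unfolding dns_def by blast
    then obtain w where w: "w \<in> cyl (?p ` F) (z \<circ> \<pi>)" "w \<in> D k" by blast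
    have "w \<circ> ?p \<circ> \<pi> = w" using b by (auto simp: bij_is_inj)
    moreover have "w (?p c) = z c" if "c \<in> F" for c
    proof -
      have "w (?p c) = (z \<circ> \<pi>) (?p c)" using w(1) that unfolding cyl_def by blast
      then show ?thesis using b by (simp add: bij_is_surj surj_f_inv_f)
    qed
    ultimately have "w \<circ> ?p \<in> cyl F z \<inter> {z. z \<circ> \<pi> \<in> D k}" using w(2) unfolding cyl_def by simp
    then show "cyl F z \<inter> {z. z \<circ> \<pi> \<in> D k} \<noteq> {}" by blast
  qed
  show ?thesis unfolding comeager_def
    by (rule exI[of _ "\<lambda>k. {z. z \<circ> \<pi> \<in> D k}"]) (use o d D(3) in auto)
qed

lemma topspace_ptop: "topspace ptop = UNIV"
  by (simp add: ptop_def)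

lemma openin_ptop_cyl:
  assumes "finite F" shows "openin ptop {x. co_of x \<in> cyl F w}"
  using assms
proof (induction F rule: finite_induct)
  case empty
  then show ?case unfolding cyl_def using openin_topspace[of ptop] by (simp add: topspace_ptop)
next
  case (insert c F)
  obtain l k m where c: "c = (l, k, m)" by (metis surj_pair)
  have "openin ptop {x \<in> topspace ptop. x l k m \<in> {w c}}"
    using continuous_coord[of l k m] by (rule openin_continuous_map_preimage) simp
  then have "openin ptop {x. co_of x c = w c}" unfolding topspace_ptop c co_of_def by simp
  then have "openin ptop ({x. co_of x c = w c} \<inter> {x. co_of x \<in> cyl F w})" using insert.IH by (rule openin_Int)
  moreover have "{x. co_of x c = w c} \<inter> {x. co_of x \<in> cyl F w} = {x. co_of x \<in> cyl (insert c F) w}" unfolding cyl_def by auto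
  ultimately show ?case by simp
qed

lemma openin_ptop_opn:
  assumes "opn D" shows "openin ptop {x. co_of x \<in> D}"
proof (subst openin_subopen, intro ballI)
  fix x assume "x \<in> {x. co_of x \<in> D}"
  then obtain F where "finite F" "cyl F (co_of x) \<subseteq> D" using assms unfolding opn_def by blast
  then show "\<exists>T. openin ptop T \<and> x \<in> T \<and> T \<subseteq> {x. co_of x \<in> D}"
    using openin_ptop_cyl[of F "co_of x"] by (intro exI[of _ "{x'. co_of x' \<in> cyl F (co_of x)}"]) auto
qed

text \<open>Density passes to the subspace because a point that is generic for all
  \<open>D k\<close>, cut off at \<open>n\<close>, lies in the space by itself.\<close>

lemma comeager_in_Xtop:
  assumes D: "\<And>k::nat. opn (D k)" "\<And>k. dns (D k)"
    and inv: "\<And>k w w'. (\<And>l a b. enat l < n \<Longrightarrow> w (l, a, b) = w' (l, a, b)) \<Longrightarrow> w \<in> D k \<Longrightarrow> w' \<in> D k"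
    and X: "\<And>x. (\<And>l. \<not> enat l < n \<Longrightarrow> x l = (\<lambda>_ _. False)) \<Longrightarrow> (\<And>k. co_of x \<in> D k) \<Longrightarrow> x \<in> Xsp n"
  shows "comeager_in (Xtop n) {x \<in> Xsp n. \<forall>k. co_of x \<in> D k}"
  unfolding comeager_in_def
proof (intro conjI exI allI)
  show "{x \<in> Xsp n. \<forall>k. co_of x \<in> D k} \<subseteq> topspace (Xtop n)" by auto
  show "(\<Inter>k. {x \<in> Xsp n. co_of x \<in> D k}) \<subseteq> {x \<in> Xsp n. \<forall>k. co_of x \<in> D k}" by auto
  fix k
  have "{x \<in> Xsp n. co_of x \<in> D k} = {x. co_of x \<in> D k} \<inter> Xsp n" by auto
  then show "openin (Xtop n) {x \<in> Xsp n. co_of x \<in> D k}"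
    unfolding Xtop_def openin_subtopology using openin_ptop_opn[OF D(1)] by blast
  have "Xsp n \<subseteq> Xtop n closure_of {x \<in> Xsp n. co_of x \<in> D k}"
  proof
    fix x assume x: "x \<in> Xsp n"
    show "x \<in> Xtop n closure_of {x \<in> Xsp n. co_of x \<in> D k}"
      unfolding in_closure_of
    proof (intro conjI allI impI)
      show "x \<in> topspace (Xtop n)" using x by simp
      fix T assume "x \<in> T \<and> openin (Xtop n) T"
      then obtain V where V: "openin ptop V" "T = V \<inter> Xsp n" "x \<in> V" unfolding Xtop_def openin_subtopology by blast
      obtain F where F: "finite F" "\<And>x'. (\<forall>c\<in>F. co_of x' c = co_of x c) \<Longrightarrow> x' \<in> V" using openin_ptop_finite[OF V(1,3)] by blast
      have "comeager (\<Inter>k. D k)" unfolding comeager_def by (rule exI[of _ D]) (use D in auto)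
      then obtain w where w: "w \<in> cyl F (co_of x)" "\<And>k. w \<in> D k" using baire[of "\<Inter>k. D k", OF _ F(1), of "co_of x"] by blast
      define y where "y l a b = (enat l < n \<and> w (l, a, b))" for l a b
      have yD: "co_of y \<in> D k" for k by (rule inv[OF _ w(2)]) (simp add: co_of_def y_def)
      have yX: "y \<in> Xsp n" by (rule X[OF _ yD]) (simp add: y_def fun_eq_iff)
      have "co_of y c = co_of x c" if "c \<in> F" for c
      proof -
        obtain l a b where c: "c = (l, a, b)" by (metis surj_pair)
        have "w c = co_of x c" using w(1) that unfolding cyl_def by blast
        then show ?thesis using Xsp_D(1)[OF x, of l] unfolding c co_of_def y_def by (cases "enat l < n") auto
      qed
      then have "y \<in> V" using F(2) by blast
      then show "\<exists>y. y \<in> {x \<in> Xsp n. co_of x \<in> D k} \<and> y \<in> T" using yX yD V(2) by blast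
    qed
  qed
  then show "Xtop n closure_of {x \<in> Xsp n. co_of x \<in> D k} = topspace (Xtop n)"
    using closure_of_subset_topspace[of "Xtop n"] by simp blast
qed

lemma tk_cong:
  assumes "\<And>l'. l' \<le> l \<Longrightarrow> x l' = y l'" shows "tk x l k = tk y l k"
  using assms
proof (induction l arbitrary: k)
  case (Suc l)
  then have "tk x l = tk y l" by (intro ext) simp
  then show ?case using Suc.prems[of "Suc l"] unfolding tk_Suc by simp
qed simp

lemma tks_cong: "(\<And>l'. l' \<le> l \<Longrightarrow> x l' = y l') \<Longrightarrow> tks x l = tks y l"
  unfolding tks_def using tk_cong[of l x y] by auto

definition rd :: "enat \<Rightarrow> (nat \<times> nat \<times> nat \<Rightarrow> 'd) \<Rightarrow> ('d \<Rightarrow> bool) \<Rightarrow> pt" where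
  "rd n c z l k m \<longleftrightarrow> enat l < n \<and> z (c (l, k, m))"

text \<open>Renumbering the tokens of level \<open>i - 1\<close> by \<open>\<sigma>\<close> permutes
  the columns of component \<open>i\<close> and changes no other component.\<close>

definition permcol :: "(nat \<times> nat \<times> nat \<Rightarrow> 'd) \<Rightarrow> nat \<Rightarrow> (nat \<Rightarrow> nat) \<Rightarrow> 'd \<Rightarrow> 'd" where
  "permcol c i \<sigma> d = (if d \<in> c ` ({i} \<times> UNIV) then
     (case inv_into ({i} \<times> UNIV) c d of (l, k, m) \<Rightarrow> c (i, k, \<sigma> m)) else d)"

lemma permcol_at:
  assumes "inj_on c ({i} \<times> UNIV)" shows "permcol c i \<sigma> (c (i, k, m)) = c (i, k, \<sigma> m)"
proof -
  have "inv_into ({i} \<times> UNIV) c (c (i, k, m)) = (i, k, m)" using assms by (intro inv_into_f_f) auto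
  then show ?thesis unfolding permcol_def by auto
qed

lemma permcol_other: "d \<notin> c ` ({i} \<times> UNIV) \<Longrightarrow> permcol c i \<sigma> d = d"
  unfolding permcol_def by simp

lemma permcol_bij:
  assumes c: "inj_on c ({i} \<times> UNIV)" and s: "bij \<sigma>" shows "bij (permcol c i \<sigma>)"
proof -
  have k: "permcol c i s (permcol c i r d) = d" if "\<And>m. s (r m) = m" for s r d
  proof (cases "d \<in> c ` ({i} \<times> UNIV)")
    case True
    then obtain a b where "d = c (i, a, b)" by auto
    then show ?thesis using that by (simp add: permcol_at[OF c])
  qed (simp add: permcol_other)
  have "permcol c i (inv \<sigma>) \<circ> permcol c i \<sigma> = id" "permcol c i \<sigma> \<circ> permcol c i (inv \<sigma>) = id"
    using k[of "inv \<sigma>" \<sigma>] k[of \<sigma> "inv \<sigma>"] s by (auto simp: bij_is_inj bij_is_surj surj_f_inv_f fun_eq_iff)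
  then show ?thesis by (rule o_bij)
qed

text \<open>The readings share their coordinates below \<open>i\<close> and are independent from
  \<open>i\<close> on. So a generic \<open>x\<close> is related to almost every point with the lower
  levels of \<open>x\<close> and fresh upper levels. If \<open>x\<close> and \<open>y\<close> have
  the same tokens below \<open>i\<close>, the same upper levels can be used for both, up to a
  renumbering.\<close>

lemma comeager_absorbing:
  fixes cT cF :: "nat \<times> nat \<times> nat \<Rightarrow> 'd::countable"
  assumes n1: "1 \<le> n" and eq: "equiv (Xsp n) E" and FE: "Frel n \<subseteq> E" and iN: "enat i < n"
    and injT: "inj_on cT {c. enat (fst c) < n}" and injF: "inj_on cF {c. enat (fst c) < n}"
    and low: "\<And>c. fst c < i \<Longrightarrow> cT c = cF c"
    and up: "\<And>c d. enat (fst c) < n \<Longrightarrow> enat (fst d) < n \<Longrightarrow> i \<le> fst d \<Longrightarrow> cT c \<noteq> cF d"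
    and com: "comeager {z. rd n cT z \<in> Xsp n \<and> rd n cF z \<in> Xsp n \<and> (rd n cT z, rd n cF z) \<in> E}"
  shows "\<exists>C. comeager_in (Xtop n) C \<and> (\<forall>x\<in>C. \<forall>y\<in>C. x \<in> Xsp n \<and> y \<in> Xsp n \<and> ((\<forall>l<i. tks x l = tks y l) \<longrightarrow> (x, y) \<in> E))"
proof -
  let ?A = "{c :: nat \<times> nat \<times> nat. enat (fst c) < n}"
  \<comment> \<open>With distinct rows the tokens of level \<open>i - 1\<close> are enumerated
    without repetition, so two enumerations of the same tokens differ by a permutation. For
    \<open>i = 0\<close> there is nothing to renumber.\<close>
  let ?rows = "\<lambda>z. \<forall>k k'. k \<noteq> k' \<longrightarrow> 0 < i \<longrightarrow> (\<exists>m. z (cT (i - 1, k, m)) \<noteq> z (cT (i - 1, k', m)))"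
  define Q where "Q = {z. rd n cT z \<in> Xsp n \<and> rd n cF z \<in> Xsp n \<and> (rd n cT z, rd n cF z) \<in> E} \<inter> {z. ?rows z}"
  have le: "enat l < n" if "l \<le> i" for l using that iN by (meson enat_ord_simps(1) le_less_trans)
  have "comeager {z. k \<noteq> k' \<longrightarrow> 0 < i \<longrightarrow> (\<exists>m. z (cT (i - 1, k, m)) \<noteq> z (cT (i - 1, k', m)))}" for k k'
  proof (cases "k \<noteq> k'")
    case True
    have l: "enat (i - 1) < n" using le by simp
    have "inj (\<lambda>m. cT (i - 1, k, m))"
    proof (rule injI)
      fix m m' assume "cT (i - 1, k, m) = cT (i - 1, k, m')"
      then have "(i - 1, k, m) = (i - 1, k, m')" by (rule inj_onD[OF injT]) (use l in simp_all)
      then show "m = m'" by simp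
    qed
    moreover have "cT (i - 1, k, m) \<noteq> cT (i - 1, k', m')" for m m'
    proof
      assume "cT (i - 1, k, m) = cT (i - 1, k', m')"
      then have "(i - 1, k, m) = (i - 1, k', m')" by (rule inj_onD[OF injT]) (use l in simp_all)
      then show False using True by simp
    qed
    ultimately have "comeager {z. \<exists>m. z (cT (i - 1, k, m)) \<noteq> z (cT (i - 1, k', m))}"
      using opn_dns_rows_differ[of "\<lambda>m. cT (i - 1, k, m)" "\<lambda>m. cT (i - 1, k', m)"] by (intro comeager_opn_dns) blast+
    then show ?thesis by (rule comeager_mono) blast
  qed (simp add: comeager_UNIV)
  then have "comeager {z. ?rows z}" by (intro comeager_Collect_all)
  then have cQ: "comeager Q" unfolding Q_def using com by (intro comeager_Int)
  obtain D where D0: "\<forall>k::nat. opn (D k) \<and> dns (D k) \<and> (\<forall>w w'. (\<forall>c\<in>?A. w c = w' c) \<longrightarrow> w \<in> D k \<longrightarrow> w' \<in> D k)"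
    and D1: "\<forall>w\<in>(\<Inter>k. D k). comeager {z. glue cT ?A w z \<in> Q}" using kuratowski_ulam[OF injT cQ] by blast
  have gT: "rd n cT (glue cT ?A (co_of x) z) = x" if "\<And>l. \<not> enat l < n \<Longrightarrow> x l = (\<lambda>_ _. False)" for x z
  proof (intro ext)
    fix l k m show "rd n cT (glue cT ?A (co_of x) z) l k m = x l k m"
      using that[of l] glue_image[OF injT, of "(l, k, m)" "co_of x" z] unfolding rd_def by (cases "enat l < n") (auto simp: co_of_def)
  qed
  have gF: "rd n cF (glue cT ?A (co_of x) z) l k m = (if l < i then x l k m else enat l < n \<and> z (cF (l, k, m)))" for x z l k m
  proof (cases "l < i")
    case True
    then have l: "enat l < n" using le by simp
    then have "glue cT ?A (co_of x) z (cF (l, k, m)) = co_of x (l, k, m)"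
      using glue_image[OF injT, of "(l, k, m)" "co_of x" z] low[of "(l, k, m)"] True by simp
    then show ?thesis using True l unfolding rd_def co_of_def by simp
  next
    case False
    show ?thesis
    proof (cases "enat l < n")
      case True
      have "cF (l, k, m) \<notin> cT ` ?A"
      proof
        assume "cF (l, k, m) \<in> cT ` ?A"
        then obtain c where "enat (fst c) < n" "cF (l, k, m) = cT c" by blast
        then show False using up[of c "(l, k, m)"] True False by simp
      qed
      then show ?thesis using False True unfolding rd_def by (simp add: glue_other)
    qed (use False in \<open>simp add: rd_def\<close>)
  qed
  have cx: "comeager {z. glue cT ?A (co_of x) z \<in> Q}" if "\<And>k. co_of x \<in> D k" for x
    using D1 that by blast
  have "comeager_in (Xtop n) {x \<in> Xsp n. \<forall>k. co_of x \<in> D k}"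
  proof (rule comeager_in_Xtop)
    show "w' \<in> D k" if e: "\<And>l a b. enat l < n \<Longrightarrow> w (l, a, b) = w' (l, a, b)" and "w \<in> D k" for k w w'
    proof -
      have "\<forall>c\<in>?A. w c = w' c" using e by auto
      then show ?thesis using D0 \<open>w \<in> D k\<close> by blast
    qed
    show "x \<in> Xsp n" if x: "\<And>l. \<not> enat l < n \<Longrightarrow> x l = (\<lambda>_ _. False)" "\<And>k. co_of x \<in> D k" for x
    proof -
      obtain z where "glue cT ?A (co_of x) z \<in> Q" using comeager_nonempty[OF cx[OF x(2)]] by blast
      then have "rd n cT (glue cT ?A (co_of x) z) \<in> Xsp n" unfolding Q_def by blast
      then show ?thesis using gT[OF x(1)] by simp
    qed
  qed (use D0 in blast)+
  moreover have "(x, y) \<in> E" if x: "x \<in> Xsp n" "\<And>k. co_of x \<in> D k" and y: "y \<in> Xsp n" "\<And>k. co_of y \<in> D k"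
    and t: "\<And>l. l < i \<Longrightarrow> tks x l = tks y l" for x y
  proof -
    have injtk: "inj (tk w (i - 1))" if w: "w \<in> Xsp n" "\<And>k. co_of w \<in> D k" and i: "0 < i" for w
    proof (rule injI, rule ccontr)
      fix k k' assume e: "tk w (i - 1) k = tk w (i - 1) k'" and ne: "k \<noteq> k'"
      have l: "enat (i - 1) < n" using le by simp
      obtain z where z: "glue cT ?A (co_of w) z \<in> Q" using comeager_nonempty[OF cx[OF w(2)]] by blast
      have "w (i - 1) k = w (i - 1) k'" using e tk_eq_iff[OF w(1) l] by blast
      moreover have "glue cT ?A (co_of w) z (cT (i - 1, k, m)) = w (i - 1) k m" for k m
        using glue_image[OF injT, of "(i - 1, k, m)" "co_of w" z] l by (simp add: co_of_def)
      moreover have "\<exists>m. glue cT ?A (co_of w) z (cT (i - 1, k, m)) \<noteq> glue cT ?A (co_of w) z (cT (i - 1, k', m))"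
        using z ne i unfolding Q_def by blast
      ultimately show False by simp
    qed
    have "\<exists>\<sigma>. bij \<sigma> \<and> (i = 0 \<longrightarrow> \<sigma> = id) \<and> (0 < i \<longrightarrow> (\<forall>m. tk y (i - 1) m = tk x (i - 1) (\<sigma> m)))"
    proof (cases "i = 0")
      case False
      then have i: "0 < i" "i - 1 < i" by simp_all
      have r: "range (tk x (i - 1)) = range (tk y (i - 1))" using t[OF i(2)] unfolding tks_def .
      define \<sigma> where "\<sigma> m = inv (tk x (i - 1)) (tk y (i - 1) m)" for m
      have s: "tk x (i - 1) (\<sigma> m) = tk y (i - 1) m" for m unfolding \<sigma>_def by (rule f_inv_into_f) (unfold r, rule rangeI)
      have "inj \<sigma>" using s injD[OF injtk[OF y i(1)]] by (intro injI) metis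
      moreover have "surj \<sigma>"
      proof (rule surjI)
        fix k
        have "tk x (i - 1) k \<in> range (tk y (i - 1))" unfolding r[symmetric] by (rule rangeI)
        then have "tk y (i - 1) (inv (tk y (i - 1)) (tk x (i - 1) k)) = tk x (i - 1) k" by (rule f_inv_into_f)
        then show "\<sigma> (inv (tk y (i - 1)) (tk x (i - 1) k)) = k"
          unfolding \<sigma>_def using injtk[OF x i(1)] by simp
      qed
      ultimately show ?thesis using s False by (intro exI[of _ \<sigma>]) (auto simp: bij_def)
    qed (intro exI[of _ id], simp)
    then obtain \<sigma> where \<sigma>: "bij \<sigma>" "i = 0 \<Longrightarrow> \<sigma> = id" "\<And>m. 0 < i \<Longrightarrow> tk y (i - 1) m = tk x (i - 1) (\<sigma> m)" by blast
    have injF': "inj_on cF ({i} \<times> UNIV)" using injF by (rule inj_on_subset) (use iN in auto)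
    define \<pi> where "\<pi> = permcol cF i \<sigma>"
    have "comeager {z. z \<circ> \<pi> \<in> {z. glue cT ?A (co_of y) z \<in> Q}}"
      unfolding \<pi>_def by (intro comeager_permute permcol_bij injF' \<sigma>(1) cx y(2))
    \<comment> \<open>One \<open>z\<close> serves both points: over \<open>x\<close> as it stands
      and over \<open>y\<close> after permuting the columns. This gives \<open>u\<close> related to
      \<open>x\<close> and \<open>v\<close> related to \<open>y\<close> with \<open>u\<close> and
      \<open>v\<close> coding the same sets.\<close>
    then have "comeager ({z. glue cT ?A (co_of x) z \<in> Q} \<inter> {z. z \<circ> \<pi> \<in> {z. glue cT ?A (co_of y) z \<in> Q}})"
      using cx[OF x(2)] by (intro comeager_Int)
    then obtain z where z: "glue cT ?A (co_of x) z \<in> Q" "glue cT ?A (co_of y) (z \<circ> \<pi>) \<in> Q"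
      using comeager_nonempty by blast
    define u where "u = rd n cF (glue cT ?A (co_of x) z)"
    define v where "v = rd n cF (glue cT ?A (co_of y) (z \<circ> \<pi>))"
    have xu: "(x, u) \<in> E" "u \<in> Xsp n" using z(1) gT[OF Xsp_D(1)[OF x(1)]] unfolding Q_def u_def by auto
    have yv: "(y, v) \<in> E" "v \<in> Xsp n" using z(2) gT[OF Xsp_D(1)[OF y(1)]] unfolding Q_def v_def by auto
    have ulow: "u l = x l" if "l < i" for l using that unfolding u_def by (intro ext) (simp add: gF)
    have vlow: "v l = y l" if "l < i" for l using that unfolding v_def by (intro ext) (simp add: gF)
    have ui: "u i k m = z (cF (i, k, m))" "v i k m = z (cF (i, k, \<sigma> m))" for k m
      unfolding u_def v_def \<pi>_def using iN by (simp_all add: gF permcol_at[OF injF'])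
    have uhi: "u l = v l" if "i < l" for l
    proof (intro ext)
      fix k m
      have "\<pi> (cF (l, k, m)) = cF (l, k, m)" if "enat l < n"
        unfolding \<pi>_def
      proof (rule permcol_other, rule notI)
        assume "cF (l, k, m) \<in> cF ` ({i} \<times> UNIV)"
        then obtain p where p: "cF (l, k, m) = cF (i, p)" by auto
        have "(l, k, m) = (i, p)" by (rule inj_onD[OF injF p]) (use \<open>enat l < n\<close> iN in simp_all)
        then show False using \<open>i < l\<close> by simp
      qed
      then show "u l k m = v l k m" using \<open>i < l\<close> unfolding u_def v_def by (auto simp: gF)
    qed
    have ti: "tk u i k = tk v i k" for k
    proof (cases i)
      case 0
      have "u 0 k m = v 0 k m" for m using ui[of k m, unfolded 0] \<sigma>(2)[OF 0] by simp
      then show ?thesis unfolding 0 by auto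
    next
      case (Suc j)
      have tu: "tk u j m = tk x j m" "tk v j m = tk y j m" for m
        using tk_cong[of j u x m] tk_cong[of j v y m] ulow vlow Suc by simp_all
      have sg: "tk y j m = tk x j (\<sigma> m)" for m using \<sigma>(3)[of m] Suc by simp
      have "(\<exists>m. u i k m \<and> a = tk x j m) \<longleftrightarrow> (\<exists>m. v i k m \<and> a = tk x j (\<sigma> m))" for a
        unfolding ui using bij_is_surj[OF \<sigma>(1)] by (metis surjD)
      then show ?thesis unfolding Suc hmem_ext hmem_tk_Suc tu sg by simp
    qed
    have th: "tk u l k = tk v l k" if "i \<le> l" for l k
      using that
    proof (induction l arbitrary: k rule: dec_induct)
      case base show ?case by (rule ti)
    next
      case (step l)
      have "tk u l = tk v l" using step.IH by (intro ext)
      then show ?case using uhi[of "Suc l"] step.hyps unfolding tk_Suc by simp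
    qed
    have "tks u l = tks v l" for l
    proof (cases "l < i")
      case True
      then have "tks u l = tks x l" "tks v l = tks y l" by (auto intro!: tks_cong ulow vlow)
      then show ?thesis using t[OF True] by simp
    next
      case False
      then show ?thesis unfolding tks_def using th[of l] by simp
    qed
    then have "(u, v) \<in> Frel n" using tks_eq_Frel[OF xu(2) yv(2) n1] by blast
    then have "(u, v) \<in> E" using FE by blast
    then show ?thesis using xu(1) yv(1) equivE[OF eq] by (meson symD transD)
  qed
  ultimately show ?thesis by (intro exI[of _ "{x \<in> Xsp n. \<forall>k. co_of x \<in> D k}"]) blast
qed

section \<open>Coordinates for pairs whose tokens are disjoint on level \<open>i\<close>\<close>

abbreviation dty :: "nat \<Rightarrow> jtype" where
  "dty i \<equiv> (i, True, False, True, False, False)"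

fun lvl :: "nat \<Rightarrow> ix \<Rightarrow> nat" where
  "lvl i (I (KC l) a) = l"
| "lvl i (I (KP s) a) = i"
| "lvl i (I (KT s) a) = 0"
| "lvl i (I (KH s l) a) = l"
| "lvl i (J s k a b) = i + 1"

fun sdt :: "ix \<Rightarrow> bool" where
  "sdt (I (KC l) a) = False"
| "sdt (I (KP s) a) = s"
| "sdt (I (KT s) a) = s"
| "sdt (I (KH s l) a) = s"
| "sdt (J s k a b) = s"

lemma Pix_dty:
  assumes "enat l < n"
  shows "\<alpha> \<in> Pix n (dty i) s l \<Longrightarrow> lvl i \<alpha> = l"
    "i \<le> l \<Longrightarrow> \<alpha> \<in> Pix n (dty i) s l \<Longrightarrow> sdt \<alpha> = s"
    "l < i \<Longrightarrow> Pix n (dty i) s l = Pix n (dty i) s' l"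
    "i \<le> l \<Longrightarrow> \<alpha> \<in> Pix n (dty i) s l \<Longrightarrow> \<nexists>l' a. \<alpha> = I (KC l') a"
    "l \<noteq> i + 1 \<Longrightarrow> \<alpha> \<in> Pix n (dty i) s l \<Longrightarrow> \<nexists>s' k a b. \<alpha> = J s' k a b"
    "infinite (Pix n (dty i) s l)"
proof -
  have p: "Pix n (dty i) s l = (if l < i then range (I (KC l)) else if l = i then range (I (KP s))
     else if l = i + 1 then {J s k a b |k a b. jav n (dty i) (J s k a b)} else range (I (KH s l)))" for s
    unfolding Pix_def by simp
  show "lvl i \<alpha> = l" if "\<alpha> \<in> Pix n (dty i) s l" using that unfolding p by (auto split: if_splits)
  show "sdt \<alpha> = s" if "i \<le> l" "\<alpha> \<in> Pix n (dty i) s l" using that unfolding p by (auto split: if_splits)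
  show "Pix n (dty i) s l = Pix n (dty i) s' l" if "l < i" using that unfolding p by simp
  show "\<nexists>l' a. \<alpha> = I (KC l') a" if "i \<le> l" "\<alpha> \<in> Pix n (dty i) s l" using that unfolding p by (auto split: if_splits)
  show "\<nexists>s' k a b. \<alpha> = J s' k a b" if "l \<noteq> i + 1" "\<alpha> \<in> Pix n (dty i) s l" using that unfolding p by (auto split: if_splits)
  have inf: "infinite (range (I k))" for k by (intro range_inj_infinite) (simp add: inj_def)
  show "infinite (Pix n (dty i) s l)"
  proof (cases "l = i + 1")
    case True
    have "jav n (dty i) (J s (KC (i + 1)) a 0)" for a using assms True by (simp add: jpk_def)
    then have "range (\<lambda>a. J s (KC (i + 1)) a 0) \<subseteq> Pix n (dty i) s l" unfolding p using True by auto
    moreover have "infinite (range (\<lambda>a. J s (KC (i + 1)) a 0))" by (intro range_inj_infinite) (simp add: inj_def)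
    ultimately show ?thesis using infinite_super by blast
  qed (simp add: p inf)
qed

lemma pix_dty:
  assumes "enat l < n" shows "pix n (dty i) s l k \<in> Pix n (dty i) s l" "inj (pix n (dty i) s l)"
proof -
  have "bij_betw (pix n (dty i) s l) UNIV (Pix n (dty i) s l)"
    unfolding pix_def by (rule bij_betw_from_nat_into) (simp_all only: uncountable_infinite countableI_type Pix_dty(6)[OF assms] not_False_eq_True)
  then show "pix n (dty i) s l k \<in> Pix n (dty i) s l" "inj (pix n (dty i) s l)" unfolding bij_betw_def by blast+
qed

text \<open>For disjoint pairs no common object lies directly below an object \<open>J\<close>, so
  no bit is redirected to a trace, and each point is read off an injective family of
  coordinates.\<close>

definition cmp :: "enat \<Rightarrow> nat \<Rightarrow> bool \<Rightarrow> nat \<times> nat \<times> nat \<Rightarrow> co" where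
  "cmp n i s = (\<lambda>(l, k, m). case l of 0 \<Rightarrow> Rb (pix n (dty i) s 0 k) m
     | Suc l' \<Rightarrow> Bt (pix n (dty i) s l' m) (pix n (dty i) s l k))"

lemma phi_dty: "phi n (dty i) s z = rd n (cmp n i s) z"
proof (intro ext)
  fix l k m
  show "phi n (dty i) s z l k m = rd n (cmp n i s) z l k m"
  proof (cases "enat l < n")
    case True
    show ?thesis
    proof (cases l)
      case (Suc l')
      let ?\<alpha> = "pix n (dty i) s l' m" and ?\<beta> = "pix n (dty i) s l k"
      have l': "enat l' < n" using True Suc enat_Suc_lessD by blast
      note a = pix_dty(1)[OF l', of i s m] and b = pix_dty(1)[OF True, of i s k]
      have "cob ?\<alpha> ?\<beta> = Bt ?\<alpha> ?\<beta>"
      proof (cases "l = i + 1")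
        case True
        then have "\<nexists>l'' c. ?\<alpha> = I (KC l'') c" using Pix_dty(4)[OF l' _ a] Suc by simp
        then show ?thesis unfolding cob_def by (auto split: ix.split kd.split)
      next
        case False
        then have "\<nexists>s' k' c d. ?\<beta> = J s' k' c d" using Pix_dty(5)[OF \<open>enat l < n\<close> _ b] by simp
        then show ?thesis unfolding cob_def by (auto split: ix.split)
      qed
      then show ?thesis using True Suc unfolding phi_def rd_def cmp_def by simp
    qed (simp add: phi_def rd_def cmp_def)
  qed (simp add: phi_def rd_def)
qed

lemma inj_on_cmp: "inj_on (cmp n i s) {c. enat (fst c) < n}"
proof (rule inj_onI)
  fix c d assume c: "c \<in> {c. enat (fst c) < n}" and d: "d \<in> {c. enat (fst c) < n}" and e: "cmp n i s c = cmp n i s d"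
  obtain l k m l' k' m' where cd: "c = (l, k, m)" "d = (l', k', m')" by (metis surj_pair)
  have l: "enat l < n" "enat l' < n" using c d cd by simp_all
  show "c = d"
  proof (cases l)
    case 0
    then obtain "l' = 0" using e unfolding cd cmp_def by (cases l') auto
    then show ?thesis using e 0 injD[OF pix_dty(2)[OF l(1), of i s]] unfolding cd cmp_def by simp
  next
    case (Suc a)
    then obtain b where b: "l' = Suc b" using e unfolding cd cmp_def by (cases l') auto
    have e': "pix n (dty i) s a m = pix n (dty i) s b m'" "pix n (dty i) s l k = pix n (dty i) s l' k'"
      using e Suc b unfolding cd cmp_def by simp_all
    have a: "enat a < n" "enat b < n" using l Suc b enat_Suc_lessD by blast+
    have "l = l'" using Pix_dty(1)[OF l(1) pix_dty(1)[OF l(1)], of i s k] Pix_dty(1)[OF l(2) pix_dty(1)[OF l(2)], of i s k'] e'(2) by simp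
    then have "l = l'" "a = b" using Suc b by simp_all
    then show ?thesis using e' injD[OF pix_dty(2)[OF l(1), of i s]] injD[OF pix_dty(2)[OF a(1), of i s]] unfolding cd by simp
  qed
qed

lemma cmp_low:
  assumes iN: "enat i < n" and c: "fst c < i" shows "cmp n i s c = cmp n i s' c"
proof -
  obtain l k m where cd: "c = (l, k, m)" by (metis surj_pair)
  have "pix n (dty i) s a = pix n (dty i) s' a" if "a < i" for a
  proof -
    have "enat a < n" using that iN by (meson enat_ord_simps(2) less_trans)
    then show ?thesis unfolding pix_def using Pix_dty(3)[of a n i s s'] that by simp
  qed
  then show ?thesis using c unfolding cd cmp_def by (cases l) simp_all
qed

text \<open>From level \<open>i\<close> on every index carries its side, so the two points use
  different coordinates there.\<close>

lemma cmp_up: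
  assumes c: "enat (fst c) < n" and d: "enat (fst d) < n" "i \<le> fst d" shows "cmp n i True c \<noteq> cmp n i False d"
proof
  assume e: "cmp n i True c = cmp n i False d"
  obtain l k m l' k' m' where cd: "c = (l, k, m)" "d = (l', k', m')" by (metis surj_pair)
  have l: "enat l < n" "enat l' < n" "i \<le> l'" using c d cd by simp_all
  have e': "pix n (dty i) True l k = pix n (dty i) False l' k'" using e unfolding cd cmp_def by (cases l; cases l') auto
  note a = pix_dty(1)[OF l(1), of i True k] and b = pix_dty(1)[OF l(2), of i False k']
  have "l = l'" using Pix_dty(1)[OF l(1) a] Pix_dty(1)[OF l(2) b] e' by simp
  then show False using Pix_dty(2)[OF l(1) _ a] Pix_dty(2)[OF l(2) l(3) b] e' l(3) by simp
qed

lemma hred_Frel: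
  assumes n1: "1 \<le> n" and inj: "\<And>w w'. w \<in> urt \<Longrightarrow> w' \<in> urt \<Longrightarrow> rl G w = rl G w' \<Longrightarrow> w = w'"
    and x: "x \<in> Xsp n" "y \<in> Xsp n" and F: "(x, y) \<in> Frel n"
  shows "(hred n G x, hred n G y) \<in> Frel n"
proof -
  have t: "tks x l = tks y l" if "enat l < n" for l using F tks_eq_Frel[OF x n1] that by blast
  have "El (tks x) l = El (tks y) l" if "enat l < n" for l
  proof (rule El_cong)
    fix l' assume "l' \<le> l"
    then show "tks x l' = tks y l'" using that by (intro t) (meson enat_ord_simps(1) le_less_trans)
  qed
  then have e: "enum_of n (El (tks x)) bit (rl G) (\<lambda>l k. ev y l (from_nat k)) (hred n G y)"
    using hred_enum[OF n1, of y G] unfolding enum_of_def by simp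
  have h: "hred n G w \<in> Xsp n" for w using El_enum_Xsp[OF hred_enum[OF n1] inj] by blast
  show ?thesis using enum_of_tks_eq[OF hred_enum[OF n1] e] tks_eq_Frel[OF h h n1] by blast
qed

theorem mainTheorem2:
  fixes n :: enat and E :: "(pt \<times> pt) set"
  assumes "1 \<le> n"
    and "equiv (Xsp n) E"
    and "classifiable (Xtop n) E"
    and "Frel n \<subseteq> E"
  shows "borel_reducible (Xtop n) (Frel n) (Xtop n) E \<or>
    (\<exists>k::nat. enat k < n \<and> (\<exists>C. comeager_in (Xtop n) C \<and>
       (\<forall>x\<in>C. \<forall>y\<in>C. (restr x k, restr y k) \<in> Frel (enat k) \<longrightarrow> (x, y) \<in> E)))"
proof -
  obtain G R where inj': "\<forall>w\<in>urt. \<forall>w'\<in>urt. rl G w = rl G w' \<longrightarrow> w = w'"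
    and H: "\<forall>x y i. pairJ n x y i \<longrightarrow> ((hred n G x, hred n G y) \<in> E \<longleftrightarrow> R (pairJ.ty x y i))"
    and CM: "\<forall>x y i. pairJ n x y i \<longrightarrow> R (pairJ.ty x y i) \<longrightarrow> comeager {z. relz n E (pairJ.ty x y i) z}"
    using ex_generic_reduction[OF assms] by blast
  have inj: "w = w'" if "w \<in> urt" "w' \<in> urt" "rl G w = rl G w'" for w w' using inj' that by blast
  have st: "sym E" "trans E" using equivE[OF assms(2)] by blast+
  show ?thesis
  proof (cases "\<forall>x\<in>Xsp n. \<forall>y\<in>Xsp n. (hred n G x, hred n G y) \<in> E \<longrightarrow> (x, y) \<in> Frel n")
    case True
    have "borel_reducible (Xtop n) (Frel n) (Xtop n) E"
      unfolding borel_reducible_def topspace_Xtop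
    proof (intro bexI[of _ "hred n G"] ballI iffI)
      fix x y assume x: "x \<in> Xsp n" "y \<in> Xsp n"
      show "(hred n G x, hred n G y) \<in> E" if "(x, y) \<in> Frel n" using hred_Frel[OF assms(1) inj x that] assms(4) by blast
      show "(x, y) \<in> Frel n" if "(hred n G x, hred n G y) \<in> E" using True x that by blast
    qed (rule hred_measurable[OF assms(1) inj])
    then show ?thesis by blast
  next
    case False
    then obtain x y where x: "x \<in> Xsp n" "y \<in> Xsp n" and r: "(hred n G x, hred n G y) \<in> E" and nF: "(x, y) \<notin> Frel n" by blast
    \<comment> \<open>The least level of disagreement becomes the \<open>k\<close> of the second
      alternative.\<close>
    define i where "i = (LEAST l. enat l < n \<and> tks x l \<noteq> tks y l)"
    have ex: "\<exists>l. enat l < n \<and> tks x l \<noteq> tks y l" using nF tks_eq_Frel[OF x assms(1)] by blast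
    then have i: "enat i < n" "tks x i \<noteq> tks y i" using LeastI_ex[OF ex] unfolding i_def by blast+
    have lo: "tks x l = tks y l" if "l < i" for l
    proof -
      have "enat l < n" using that i(1) by (meson enat_ord_simps(2) less_trans)
      then show ?thesis using not_less_Least[of l "\<lambda>l. enat l < n \<and> tks x l \<noteq> tks y l"] that unfolding i_def by blast
    qed
    have "\<exists>x y. pairJ n x y i \<and> x \<in> Xsp n \<and> y \<in> Xsp n \<and> (hred n G x, hred n G y) \<in> E"
    proof (cases "tks x i \<subseteq> tks y i")
      case False
      then have "pairJ n x y i" using i(1) lo by unfold_locales
      then show ?thesis using x r by blast
    next
      case True
      then have "pairJ n y x i" using i lo by unfold_locales auto
      then show ?thesis using x r symD[OF st(1)] by blast
    qed
    then obtain x y where p: "pairJ n x y i" "x \<in> Xsp n" "y \<in> Xsp n" "(hred n G x, hred n G y) \<in> E" by blast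
    have "\<exists>x' y'. pairJ n x' y' i \<and> pairJ.ty x' y' i = dty i \<and> R (pairJ.ty x' y' i)"
      by (rule related_disjoint_pair[OF st _ p(1-3), where h = "hred n G"]) (use H p(4) in blast)+
    then obtain x' y' where p': "pairJ n x' y' i" "pairJ.ty x' y' i = dty i" "R (pairJ.ty x' y' i)" by blast
    have "comeager {z. relz n E (dty i) z}" using CM p' by metis
    then have com: "comeager {z. rd n (cmp n i True) z \<in> Xsp n \<and> rd n (cmp n i False) z \<in> Xsp n \<and> (rd n (cmp n i True) z, rd n (cmp n i False) z) \<in> E}"
      unfolding relz_def phi_dty .
    obtain C where C: "comeager_in (Xtop n) C" "\<And>x y. x \<in> C \<Longrightarrow> y \<in> C \<Longrightarrow> (\<And>l. l < i \<Longrightarrow> tks x l = tks y l) \<Longrightarrow> (x, y) \<in> E"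
      using comeager_absorbing[OF assms(1,2,4) i(1) inj_on_cmp inj_on_cmp cmp_low[OF i(1)] cmp_up com] by blast
    have "(x, y) \<in> E" if "x \<in> C" "y \<in> C" and F: "(restr x i, restr y i) \<in> Frel (enat i)" for x y
    proof (rule C(2)[OF that(1,2)])
      fix l assume l: "l < i"
      have "restr x i \<in> Xsp (enat i)" "restr y i \<in> Xsp (enat i)" using F unfolding Frel_def by auto
      moreover have "1 \<le> enat i" using l by (simp add: one_enat_def)
      ultimately have "tks (restr x i) l = tks (restr y i) l" using tks_eq_Frel[of "restr x i" "enat i" "restr y i"] F l by simp
      moreover have "tks (restr w i) l = tks w l" for w using l by (intro tks_cong) (simp add: restr_def)
      ultimately show "tks x l = tks y l" by simp
    qed
    then show ?thesis using i(1) C(1) by blast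
  qed
qed

end
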